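(* Let $d\ge2$ and let $\alpha$ be in the $H^2$-subcritical range ($\alpha>0$ if $d\le4$, $0<\alpha<\frac8{d-4}$ if $d\ge5$). Then the mass of the radial ground states satisfies, as $\epsilon\to0^+$, $$M(Q_\epsilon^{\rm rad})\approx\begin{cases}\epsilon^{\frac2\alpha-\frac d2}, & 0<\alpha<\frac2{d-1},\\[2pt] \epsilon^{\frac{d-2}{2}}\,|\ln\epsilon|^{-(d-1)}, & \alpha=\frac2{d-1},\\[2pt] \epsilon^{\frac1\alpha-\frac12}, & \alpha>\frac2{d-1}.\end{cases}$$
   Context: $M(u)=\|u\|_{L^2(\mathbb R^d)}^2$. For $\epsilon>0$, with the unitary Fourier transform, $$\mathcal R^{\rm rad}_\epsilon(\alpha)=\inf_{u\in H^2_{\rm rad}(\mathbb R^d)\setminus\{0\}}\frac{\int_{\mathbb R^d}\big((|\xi|^2-1)^2+\epsilon\big)|\hat u(\xi)|^2\,d\xi}{\|u\|_{L^{\alpha+2}(\mathbb R^d)}^2},$$ where $H^2_{\rm rad}(\mathbb R^d)$ is the space of radial functions in $H^2(\mathbb R^d)$. $Q^{\rm rad}_\epsilon=\mathcal R^{\rm rad}_\epsilon(\alpha)^{1/\alpha}v_\epsilon$, where $v_\epsilon$ is a minimizer for $\mathcal R^{\rm rad}_\epsilon(\alpha)$ with $\|v_\epsilon\|_{L^{\alpha+2}}=1$; it is a least-action radial solution of $\Delta^2Q+2\Delta Q+(1+\epsilon)Q-|Q|^\alpha Q=0$. $A_\epsilon\approx B_\epsilon$ means: there are constants $0<c<C<\infty$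 independent of $\epsilon$ with $cB_\epsilon\le A_\epsilon\le CB_\epsilon$ for all sufficiently small $\epsilon>0$. *)

theory Defs
  imports "HOL-Analysis.Analysis"
begin

text \<open>
  Elements of the function spaces are represented by Borel functions, with "equal to zero" and
  "radial" read almost everywhere.
\<close>

definition L2_space :: "('a::euclidean_space \<Rightarrow> complex) set" where
  "L2_space = {u. u \<in> borel_measurable lborel \<and> integrable lborel (\<lambda>x. (norm (u x))\<^sup>2)}"

definition Lp_norm :: "real \<Rightarrow> ('a::euclidean_space \<Rightarrow> complex) \<Rightarrow> real" where
  "Lp_norm p u = (LINT x|lborel. norm (u x) powr p) powr (1 / p)"

definition mass :: "('a::euclidean_space \<Rightarrow> complex) \<Rightarrow> real" where
  "mass u = (Lp_norm 2 u)\<^sup>2"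

definition fourier_L1 :: "('a::euclidean_space \<Rightarrow> complex) \<Rightarrow> 'a \<Rightarrow> complex" where
  "fourier_L1 u \<xi> =
     complex_of_real ((2 * pi) powr (- real DIM('a) / 2)) *
     (LINT x|lborel. exp (- (\<i> * complex_of_real (x \<bullet> \<xi>))) * u x)"

text \<open>
  The unitary (Plancherel) Fourier transform: for square-integrable \<open>u\<close>, the transforms of the
  integrable truncations of \<open>u\<close> to balls converge to it in the mean-square sense.  This
  determines it up to a null set, and only its class is ever used.
\<close>

definition fourier :: "('a::euclidean_space \<Rightarrow> complex) \<Rightarrow> 'a \<Rightarrow> complex" where
  "fourier u = (SOME w. w \<in> L2_space \<and>
     ((\<lambda>R. \<integral>\<^sup>+ \<xi>. ennreal ((norm (fourier_L1 (\<lambda>x. if norm x \<le> R then u x else 0) \<xi> - w \<xi>))\<^sup>2) \<partial>lborel)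
        \<longlongrightarrow> 0) at_top)"

definition H2_space :: "('a::euclidean_space \<Rightarrow> complex) set" where
  "H2_space = {u \<in> L2_space.
     (\<lambda>\<xi>. complex_of_real (1 + (norm \<xi>)\<^sup>2) * fourier u \<xi>) \<in> L2_space}"

definition radial :: "('a::euclidean_space \<Rightarrow> complex) \<Rightarrow> bool" where
  "radial u \<longleftrightarrow> (\<exists>g. AE x in lborel. u x = g (norm x))"

definition H2_rad :: "('a::euclidean_space \<Rightarrow> complex) set" where
  "H2_rad = {u \<in> H2_space. radial u}"

definition rayleigh_quotient :: "real \<Rightarrow> real \<Rightarrow> ('a::euclidean_space \<Rightarrow> complex) \<Rightarrow> real" where
  "rayleigh_quotient \<alpha> \<epsilon> u =
     (LINT \<xi>|lborel. (((norm \<xi>)\<^sup>2 - 1)\<^sup>2 + \<epsilon>) * (norm (fourier u \<xi>))\<^sup>2) / (Lp_norm (\<alpha> + 2) u)\<^sup>2"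

definition R_rad :: "'a::euclidean_space itself \<Rightarrow> real \<Rightarrow> real \<Rightarrow> real" where
  "R_rad _ \<alpha> \<epsilon> =
     (INF u \<in> {u :: 'a \<Rightarrow> complex. u \<in> H2_rad \<and> \<not> (AE x in lborel. u x = 0)}. rayleigh_quotient \<alpha> \<epsilon> u)"

definition normalized_minimizer :: "real \<Rightarrow> real \<Rightarrow> ('a::euclidean_space \<Rightarrow> complex) \<Rightarrow> bool" where
  "normalized_minimizer \<alpha> \<epsilon> v \<longleftrightarrow>
     v \<in> H2_rad \<and> \<not> (AE x in lborel. v x = 0) \<and> Lp_norm (\<alpha> + 2) v = 1 \<and>
     rayleigh_quotient \<alpha> \<epsilon> v = R_rad TYPE('a) \<alpha> \<epsilon>"

definition radial_ground_state :: "real \<Rightarrow> real \<Rightarrow> ('a::euclidean_space \<Rightarrow> complex) \<Rightarrow> bool" where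
  "radial_ground_state \<alpha> \<epsilon> Q \<longleftrightarrow>
     (\<exists>v. normalized_minimizer \<alpha> \<epsilon> v \<and>
          Q = (\<lambda>x. complex_of_real (R_rad TYPE('a) \<alpha> \<epsilon> powr (1 / \<alpha>)) * v x))"

end

theory Submission
  imports Defs "HOL-Probability.Probability"
begin

text \<open>
  Let \<open>p = \<alpha> + 2\<close> and \<open>R(\<epsilon>)\<close> be the minimal Rayleigh quotient. The theorem follows from
  \<open>R(\<epsilon>) \<approx> sqrt \<epsilon> \<Lambda>(\<epsilon>)\<^sup>-\<^sup>2\<^sup>/\<^sup>p\<close>, where \<open>\<Lambda>\<close> is \<open>1\<close>, \<open>\<bar>ln \<epsilon>\<bar>\<close> or a negative power of \<open>\<epsilon>\<close> in the three
  regimes. Indeed \<open>M(Q) = R(\<epsilon>)\<^sup>2\<^sup>/\<^sup>\<alpha> M(v)\<close>; the numerator dominates \<open>\<epsilon> M(v)\<close>, so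
  \<open>\<epsilon> M(v) \<le> R(\<epsilon>)\<close>, and testing \<open>R(K \<epsilon>)\<close> with the minimizer \<open>v\<close> of \<open>R(\<epsilon>)\<close> gives
  \<open>R(K \<epsilon>) - R(\<epsilon>) \<le> (K - 1) \<epsilon> M(v)\<close>, where the left side is comparable to \<open>R(\<epsilon>)\<close> for large \<open>K\<close>.

  For the lower bound on \<open>R\<close>, the low-frequency part of a radial function is an average of
  spherical means of plane waves, which decay like \<open>\<bar>x\<bar>\<close> to the power \<open>-(d - 1) / 2\<close>; the Cauchy-Schwarz inequality
  against the symbol, whose inverse has integral of order \<open>1 / sqrt \<epsilon>\<close> across the unit sphere, bounds it
  pointwise up to \<open>\<bar>x\<bar> = 1 / sqrt \<epsilon>\<close>, and its mass controls the rest. For the upper bound, the test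
  function has as its Fourier transform the indicator of the shell \<open>\<bar>\<bar>\<xi>\<bar> - 1\<bar> \<le> sqrt \<epsilon>\<close>; since this is
  nonnegative, the mass of the test function against Gaussian weights is bounded below by an elementary
  volume estimate, and this bounds its \<open>L\<^sup>p\<close> norm below by duality.
\<close>

section \<open>Lebesgue measure under rotations, and radial integrals\<close>

text \<open>In polar coordinates the \<open>p\<close>-th power of \<open>|x|\<close> to the power
  \<open>-(d - 1) / 2\<close> has the integrand \<open>r powr (- 1 - \<kappa>)\<close> with
  \<open>\<kappa> = (d - 1) * \<alpha> / 2 - 1\<close>; the threshold
  \<open>\<alpha> = 2 / (d - 1)\<close> is \<open>\<kappa> = 0\<close>. The radius
  \<open>1 / sqrt \<epsilon>\<close> is where a frequency shell of thickness
  \<open>sqrt \<epsilon>\<close> ceases to act like the unit sphere. The mass of a minimizer is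
  formally the derivative of the minimal quotient in \<open>\<epsilon>\<close>, but bounds with
  different constants \<open>c\<close> and \<open>C\<close> cannot be differentiated. Hence two
  points are compared: the growth factor does not increase with \<open>\<epsilon>\<close>, so the
  comparison function gains at least \<open>sqrt K\<close> from \<open>\<epsilon>\<close> to
  \<open>K * \<epsilon>\<close>, and \<open>K = (2 * C / c)^2\<close> beats the gap between the
  constants. The delicate case is the critical exponent, where every dyadic distance contributes
  equally and the lower bound for the test function must collect all of them. Its oscillation is
  never examined: the squared modulus is paired with weights whose Fourier transforms are
  nonnegative, so that the pairing is a double integral of nonnegative functions.\<close>

lemma lborel_distr_minus_left:
  fixes c :: "'a::euclidean_space"
  shows "distr lborel borel (\<lambda>x. c - x) = lborel"
proof -
  have "lborel = density (distr lborel borel (\<lambda>x. c + (-1) *\<^sub>R x)) (\<lambda>_. ennreal (\<bar>-1\<bar> ^ DIM('a)))"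
    by (rule lborel_affine) simp
  then show ?thesis by (simp add: density_1)
qed

lemma nn_integral_lborel_add:
  fixes c :: "'a::euclidean_space" and f :: "'a \<Rightarrow> ennreal"
  assumes [measurable]: "f \<in> borel_measurable borel"
  shows "(\<integral>\<^sup>+x. f (x + c) \<partial>lborel) = (\<integral>\<^sup>+x. f x \<partial>lborel)"
  by (subst (2) lborel_distr_plus[of c, symmetric]) (simp add: nn_integral_distr add.commute)

lemma nn_integral_lborel_diff:
  fixes c :: "'a::euclidean_space" and f :: "'a \<Rightarrow> ennreal"
  assumes [measurable]: "f \<in> borel_measurable borel"
  shows "(\<integral>\<^sup>+x. f (x - c) \<partial>lborel) = (\<integral>\<^sup>+x. f x \<partial>lborel)"
  using nn_integral_lborel_add[OF assms, of "-c"] by simp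

lemma nn_integral_lborel_minus_left:
  fixes c :: "'a::euclidean_space" and f :: "'a \<Rightarrow> ennreal"
  assumes [measurable]: "f \<in> borel_measurable borel"
  shows "(\<integral>\<^sup>+x. f (c - x) \<partial>lborel) = (\<integral>\<^sup>+x. f x \<partial>lborel)"
  by (subst (2) lborel_distr_minus_left[of c, symmetric]) (simp add: nn_integral_distr)

lemma orthogonal_transformation_measurable [measurable_dest]:
  fixes T :: "real^'n \<Rightarrow> real^'n"
  assumes "orthogonal_transformation T"
  shows "T \<in> borel_measurable borel"
  by (intro borel_measurable_continuous_onI linear_continuous_on
      linear_conv_bounded_linear[THEN iffD1] orthogonal_transformation_linear assms)

text \<open>
  This is the uniqueness proof for Haar measure, run for the image of Lebesgue measure under
  \<open>T\<close>; the unit ball, which \<open>T\<close> preserves, fixes the constant.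
\<close>

lemma lborel_distr_orthogonal:
  fixes T :: "real^'n \<Rightarrow> real^'n"
  assumes T: "orthogonal_transformation T"
  shows "distr lborel borel T = lborel"
proof (rule measure_eqI)
  show "sets (distr lborel borel T) = sets lborel" by simp
  fix A :: "(real^'n) set" assume "A \<in> sets (distr lborel borel T)"
  then have A[measurable]: "A \<in> sets borel" by simp
  have [measurable]: "T \<in> borel_measurable borel" using T by measurable
  define S where "S = inv T"
  have TS: "T (S y) = y" for y
    unfolding S_def using T by (simp add: orthogonal_transformation_surj surj_f_inv_f)
  have linT: "linear T" using T by (simp add: orthogonal_transformation_linear)
  have normT: "norm (T x) = norm x" for x using T by (simp add: orthogonal_transformation_norm)
  define B :: "(real^'n) set" where "B = ball 0 1"
  have [measurable]: "B \<in> sets borel" by (simp add: B_def)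
  have BT: "indicator B (T x) = (indicator B x :: ennreal)" for x
    by (simp add: B_def indicator_def normT)
  have inner: "(\<integral>\<^sup>+x. indicator B (y - T x) \<partial>lborel) = emeasure lborel B" for y
  proof -
    have "y - T x = T (S y - x)" for x
      using linear_diff[OF linT] TS by simp
    then have "(\<integral>\<^sup>+x. indicator B (y - T x) \<partial>lborel) = (\<integral>\<^sup>+x. indicator B (S y - x) \<partial>lborel)"
      by (simp add: BT)
    also have "\<dots> = (\<integral>\<^sup>+x. indicator B x \<partial>lborel)"
      by (rule nn_integral_lborel_minus_left) simp
    finally show ?thesis by simp
  qed
  have shift: "(\<integral>\<^sup>+x. indicator A (T x + y) \<partial>lborel) = (\<integral>\<^sup>+x. indicator A (T x) \<partial>lborel)" for y
  proof -
    have "T x + y = T (x + S y)" for x using linear_add[OF linT] TS by simp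
    then have "(\<integral>\<^sup>+x. indicator A (T x + y) \<partial>lborel) = (\<integral>\<^sup>+x. indicator A (T (x + S y)) \<partial>lborel)"
      by simp
    also have "\<dots> = (\<integral>\<^sup>+x. indicator A (T x) \<partial>lborel)"
      by (rule nn_integral_lborel_add) simp
    finally show ?thesis .
  qed
  have dA: "emeasure (distr lborel borel T) A = (\<integral>\<^sup>+x. indicator A (T x) \<partial>lborel)"
  proof -
    have "emeasure (distr lborel borel T) A = (\<integral>\<^sup>+x. indicator A x \<partial>distr lborel borel T)" by simp
    also have "\<dots> = (\<integral>\<^sup>+x. indicator A (T x) \<partial>lborel)" by (rule nn_integral_distr) simp_all
    finally show ?thesis .
  qed
  \<comment> \<open>The double integral of \<open>indicator B y * indicator A (T x + y)\<close> is
    evaluated in both orders. Integrating in \<open>x\<close> first gives the image measure of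
    \<open>A\<close>, by \<open>shift\<close>; integrating in \<open>y\<close> first and moving
    \<open>T x\<close> onto \<open>B\<close> gives the Lebesgue measure of \<open>A\<close>, by
    \<open>inner\<close>.\<close>
  have "emeasure (distr lborel borel T) A * emeasure lborel B
      = (\<integral>\<^sup>+y. indicator B y * (\<integral>\<^sup>+x. indicator A (T x) \<partial>lborel) \<partial>lborel)"
    by (simp add: dA nn_integral_multc mult.commute)
  also have "\<dots> = (\<integral>\<^sup>+y. (\<integral>\<^sup>+x. indicator B y * indicator A (T x + y) \<partial>lborel) \<partial>lborel)"
    by (simp add: shift nn_integral_cmult)
  also have "\<dots> = (\<integral>\<^sup>+x. (\<integral>\<^sup>+y. indicator B y * indicator A (T x + y) \<partial>lborel) \<partial>lborel)"
    by (rule lborel_pair.Fubini') measurable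
  also have "\<dots> = (\<integral>\<^sup>+x. (\<integral>\<^sup>+y. indicator B (y - T x) * indicator A y \<partial>lborel) \<partial>lborel)"
  proof (rule nn_integral_cong)
    fix x
    have "(\<integral>\<^sup>+y. indicator B y * indicator A (T x + y) \<partial>lborel)
        = (\<integral>\<^sup>+y. (\<lambda>y. indicator B (y - T x) * indicator A y) (y + T x) \<partial>lborel)"
      by (simp add: add.commute)
    also have "\<dots> = (\<integral>\<^sup>+y. indicator B (y - T x) * indicator A y \<partial>lborel)"
      by (rule nn_integral_lborel_add) simp
    finally show "(\<integral>\<^sup>+y. indicator B y * indicator A (T x + y) \<partial>lborel)
        = (\<integral>\<^sup>+y. indicator B (y - T x) * indicator A y \<partial>lborel)" .
  qed
  also have "\<dots> = (\<integral>\<^sup>+y. (\<integral>\<^sup>+x. indicator B (y - T x) * indicator A y \<partial>lborel) \<partial>lborel)"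
    by (rule lborel_pair.Fubini') measurable
  also have "\<dots> = emeasure lborel A * emeasure lborel B"
    by (simp add: nn_integral_multc inner nn_integral_cmult mult.commute)
  finally have eq: "emeasure (distr lborel borel T) A * emeasure lborel B = emeasure lborel A * emeasure lborel B" .
  have "emeasure lborel B = ennreal (unit_ball_vol (CARD('n)))"
    by (simp add: B_def emeasure_ball)
  moreover have "unit_ball_vol (CARD('n)) \<noteq> 0" by (metis less_irrefl of_nat_0_le_iff unit_ball_vol_pos)
  ultimately show "emeasure (distr lborel borel T) A = emeasure lborel A"
    using eq by (simp add: ennreal_mult_cancel_left mult.commute[of _ "ennreal _"])
qed

lemma integral_orthogonal:
  fixes T :: "real^'n \<Rightarrow> real^'n" and f :: "real^'n \<Rightarrow> 'b::{banach, second_countable_topology}"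
  assumes T: "orthogonal_transformation T" and [measurable]: "f \<in> borel_measurable borel"
  shows "(LINT x|lborel. f (T x)) = (LINT x|lborel. f x)"
proof -
  have [measurable]: "T \<in> borel_measurable borel" using T by measurable
  show ?thesis
    by (subst (2) lborel_distr_orthogonal[OF T, symmetric]) (simp add: integral_distr)
qed

text \<open>The rays \<open>{..a}\<close> generate the Borel sets, and on them both sides are
  volumes of balls, because the density is the derivative of the ball volume in the radius. This
  gives polar coordinates for radial integrands without a surface measure.\<close>

lemma lborel_distr_norm:
  "distr (lborel :: 'a::euclidean_space measure) borel norm =
     density lborel (\<lambda>r. ennreal (DIM('a) * unit_ball_vol (DIM('a)) * r ^ (DIM('a) - 1)) * indicator {0..} r)"
    (is "?M = ?N")
proof (rule measure_eqI_generator_eq)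
  let ?E = "range (\<lambda>a::real. {..a})"
  show "Int_stable ?E" by (auto simp: Int_stable_def)
  show "?E \<subseteq> Pow UNIV" by simp
  show "sets ?M = sigma_sets UNIV ?E" "sets ?N = sigma_sets UNIV ?E"
    by (simp_all add: borel_eq_atMost)
  show "range (\<lambda>i::nat. {..real i}) \<subseteq> ?E" by auto
  show "(\<Union>i::nat. {..real i}) = UNIV" by (auto intro: real_arch_simple)
  have M: "emeasure ?M {..a} = ennreal (if a \<ge> 0 then unit_ball_vol (DIM('a)) * a ^ DIM('a) else 0)" for a
  proof -
    have eq: "norm -` {..a} = (cball 0 a :: 'a set)" by (auto simp: cball_def)
    have "emeasure ?M {..a} = emeasure lborel (cball (0::'a) a)"
      by (subst emeasure_distr) (simp_all add: eq)
    then show ?thesis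
      by (cases "a \<ge> 0") (auto simp: emeasure_cball)
  qed
  show "emeasure ?M {..real i} \<noteq> \<infinity>" for i :: nat by (simp add: M)
  fix X assume "X \<in> ?E"
  then obtain a where X: "X = {..a}" by auto
  let ?f = "\<lambda>r. DIM('a) * unit_ball_vol (DIM('a)) * r ^ (DIM('a) - 1)"
  have "emeasure ?N {..a} = (\<integral>\<^sup>+r. ennreal (?f r) * indicator {0..a} r \<partial>lborel)"
    by (subst emeasure_density) (auto intro!: nn_integral_cong simp: indicator_def)
  also have "\<dots> = ennreal (if a \<ge> 0 then unit_ball_vol (DIM('a)) * a ^ DIM('a) else 0)"
  proof (cases "a \<ge> 0")
    case True
    have "(\<integral>\<^sup>+r. ennreal (?f r) * indicator {0..a} r \<partial>lborel)
        = unit_ball_vol (DIM('a)) * a ^ DIM('a) - unit_ball_vol (DIM('a)) * 0 ^ DIM('a)"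
    proof (rule nn_integral_FTC_Icc)
      fix x assume "x \<in> {0..a}"
      show "((\<lambda>x. unit_ball_vol (DIM('a)) * x ^ DIM('a)) has_real_derivative ?f x) (at x)"
        by (auto intro!: derivative_eq_intros)
      show "0 \<le> ?f x" using \<open>x \<in> {0..a}\<close> by (auto intro!: mult_nonneg_nonneg)
    qed (use True in auto)
    then show ?thesis using True by (simp add: zero_power)
  qed simp
  finally show "emeasure ?M X = emeasure ?N X" by (simp add: X M)
qed

lemma nn_integral_radial:
  assumes [measurable]: "f \<in> borel_measurable borel"
  shows "(\<integral>\<^sup>+x. f (norm x) \<partial>(lborel :: 'a::euclidean_space measure)) =
     (\<integral>\<^sup>+r. ennreal (DIM('a) * unit_ball_vol (DIM('a)) * r ^ (DIM('a) - 1)) * indicator {0..} r * f r \<partial>lborel)"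
  (is "_ = ?r")
proof -
  have "(\<integral>\<^sup>+x. f (norm x) \<partial>(lborel :: 'a measure)) = (\<integral>\<^sup>+r. f r \<partial>distr (lborel :: 'a measure) borel norm)"
    by (simp add: nn_integral_distr)
  also have "\<dots> = ?r" unfolding lborel_distr_norm by (subst nn_integral_density) auto
  finally show ?thesis .
qed

section \<open>Continuity of translations\<close>

lemma tendsto_0_ennrealI:
  fixes X :: "'a \<Rightarrow> ennreal"
  assumes "\<And>e::real. e > 0 \<Longrightarrow> eventually (\<lambda>x. X x \<le> ennreal e) F"
  shows "(X \<longlongrightarrow> 0) F"
proof (rule order_tendstoI)
  fix a :: ennreal assume "0 < a"
  then obtain b where b: "0 < b" "b < a" using dense by blast
  then obtain e where e: "b = ennreal e" "e \<ge> 0" by (cases b) auto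
  with b have "e > 0" by auto
  from assms[OF this] show "eventually (\<lambda>x. X x < a) F"
    by eventually_elim (use b e in auto)
qed simp

text \<open>Inner regularity yields a closed set; finite measure allows it to be cut with a large
  ball. Compactness matters later, since it separates \<open>K\<close> from the complement of
  \<open>U\<close> by a positive distance.\<close>

lemma borel_inner_outer:
  fixes A :: "'a::euclidean_space set" and e :: real
  assumes "A \<in> sets borel" "emeasure lborel A < \<infinity>" "e > 0"
  obtains K U where "compact K" "open U" "K \<subseteq> A" "A \<subseteq> U" "emeasure lborel (U - K) \<le> ennreal e"
proof -
  have [measurable]: "A \<in> sets borel" by fact
  then have AL: "A \<in> sets lebesgue" by simp
  have e3: "e/3 > 0" using \<open>e > 0\<close> by simp
  obtain C where C: "closed C" "C \<subseteq> A" "emeasure lebesgue (A - C) < ennreal (e/3)"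
    using sets_lebesgue_inner_closed[OF AL e3] by metis
  obtain U where U: "open U" "A \<subseteq> U" "emeasure lebesgue (U - A) < ennreal (e/3)"
    using sets_lebesgue_outer_open[OF AL e3] by metis
  have [measurable]: "C \<in> sets borel" "U \<in> sets borel" using C U by auto
  have "(\<lambda>n. emeasure lborel (A - cball 0 (real n))) \<longlonglongrightarrow> emeasure lborel (\<Inter>n. A - cball 0 (real n))"
  proof (rule Lim_emeasure_decseq)
    show "emeasure lborel (A - cball 0 (real i)) \<noteq> \<infinity>" for i
      using emeasure_mono[of "A - cball 0 (real i)" A lborel] assms by (auto simp: top_unique)
  qed (auto simp: decseq_def)
  also have "(\<Inter>n. A - cball 0 (real n)) = {}" by (auto intro: real_arch_simple)
  finally have "(\<lambda>n. emeasure lborel (A - cball 0 (real n))) \<longlonglongrightarrow> 0" by simp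
  then have "eventually (\<lambda>n. emeasure lborel (A - cball 0 (real n)) < ennreal (e/3)) sequentially"
    using \<open>e > 0\<close> by (intro order_tendstoD) auto
  then obtain n where n: "emeasure lborel (A - cball 0 (real n)) < ennreal (e/3)"
    by (auto simp: eventually_sequentially)
  define K where "K = C \<inter> cball 0 (real n)"
  have "compact K" unfolding K_def using C by (intro closed_Int_compact) auto
  have "emeasure lborel (U - K) \<le> emeasure lborel ((U - A) \<union> (A - C) \<union> (A - cball 0 (real n)))"
    by (intro emeasure_mono) (auto simp: K_def)
  also have "\<dots> \<le> emeasure lborel (U - A) + emeasure lborel (A - C) + emeasure lborel (A - cball 0 (real n))"
    by (intro order_trans[OF emeasure_subadditive] add_mono) auto
  also have "\<dots> \<le> ennreal (e/3) + ennreal (e/3) + ennreal (e/3)"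
    using C U n by (intro add_mono) (auto simp: emeasure_completion)
  also have "\<dots> = ennreal e" using \<open>e > 0\<close> by (simp flip: ennreal_plus)
  finally show thesis using that[of K U] \<open>compact K\<close> U C by (auto simp: K_def)
qed

text \<open>For an indicator, a shift shorter than the distance from \<open>K\<close> to the
  complement of \<open>U\<close> changes the value only on \<open>U - K\<close> and on its
  translate. Sums and dominated limits carry this over to all integrable functions.\<close>

lemma L1_translation_continuous:
  fixes f :: "'a::euclidean_space \<Rightarrow> real"
  assumes "integrable lborel f"
  shows "((\<lambda>h. \<integral>\<^sup>+x. ennreal \<bar>f x - f (x - h)\<bar> \<partial>lborel) \<longlongrightarrow> 0) (nhds 0)"
  using assms
proof (induction f rule: integrable_induct)
  case (base A c)
  have A[measurable]: "A \<in> sets borel" using base by simp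
  show ?case
  proof (rule tendsto_0_ennrealI)
    fix e :: real assume "e > 0"
    \<comment> \<open>The defect will be at most \<open>2 * \<bar>c\<bar> * \<eta>\<close>; adding
      \<open>1\<close> in the denominator covers \<open>c = 0\<close>.\<close>
    define \<eta> where "\<eta> = e / (2 * (\<bar>c\<bar> + 1))"
    have "\<eta> > 0" using \<open>e > 0\<close> by (simp add: \<eta>_def add_nonneg_pos)
    obtain K U where KU: "compact K" "open U" "K \<subseteq> A" "A \<subseteq> U" "emeasure lborel (U - K) \<le> ennreal \<eta>"
      using borel_inner_outer[OF A base(2) \<open>\<eta> > 0\<close>] by metis
    have [measurable]: "K \<in> sets borel" "U \<in> sets borel" using KU by (auto simp: borel_compact)
    define D where "D = U - K"
    have [measurable]: "D \<in> sets borel" by (simp add: D_def)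
    obtain r where r: "r > 0" "\<And>x y. x \<in> K \<Longrightarrow> y \<in> - U \<Longrightarrow> r \<le> dist x y"
      using separate_compact_closed[of K "- U"] KU by (metis Compl_disjoint Compl_iff closed_Compl disjoint_iff subsetD)
    have pt: "\<bar>indicator A x *\<^sub>R c - indicator A (x - h) *\<^sub>R c\<bar> \<le> \<bar>c\<bar> * (indicator D x + indicator D (x - h))"
      if "norm h < r" for h x
    proof -
      have "x - h \<in> U" if "x \<in> K" using r(2)[OF that, of "x - h"] \<open>norm h < r\<close> by (auto simp: dist_norm)
      moreover have "x \<in> U" if "x - h \<in> K" using r(2)[OF that, of x] \<open>norm h < r\<close> by (auto simp: dist_norm)
      ultimately show ?thesis using KU by (auto simp: indicator_def D_def)
    qed
    have "(\<integral>\<^sup>+x. ennreal \<bar>indicator A x *\<^sub>R c - indicator A (x - h) *\<^sub>R c\<bar> \<partial>lborel) \<le> ennreal e"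
      if h: "norm h < r" for h
    proof -
      have "(\<integral>\<^sup>+x. ennreal \<bar>indicator A x *\<^sub>R c - indicator A (x - h) *\<^sub>R c\<bar> \<partial>lborel)
         \<le> (\<integral>\<^sup>+x. ennreal \<bar>c\<bar> * (indicator D x + indicator D (x - h)) \<partial>lborel)"
      proof (intro nn_integral_mono)
        fix x
        have "ennreal \<bar>indicator A x *\<^sub>R c - indicator A (x - h) *\<^sub>R c\<bar>
            \<le> ennreal (\<bar>c\<bar> * (indicator D x + indicator D (x - h)))"
          using pt[OF h] by (intro ennreal_leI)
        also have "\<dots> = ennreal \<bar>c\<bar> * (indicator D x + indicator D (x - h))"
          by (simp add: ennreal_mult ennreal_plus ennreal_indicator)
        finally show "ennreal \<bar>indicator A x *\<^sub>R c - indicator A (x - h) *\<^sub>R c\<bar>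
            \<le> ennreal \<bar>c\<bar> * (indicator D x + indicator D (x - h))" .
      qed
      also have "\<dots> = ennreal \<bar>c\<bar> * (emeasure lborel D + (\<integral>\<^sup>+x. indicator D (x - h) \<partial>lborel))"
        by (simp add: nn_integral_cmult nn_integral_add)
      also have "(\<integral>\<^sup>+x. indicator D (x - h) \<partial>lborel) = emeasure lborel D"
        by (subst nn_integral_lborel_diff) auto
      also have "ennreal \<bar>c\<bar> * (emeasure lborel D + emeasure lborel D) \<le> ennreal \<bar>c\<bar> * (ennreal \<eta> + ennreal \<eta>)"
        using KU by (intro mult_left_mono add_mono) (auto simp: D_def)
      also have "\<dots> = ennreal (\<bar>c\<bar> * (2 * \<eta>))"
        using \<open>\<eta> > 0\<close> by (simp add: ennreal_mult flip: ennreal_plus)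
      also have "\<dots> \<le> ennreal e"
      proof (rule ennreal_leI)
        have "\<bar>c\<bar> * (2 * \<eta>) = e * (\<bar>c\<bar> / (\<bar>c\<bar> + 1))" 
          by (simp add: \<eta>_def divide_simps)
        also have "\<dots> \<le> e * 1" using \<open>e > 0\<close> by (intro mult_left_mono) auto
        finally show "\<bar>c\<bar> * (2 * \<eta>) \<le> e" by simp
      qed
      finally show ?thesis .
    qed
    moreover have "eventually (\<lambda>h::'a. norm h < r) (nhds 0)"
      using \<open>r > 0\<close> by (auto simp: eventually_nhds_metric)
    ultimately show "\<forall>\<^sub>F h in nhds 0. (\<integral>\<^sup>+x. ennreal \<bar>indicator A x *\<^sub>R c - indicator A (x - h) *\<^sub>R c\<bar> \<partial>lborel) \<le> ennreal e"
      by (auto elim: eventually_mono)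
  qed
next
  case (add f g)
  have [measurable]: "f \<in> borel_measurable borel" "g \<in> borel_measurable borel" using add by auto
  show ?case
  proof (rule tendsto_sandwich[OF _ _ tendsto_const])
    show "((\<lambda>h. (\<integral>\<^sup>+x. ennreal \<bar>f x - f (x - h)\<bar> \<partial>lborel) + (\<integral>\<^sup>+x. ennreal \<bar>g x - g (x - h)\<bar> \<partial>lborel)) \<longlongrightarrow> 0) (nhds 0)"
      using tendsto_add[OF add(3,4)] by simp
    have "(\<integral>\<^sup>+x. ennreal \<bar>f x + g x - (f (x - h) + g (x - h))\<bar> \<partial>lborel)
      \<le> (\<integral>\<^sup>+x. ennreal \<bar>f x - f (x - h)\<bar> \<partial>lborel) + (\<integral>\<^sup>+x. ennreal \<bar>g x - g (x - h)\<bar> \<partial>lborel)" for h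
      by (subst nn_integral_add[symmetric]) (auto intro!: nn_integral_mono ennreal_leI simp flip: ennreal_plus)
    then show "\<forall>\<^sub>F h in nhds 0. (\<integral>\<^sup>+x. ennreal \<bar>f x + g x - (f (x - h) + g (x - h))\<bar> \<partial>lborel)
      \<le> (\<integral>\<^sup>+x. ennreal \<bar>f x - f (x - h)\<bar> \<partial>lborel) + (\<integral>\<^sup>+x. ennreal \<bar>g x - g (x - h)\<bar> \<partial>lborel)"
      by simp
  qed simp
next
  case (lim f s)
  have [measurable]: "f \<in> borel_measurable borel" "\<And>i. s i \<in> borel_measurable borel" using lim by auto
  have conv: "(\<lambda>i. \<integral>\<^sup>+x. ennreal (norm (f x - s i x)) \<partial>lborel) \<longlonglongrightarrow> 0"
  proof (rule nn_integral_dominated_convergence_norm)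
    show "(\<integral>\<^sup>+x. ennreal (2 * norm (f x)) \<partial>lborel) < \<infinity>"
      using \<open>integrable lborel f\<close> by (simp add: integrable_iff_bounded ennreal_mult nn_integral_cmult ennreal_mult_less_top)
  qed (use lim in auto)
  show ?case
  proof (rule tendsto_0_ennrealI)
    fix e :: real assume "e > 0"
    have "eventually (\<lambda>i. (\<integral>\<^sup>+x. ennreal (norm (f x - s i x)) \<partial>lborel) < ennreal (e/4)) sequentially"
      using conv \<open>e > 0\<close> by (intro order_tendstoD) auto
    then obtain i where i: "(\<integral>\<^sup>+x. ennreal (norm (f x - s i x)) \<partial>lborel) < ennreal (e/4)"
      by (auto simp: eventually_sequentially)
    have "eventually (\<lambda>h. (\<integral>\<^sup>+x. ennreal \<bar>s i x - s i (x - h)\<bar> \<partial>lborel) < ennreal (e/2)) (nhds 0)"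
      using lim.IH[of i] \<open>e > 0\<close> by (intro order_tendstoD) auto
    then show "\<forall>\<^sub>F h in nhds 0. (\<integral>\<^sup>+x. ennreal \<bar>f x - f (x - h)\<bar> \<partial>lborel) \<le> ennreal e"
    proof eventually_elim
      case (elim h)
      have "(\<integral>\<^sup>+x. ennreal \<bar>f x - f (x - h)\<bar> \<partial>lborel)
        \<le> (\<integral>\<^sup>+x. ennreal (norm (f x - s i x)) + ennreal \<bar>s i x - s i (x - h)\<bar> + ennreal (norm (f (x - h) - s i (x - h))) \<partial>lborel)"
        by (intro nn_integral_mono) (auto intro!: ennreal_leI simp flip: ennreal_plus)
      also have "\<dots> = (\<integral>\<^sup>+x. ennreal (norm (f x - s i x)) \<partial>lborel) + (\<integral>\<^sup>+x. ennreal \<bar>s i x - s i (x - h)\<bar> \<partial>lborel)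
         + (\<integral>\<^sup>+x. ennreal (norm (f (x - h) - s i (x - h))) \<partial>lborel)"
        by (simp add: nn_integral_add)
      also have "(\<integral>\<^sup>+x. ennreal (norm (f (x - h) - s i (x - h))) \<partial>lborel) = (\<integral>\<^sup>+x. ennreal (norm (f x - s i x)) \<partial>lborel)"
        by (rule nn_integral_lborel_diff) simp
      also have "(\<integral>\<^sup>+x. ennreal (norm (f x - s i x)) \<partial>lborel) + (\<integral>\<^sup>+x. ennreal \<bar>s i x - s i (x - h)\<bar> \<partial>lborel)
         + (\<integral>\<^sup>+x. ennreal (norm (f x - s i x)) \<partial>lborel) \<le> ennreal (e/4) + ennreal (e/2) + ennreal (e/4)"
        using i elim by (intro add_mono) auto
      also have "\<dots> = ennreal e" using \<open>e > 0\<close> by (simp flip: ennreal_plus)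
      finally show ?case .
    qed
  qed
qed

text \<open>
  The signed square \<open>a \<mapsto> a\<bar>a\<bar>\<close> carries the \<open>L\<^sup>1\<close> continuity of translations over to \<open>L\<^sup>2\<close>.
\<close>

lemma power2_diff_le_signed_square:
  fixes a b :: real
  shows "(a - b)\<^sup>2 \<le> 2 * \<bar>a * \<bar>a\<bar> - b * \<bar>b\<bar>\<bar>"
proof -
  have 1: "(a - b)\<^sup>2 \<le> 2 * \<bar>a * a - b * b\<bar>" if "a \<ge> 0" "b \<ge> 0" for a b :: real
  proof -
    have "(a - b)\<^sup>2 = \<bar>a - b\<bar> * \<bar>a - b\<bar>" by (simp add: power2_eq_square)
    also have "\<dots> \<le> \<bar>a - b\<bar> * (a + b)" using that by (intro mult_left_mono) auto
    also have "\<dots> = \<bar>a * a - b * b\<bar>" using that by (simp add: square_diff_square_factored abs_mult)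
    also have "\<dots> \<le> 2 * \<bar>a * a - b * b\<bar>" using abs_ge_zero[of "a * a - b * b"] by (simp del: abs_ge_zero)
    finally show ?thesis .
  qed
  have 2: "(a - b)\<^sup>2 \<le> 2 * (a * a + b * b)" for a b :: real
    using sum_power2_ge_zero[of "a + b" 0] by (simp add: power2_eq_square algebra_simps)
  note 0 = 1
  consider "a \<ge> 0" "b \<ge> 0" | "a < 0" "b < 0" | "a \<ge> 0" "b < 0" | "a < 0" "b \<ge> 0" by linarith
  then show ?thesis
  proof cases
    case 1 then show ?thesis using 0[of a b] by simp
  next
    case 2 then show ?thesis using 0[of "-a" "-b"] by (simp add: power2_commute abs_minus_commute)
  next
    case 3
    have "\<bar>a * a + b * b\<bar> = a * a + b * b" by simp
    then show ?thesis using 3 2[of a b] by simp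
  next
    case 4
    have "\<bar>- (a * a) - b * b\<bar> = a * a + b * b"
      using zero_le_square[of a] zero_le_square[of b] by linarith
    then show ?thesis using 4 2[of a b] by simp
  qed
qed

lemma L2_translation_continuous:
  fixes u :: "'a::euclidean_space \<Rightarrow> complex"
  assumes u: "u \<in> L2_space"
  shows "((\<lambda>h. \<integral>\<^sup>+x. ennreal ((norm (u x - u (x - h)))\<^sup>2) \<partial>lborel) \<longlongrightarrow> 0) (nhds 0)"
proof -
  have [measurable]: "u \<in> borel_measurable borel" and int: "integrable lborel (\<lambda>x. (norm (u x))\<^sup>2)"
    using u by (auto simp: L2_space_def)
  define f g where "f = (\<lambda>x. Re (u x) * \<bar>Re (u x)\<bar>)" and "g = (\<lambda>x. Im (u x) * \<bar>Im (u x)\<bar>)"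
  have [measurable]: "f \<in> borel_measurable borel" "g \<in> borel_measurable borel"
    by (simp_all add: f_def g_def)
  have "integrable lborel f" "integrable lborel g"
    by (auto intro!: Bochner_Integration.integrable_bound[OF int] simp: f_def g_def abs_mult cmod_def
        power2_eq_square[symmetric])
  from L1_translation_continuous[OF this(1)] L1_translation_continuous[OF this(2)]
  have lim: "((\<lambda>h. 2 * (\<integral>\<^sup>+x. ennreal \<bar>f x - f (x - h)\<bar> \<partial>lborel) + 2 * (\<integral>\<^sup>+x. ennreal \<bar>g x - g (x - h)\<bar> \<partial>lborel))
      \<longlongrightarrow> 2 * 0 + 2 * 0) (nhds 0)"
    by (intro tendsto_add ennreal_tendsto_cmult) auto
  show ?thesis
  proof (rule tendsto_sandwich[OF _ _ tendsto_const])
    show "((\<lambda>h. 2 * (\<integral>\<^sup>+x. ennreal \<bar>f x - f (x - h)\<bar> \<partial>lborel) + 2 * (\<integral>\<^sup>+x. ennreal \<bar>g x - g (x - h)\<bar> \<partial>lborel))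
      \<longlongrightarrow> 0) (nhds 0)" using lim by simp
    have "(\<integral>\<^sup>+x. ennreal ((norm (u x - u (x - h)))\<^sup>2) \<partial>lborel)
       \<le> 2 * (\<integral>\<^sup>+x. ennreal \<bar>f x - f (x - h)\<bar> \<partial>lborel) + 2 * (\<integral>\<^sup>+x. ennreal \<bar>g x - g (x - h)\<bar> \<partial>lborel)" for h
    proof -
      have "(\<integral>\<^sup>+x. ennreal ((norm (u x - u (x - h)))\<^sup>2) \<partial>lborel)
        \<le> (\<integral>\<^sup>+x. 2 * ennreal \<bar>f x - f (x - h)\<bar> + 2 * ennreal \<bar>g x - g (x - h)\<bar> \<partial>lborel)"
      proof (intro nn_integral_mono)
        fix x
        have "(norm (u x - u (x - h)))\<^sup>2 \<le> 2 * \<bar>f x - f (x - h)\<bar> + 2 * \<bar>g x - g (x - h)\<bar>"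
          unfolding cmod_power2 f_def g_def minus_complex.sel
          by (intro add_mono power2_diff_le_signed_square)
        then have "ennreal ((norm (u x - u (x - h)))\<^sup>2) \<le> ennreal (2 * \<bar>f x - f (x - h)\<bar> + 2 * \<bar>g x - g (x - h)\<bar>)"
          by (rule ennreal_leI)
        then show "ennreal ((norm (u x - u (x - h)))\<^sup>2) \<le> 2 * ennreal \<bar>f x - f (x - h)\<bar> + 2 * ennreal \<bar>g x - g (x - h)\<bar>"
          by (simp add: ennreal_mult)
      qed
      then show ?thesis by (simp add: nn_integral_add nn_integral_cmult)
    qed
    then show "\<forall>\<^sub>F h in nhds 0. (\<integral>\<^sup>+x. ennreal ((norm (u x - u (x - h)))\<^sup>2) \<partial>lborel)
       \<le> 2 * (\<integral>\<^sup>+x. ennreal \<bar>f x - f (x - h)\<bar> \<partial>lborel) + 2 * (\<integral>\<^sup>+x. ennreal \<bar>g x - g (x - h)\<bar> \<partial>lborel)"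
      by simp
  qed simp
qed

section \<open>Gaussians and the Fourier transform of integrable functions\<close>

text \<open>With this normalization the Fourier transform exchanges \<open>gauss s\<close> and
  \<open>gauss (1 / s)\<close> up to a constant, and \<open>gauss 1\<close> is fixed.\<close>

definition gauss :: "real \<Rightarrow> 'a::euclidean_space \<Rightarrow> real" where
  "gauss s z = exp (- (s * (norm z)\<^sup>2) / 2)"

lemma gauss_measurable [measurable]: "gauss s \<in> borel_measurable borel"
  unfolding gauss_def[abs_def] by measurable

lemma gauss_pos [simp]: "gauss s z > 0" and gauss_nonneg [simp]: "gauss s z \<ge> 0"
  by (simp_all add: gauss_def)

lemma gauss_minus [simp]: "gauss s (- z) = gauss s z"
  by (simp add: gauss_def)

lemma gauss_scaleR: "gauss s (c *\<^sub>R z) = gauss (s * c\<^sup>2) z"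
  by (simp add: gauss_def power_mult_distrib mult_ac)

lemma lborel_scale:
  fixes f :: "'a::euclidean_space \<Rightarrow> 'b::{banach, second_countable_topology}"
  assumes c: "c \<noteq> 0" and [measurable]: "f \<in> borel_measurable borel"
  shows integrable_lborel_scale: "integrable lborel (\<lambda>y. f (c *\<^sub>R y)) \<longleftrightarrow> integrable lborel f"
    and integral_lborel_scale: "(LINT z|lborel. f z) = \<bar>c\<bar> ^ DIM('a) *\<^sub>R (LINT y|lborel. f (c *\<^sub>R y))"
proof -
  have eq: "lborel = density (distr lborel borel (\<lambda>y::'a. 0 + c *\<^sub>R y)) (\<lambda>_. ennreal (\<bar>c\<bar> ^ DIM('a)))"
    using c by (intro lborel_affine) auto
  have "integrable lborel f \<longleftrightarrow> integrable lborel (\<lambda>y. \<bar>c\<bar> ^ DIM('a) *\<^sub>R f (c *\<^sub>R y))"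
    by (subst eq) (simp add: integrable_density integrable_distr_eq)
  also have "\<dots> \<longleftrightarrow> integrable lborel (\<lambda>y. f (c *\<^sub>R y))"
  proof
    assume "integrable lborel (\<lambda>y. \<bar>c\<bar> ^ DIM('a) *\<^sub>R f (c *\<^sub>R y))"
    then have "integrable lborel (\<lambda>y. inverse (\<bar>c\<bar> ^ DIM('a)) *\<^sub>R \<bar>c\<bar> ^ DIM('a) *\<^sub>R f (c *\<^sub>R y))"
      by (rule integrable_scaleR_right)
    then show "integrable lborel (\<lambda>y. f (c *\<^sub>R y))" using c by simp
  qed (rule integrable_scaleR_right)
  finally show "integrable lborel (\<lambda>y. f (c *\<^sub>R y)) \<longleftrightarrow> integrable lborel f" by simp
  show "(LINT z|lborel. f z) = \<bar>c\<bar> ^ DIM('a) *\<^sub>R (LINT y|lborel. f (c *\<^sub>R y))"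
    by (subst eq) (simp add: integral_density integral_distr)
qed

lemma nn_integral_lborel_scale:
  fixes f :: "'a::euclidean_space \<Rightarrow> ennreal"
  assumes c: "c \<noteq> 0" and [measurable]: "f \<in> borel_measurable borel"
  shows "(\<integral>\<^sup>+z. f z \<partial>lborel) = (\<integral>\<^sup>+y. ennreal (\<bar>c\<bar> ^ DIM('a)) * f (c *\<^sub>R y) \<partial>lborel)"
proof -
  have eq: "lborel = density (distr lborel borel (\<lambda>y::'a. 0 + c *\<^sub>R y)) (\<lambda>_. ennreal (\<bar>c\<bar> ^ DIM('a)))"
    using c by (intro lborel_affine) auto
  show ?thesis
    by (subst eq) (simp add: nn_integral_density nn_integral_distr)
qed

lemma lborel_integral_prod:
  fixes f :: "'a::euclidean_space \<Rightarrow> real \<Rightarrow> complex"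
  assumes f: "\<And>b. b \<in> Basis \<Longrightarrow> integrable lborel (f b)"
  shows integrable_lborel_prod: "integrable lborel (\<lambda>x::'a. \<Prod>b\<in>Basis. f b (x \<bullet> b))"
    and integral_lborel_prod: "(LINT x|lborel. (\<Prod>b\<in>Basis. f b (x \<bullet> b))) = (\<Prod>b\<in>Basis. LINT y|lborel. f b y)"
proof -
  interpret product_sigma_finite "\<lambda>_::'a. lborel :: real measure" ..
  have [measurable]: "b \<in> Basis \<Longrightarrow> f b \<in> borel_measurable borel" for b using f by auto
  have simp1: "(\<Prod>b\<in>Basis. f b ((\<Sum>b\<in>Basis. g b *\<^sub>R b) \<bullet> b)) = (\<Prod>b\<in>Basis. f b (g b))" for g
    by (intro prod.cong refl) simp
  show "integrable lborel (\<lambda>x::'a. \<Prod>b\<in>Basis. f b (x \<bullet> b))"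
    by (subst lborel_eq) (simp add: integrable_distr_eq simp1 product_integrable_prod f)
  show "(LINT x|lborel. (\<Prod>b\<in>Basis. f b (x \<bullet> b))) = (\<Prod>b\<in>Basis. LINT y|lborel. f b y)"
    by (subst lborel_eq) (simp add: integral_distr simp1 product_integral_prod f)
qed

text \<open>This is the characteristic function of the standard normal distribution; the transforms
  of all other Gaussians follow from it by products and scaling.\<close>

lemma gauss_fourier_real:
  fixes t :: real
  shows "integrable lborel (\<lambda>y::real. complex_of_real (exp (- y\<^sup>2 / 2)) * exp (\<i> * complex_of_real (t * y)))" (is ?I)
    and "(LINT y|lborel. complex_of_real (exp (- y\<^sup>2 / 2)) * exp (\<i> * complex_of_real (t * y)))
       = complex_of_real (sqrt (2 * pi) * exp (- t\<^sup>2 / 2))" (is ?E)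
proof -
  have sp: "sqrt (2 * pi) > 0" by simp
  have eq: "complex_of_real (exp (- y\<^sup>2 / 2)) * exp (\<i> * complex_of_real (t * y))
      = complex_of_real (sqrt (2 * pi)) * (std_normal_density y *\<^sub>R exp (\<i> * complex_of_real (t * y)))" for y
    using sp by (simp add: std_normal_density_def scaleR_conv_of_real flip: of_real_mult)
  have int: "integrable lborel (\<lambda>y. std_normal_density y *\<^sub>R exp (\<i> * complex_of_real (t * y)))"
    by (rule Bochner_Integration.integrable_bound[OF integrable_std_normal_moment[of 0]])
       (auto simp: normal_density_nonneg)
  then show ?I by (subst eq) (intro integrable_mult_right)
  have "(LINT y|lborel. std_normal_density y *\<^sub>R exp (\<i> * complex_of_real (t * y))) = char std_normal_distribution t"
    unfolding char_def by (subst integral_density) (auto simp: normal_density_nonneg)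
  also have "\<dots> = complex_of_real (exp (- t\<^sup>2 / 2))" by (simp add: char_std_normal_distribution)
  finally show ?E unfolding eq integral_mult_right_zero by simp
qed

lemma gauss_fourier_1:
  fixes x :: "'a::euclidean_space"
  shows "integrable lborel (\<lambda>z. complex_of_real (gauss 1 z) * exp (\<i> * complex_of_real (x \<bullet> z)))" (is ?I)
    and "(LINT z|lborel. complex_of_real (gauss 1 z) * exp (\<i> * complex_of_real (x \<bullet> z)))
       = complex_of_real ((2 * pi) powr (DIM('a) / 2) * gauss 1 x)" (is ?E)
proof -
  define f where "f = (\<lambda>b y. complex_of_real (exp (- y\<^sup>2 / 2)) * exp (\<i> * complex_of_real ((x \<bullet> b) * y)))"
  have n2: "(norm z)\<^sup>2 = (\<Sum>b\<in>Basis. (z \<bullet> b)\<^sup>2)" for z :: 'a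
    unfolding power2_norm_eq_inner by (subst euclidean_inner) (simp add: power2_eq_square)
  have g: "gauss 1 z = (\<Prod>b\<in>Basis. exp (- (z \<bullet> b)\<^sup>2 / 2))" for z :: 'a
    by (simp add: gauss_def n2 exp_sum[symmetric] sum_negf sum_divide_distrib[symmetric])
  have e: "exp (\<i> * complex_of_real (x \<bullet> z)) = (\<Prod>b\<in>Basis. exp (\<i> * complex_of_real ((x \<bullet> b) * (z \<bullet> b))))" for z
    by (subst euclidean_inner) (simp add: exp_sum[symmetric] sum_distrib_left)
  have eq: "complex_of_real (gauss 1 z) * exp (\<i> * complex_of_real (x \<bullet> z)) = (\<Prod>b\<in>Basis. f b (z \<bullet> b))" for z
    unfolding g e f_def by (simp only: of_real_prod prod.distrib)
  have int: "integrable lborel (f b)" for b unfolding f_def by (rule gauss_fourier_real)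
  show ?I unfolding eq by (rule integrable_lborel_prod[OF int])
  have sq: "sqrt (2 * pi) ^ DIM('a) = (2 * pi) powr (DIM('a) / 2)"
    by (simp add: powr_half_sqrt[symmetric] powr_powr powr_realpow[symmetric])
  have "(LINT z|lborel. complex_of_real (gauss 1 z) * exp (\<i> * complex_of_real (x \<bullet> z)))
     = (\<Prod>b\<in>(Basis::'a set). LINT y|lborel. f b y)"
    unfolding eq by (rule integral_lborel_prod[OF int])
  also have "\<dots> = (\<Prod>b\<in>(Basis::'a set). complex_of_real (sqrt (2 * pi) * exp (- (x \<bullet> b)\<^sup>2 / 2)))"
    unfolding f_def by (intro prod.cong refl gauss_fourier_real)
  also have "\<dots> = complex_of_real (sqrt (2 * pi) ^ DIM('a) * gauss 1 x)"
    unfolding g by (simp only: of_real_prod[symmetric] prod.distrib prod_constant)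
  finally show ?E by (simp add: sq)
qed

lemma gauss_fourier:
  fixes x :: "'a::euclidean_space"
  assumes s: "s > 0"
  shows integrable_gauss_exp: "integrable lborel (\<lambda>z. complex_of_real (gauss s z) * exp (\<i> * complex_of_real (x \<bullet> z)))" (is ?I)
    and integral_gauss_exp: "(LINT z|lborel. complex_of_real (gauss s z) * exp (\<i> * complex_of_real (x \<bullet> z)))
       = complex_of_real ((2 * pi / s) powr (DIM('a) / 2) * gauss (1 / s) x)" (is ?E)
proof -
  define c where "c = 1 / sqrt s"
  have c: "c > 0" "s * c\<^sup>2 = 1" "c\<^sup>2 = 1 / s" using s by (simp_all add: c_def power_divide)
  let ?F = "\<lambda>z. complex_of_real (gauss s z) * exp (\<i> * complex_of_real (x \<bullet> z))"
  have F: "?F (c *\<^sub>R y) = complex_of_real (gauss 1 y) * exp (\<i> * complex_of_real ((c *\<^sub>R x) \<bullet> y))" for y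
    using c(2) by (simp only: gauss_scaleR inner_scaleR_left inner_scaleR_right)
  have "integrable lborel (\<lambda>y. ?F (c *\<^sub>R y))" unfolding F by (rule gauss_fourier_1)
  then show ?I using c by (subst (asm) integrable_lborel_scale) auto
  have cd: "c ^ DIM('a) = (1 / s) powr (DIM('a) / 2)"
    using s by (simp add: c_def powr_half_sqrt[symmetric] powr_powr powr_realpow[symmetric] powr_divide real_sqrt_divide)
  have "integral\<^sup>L lborel ?F = \<bar>c\<bar> ^ DIM('a) *\<^sub>R (LINT y|lborel. ?F (c *\<^sub>R y))"
    using c by (intro integral_lborel_scale) auto
  also have "\<dots> = \<bar>c\<bar> ^ DIM('a) *\<^sub>R complex_of_real ((2 * pi) powr (DIM('a) / 2) * gauss 1 (c *\<^sub>R x))"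
    unfolding F gauss_fourier_1 ..
  also have "\<dots> = complex_of_real ((2 * pi / s) powr (DIM('a) / 2) * gauss (1 / s) x)"
    using c s by (simp add: gauss_scaleR cd scaleR_conv_of_real powr_divide powr_mult)
  finally show ?E .
qed

lemma integrable_gauss: "s > 0 \<Longrightarrow> integrable lborel (gauss s :: 'a::euclidean_space \<Rightarrow> real)"
  using integrable_gauss_exp[of s "0::'a"] by (simp add: complex_of_real_integrable_eq)

lemma integral_gauss:
  assumes "s > 0"
  shows "(LINT z|lborel. gauss s (z::'a::euclidean_space)) = (2 * pi / s) powr (DIM('a) / 2)"
proof -
  have "complex_of_real (LINT z|lborel. gauss s (z::'a)) = complex_of_real ((2 * pi / s) powr (DIM('a) / 2))"
    using integral_gauss_exp[OF assms, of "0::'a"] by (simp add: gauss_def)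
  then show ?thesis by (simp only: of_real_eq_iff)
qed

lemma nn_integral_gauss:
  assumes "s > 0"
  shows "(\<integral>\<^sup>+z. ennreal (gauss s (z::'a::euclidean_space)) \<partial>lborel) = ennreal ((2 * pi / s) powr (DIM('a) / 2))"
  by (subst nn_integral_eq_integral[OF integrable_gauss[OF assms]]) (simp_all add: integral_gauss assms)

lemma integrable_pair_bound:
  fixes F :: "'a::euclidean_space \<times> 'b::euclidean_space \<Rightarrow> complex" and f :: "'a \<Rightarrow> complex" and g :: "'b \<Rightarrow> complex"
  assumes [measurable]: "F \<in> borel_measurable (borel \<Otimes>\<^sub>M borel)"
    and f: "integrable lborel f" and g: "integrable lborel g"
    and le: "\<And>x y. norm (F (x, y)) \<le> norm (f x) * norm (g y)"
  shows "integrable (lborel \<Otimes>\<^sub>M lborel) F"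
proof -
  have [measurable]: "f \<in> borel_measurable borel" "g \<in> borel_measurable borel" using f g by auto
  have "integrable (lborel \<Otimes>\<^sub>M lborel) (\<lambda>p. norm (f (fst p)) * norm (g (snd p)))"
  proof (rule lborel_pair.Fubini_integrable)
    show "integrable lborel (\<lambda>x. LINT y|lborel. norm (norm (f (fst (x, y))) * norm (g (snd (x, y)))))"
      using f by (simp add: abs_mult)
    show "AE x in lborel. integrable lborel (\<lambda>y. norm (f (fst (x, y))) * norm (g (snd (x, y))))"
      using g by simp
  qed measurable
  then show ?thesis
    by (rule Bochner_Integration.integrable_bound) (auto simp: le abs_mult)
qed

section \<open>The Fourier integral on integrable functions\<close>

lemma fourier_L1_measurable [measurable]:
  assumes [measurable]: "u \<in> borel_measurable borel"
  shows "fourier_L1 u \<in> borel_measurable borel"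
  unfolding fourier_L1_def[abs_def] by measurable

lemma norm_exp_ii [simp]: "norm (exp (- (\<i> * complex_of_real t))) = 1"
  using norm_exp_i_times[of "-t"] by simp

lemma norm_fourier_L1_le:
  "norm (fourier_L1 u \<xi>) \<le> (2 * pi) powr (- real DIM('a) / 2) * (LINT x|lborel. norm (u (x::'a::euclidean_space)))"
proof -
  have "norm (LINT x|lborel. exp (- (\<i> * complex_of_real (x \<bullet> \<xi>))) * u x)
     \<le> (LINT x|lborel. norm (exp (- (\<i> * complex_of_real (x \<bullet> \<xi>))) * u x))"
    by (rule integral_norm_bound)
  then show ?thesis
    unfolding fourier_L1_def by (simp add: norm_mult mult_left_mono)
qed

text \<open>Fubini, since the kernel is symmetric in \<open>x\<close> and \<open>\<xi>\<close>. Both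
  the Gaussian form of Plancherel and the adjoint relation for square-integrable functions are
  derived from this multiplication formula.\<close>

lemma fourier_L1_exchange:
  fixes u g :: "'a::euclidean_space \<Rightarrow> complex"
  assumes u: "integrable lborel u" and g: "integrable lborel g"
  shows "(LINT \<xi>|lborel. fourier_L1 u \<xi> * g \<xi>) = (LINT x|lborel. u x * fourier_L1 g x)"
proof -
  have [measurable]: "u \<in> borel_measurable borel" "g \<in> borel_measurable borel" using u g by auto
  let ?c = "complex_of_real ((2 * pi) powr (- real DIM('a) / 2))"
  have int: "integrable (lborel \<Otimes>\<^sub>M lborel) (\<lambda>(x, \<xi>). exp (- (\<i> * complex_of_real (x \<bullet> \<xi>))) * u x * g \<xi>)"
    by (rule integrable_pair_bound[OF _ u g]) (auto simp: norm_mult)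
  have "(LINT \<xi>|lborel. fourier_L1 u \<xi> * g \<xi>)
     = ?c * (LINT \<xi>|lborel. LINT x|lborel. exp (- (\<i> * complex_of_real (x \<bullet> \<xi>))) * u x * g \<xi>)"
  proof -
    have "fourier_L1 u \<xi> * g \<xi> = ?c * (LINT x|lborel. exp (- (\<i> * complex_of_real (x \<bullet> \<xi>))) * u x * g \<xi>)" for \<xi>
      by (simp only: fourier_L1_def integral_mult_left_zero mult.assoc[symmetric])
    then show ?thesis by (simp only: integral_mult_right_zero)
  qed
  also have "(LINT \<xi>|lborel. LINT x|lborel. exp (- (\<i> * complex_of_real (x \<bullet> \<xi>))) * u x * g \<xi>)
     = (LINT x|lborel. LINT \<xi>|lborel. exp (- (\<i> * complex_of_real (x \<bullet> \<xi>))) * u x * g \<xi>)"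
    by (rule lborel_pair.Fubini_integral) (use int in simp)
  also have "\<dots> = (LINT x|lborel. u x * (LINT \<xi>|lborel. exp (- (\<i> * complex_of_real (\<xi> \<bullet> x))) * g \<xi>))"
  proof (rule Bochner_Integration.integral_cong)
    fix x
    have "(LINT \<xi>|lborel. exp (- (\<i> * complex_of_real (x \<bullet> \<xi>))) * u x * g \<xi>)
       = (LINT \<xi>|lborel. u x * (exp (- (\<i> * complex_of_real (\<xi> \<bullet> x))) * g \<xi>))"
      by (simp add: inner_commute mult_ac)
    then show "(LINT \<xi>|lborel. exp (- (\<i> * complex_of_real (x \<bullet> \<xi>))) * u x * g \<xi>)
      = u x * (LINT \<xi>|lborel. exp (- (\<i> * complex_of_real (\<xi> \<bullet> x))) * g \<xi>)" by simp
  qed simp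
  also have "?c * \<dots> = (LINT x|lborel. u x * fourier_L1 g x)"
    unfolding fourier_L1_def integral_mult_right_zero[symmetric]
    by (intro Bochner_Integration.integral_cong refl) (simp only: mult.left_commute integral_mult_right_zero)
  finally show ?thesis .
qed

lemma cnj_fourier_L1:
  "cnj (fourier_L1 u \<xi>) = fourier_L1 (\<lambda>x. cnj (u x)) (- \<xi>)"
proof -
  have "cnj (LINT x|lborel. exp (- (\<i> * complex_of_real (x \<bullet> \<xi>))) * u x)
     = (LINT x|lborel. cnj (exp (- (\<i> * complex_of_real (x \<bullet> \<xi>))) * u x))"
    by (rule Bochner_Integration.integral_cnj[symmetric])
  then show ?thesis unfolding fourier_L1_def by (simp add: exp_cnj)
qed

section \<open>The Plancherel theorem\<close>

lemma nn_integral_L2_space: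
  assumes "u \<in> L2_space"
  shows "(\<integral>\<^sup>+x. ennreal ((norm (u x))\<^sup>2) \<partial>lborel) = ennreal (LINT x|lborel. (norm (u x))\<^sup>2)"
  using assms by (intro nn_integral_eq_integral) (auto simp: L2_space_def)

lemma norm_diff_power2_le: "(norm (a - b))\<^sup>2 \<le> 2 * (norm a)\<^sup>2 + 2 * (norm (b::'a::real_normed_vector))\<^sup>2"
proof -
  have "(norm (a - b))\<^sup>2 \<le> (norm a + norm b)\<^sup>2"
    by (intro power_mono norm_triangle_ineq4) simp
  also have "\<dots> \<le> 2 * (norm a)\<^sup>2 + 2 * (norm b)\<^sup>2"
    using zero_le_power2[of "norm a - norm b"] by (simp add: power2_eq_square algebra_simps)
  finally show ?thesis .
qed

lemma ennreal_two_mult: "r \<ge> 0 \<Longrightarrow> 2 * ennreal r = ennreal (2 * r)"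
  by (simp add: ennreal_mult)

definition translation_defect :: "('a::euclidean_space \<Rightarrow> complex) \<Rightarrow> 'a \<Rightarrow> ennreal" where
  "translation_defect u h = (\<integral>\<^sup>+x. ennreal ((norm (u x - u (x - h)))\<^sup>2) \<partial>lborel)"

lemma translation_defect_measurable [measurable]:
  assumes [measurable]: "u \<in> borel_measurable borel"
  shows "translation_defect u \<in> borel_measurable borel"
  unfolding translation_defect_def[abs_def] by measurable

lemma translation_defect_le:
  assumes u: "u \<in> L2_space"
  shows "translation_defect u h \<le> ennreal (4 * (LINT x|lborel. (norm (u x))\<^sup>2))"
proof -
  have [measurable]: "u \<in> borel_measurable borel" using u by (auto simp: L2_space_def)
  have "translation_defect u h \<le> (\<integral>\<^sup>+x. 2 * ennreal ((norm (u x))\<^sup>2) + 2 * ennreal ((norm (u (x - h)))\<^sup>2) \<partial>lborel)"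
    unfolding translation_defect_def
    by (intro nn_integral_mono) (simp add: ennreal_two_mult norm_diff_power2_le flip: ennreal_plus)
  also have "\<dots> = 2 * (\<integral>\<^sup>+x. ennreal ((norm (u x))\<^sup>2) \<partial>lborel) + 2 * (\<integral>\<^sup>+x. ennreal ((norm (u (x - h)))\<^sup>2) \<partial>lborel)"
    by (simp add: nn_integral_add nn_integral_cmult)
  also have "(\<integral>\<^sup>+x. ennreal ((norm (u (x - h)))\<^sup>2) \<partial>lborel) = (\<integral>\<^sup>+x. ennreal ((norm (u x))\<^sup>2) \<partial>lborel)"
    by (rule nn_integral_lborel_diff) simp
  also have "2 * \<dots> + 2 * \<dots> = ennreal (4 * (LINT x|lborel. (norm (u x))\<^sup>2))"
    by (simp add: nn_integral_L2_space[OF u] ennreal_two_mult flip: ennreal_plus)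
  finally show ?thesis .
qed

text \<open>Dominated convergence: the defect at a fixed \<open>z\<close> vanishes by continuity of
  translations and is bounded by four times the mass. This is the error term of the regularized
  Plancherel identity.\<close>

lemma mollified_defect_tendsto_0:
  fixes u :: "'a::euclidean_space \<Rightarrow> complex"
  assumes u: "u \<in> L2_space"
  shows "(\<lambda>n. \<integral>\<^sup>+z. ennreal (gauss 1 z) * translation_defect u ((1 / real (Suc n)) *\<^sub>R z) \<partial>lborel) \<longlonglongrightarrow> 0"
proof -
  have [measurable]: "u \<in> borel_measurable borel" using u by (auto simp: L2_space_def)
  let ?M = "4 * (LINT x|lborel. (norm (u x))\<^sup>2)"
  have "(\<lambda>n. \<integral>\<^sup>+z. ennreal (gauss 1 z) * translation_defect u ((1 / real (Suc n)) *\<^sub>R z) \<partial>lborel)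
    \<longlonglongrightarrow> (\<integral>\<^sup>+(z::'a). 0 \<partial>lborel)"
  proof (rule nn_integral_dominated_convergence)
    show "AE z in lborel. ennreal (gauss 1 z) * translation_defect u ((1 / real (Suc n)) *\<^sub>R z) \<le> ennreal (gauss 1 z) * ennreal ?M" for n
      by (intro AE_I2 mult_left_mono translation_defect_le u) simp
    show "(\<integral>\<^sup>+(z::'a). ennreal (gauss 1 z) * ennreal ?M \<partial>lborel) < \<infinity>"
      by (simp add: nn_integral_multc nn_integral_gauss ennreal_mult_less_top)
    show "AE z in lborel. (\<lambda>n. ennreal (gauss 1 z) * translation_defect u ((1 / real (Suc n)) *\<^sub>R z)) \<longlonglongrightarrow> 0"
    proof (intro AE_I2)
      fix z :: 'a
      have "(\<lambda>n. (1 / real (Suc n)) *\<^sub>R z) \<longlonglongrightarrow> 0 *\<^sub>R z"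
        by (intro tendsto_scaleR tendsto_const) (use LIMSEQ_inverse_real_of_nat in \<open>simp add: inverse_eq_divide\<close>)
      then have "filterlim (\<lambda>n. (1 / real (Suc n)) *\<^sub>R z) (nhds 0) sequentially" by simp
      from filterlim_compose[OF L2_translation_continuous[OF u] this]
      have "(\<lambda>n. translation_defect u ((1 / real (Suc n)) *\<^sub>R z)) \<longlonglongrightarrow> 0"
        unfolding translation_defect_def .
      then show "(\<lambda>n. ennreal (gauss 1 z) * translation_defect u ((1 / real (Suc n)) *\<^sub>R z)) \<longlonglongrightarrow> 0"
        using ennreal_tendsto_cmult[of "ennreal (gauss 1 z)"] by fastforce
    qed
  qed measurable
  then show ?thesis by simp
qed

lemma borel_measurable_cnj [measurable]: "cnj \<in> borel_measurable borel"
  by (intro borel_measurable_continuous_onI continuous_intros)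

lemma fourier_L1_gauss_modulation:
  fixes x y :: "'a::euclidean_space"
  assumes s: "s > 0"
  shows "fourier_L1 (\<lambda>\<xi>. exp (\<i> * complex_of_real (\<xi> \<bullet> x)) * complex_of_real (gauss s \<xi>)) y
    = complex_of_real ((2 * pi) powr (- real DIM('a) / 2) * (2 * pi / s) powr (DIM('a) / 2) * gauss (1 / s) (x - y))"
proof -
  have eq: "exp (- (\<i> * complex_of_real (\<xi> \<bullet> y))) * (exp (\<i> * complex_of_real (\<xi> \<bullet> x)) * complex_of_real (gauss s \<xi>))
    = complex_of_real (gauss s \<xi>) * exp (\<i> * complex_of_real ((x - y) \<bullet> \<xi>))" for \<xi>
    by (simp add: inner_diff_right inner_diff_left inner_commute mult_exp_exp algebra_simps)
  show ?thesis
    unfolding fourier_L1_def eq integral_gauss_exp[OF s] by simp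
qed

text \<open>The density of the centred Gaussian of variance \<open>s\<close>, which is the
  convolution kernel of the multiplier \<open>gauss s\<close>. The two powers of
  \<open>2 * pi\<close> with negative exponent come from two unitary transforms.\<close>

definition gauss_kernel :: "real \<Rightarrow> 'a::euclidean_space \<Rightarrow> real" where
  "gauss_kernel s z = (2 * pi) powr (- real DIM('a) / 2) * ((2 * pi) powr (- real DIM('a) / 2) * (2 * pi / s) powr (DIM('a) / 2)) * gauss (1 / s) z"

lemma gauss_kernel_minus: "gauss_kernel s (- z) = gauss_kernel s z"
  by (simp add: gauss_kernel_def)

lemma gauss_kernel_nonneg: "gauss_kernel s z \<ge> 0"
  by (simp add: gauss_kernel_def)

lemma gauss_kernel_measurable [measurable]: "gauss_kernel s \<in> borel_measurable borel"
  unfolding gauss_kernel_def[abs_def] by measurable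

text \<open>The transform of an integrable function is bounded, so the Gaussian factor makes
  \<open>h\<close> integrable and the multiplication formula applies to \<open>u\<close> and
  \<open>h\<close>; the transform of \<open>h\<close> is a convolution with the kernel. The identity
  serves twice: for Plancherel, and with a nonnegative \<open>u\<close> for the lower bound on the
  test function.\<close>

lemma gauss_quadratic_form:
  fixes u :: "'a::euclidean_space \<Rightarrow> complex"
  assumes u1: "integrable lborel u" and s: "s > 0"
  shows "complex_of_real (LINT \<xi>|lborel. (norm (fourier_L1 u \<xi>))\<^sup>2 * gauss s \<xi>)
    = (LINT x|lborel. u x * (LINT y|lborel. cnj (u y) * complex_of_real (gauss_kernel s (y - x))))"
    and integrable_fourier_gauss: "integrable lborel (\<lambda>\<xi>. (norm (fourier_L1 u \<xi>))\<^sup>2 * gauss s \<xi>)"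
proof -
  have [measurable]: "u \<in> borel_measurable borel" using u1 by auto
  define c where "c = (2 * pi) powr (- real DIM('a) / 2)"
  define h where "h = (\<lambda>\<xi>. cnj (fourier_L1 u \<xi>) * complex_of_real (gauss s \<xi>))"
  define B where "B = c * (LINT x|lborel. norm (u x))"
  have uB: "norm (fourier_L1 u \<xi>) \<le> B" for \<xi> unfolding B_def c_def by (rule norm_fourier_L1_le)
  have B0: "B \<ge> 0" using uB[of 0] norm_ge_zero order_trans by blast
  have "integrable lborel (\<lambda>\<xi>::'a. B * gauss s \<xi>)" by (intro integrable_mult_right integrable_gauss s)
  then have Ih: "integrable lborel h"
    by (rule Bochner_Integration.integrable_bound)
       (auto simp: h_def norm_mult B0 intro!: AE_I2 mult_right_mono uB)
  have Fh: "fourier_L1 h x = (LINT y|lborel. cnj (u y) * complex_of_real (gauss_kernel s (y - x)))" for x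
  proof -
    define m where "m = (\<lambda>\<xi>. exp (\<i> * complex_of_real (\<xi> \<bullet> x)) * complex_of_real (gauss s \<xi>))"
    have [measurable]: "m \<in> borel_measurable borel" unfolding m_def by measurable
    have Im: "integrable lborel m"
      by (rule Bochner_Integration.integrable_bound[OF integrable_gauss[OF s]]) (auto simp: m_def norm_mult)
    have "fourier_L1 h x = complex_of_real c * (LINT \<xi>|lborel. fourier_L1 (\<lambda>y. cnj (u y)) (- \<xi>) * m (- \<xi>))"
      unfolding fourier_L1_def[of h] by (simp add: h_def m_def cnj_fourier_L1 c_def mult_ac)
    also have "(LINT \<xi>|lborel. fourier_L1 (\<lambda>y. cnj (u y)) (- \<xi>) * m (- \<xi>))
        = (LINT \<xi>|lborel. fourier_L1 (\<lambda>y. cnj (u y)) \<xi> * m \<xi>)"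
      using integral_lborel_scale[of "-1" "\<lambda>\<xi>. fourier_L1 (\<lambda>y. cnj (u y)) \<xi> * m \<xi>"] by simp
    also have "\<dots> = (LINT y|lborel. cnj (u y) * fourier_L1 m y)"
      by (intro fourier_L1_exchange Im) (use u1 in simp)
    also have "\<dots> = (LINT y|lborel. cnj (u y) * complex_of_real (c * (2 * pi / s) powr (DIM('a) / 2) * gauss (1 / s) (x - y)))"
      unfolding m_def fourier_L1_gauss_modulation[OF s] c_def ..
    also have "complex_of_real c * \<dots> = (LINT y|lborel. cnj (u y) * complex_of_real (gauss_kernel s (x - y)))"
      unfolding gauss_kernel_def c_def integral_mult_right_zero[symmetric] by (simp add: mult_ac)
    also have "\<dots> = (LINT y|lborel. cnj (u y) * complex_of_real (gauss_kernel s (y - x)))"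
    proof -
      have "gauss_kernel s (x - y) = gauss_kernel s (y - x)" for y using gauss_kernel_minus[of s "x - y"] by simp
      then show ?thesis by simp
    qed
    finally show ?thesis .
  qed
  have "complex_of_real (LINT \<xi>|lborel. (norm (fourier_L1 u \<xi>))\<^sup>2 * gauss s \<xi>) = (LINT \<xi>|lborel. complex_of_real ((norm (fourier_L1 u \<xi>))\<^sup>2 * gauss s \<xi>))"
    by (simp only: integral_complex_of_real)
  also have "\<dots> = (LINT \<xi>|lborel. fourier_L1 u \<xi> * h \<xi>)"
    unfolding h_def by (simp add: complex_norm_square mult.assoc[symmetric] del: of_real_power)
  also have "\<dots> = (LINT x|lborel. u x * fourier_L1 h x)"
    by (rule fourier_L1_exchange[OF u1 Ih])
  finally show "complex_of_real (LINT \<xi>|lborel. (norm (fourier_L1 u \<xi>))\<^sup>2 * gauss s \<xi>)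
    = (LINT x|lborel. u x * (LINT y|lborel. cnj (u y) * complex_of_real (gauss_kernel s (y - x))))"
    by (simp only: Fh)
  show "integrable lborel (\<lambda>\<xi>. (norm (fourier_L1 u \<xi>))\<^sup>2 * gauss s \<xi>)"
    by (rule Bochner_Integration.integrable_bound[of _ "\<lambda>\<xi>. B\<^sup>2 * gauss s \<xi>"])
       (use integrable_gauss[OF s, where 'a='a] in \<open>auto intro!: AE_I2 mult_right_mono power_mono uB\<close>)
qed

text \<open>
  Polarization in the form \<open>2 Re (a * cnj b) = \<bar>a\<bar>\<^sup>2 + \<bar>b\<bar>\<^sup>2 - \<bar>a - b\<bar>\<^sup>2\<close> turns the Gaussian
  regularization of \<open>\<integral>\<bar>F u\<bar>\<^sup>2\<close> into \<open>\<integral>\<bar>u\<bar>\<^sup>2\<close> minus an averaged translation defect.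
\<close>

lemma plancherel_gauss:
  fixes u :: "'a::euclidean_space \<Rightarrow> complex"
  assumes u: "u \<in> L2_space" and u1: "integrable lborel u"
  shows "2 * (\<integral>\<^sup>+\<xi>. ennreal ((norm (fourier_L1 u \<xi>))\<^sup>2 * gauss (1 / (real (Suc n))\<^sup>2) \<xi>) \<partial>lborel)
     + ennreal ((2 * pi) powr (- real DIM('a) / 2)) * (\<integral>\<^sup>+z. ennreal (gauss 1 z) * translation_defect u ((1 / real (Suc n)) *\<^sub>R z) \<partial>lborel)
     = ennreal (2 * (LINT x|lborel. (norm (u x))\<^sup>2))"
proof -
  define s where "s = 1 / (real (Suc n))\<^sup>2"
  have s: "s > 0" by (simp add: s_def)
  define c where "c = (2 * pi) powr (- real DIM('a) / 2)"
  have c: "c > 0" by (simp add: c_def)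
  define K where "K = (\<lambda>z::'a. c * (c * (2 * pi / s) powr (DIM('a) / 2)) * gauss (1 / s) z)"
  have [measurable]: "K \<in> borel_measurable borel" unfolding K_def by measurable
  have K0: "K z \<ge> 0" and Km: "K (- z) = K z" for z using c by (simp_all add: K_def)
  define M where "M = (LINT x|lborel. (norm (u x))\<^sup>2)"
  have M0: "M \<ge> 0" by (simp add: M_def)
  have um[measurable]: "u \<in> borel_measurable borel" and u2: "integrable lborel (\<lambda>x. (norm (u x))\<^sup>2)"
    using u by (auto simp: L2_space_def)
  have uM: "(\<integral>\<^sup>+x. ennreal ((norm (u x))\<^sup>2) \<partial>lborel) = ennreal M"
    unfolding M_def by (rule nn_integral_L2_space[OF u])
  have c1: "c * (2 * pi) powr (DIM('a) / 2) = 1"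
    by (simp add: c_def powr_minus[symmetric] flip: powr_add)
  have "(2 * pi / s) powr (DIM('a) / 2) * (2 * pi / (1 / s)) powr (DIM('a) / 2)
      = (2 * pi) powr (DIM('a) / 2) * (2 * pi) powr (DIM('a) / 2)"
    using s by (simp add: powr_divide powr_mult)
  then have cK: "c * (c * (2 * pi / s) powr (DIM('a) / 2)) * (2 * pi / (1 / s)) powr (DIM('a) / 2) = 1"
    unfolding mult.assoc by (simp only: mult.left_commute[of c "(2 * pi) powr (DIM('a) / 2)"] c1 mult_1_right)
  have KI: "(\<integral>\<^sup>+z. ennreal (K z) \<partial>lborel) = 1"
  proof -
    have "(\<integral>\<^sup>+z. ennreal (K z) \<partial>lborel) = ennreal (c * (c * (2 * pi / s) powr (DIM('a) / 2))) * (\<integral>\<^sup>+z. ennreal (gauss (1/s) (z::'a)) \<partial>lborel)"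
      unfolding K_def using c by (subst nn_integral_cmult[symmetric]) (auto simp: ennreal_mult)
    also have "\<dots> = ennreal (c * (c * (2 * pi / s) powr (DIM('a) / 2)) * (2 * pi / (1 / s)) powr (DIM('a) / 2))"
      using s c by (subst nn_integral_gauss) (auto simp: ennreal_mult)
    finally show ?thesis by (simp only: cK ennreal_1)
  qed
  let ?P = "lborel \<Otimes>\<^sub>M lborel :: ('a \<times> 'a) measure"
  define a b q where "a = (\<lambda>(x, y). (norm (u x))\<^sup>2 * K (y - x))"
    and "b = (\<lambda>(x, y). (norm (u y))\<^sup>2 * K (y - x))"
    and "q = (\<lambda>(x, y). (norm (u x - u y))\<^sup>2 * K (y - x))"
  define \<Phi> where "\<Phi> = (\<lambda>(x, y). u x * (cnj (u y) * complex_of_real (K (y - x))))"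
  have [measurable]: "a \<in> borel_measurable ?P" "b \<in> borel_measurable ?P" "q \<in> borel_measurable ?P" "\<Phi> \<in> borel_measurable ?P"
    unfolding a_def b_def q_def \<Phi>_def by measurable
  have pos: "a p \<ge> 0" "b p \<ge> 0" "q p \<ge> 0" for p
    by (simp_all add: a_def b_def q_def K0 split: prod.split)
  have Na: "(\<integral>\<^sup>+p. ennreal (a p) \<partial>?P) = ennreal M"
  proof -
    have "(\<integral>\<^sup>+p. ennreal (a p) \<partial>?P) = (\<integral>\<^sup>+x. \<integral>\<^sup>+y. ennreal (a (x, y)) \<partial>lborel \<partial>lborel)"
      by (rule lborel.nn_integral_fst[symmetric]) measurable
    also have "\<dots> = (\<integral>\<^sup>+x. ennreal ((norm (u x))\<^sup>2) * (\<integral>\<^sup>+y. ennreal (K (y - x)) \<partial>lborel) \<partial>lborel)"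
      by (intro nn_integral_cong, subst nn_integral_cmult[symmetric]) (auto simp: a_def ennreal_mult K0)
    also have "\<dots> = (\<integral>\<^sup>+x. ennreal ((norm (u x))\<^sup>2) * 1 \<partial>lborel)"
      by (subst nn_integral_lborel_diff[where f="\<lambda>z. ennreal (K z)"]) (simp_all add: KI)
    finally show ?thesis by (simp add: uM)
  qed
  have Nb: "(\<integral>\<^sup>+p. ennreal (b p) \<partial>?P) = ennreal M"
  proof -
    have "(\<integral>\<^sup>+p. ennreal (b p) \<partial>?P) = (\<integral>\<^sup>+y. \<integral>\<^sup>+x. ennreal (b (x, y)) \<partial>lborel \<partial>lborel)"
      by (rule lborel_pair.nn_integral_snd[symmetric]) measurable
    also have "\<dots> = (\<integral>\<^sup>+y. ennreal ((norm (u y))\<^sup>2) * (\<integral>\<^sup>+x. ennreal (K (y - x)) \<partial>lborel) \<partial>lborel)"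
      by (intro nn_integral_cong, subst nn_integral_cmult[symmetric]) (auto simp: b_def ennreal_mult K0)
    also have "\<dots> = (\<integral>\<^sup>+y. ennreal ((norm (u y))\<^sup>2) * 1 \<partial>lborel)"
      by (subst nn_integral_lborel_minus_left[where f="\<lambda>z. ennreal (K z)"]) (simp_all add: KI)
    finally show ?thesis by (simp add: uM)
  qed
  have Ia: "integrable ?P a" and Ib: "integrable ?P b"
    using Na Nb pos by (auto intro!: integrableI_nonneg)
  have La: "integral\<^sup>L ?P a = M" and Lb: "integral\<^sup>L ?P b = M"
    using Na Nb pos M0 by (auto simp: integral_eq_nn_integral)
  have qle: "q p \<le> 2 * a p + 2 * b p" for p
    using mult_right_mono[OF norm_diff_power2_le[of "u (fst p)" "u (snd p)"] K0[of "snd p - fst p"]]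
    by (simp add: a_def b_def q_def split_beta algebra_simps)
  have Iq: "integrable ?P q"
    by (rule Bochner_Integration.integrable_bound[of _ "\<lambda>p. 2 * a p + 2 * b p"]) (use Ia Ib qle pos in \<open>auto simp: abs_of_nonneg intro!: add_nonneg_nonneg\<close>)
  have polar: "2 * Re (\<Phi> p) = a p + b p - q p" for p
  proof -
    obtain x y where p: "p = (x, y)" by (cases p)
    have r1: "2 * Re (u x * cnj (u y)) = (norm (u x))\<^sup>2 + (norm (u y))\<^sup>2 - (norm (u x - u y))\<^sup>2"
      unfolding cmod_power2 by (simp add: power2_eq_square algebra_simps)
    have r2: "Re (\<Phi> p) = Re (u x * cnj (u y)) * K (y - x)"
      unfolding p \<Phi>_def by (simp add: algebra_simps)
    have "2 * Re (\<Phi> p) = (2 * Re (u x * cnj (u y))) * K (y - x)" by (simp only: r2 mult.assoc)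
    then show ?thesis unfolding r1 by (simp add: p a_def b_def q_def algebra_simps)
  qed
  have I\<Phi>: "integrable ?P \<Phi>"
  proof (rule Bochner_Integration.integrable_bound[of _ "\<lambda>p. a p + b p"])
    show "AE p in ?P. norm (\<Phi> p) \<le> norm (a p + b p)"
    proof (intro AE_I2)
      fix p :: "'a \<times> 'a"
      obtain x y where p: "p = (x, y)" by (cases p)
      have "norm (u x) * norm (u y) \<le> (norm (u x))\<^sup>2 + (norm (u y))\<^sup>2"
      proof -
        have "0 \<le> norm (u x) * norm (u y)" by simp
        moreover have "2 * (norm (u x) * norm (u y)) \<le> (norm (u x))\<^sup>2 + (norm (u y))\<^sup>2"
          using zero_le_power2[of "norm (u x) - norm (u y)"] by (simp add: power2_eq_square algebra_simps)
        ultimately show ?thesis by linarith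
      qed
      from mult_right_mono[OF this K0[of "y - x"]]
      have "norm (\<Phi> p) \<le> a p + b p" by (simp add: p \<Phi>_def a_def b_def norm_mult K0 algebra_simps)
      then show "norm (\<Phi> p) \<le> norm (a p + b p)" by simp
    qed
  qed (use Ia Ib in auto)
  have "2 * (LINT p|?P. Re (\<Phi> p)) = (LINT p|?P. 2 * Re (\<Phi> p))" by simp
  also have "\<dots> = (LINT p|?P. a p + b p - q p)" by (simp only: polar)
  also have "\<dots> = M + M - (LINT p|?P. q p)" using Ia Ib Iq La Lb by simp
  finally have main: "2 * Re (integral\<^sup>L ?P \<Phi>) + (LINT p|?P. q p) = 2 * M" using I\<Phi> by simp
  have KG: "gauss_kernel s z = K z" for z by (simp add: gauss_kernel_def K_def c_def)
  have "integral\<^sup>L ?P \<Phi> = (LINT x|lborel. LINT y|lborel. \<Phi> (x, y))"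
    by (rule lborel_pair.integral_fst'[symmetric, OF I\<Phi>])
  also have "\<dots> = (LINT x|lborel. u x * (LINT y|lborel. cnj (u y) * complex_of_real (gauss_kernel s (y - x))))"
    by (simp add: \<Phi>_def KG)
  finally have \<Phi>F: "integral\<^sup>L ?P \<Phi> = complex_of_real (LINT \<xi>|lborel. (norm (fourier_L1 u \<xi>))\<^sup>2 * gauss s \<xi>)"
    by (simp only: gauss_quadratic_form[OF u1 s])
  note IF = integrable_fourier_gauss[OF u1 s]
  have NF: "(\<integral>\<^sup>+\<xi>. ennreal ((norm (fourier_L1 u \<xi>))\<^sup>2 * gauss s \<xi>) \<partial>lborel) = ennreal (LINT \<xi>|lborel. (norm (fourier_L1 u \<xi>))\<^sup>2 * gauss s \<xi>)"
    by (rule nn_integral_eq_integral[OF IF]) simp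
  have Nq: "ennreal (LINT p|?P. q p) = ennreal c * (\<integral>\<^sup>+z. ennreal (gauss 1 z) * translation_defect u ((1 / real (Suc n)) *\<^sub>R z) \<partial>lborel)"
  proof -
    have "ennreal (LINT p|?P. q p) = (\<integral>\<^sup>+p. ennreal (q p) \<partial>?P)"
      by (rule nn_integral_eq_integral[symmetric, OF Iq]) (simp add: pos)
    also have "\<dots> = (\<integral>\<^sup>+x. \<integral>\<^sup>+y. ennreal (q (x, y)) \<partial>lborel \<partial>lborel)"
      by (rule lborel.nn_integral_fst[symmetric]) measurable
    also have "\<dots> = (\<integral>\<^sup>+x. \<integral>\<^sup>+z. ennreal (q (x, x - z)) \<partial>lborel \<partial>lborel)"
    proof (rule nn_integral_cong)
      fix x
      have "(\<lambda>y. ennreal (q (x, y))) \<in> borel_measurable borel" by (simp add: q_def)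
      from nn_integral_lborel_minus_left[OF this, of x]
      show "(\<integral>\<^sup>+y. ennreal (q (x, y)) \<partial>lborel) = (\<integral>\<^sup>+z. ennreal (q (x, x - z)) \<partial>lborel)"
        by simp
    qed
    also have "\<dots> = (\<integral>\<^sup>+x. \<integral>\<^sup>+z. ennreal ((norm (u x - u (x - z)))\<^sup>2) * ennreal (K z) \<partial>lborel \<partial>lborel)"
      by (simp add: q_def ennreal_mult K0 Km)
    also have "\<dots> = (\<integral>\<^sup>+z. \<integral>\<^sup>+x. ennreal ((norm (u x - u (x - z)))\<^sup>2) * ennreal (K z) \<partial>lborel \<partial>lborel)"
      by (rule lborel_pair.Fubini') measurable
    also have "\<dots> = (\<integral>\<^sup>+z. translation_defect u z * ennreal (K z) \<partial>lborel)"
      unfolding translation_defect_def by (subst nn_integral_multc) auto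
    \<comment> \<open>The kernel has width \<open>sqrt s = 1 / Suc n\<close>. Rescaling by it turns
      the weight into the fixed \<open>gauss 1\<close> and moves \<open>n\<close> into the argument
      of the defect, the form to which dominated convergence applies.\<close>
    also have "\<dots> = (\<integral>\<^sup>+z. ennreal (\<bar>1 / real (Suc n)\<bar> ^ DIM('a)) * (translation_defect u ((1 / real (Suc n)) *\<^sub>R z) * ennreal (K ((1 / real (Suc n)) *\<^sub>R z))) \<partial>lborel)"
      by (rule nn_integral_lborel_scale[where c="1 / real (Suc n)" and f="\<lambda>z. translation_defect u z * ennreal (K z)"]) auto
    also have "\<dots> = (\<integral>\<^sup>+z. ennreal c * (ennreal (gauss 1 z) * translation_defect u ((1 / real (Suc n)) *\<^sub>R z)) \<partial>lborel)"
    proof (intro nn_integral_cong)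
      fix z :: 'a
      have "(2 * pi / s) powr (DIM('a) / 2) = (2 * pi) powr (DIM('a) / 2) * real (Suc n) ^ DIM('a)"
      proof -
        have "(2 * pi / s) powr (DIM('a) / 2) = (2 * pi) powr (DIM('a) / 2) * ((real (Suc n))\<^sup>2) powr (DIM('a) / 2)"
          unfolding s_def by (simp add: powr_mult)
        also have "((real (Suc n))\<^sup>2) powr (DIM('a) / 2) = (real (Suc n) powr 2) powr (DIM('a) / 2)"
          by (subst powr_realpow[symmetric]) auto
        also have "\<dots> = real (Suc n) powr DIM('a)" by (simp only: powr_powr) simp
        also have "\<dots> = real (Suc n) ^ DIM('a)" by (simp add: powr_realpow)
        finally show ?thesis .
      qed
      then have "c * (2 * pi / s) powr (DIM('a) / 2) = real (Suc n) ^ DIM('a)" using c1 by (simp add: mult.assoc[symmetric])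
      moreover have "gauss (1 / s) ((1 / real (Suc n)) *\<^sub>R z) = gauss 1 z"
        unfolding gauss_scaleR by (simp add: s_def power_divide)
      ultimately have "K ((1 / real (Suc n)) *\<^sub>R z) = c * real (Suc n) ^ DIM('a) * gauss 1 z"
        by (simp add: K_def)
      then have "\<bar>1 / real (Suc n)\<bar> ^ DIM('a) * K ((1 / real (Suc n)) *\<^sub>R z) = c * gauss 1 z"
        by (simp add: power_divide)
      then have "ennreal (\<bar>1 / real (Suc n)\<bar> ^ DIM('a)) * ennreal (K ((1 / real (Suc n)) *\<^sub>R z)) = ennreal c * ennreal (gauss 1 z)"
        using c K0 by (simp flip: ennreal_mult)
      then show "ennreal (\<bar>1 / real (Suc n)\<bar> ^ DIM('a)) * (translation_defect u ((1 / real (Suc n)) *\<^sub>R z) * ennreal (K ((1 / real (Suc n)) *\<^sub>R z)))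
        = ennreal c * (ennreal (gauss 1 z) * translation_defect u ((1 / real (Suc n)) *\<^sub>R z))"
        by (simp only: mult.commute[of "translation_defect _ _"] mult.assoc[symmetric])
    qed
    also have "\<dots> = ennreal c * (\<integral>\<^sup>+z. ennreal (gauss 1 z) * translation_defect u ((1 / real (Suc n)) *\<^sub>R z) \<partial>lborel)"
      by (rule nn_integral_cmult) measurable
    finally show ?thesis .
  qed
  have q0: "(LINT p|?P. q p) \<ge> 0" by (simp add: pos)
  have "ennreal (2 * M) = ennreal (2 * (LINT \<xi>|lborel. (norm (fourier_L1 u \<xi>))\<^sup>2 * gauss s \<xi>) + (LINT p|?P. q p))"
    using main by (simp add: \<Phi>F)
  also have "\<dots> = 2 * ennreal (LINT \<xi>|lborel. (norm (fourier_L1 u \<xi>))\<^sup>2 * gauss s \<xi>) + ennreal (LINT p|?P. q p)"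
    using q0 by (subst ennreal_plus) (auto simp: ennreal_two_mult)
  also have "\<dots> = 2 * (\<integral>\<^sup>+\<xi>. ennreal ((norm (fourier_L1 u \<xi>))\<^sup>2 * gauss s \<xi>) \<partial>lborel) +
      ennreal c * (\<integral>\<^sup>+z. ennreal (gauss 1 z) * translation_defect u ((1 / real (Suc n)) *\<^sub>R z) \<partial>lborel)"
    by (simp only: NF Nq)
  finally show ?thesis by (simp only: s_def c_def M_def)
qed

text \<open>As \<open>n\<close> grows, the Gaussian weight increases to \<open>1\<close> and the
  averaged defect vanishes. Working with nonnegative extended integrals allows the limit before the
  transform is known to be square-integrable.\<close>

theorem plancherel_L1_L2:
  fixes u :: "'a::euclidean_space \<Rightarrow> complex"
  assumes u: "u \<in> L2_space" and u1: "integrable lborel u"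
  shows "fourier_L1 u \<in> L2_space"
    and "(LINT \<xi>|lborel. (norm (fourier_L1 u \<xi>))\<^sup>2) = (LINT x|lborel. (norm (u x))\<^sup>2)"
proof -
  have [measurable]: "u \<in> borel_measurable borel" using u by (auto simp: L2_space_def)
  define M where "M = (LINT x|lborel. (norm (u x))\<^sup>2)"
  have M0: "M \<ge> 0" by (simp add: M_def)
  let ?f = "\<lambda>n \<xi>. ennreal ((norm (fourier_L1 u \<xi>))\<^sup>2 * gauss (1 / (real (Suc n))\<^sup>2) \<xi>)"
  let ?N = "\<integral>\<^sup>+\<xi>. ennreal ((norm (fourier_L1 u \<xi>))\<^sup>2) \<partial>lborel"
  have "(\<lambda>n. \<integral>\<^sup>+\<xi>. ?f n \<xi> \<partial>lborel) \<longlonglongrightarrow> ?N"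
  proof (rule nn_integral_LIMSEQ)
    show "incseq ?f"
      unfolding incseq_def le_fun_def gauss_def
      by (intro allI impI ennreal_leI mult_left_mono)
         (simp_all add: divide_left_mono power_mono mult_right_mono)
    show "(\<lambda>n. ?f n \<xi>) \<longlonglongrightarrow> ennreal ((norm (fourier_L1 u \<xi>))\<^sup>2)" for \<xi>
    proof -
      have "(\<lambda>n. 1 / (real (Suc n))\<^sup>2) \<longlonglongrightarrow> 0"
        using tendsto_power[OF LIMSEQ_inverse_real_of_nat, of 2] by (simp add: inverse_eq_divide power_divide)
      then have "(\<lambda>n. (norm (fourier_L1 u \<xi>))\<^sup>2 * gauss (1 / (real (Suc n))\<^sup>2) \<xi>)
          \<longlonglongrightarrow> (norm (fourier_L1 u \<xi>))\<^sup>2 * exp (- (0 * (norm \<xi>)\<^sup>2) / 2)"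
        unfolding gauss_def by (intro tendsto_intros) auto
      then show ?thesis by (intro tendsto_ennrealI) simp
    qed
  qed measurable
  then have "(\<lambda>n. 2 * (\<integral>\<^sup>+\<xi>. ?f n \<xi> \<partial>lborel)
     + ennreal ((2 * pi) powr (- real DIM('a) / 2)) * (\<integral>\<^sup>+z. ennreal (gauss 1 z) * translation_defect u ((1 / real (Suc n)) *\<^sub>R z) \<partial>lborel))
     \<longlonglongrightarrow> 2 * ?N + ennreal ((2 * pi) powr (- real DIM('a) / 2)) * 0"
    by (intro tendsto_add ennreal_tendsto_cmult mollified_defect_tendsto_0 u) auto
  then have "(\<lambda>n::nat. ennreal (2 * M)) \<longlonglongrightarrow> 2 * ?N"
    unfolding plancherel_gauss[OF u u1] M_def by simp
  then have eq: "ennreal (2 * M) = 2 * ?N" by (rule LIMSEQ_unique[OF tendsto_const])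
  then have "2 * ennreal M = 2 * ?N" using M0 by (simp add: ennreal_two_mult)
  then have N: "?N = ennreal M"
    by (simp add: ennreal_mult_cancel_left)
  then show "fourier_L1 u \<in> L2_space"
    unfolding L2_space_def by (auto intro!: integrableI_nonneg)
  show "(LINT \<xi>|lborel. (norm (fourier_L1 u \<xi>))\<^sup>2) = (LINT x|lborel. (norm (u x))\<^sup>2)"
    using N M0 by (subst integral_eq_nn_integral) (auto simp: M_def)
qed

section \<open>The Fourier transform of square-integrable functions\<close>

definition L2_inner :: "('a::euclidean_space \<Rightarrow> complex) \<Rightarrow> ('a \<Rightarrow> complex) \<Rightarrow> complex" where
  "L2_inner f g = (LINT x|lborel. f x * cnj (g x))"

definition L2_sq :: "('a::euclidean_space \<Rightarrow> complex) \<Rightarrow> real" where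
  "L2_sq f = (LINT x|lborel. (norm (f x))\<^sup>2)"

lemma L2_sq_nonneg [simp]: "L2_sq f \<ge> 0"
  by (simp add: L2_sq_def)

lemma L2_spaceD:
  assumes "f \<in> L2_space"
  shows "f \<in> borel_measurable borel" "integrable lborel (\<lambda>x. (norm (f x))\<^sup>2)"
  using assms by (auto simp: L2_space_def)

lemma L2_space_bound:
  assumes [measurable]: "f \<in> borel_measurable borel" and "integrable lborel h"
    and "AE x in lborel. (norm (f x))\<^sup>2 \<le> h x"
  shows "f \<in> L2_space"
  unfolding L2_space_def using assms
  by (auto intro!: Bochner_Integration.integrable_bound[of lborel h] elim!: eventually_mono)

lemma L2_space_diff:
  assumes f: "f \<in> L2_space" and g: "g \<in> L2_space"
  shows "(\<lambda>x. f x - g x) \<in> L2_space"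
proof -
  note [measurable] = L2_spaceD(1)[OF f] L2_spaceD(1)[OF g]
  show ?thesis
    by (rule L2_space_bound[of _ "\<lambda>x. 2 * (norm (f x))\<^sup>2 + 2 * (norm (g x))\<^sup>2"])
       (use L2_spaceD(2)[OF f] L2_spaceD(2)[OF g] in \<open>auto intro!: norm_diff_power2_le\<close>)
qed

lemma L2_mult_integrable:
  assumes f: "f \<in> L2_space" and g: "g \<in> L2_space"
  shows "integrable lborel (\<lambda>x. f x * g x)"
proof -
  note [measurable] = L2_spaceD(1)[OF f] L2_spaceD(1)[OF g]
  show ?thesis
  proof (rule Bochner_Integration.integrable_bound[of _ "\<lambda>x. (norm (f x))\<^sup>2 + (norm (g x))\<^sup>2"])
    have "norm (f x * g x) \<le> norm ((norm (f x))\<^sup>2 + (norm (g x))\<^sup>2)" for x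
    proof -
      have "0 \<le> norm (f x) * norm (g x)" by simp
      moreover have "2 * (norm (f x) * norm (g x)) \<le> (norm (f x))\<^sup>2 + (norm (g x))\<^sup>2"
        using zero_le_power2[of "norm (f x) - norm (g x)"] by (simp add: power2_eq_square algebra_simps)
      ultimately have "norm (f x) * norm (g x) \<le> (norm (f x))\<^sup>2 + (norm (g x))\<^sup>2" by linarith
      then show ?thesis by (simp add: norm_mult)
    qed
    then show "AE x in lborel. norm (f x * g x) \<le> norm ((norm (f x))\<^sup>2 + (norm (g x))\<^sup>2)" by simp
  qed (use L2_spaceD(2)[OF f] L2_spaceD(2)[OF g] in auto)
qed

lemma L2_space_cnj: "f \<in> L2_space \<Longrightarrow> (\<lambda>x. cnj (f x)) \<in> L2_space"
  unfolding L2_space_def by auto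

lemma L2_Cauchy_Schwarz:
  assumes f: "f \<in> L2_space" and g: "g \<in> L2_space"
  shows "(LINT x|lborel. norm (f x) * norm (g x))\<^sup>2 \<le> L2_sq f * L2_sq g"
proof -
  note [measurable] = L2_spaceD(1)[OF f] L2_spaceD(1)[OF g]
  have "integrable lborel (\<lambda>x. norm (f x * g x))"
    using L2_mult_integrable[OF f g] by (rule integrable_norm)
  then have int: "integrable lborel (\<lambda>x. norm (f x) * norm (g x))" by (simp add: norm_mult)
  have "ennreal ((LINT x|lborel. norm (f x) * norm (g x))\<^sup>2) = (\<integral>\<^sup>+x. ennreal (norm (f x)) * ennreal (norm (g x)) \<partial>lborel)\<^sup>2"
    using nn_integral_eq_integral[OF int] by (simp add: ennreal_mult ennreal_power)
  also have "\<dots> \<le> (\<integral>\<^sup>+x. ennreal (norm (f x)) ^ 2 \<partial>lborel) * (\<integral>\<^sup>+x. ennreal (norm (g x)) ^ 2 \<partial>lborel)"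
    by (rule Cauchy_Schwarz_nn_integral) measurable
  also have "\<dots> = ennreal (L2_sq f * L2_sq g)"
    by (simp add: ennreal_power nn_integral_L2_space[OF f] nn_integral_L2_space[OF g] ennreal_mult L2_sq_def)
  finally show ?thesis by (simp add: ennreal_le_iff)
qed

lemma norm_L2_inner_le:
  assumes f: "f \<in> L2_space" and g: "g \<in> L2_space"
  shows "norm (L2_inner f g) \<le> sqrt (L2_sq f) * sqrt (L2_sq g)"
proof -
  have "norm (L2_inner f g) \<le> (LINT x|lborel. norm (f x * cnj (g x)))"
    unfolding L2_inner_def by (rule integral_norm_bound)
  then have "norm (L2_inner f g) \<le> (LINT x|lborel. norm (f x) * norm (g x))" by (simp add: norm_mult)
  also have "\<dots> \<le> sqrt (L2_sq f * L2_sq g)"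
    by (rule real_le_rsqrt[OF L2_Cauchy_Schwarz[OF f g]])
  finally show ?thesis by (simp add: real_sqrt_mult)
qed

lemma L2_inner_diff_left:
  assumes "f \<in> L2_space" "g \<in> L2_space" "h \<in> L2_space"
  shows "L2_inner (\<lambda>x. f x - g x) h = L2_inner f h - L2_inner g h"
  unfolding L2_inner_def using L2_mult_integrable[OF assms(1) L2_space_cnj[OF assms(3)]] L2_mult_integrable[OF assms(2) L2_space_cnj[OF assms(3)]]
  by (simp add: left_diff_distrib)

lemma L2_sq_diff:
  assumes f: "f \<in> L2_space" and g: "g \<in> L2_space"
  shows "L2_sq (\<lambda>x. f x - g x) = L2_sq f + L2_sq g - 2 * Re (L2_inner f g)"
proof -
  have int: "integrable lborel (\<lambda>x. f x * cnj (g x))" by (rule L2_mult_integrable[OF f L2_space_cnj[OF g]])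
  have "(norm (f x - g x))\<^sup>2 = (norm (f x))\<^sup>2 + (norm (g x))\<^sup>2 - 2 * Re (f x * cnj (g x))" for x
    unfolding cmod_power2 by (simp add: power2_eq_square algebra_simps)
  then have "L2_sq (\<lambda>x. f x - g x) = (LINT x|lborel. (norm (f x))\<^sup>2 + (norm (g x))\<^sup>2 - 2 * Re (f x * cnj (g x)))"
    unfolding L2_sq_def by simp
  also have "\<dots> = L2_sq f + L2_sq g - 2 * (LINT x|lborel. Re (f x * cnj (g x)))"
    unfolding L2_sq_def using L2_spaceD(2)[OF f] L2_spaceD(2)[OF g] int
    by (simp del: times_complex.sel)
  also have "(LINT x|lborel. Re (f x * cnj (g x))) = Re (L2_inner f g)"
    unfolding L2_inner_def using int by (rule integral_Re)
  finally show ?thesis .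
qed

lemma L2_sq_diff_le:
  assumes f: "f \<in> L2_space" and g: "g \<in> L2_space"
  shows "L2_sq (\<lambda>x. f x - g x) \<le> 2 * L2_sq f + 2 * L2_sq g"
proof -
  have "L2_sq (\<lambda>x. f x - g x) \<le> (LINT x|lborel. 2 * (norm (f x))\<^sup>2 + 2 * (norm (g x))\<^sup>2)"
    unfolding L2_sq_def
    by (intro integral_mono norm_diff_power2_le L2_spaceD L2_space_diff f g Bochner_Integration.integrable_add integrable_mult_right)
  also have "\<dots> = 2 * L2_sq f + 2 * L2_sq g"
    unfolding L2_sq_def using L2_spaceD(2)[OF f] L2_spaceD(2)[OF g] by simp
  finally show ?thesis .
qed

lemma L2_inner_tendsto:
  assumes f: "\<And>R. f R \<in> L2_space" and l: "l \<in> L2_space" and g: "g \<in> L2_space"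
    and lim: "((\<lambda>R. L2_sq (\<lambda>x. f R x - l x)) \<longlongrightarrow> 0) F"
  shows "((\<lambda>R. L2_inner (f R) g) \<longlongrightarrow> L2_inner l g) F"
proof -
  have "((\<lambda>R. L2_inner (f R) g - L2_inner l g) \<longlongrightarrow> 0) F"
  proof (rule Lim_null_comparison)
    show "\<forall>\<^sub>F R in F. norm (L2_inner (f R) g - L2_inner l g) \<le> sqrt (L2_sq (\<lambda>x. f R x - l x)) * sqrt (L2_sq g)"
      unfolding L2_inner_diff_left[OF f l g, symmetric]
      by (intro always_eventually allI norm_L2_inner_le L2_space_diff f l g)
    show "((\<lambda>R. sqrt (L2_sq (\<lambda>x. f R x - l x)) * sqrt (L2_sq g)) \<longlongrightarrow> 0) F"
      using tendsto_mult[OF tendsto_real_sqrt[OF lim] tendsto_const] by simp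
  qed
  then show ?thesis by (rule LIM_zero_cancel)
qed

lemma L2_sq_tendsto:
  assumes f: "\<And>R. f R \<in> L2_space" and l: "l \<in> L2_space"
    and lim: "((\<lambda>R. L2_sq (\<lambda>x. f R x - l x)) \<longlongrightarrow> 0) F"
  shows "((\<lambda>R. L2_sq (f R)) \<longlongrightarrow> L2_sq l) F"
proof -
  have "L2_sq (f R) = L2_sq (\<lambda>x. f R x - l x) - L2_sq l + 2 * Re (L2_inner (f R) l)" for R
    by (simp add: L2_sq_diff[OF f l])
  moreover have "((\<lambda>R. L2_sq (\<lambda>x. f R x - l x) - L2_sq l + 2 * Re (L2_inner (f R) l)) \<longlongrightarrow> 0 - L2_sq l + 2 * Re (L2_inner l l)) F"
    by (intro tendsto_intros lim L2_inner_tendsto f l)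
  moreover have "Re (L2_inner l l) = L2_sq l"
    unfolding L2_inner_def L2_sq_def by (simp add: complex_norm_square[symmetric] del: of_real_power)
  ultimately show ?thesis by simp
qed

text \<open>One operator with two uses: in space it is the truncation in the definition of
  \<open>fourier\<close>, in frequency it is a sharp low-pass filter.\<close>

definition ball_trunc :: "real \<Rightarrow> ('a::euclidean_space \<Rightarrow> complex) \<Rightarrow> 'a \<Rightarrow> complex" where
  "ball_trunc R u = (\<lambda>x. if norm x \<le> R then u x else 0)"

lemma ball_trunc_measurable [measurable]:
  assumes [measurable]: "u \<in> borel_measurable borel"
  shows "ball_trunc R u \<in> borel_measurable borel"
  unfolding ball_trunc_def by measurable

lemma ball_trunc_L2:
  assumes u: "u \<in> L2_space"
  shows "ball_trunc R u \<in> L2_space"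
proof -
  note [measurable] = L2_spaceD(1)[OF u]
  show ?thesis
    by (rule L2_space_bound[OF _ L2_spaceD(2)[OF u]]) (auto simp: ball_trunc_def)
qed

lemma ball_trunc_integrable:
  fixes u :: "'a::euclidean_space \<Rightarrow> complex"
  assumes u: "u \<in> L2_space"
  shows "integrable lborel (ball_trunc R u)"
proof -
  note [measurable] = L2_spaceD(1)[OF u]
  have i: "integrable lborel (indicator (cball (0::'a) R) :: _ \<Rightarrow> real)"
    by (rule integrable_real_indicator) (simp, rule emeasure_bounded_finite, simp)
  show ?thesis
  proof (rule Bochner_Integration.integrable_bound[of _ "\<lambda>x. indicator (cball 0 R) x + (norm (u x))\<^sup>2"])
    have "norm (u x) \<le> 1 + (norm (u x))\<^sup>2" for x
    proof -
      have "2 * norm (u x) \<le> 1 + (norm (u x))\<^sup>2"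
        using zero_le_power2[of "norm (u x) - 1"] by (simp add: power2_eq_square algebra_simps)
      then show ?thesis using norm_ge_zero[of "u x"] by linarith
    qed
    then show "AE x in lborel. norm (ball_trunc R u x) \<le> norm (indicator (cball 0 R) x + (norm (u x))\<^sup>2)"
      by (auto simp: ball_trunc_def indicator_def)
  qed (use i L2_spaceD(2)[OF u] in auto)
qed

lemma ball_trunc_tendsto:
  fixes u :: "'a::euclidean_space \<Rightarrow> complex"
  assumes u: "u \<in> L2_space"
  shows "((\<lambda>R. L2_sq (\<lambda>x. ball_trunc R u x - u x)) \<longlongrightarrow> 0) at_top"
proof -
  note [measurable] = L2_spaceD(1)[OF u]
  have "((\<lambda>R. LINT x|lborel. (norm (ball_trunc R u x - u x))\<^sup>2) \<longlongrightarrow> (LINT x|(lborel::'a measure). 0)) at_top"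
  proof (rule integral_dominated_convergence_at_top[where w="\<lambda>x. (norm (u x))\<^sup>2"])
    show "\<forall>\<^sub>F R in at_top. AE x in lborel. norm ((norm (ball_trunc R u x - u x))\<^sup>2) \<le> (norm (u x))\<^sup>2"
      by (auto simp: ball_trunc_def)
    show "AE x in lborel. ((\<lambda>R. (norm (ball_trunc R u x - u x))\<^sup>2) \<longlongrightarrow> 0) at_top"
    proof (intro AE_I2)
      fix x :: 'a
      have "\<forall>\<^sub>F R in at_top. (norm (ball_trunc R u x - u x))\<^sup>2 = 0"
        using eventually_ge_at_top[of "norm x"] by eventually_elim (simp add: ball_trunc_def)
      then show "((\<lambda>R. (norm (ball_trunc R u x - u x))\<^sup>2) \<longlongrightarrow> 0) at_top" by (rule tendsto_eventually)
    qed
  qed (use L2_spaceD(2)[OF u] in auto)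
  then show ?thesis by (simp add: L2_sq_def)
qed

lemma fourier_L1_diff:
  assumes "integrable lborel f" "integrable lborel g"
  shows "fourier_L1 (\<lambda>x. f x - g x) \<xi> = fourier_L1 f \<xi> - fourier_L1 (g::'a::euclidean_space \<Rightarrow> complex) \<xi>"
proof -
  have "integrable lborel (\<lambda>x. exp (- (\<i> * complex_of_real (x \<bullet> \<xi>))) * h x)" if "integrable lborel h" for h :: "'a \<Rightarrow> complex"
  proof -
    have [measurable]: "h \<in> borel_measurable borel" using that by auto
    show ?thesis by (rule Bochner_Integration.integrable_bound[OF that]) (auto simp: norm_mult)
  qed
  then show ?thesis unfolding fourier_L1_def using assms by (simp add: right_diff_distrib)
qed

text \<open>The Riesz-Fischer argument. By Plancherel the transforms of the truncations are Cauchy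
  in the mean-square sense; a fast subsequence converges almost everywhere, and Fatou's lemma
  identifies its limit as the limit of the whole family.\<close>

lemma fourier_exists:
  fixes u :: "'a::euclidean_space \<Rightarrow> complex"
  assumes u: "u \<in> L2_space"
  shows "\<exists>w. w \<in> L2_space \<and>
     ((\<lambda>R. \<integral>\<^sup>+ \<xi>. ennreal ((norm (fourier_L1 (ball_trunc R u) \<xi> - w \<xi>))\<^sup>2) \<partial>lborel) \<longlongrightarrow> 0) at_top"
proof -
  note [measurable] = L2_spaceD(1)[OF u]
  define F where "F R = fourier_L1 (ball_trunc R u)" for R
  have F2: "F R \<in> L2_space" for R unfolding F_def by (intro plancherel_L1_L2 ball_trunc_L2 ball_trunc_integrable u)
  note [measurable] = L2_spaceD(1)[OF F2]
  define \<tau> where "\<tau> R = L2_sq (\<lambda>x. ball_trunc R u x - u x)" for R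
  have \<tau>0: "\<tau> R \<ge> 0" for R by (simp add: \<tau>_def)
  have \<tau>lim: "(\<tau> \<longlongrightarrow> 0) at_top" unfolding \<tau>_def[abs_def] by (rule ball_trunc_tendsto[OF u])
  have FF: "L2_sq (\<lambda>x. F R x - F S x) \<le> 2 * \<tau> R + 2 * \<tau> S" for R S
  proof -
    have d: "(\<lambda>x. ball_trunc R u x - ball_trunc S u x) \<in> L2_space" by (intro L2_space_diff ball_trunc_L2 u)
    have eq: "(\<lambda>x. F R x - F S x) = fourier_L1 (\<lambda>x. ball_trunc R u x - ball_trunc S u x)"
      unfolding F_def by (rule ext, rule fourier_L1_diff[symmetric]) (intro ball_trunc_integrable u)+
    have "L2_sq (\<lambda>x. F R x - F S x) = L2_sq (\<lambda>x. ball_trunc R u x - ball_trunc S u x)"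
      unfolding eq unfolding L2_sq_def
      by (rule plancherel_L1_L2(2)[OF d]) (intro Bochner_Integration.integrable_diff ball_trunc_integrable u)
    also have "\<dots> = L2_sq (\<lambda>x. (ball_trunc R u x - u x) - (ball_trunc S u x - u x))" by simp
    also have "\<dots> \<le> 2 * \<tau> R + 2 * \<tau> S" unfolding \<tau>_def by (intro L2_sq_diff_le L2_space_diff ball_trunc_L2 u)
    finally show ?thesis .
  qed
  have NF: "(\<integral>\<^sup>+\<xi>. ennreal ((norm (F R \<xi> - F S \<xi>))\<^sup>2) \<partial>lborel) \<le> ennreal (2 * \<tau> R + 2 * \<tau> S)" for R S
    unfolding nn_integral_L2_space[OF L2_space_diff[OF F2 F2], of R S] L2_sq_def[symmetric] by (rule ennreal_leI[OF FF])
  have "\<exists>R. \<tau> R \<le> (1/4) ^ k" for k :: nat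
  proof -
    have "eventually (\<lambda>R. \<tau> R < (1/4) ^ k) at_top" using \<tau>lim by (rule order_tendstoD) simp
    then obtain N where "\<And>R. R \<ge> N \<Longrightarrow> \<tau> R < (1/4) ^ k" by (auto simp: eventually_at_top_linorder)
    then have "\<tau> N \<le> (1/4) ^ k" by (intro less_imp_le) simp
    then show ?thesis ..
  qed
  then obtain r where r: "\<And>k. \<tau> (r k) \<le> (1/4) ^ k" by metis
  define D where "D k \<xi> = F (r (Suc k)) \<xi> - F (r k) \<xi>" for k \<xi>
  have [measurable]: "D k \<in> borel_measurable borel" for k unfolding D_def[abs_def] by measurable
  \<comment> \<open>The squared norm of \<open>D k\<close> is at most \<open>4 * (1/4) ^ k\<close>,
    so the weight \<open>2 ^ k\<close> keeps the series summable. Its finiteness at a point then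
    forces geometric decay of \<open>D k\<close> there, hence convergence of the telescoping
    sum.\<close>
  have "(\<integral>\<^sup>+\<xi>. (\<Sum>k. ennreal (2 ^ k * (norm (D k \<xi>))\<^sup>2)) \<partial>lborel) = (\<Sum>k. \<integral>\<^sup>+\<xi>. ennreal (2 ^ k * (norm (D k \<xi>))\<^sup>2) \<partial>lborel)"
    by (rule nn_integral_suminf) measurable
  also have "\<dots> \<le> (\<Sum>k. ennreal (4 * (1/2) ^ k))"
  proof (intro suminf_le allI)
    fix k
    have "(\<integral>\<^sup>+\<xi>. ennreal (2 ^ k * (norm (D k \<xi>))\<^sup>2) \<partial>lborel) = ennreal (2 ^ k) * (\<integral>\<^sup>+\<xi>. ennreal ((norm (D k \<xi>))\<^sup>2) \<partial>lborel)"
      by (subst nn_integral_cmult[symmetric]) (auto simp: ennreal_mult)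
    also have "\<dots> \<le> ennreal (2 ^ k) * ennreal (2 * \<tau> (r (Suc k)) + 2 * \<tau> (r k))"
      unfolding D_def by (intro mult_left_mono NF) simp
    also have "\<dots> = ennreal (2 ^ k * (2 * \<tau> (r (Suc k)) + 2 * \<tau> (r k)))"
      using \<tau>0 by (subst ennreal_mult) auto
    also have "\<dots> \<le> ennreal (4 * (1/2) ^ k)"
    proof (rule ennreal_leI)
      have "(1/4::real) ^ Suc k \<le> (1/4) ^ k" by simp
      then have "2 * \<tau> (r (Suc k)) + 2 * \<tau> (r k) \<le> 4 * (1/4) ^ k" using r[of k] r[of "Suc k"] by linarith
      then have "2 ^ k * (2 * \<tau> (r (Suc k)) + 2 * \<tau> (r k)) \<le> 2 ^ k * (4 * (1/4) ^ k)" by (intro mult_left_mono) auto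
      also have "\<dots> = 4 * (2 * (1/4)) ^ k" by (subst power_mult_distrib) simp
      finally show "2 ^ k * (2 * \<tau> (r (Suc k)) + 2 * \<tau> (r k)) \<le> 4 * (1/2) ^ k" by simp
    qed
    finally show "(\<integral>\<^sup>+\<xi>. ennreal (2 ^ k * (norm (D k \<xi>))\<^sup>2) \<partial>lborel) \<le> ennreal (4 * (1/2) ^ k)" .
  qed auto
  also have "\<dots> = ennreal (\<Sum>k. 4 * (1/2) ^ k)"
    by (rule suminf_ennreal_eq) (auto intro!: summable_sums summable_mult summable_geometric)
  also have "\<dots> < \<infinity>" by simp
  finally have "(\<integral>\<^sup>+\<xi>. (\<Sum>k. ennreal (2 ^ k * (norm (D k \<xi>))\<^sup>2)) \<partial>lborel) < \<infinity>" .
  then have fin: "AE \<xi> in lborel. (\<Sum>k. ennreal (2 ^ k * (norm (D k \<xi>))\<^sup>2)) \<noteq> \<infinity>"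
    by (intro nn_integral_PInf_AE) auto
  have conv1: "convergent (\<lambda>k. F (r k) \<xi>)" if X: "(\<Sum>k. ennreal (2 ^ k * (norm (D k \<xi>))\<^sup>2)) \<noteq> \<infinity>" for \<xi>
  proof -
    define X where "X = (\<Sum>k. ennreal (2 ^ k * (norm (D k \<xi>))\<^sup>2))"
    have "X \<noteq> \<infinity>" using X unfolding X_def .
    then obtain B where B0: "X = ennreal B" "B \<ge> 0" by (cases X) auto
    have B: "B \<ge> 0" "(\<Sum>k. ennreal (2 ^ k * (norm (D k \<xi>))\<^sup>2)) = ennreal B"
      using B0 by (simp_all only: X_def)
    have bound: "norm (D k \<xi>) \<le> sqrt B * (1 / sqrt 2) ^ k" for k
    proof -
      have "(\<Sum>k\<in>{k}. ennreal (2 ^ k * (norm (D k \<xi>))\<^sup>2)) \<le> ennreal B"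
        unfolding B(2)[symmetric] by (intro sum_le_suminf) auto
      then have "2 ^ k * (norm (D k \<xi>))\<^sup>2 \<le> B" using B(1) by simp
      then have "(1/2) ^ k * (2 ^ k * (norm (D k \<xi>))\<^sup>2) \<le> (1/2) ^ k * B" by (rule mult_left_mono) simp
      moreover have "(1/2) ^ k * (2 ^ k * (norm (D k \<xi>))\<^sup>2) = (norm (D k \<xi>))\<^sup>2"
        by (simp add: mult.assoc[symmetric] flip: power_mult_distrib)
      ultimately have "(norm (D k \<xi>))\<^sup>2 \<le> B * (1/2) ^ k" by (simp only: mult.commute)
      then have "norm (D k \<xi>) \<le> sqrt (B * (1/2) ^ k)" by (rule real_le_rsqrt)
      also have "\<dots> = sqrt B * (sqrt (1/2)) ^ k" by (simp only: real_sqrt_mult real_sqrt_power)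
      also have "sqrt (1/2) = 1 / sqrt 2" by (simp add: real_sqrt_divide)
      finally show ?thesis .
    qed
    have "summable (\<lambda>k. sqrt B * (1 / sqrt 2) ^ k)"
      by (intro summable_mult summable_geometric) simp
    then have "summable (\<lambda>k. D k \<xi>)" by (rule summable_comparison_test'[where N=0]) (rule bound)
    then have "convergent (\<lambda>n. \<Sum>k<n. D k \<xi>)" by (rule summable_iff_convergent[THEN iffD1])
    moreover have "(\<lambda>n. \<Sum>k<n. D k \<xi>) = (\<lambda>n. F (r n) \<xi> - F (r 0) \<xi>)"
      unfolding D_def by (rule ext) (rule sum_lessThan_telescope)
    ultimately have "convergent (\<lambda>n. F (r n) \<xi> - F (r 0) \<xi>)" by (simp only:)
    from convergent_add[OF this convergent_const[of "F (r 0) \<xi>"]] show ?thesis by simp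
  qed
  have conv: "AE \<xi> in lborel. convergent (\<lambda>k. F (r k) \<xi>)"
    using fin by (rule eventually_mono) (rule conv1)
  define w where "w \<xi> = lim (\<lambda>k. F (r k) \<xi>)" for \<xi>
  have [measurable]: "w \<in> borel_measurable borel"
    unfolding w_def[abs_def] using borel_measurable_lim_metric[of "\<lambda>k. F (r k)" borel] by simp
  have wbound: "(\<integral>\<^sup>+\<xi>. ennreal ((norm (F S \<xi> - w \<xi>))\<^sup>2) \<partial>lborel) \<le> ennreal (2 * \<tau> S)" for S
  proof -
    have "(\<integral>\<^sup>+\<xi>. ennreal ((norm (F S \<xi> - w \<xi>))\<^sup>2) \<partial>lborel)
       = (\<integral>\<^sup>+\<xi>. liminf (\<lambda>k. ennreal ((norm (F S \<xi> - F (r k) \<xi>))\<^sup>2)) \<partial>lborel)"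
    proof (rule nn_integral_cong_AE, use conv in eventually_elim)
      case (elim \<xi>)
      then have "(\<lambda>k. F (r k) \<xi>) \<longlonglongrightarrow> w \<xi>" by (simp add: w_def convergent_LIMSEQ_iff)
      then have "(\<lambda>k. ennreal ((norm (F S \<xi> - F (r k) \<xi>))\<^sup>2)) \<longlonglongrightarrow> ennreal ((norm (F S \<xi> - w \<xi>))\<^sup>2)"
        by (intro tendsto_ennrealI tendsto_intros)
      from lim_imp_Liminf[OF sequentially_bot this] show ?case by simp
    qed
    also have "\<dots> \<le> liminf (\<lambda>k. \<integral>\<^sup>+\<xi>. ennreal ((norm (F S \<xi> - F (r k) \<xi>))\<^sup>2) \<partial>lborel)"
      by (rule nn_integral_liminf) measurable
    also have "\<dots> \<le> liminf (\<lambda>k. ennreal (2 * \<tau> S + 2 * (1/4) ^ k))"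
    proof (intro Liminf_mono always_eventually allI)
      fix k
      show "(\<integral>\<^sup>+\<xi>. ennreal ((norm (F S \<xi> - F (r k) \<xi>))\<^sup>2) \<partial>lborel) \<le> ennreal (2 * \<tau> S + 2 * (1/4) ^ k)"
        by (rule order_trans[OF NF]) (intro ennreal_leI add_left_mono mult_left_mono r, simp)
    qed
    also have "\<dots> = ennreal (2 * \<tau> S)"
    proof (rule lim_imp_Liminf)
      have "(\<lambda>k. 2 * \<tau> S + 2 * (1/4) ^ k) \<longlonglongrightarrow> 2 * \<tau> S + 2 * 0"
        by (intro tendsto_intros LIMSEQ_power_zero) simp
      then show "(\<lambda>k. ennreal (2 * \<tau> S + 2 * (1/4) ^ k)) \<longlonglongrightarrow> ennreal (2 * \<tau> S)"
        by (intro tendsto_ennrealI) simp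
    qed simp
    finally show ?thesis .
  qed
  have Fw: "(\<lambda>\<xi>. F 0 \<xi> - w \<xi>) \<in> L2_space"
    using le_less_trans[OF wbound[of 0] ennreal_less_top] unfolding L2_space_def
    by (auto intro!: integrableI_nonneg)
  have "w \<in> L2_space" using L2_space_diff[OF F2[of 0] Fw] by simp
  moreover have "((\<lambda>R. \<integral>\<^sup>+ \<xi>. ennreal ((norm (F R \<xi> - w \<xi>))\<^sup>2) \<partial>lborel) \<longlongrightarrow> 0) at_top"
  proof (rule tendsto_sandwich[OF _ _ tendsto_const])
    have "((\<lambda>R. 2 * \<tau> R) \<longlongrightarrow> 2 * 0) at_top" by (intro tendsto_intros \<tau>lim)
    then have "((\<lambda>R. ennreal (2 * \<tau> R)) \<longlongrightarrow> ennreal 0) at_top" by (intro tendsto_ennrealI) simp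
    then show "((\<lambda>R. ennreal (2 * \<tau> R)) \<longlongrightarrow> 0) at_top" by simp
  qed (use wbound in auto)
  ultimately show ?thesis unfolding F_def by (intro exI[of _ w] conjI)
qed

text \<open>\<open>fourier\<close> is a choice, so existence of one candidate transfers these
  properties to it. Everything later rests on these two facts and never on which representative was
  chosen.\<close>

lemma fourier_L2:
  fixes u :: "'a::euclidean_space \<Rightarrow> complex"
  assumes u: "u \<in> L2_space"
  shows fourier_in_L2: "fourier u \<in> L2_space"
    and fourier_tendsto: "((\<lambda>R. L2_sq (\<lambda>\<xi>. fourier_L1 (ball_trunc R u) \<xi> - fourier u \<xi>)) \<longlongrightarrow> 0) at_top"
proof -
  define P where "P w \<longleftrightarrow> w \<in> L2_space \<and>
     ((\<lambda>R. \<integral>\<^sup>+ \<xi>. ennreal ((norm (fourier_L1 (ball_trunc R u) \<xi> - w \<xi>))\<^sup>2) \<partial>lborel) \<longlongrightarrow> 0) at_top" for w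
  have "\<exists>w. P w" unfolding P_def by (rule fourier_exists[OF u])
  moreover have "fourier u = (SOME w. P w)" by (simp add: fourier_def ball_trunc_def P_def)
  ultimately have "P (fourier u)" by (simp add: someI_ex)
  note * = this[unfolded P_def]
  from * show f: "fourier u \<in> L2_space" by simp
  have "fourier_L1 (ball_trunc R u) \<in> L2_space" for R
    by (intro plancherel_L1_L2 ball_trunc_L2 ball_trunc_integrable u)
  then have "((\<lambda>R. ennreal (L2_sq (\<lambda>\<xi>. fourier_L1 (ball_trunc R u) \<xi> - fourier u \<xi>))) \<longlongrightarrow> ennreal 0) at_top"
    unfolding L2_sq_def using * nn_integral_L2_space[OF L2_space_diff[OF _ f]] by simp
  then show "((\<lambda>R. L2_sq (\<lambda>\<xi>. fourier_L1 (ball_trunc R u) \<xi> - fourier u \<xi>)) \<longlongrightarrow> 0) at_top"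
    by (subst (asm) tendsto_ennreal_iff) auto
qed

theorem plancherel_L2:
  fixes u :: "'a::euclidean_space \<Rightarrow> complex"
  assumes u: "u \<in> L2_space"
  shows "L2_sq (fourier u) = L2_sq u"
proof (rule tendsto_unique)
  show "((\<lambda>R. L2_sq (fourier_L1 (ball_trunc R u))) \<longlongrightarrow> L2_sq (fourier u)) at_top"
    by (intro L2_sq_tendsto fourier_tendsto fourier_in_L2 plancherel_L1_L2 ball_trunc_L2 ball_trunc_integrable u)
  have "L2_sq (fourier_L1 (ball_trunc R u)) = L2_sq (ball_trunc R u)" for R
    unfolding L2_sq_def by (intro plancherel_L1_L2 ball_trunc_L2 ball_trunc_integrable u)
  moreover have "((\<lambda>R. L2_sq (ball_trunc R u)) \<longlongrightarrow> L2_sq u) at_top"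
    by (intro L2_sq_tendsto ball_trunc_tendsto ball_trunc_L2 u)
  ultimately show "((\<lambda>R. L2_sq (fourier_L1 (ball_trunc R u))) \<longlongrightarrow> L2_sq u) at_top" by simp
qed simp

definition inverse_fourier_L1 :: "('a::euclidean_space \<Rightarrow> complex) \<Rightarrow> 'a \<Rightarrow> complex" where
  "inverse_fourier_L1 g x = fourier_L1 g (- x)"

lemma inverse_fourier_L1_L2:
  fixes g :: "'a::euclidean_space \<Rightarrow> complex"
  assumes g: "g \<in> L2_space" "integrable lborel g"
  shows "inverse_fourier_L1 g \<in> L2_space" "L2_sq (inverse_fourier_L1 g) = L2_sq g"
proof -
  note F = plancherel_L1_L2[OF g]
  note [measurable] = L2_spaceD(1)[OF g(1)]
  note [measurable] = L2_spaceD(1)[OF F(1)]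
  have "integrable lborel (\<lambda>x. (norm (fourier_L1 g ((-1) *\<^sub>R x)))\<^sup>2)"
    using L2_spaceD(2)[OF F(1)] by (subst integrable_lborel_scale[where f="\<lambda>x. (norm (fourier_L1 g x))\<^sup>2"]) auto
  then show "inverse_fourier_L1 g \<in> L2_space"
    unfolding L2_space_def inverse_fourier_L1_def[abs_def] by simp
  have "L2_sq (inverse_fourier_L1 g) = (LINT x|lborel. (norm (fourier_L1 g x))\<^sup>2)"
    unfolding L2_sq_def inverse_fourier_L1_def
    using integral_lborel_scale[of "-1" "\<lambda>x. (norm (fourier_L1 g x))\<^sup>2"] by simp
  then show "L2_sq (inverse_fourier_L1 g) = L2_sq g" by (simp add: F(2) L2_sq_def)
qed

text \<open>The multiplication formula for the truncations of \<open>u\<close>, passed to the limit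
  on both sides. Truncations of a transform to balls are both integrable and square-integrable, so
  they are admissible as \<open>g\<close>.\<close>

lemma fourier_adjoint:
  fixes u g :: "'a::euclidean_space \<Rightarrow> complex"
  assumes u: "u \<in> L2_space" and g: "g \<in> L2_space" "integrable lborel g"
  shows "L2_inner (fourier u) g = L2_inner u (inverse_fourier_L1 g)"
proof (rule tendsto_unique)
  have g': "integrable lborel (\<lambda>x. cnj (g x))" using g by simp
  show "((\<lambda>R. L2_inner (fourier_L1 (ball_trunc R u)) g) \<longlongrightarrow> L2_inner (fourier u) g) at_top"
    by (intro L2_inner_tendsto fourier_tendsto fourier_in_L2 plancherel_L1_L2 ball_trunc_L2 ball_trunc_integrable u g)
  have "L2_inner (fourier_L1 (ball_trunc R u)) g = L2_inner (ball_trunc R u) (inverse_fourier_L1 g)" for R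
    unfolding L2_inner_def inverse_fourier_L1_def
    by (simp add: fourier_L1_exchange[OF ball_trunc_integrable[OF u] g'] cnj_fourier_L1)
  moreover have "((\<lambda>R. L2_inner (ball_trunc R u) (inverse_fourier_L1 g)) \<longlongrightarrow> L2_inner u (inverse_fourier_L1 g)) at_top"
    by (intro L2_inner_tendsto ball_trunc_tendsto ball_trunc_L2 u inverse_fourier_L1_L2 g)
  ultimately show "((\<lambda>R. L2_inner (fourier_L1 (ball_trunc R u)) g) \<longlongrightarrow> L2_inner u (inverse_fourier_L1 g)) at_top"
    by simp
qed simp

lemma L2_inner_self: "L2_inner f f = complex_of_real (L2_sq f)"
  unfolding L2_inner_def L2_sq_def
  by (simp add: complex_norm_square[symmetric] del: of_real_power flip: integral_complex_of_real)

text \<open>By the adjoint relation the inner product of \<open>u\<close> with its low-pass part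
  equals the squared norm of that part, as for an orthogonal projection; Pythagoras and Plancherel
  leave the frequency mass above \<open>A\<close>. This plays the role of Fourier inversion.\<close>

lemma low_pass_error:
  fixes u :: "'a::euclidean_space \<Rightarrow> complex"
  assumes u: "u \<in> L2_space"
  shows "L2_sq (\<lambda>x. u x - inverse_fourier_L1 (ball_trunc A (fourier u)) x)
    = (LINT \<xi>|lborel. (if norm \<xi> > A then (norm (fourier u \<xi>))\<^sup>2 else 0))"
proof -
  define g where "g = ball_trunc A (fourier u)"
  have fu: "fourier u \<in> L2_space" by (rule fourier_in_L2[OF u])
  note [measurable] = L2_spaceD(1)[OF fu]
  have g: "g \<in> L2_space" "integrable lborel g" unfolding g_def by (intro ball_trunc_L2 ball_trunc_integrable fu)+
  have "L2_inner u (inverse_fourier_L1 g) = L2_inner (fourier u) g" by (rule fourier_adjoint[symmetric, OF u g])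
  also have "\<dots> = L2_inner g g" unfolding L2_inner_def g_def ball_trunc_def by (intro Bochner_Integration.integral_cong) auto
  finally have "Re (L2_inner u (inverse_fourier_L1 g)) = L2_sq g" by (simp add: L2_inner_self)
  then have "L2_sq (\<lambda>x. u x - inverse_fourier_L1 g x) = L2_sq (fourier u) - L2_sq g"
    by (simp add: L2_sq_diff[OF u inverse_fourier_L1_L2(1)[OF g]] inverse_fourier_L1_L2(2)[OF g] plancherel_L2[OF u])
  also have "\<dots> = (LINT \<xi>|lborel. (norm (fourier u \<xi>))\<^sup>2 - (norm (g \<xi>))\<^sup>2)"
    unfolding L2_sq_def using L2_spaceD(2)[OF fu] L2_spaceD(2)[OF g(1)] by simp
  also have "\<dots> = (LINT \<xi>|lborel. (if norm \<xi> > A then (norm (fourier u \<xi>))\<^sup>2 else 0))"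
    unfolding g_def ball_trunc_def by (intro Bochner_Integration.integral_cong) auto
  finally show ?thesis by (simp add: g_def)
qed

lemma L2_sq_eq_0:
  assumes f: "f \<in> L2_space" and "L2_sq f = 0"
  shows "AE x in lborel. f x = 0"
  using assms integral_nonneg_eq_0_iff_AE[OF L2_spaceD(2)[OF f]] by (auto simp: L2_sq_def)

text \<open>The inner product of the transform with \<open>w\<close> equals the squared norm of each
  of them, so their difference has norm zero. This identifies the transform of the test
  function.\<close>

lemma fourier_inverse_fourier_L1:
  fixes w :: "'a::euclidean_space \<Rightarrow> complex"
  assumes w: "w \<in> L2_space" "integrable lborel w"
  shows "AE \<xi> in lborel. fourier (inverse_fourier_L1 w) \<xi> = w \<xi>"
proof -
  let ?u = "inverse_fourier_L1 w"
  have u: "?u \<in> L2_space" by (rule inverse_fourier_L1_L2[OF w])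
  have "L2_inner (fourier ?u) w = complex_of_real (L2_sq ?u)" by (simp add: fourier_adjoint[OF u w] L2_inner_self)
  then have "L2_sq (\<lambda>\<xi>. fourier ?u \<xi> - w \<xi>) = 0"
    by (simp add: L2_sq_diff[OF fourier_in_L2[OF u] w(1)] plancherel_L2[OF u] inverse_fourier_L1_L2(2)[OF w])
  from L2_sq_eq_0[OF L2_space_diff[OF fourier_in_L2[OF u] w(1)] this] show ?thesis
    by eventually_elim simp
qed

section \<open>Spherical means of plane waves\<close>

lemma iexp_quadratic: "cmod (exp (\<i> * complex_of_real (x + y)) - exp (\<i> * complex_of_real x)
    - \<i> * complex_of_real y * exp (\<i> * complex_of_real x)) \<le> y\<^sup>2"
proof -
  have "cmod (exp (\<i> * complex_of_real y) - (\<Sum>k\<le>1. (\<i> * complex_of_real y) ^ k / fact k)) \<le> \<bar>y\<bar> ^ Suc 1 / fact (Suc 1)"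
    by (rule iexp_approx1)
  then have "cmod (exp (\<i> * complex_of_real y) - (1 + \<i> * complex_of_real y)) \<le> y\<^sup>2 / 2"
    by (simp add: power2_eq_square flip: abs_mult)
  also have "\<dots> \<le> y\<^sup>2" by simp
  finally have "cmod (exp (\<i> * complex_of_real x) * (exp (\<i> * complex_of_real y) - (1 + \<i> * complex_of_real y))) \<le> y\<^sup>2"
    by (simp add: norm_mult)
  then show ?thesis by (simp add: algebra_simps exp_add)
qed

lemma cos_quadratic: "\<bar>cos (x + y) - cos x + y * sin x\<bar> \<le> (y::real)\<^sup>2"
  using order_trans[OF abs_Re_le_cmod iexp_quadratic[of x y]] unfolding cis_conv_exp[symmetric] by simp

lemma sin_quadratic: "\<bar>sin (x + y) - sin x - y * cos x\<bar> \<le> (y::real)\<^sup>2"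
  using order_trans[OF abs_Im_le_cmod iexp_quadratic[of x y]] unfolding cis_conv_exp[symmetric] by simp

text \<open>A quadratic remainder bound survives integration against an integrable weight, so this
  criterion yields differentiation under the integral sign with \<open>C\<close> the integral of the
  absolute weight.\<close>

lemma DERIV_quadratic_remainder:
  fixes F :: "real \<Rightarrow> real"
  assumes "\<And>h. \<bar>F (s + h) - F s - h * D\<bar> \<le> C * h\<^sup>2"
  shows "(F has_real_derivative D) (at s)"
  unfolding DERIV_def
proof -
  have "((\<lambda>h. (F (s + h) - F s) / h - D) \<longlongrightarrow> 0) (at 0)"
  proof (rule Lim_null_comparison)
    show "\<forall>\<^sub>F h in at 0. norm ((F (s + h) - F s) / h - D) \<le> C * \<bar>h\<bar>"
    proof (rule eventually_at_filter[THEN iffD2], intro always_eventually allI impI)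
      fix h :: real assume h: "h \<noteq> 0"
      have "norm ((F (s + h) - F s) / h - D) = \<bar>F (s + h) - F s - h * D\<bar> / \<bar>h\<bar>"
        using h by (simp add: abs_divide[symmetric] diff_divide_distrib)
      also have "\<dots> \<le> C * h\<^sup>2 / \<bar>h\<bar>" using assms[of h] by (intro divide_right_mono) auto
      also have "h\<^sup>2 = \<bar>h\<bar> * \<bar>h\<bar>" by (simp add: power2_eq_square)
      also have "C * (\<bar>h\<bar> * \<bar>h\<bar>) / \<bar>h\<bar> = C * \<bar>h\<bar>" using h by (simp del: abs_mult_self_eq)
      finally show "norm ((F (s + h) - F s) / h - D) \<le> C * \<bar>h\<bar>" .
    qed
    have "((\<lambda>h::real. C * \<bar>h\<bar>) \<longlongrightarrow> C * \<bar>0\<bar>) (at 0)" by (intro tendsto_intros)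
    then show "((\<lambda>h::real. C * \<bar>h\<bar>) \<longlongrightarrow> 0) (at 0)" by simp
  qed
  then show "((\<lambda>h. (F (s + h) - F s) / h) \<longlongrightarrow> D) (at 0)" by (rule LIM_zero_cancel)
qed

lemma DERIV_integral_trig:
  fixes w p b :: "'a::euclidean_space \<Rightarrow> real"
  assumes w: "integrable lborel w" and [measurable]: "p \<in> borel_measurable borel" "b \<in> borel_measurable borel"
    and b: "\<And>z. \<bar>b z\<bar> \<le> 1"
  shows DERIV_integral_cos: "((\<lambda>s. LINT z|lborel. w z * cos (p z + s * b z)) has_real_derivative
      - (LINT z|lborel. w z * b z * sin (p z + s * b z))) (at s)"
    and DERIV_integral_sin: "((\<lambda>s. LINT z|lborel. w z * sin (p z + s * b z)) has_real_derivative
      (LINT z|lborel. w z * b z * cos (p z + s * b z))) (at s)"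
proof -
  have [measurable]: "w \<in> borel_measurable borel" using w by auto
  have int: "integrable lborel (\<lambda>z. w z * m z)" if [measurable]: "m \<in> borel_measurable borel" and "\<And>z. \<bar>m z\<bar> \<le> 1" for m
    by (rule Bochner_Integration.integrable_bound[OF w]) (use that in \<open>auto simp: abs_mult intro!: AE_I2 mult_left_le\<close>)
  have ib: "integrable lborel (\<lambda>z. w z * b z * m z)" if [measurable]: "m \<in> borel_measurable borel" and "\<And>z. \<bar>m z\<bar> \<le> 1" for m
    unfolding mult.assoc by (rule int) (use that b in \<open>auto simp: abs_mult intro!: mult_le_one\<close>)
  have iw: "integrable lborel (\<lambda>z. \<bar>w z\<bar>)" using w by (rule integrable_abs)
  have hb: "(h * b z)\<^sup>2 \<le> h\<^sup>2" for h z
    using b[of z] abs_square_le_1[of "b z"] by (simp add: power_mult_distrib mult_left_le)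
  show "((\<lambda>s. LINT z|lborel. w z * cos (p z + s * b z)) has_real_derivative
      - (LINT z|lborel. w z * b z * sin (p z + s * b z))) (at s)"
  proof (rule DERIV_quadratic_remainder[where C="LINT z|lborel. \<bar>w z\<bar>"])
    fix h
    have "(LINT z|lborel. w z * cos (p z + (s + h) * b z)) - (LINT z|lborel. w z * cos (p z + s * b z))
       - h * - (LINT z|lborel. w z * b z * sin (p z + s * b z))
      = (LINT z|lborel. w z * (cos ((p z + s * b z) + h * b z) - cos (p z + s * b z) + h * b z * sin (p z + s * b z)))"
      (is "?l = integral\<^sup>L _ ?r")
    proof -
      have "integral\<^sup>L lborel ?r = (LINT z|lborel. w z * cos (p z + (s + h) * b z) - w z * cos (p z + s * b z) + h * (w z * b z * sin (p z + s * b z)))"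
        by (intro Bochner_Integration.integral_cong) (auto simp: algebra_simps)
      also have "\<dots> = ?l" by (simp add: int ib)
      finally show ?thesis by simp
    qed
    also have "\<bar>\<dots>\<bar> \<le> (LINT z|lborel. \<bar>w z\<bar> * h\<^sup>2)"
    proof (rule integral_abs_bound_integral)
      show "integrable lborel (\<lambda>z. \<bar>w z\<bar> * h\<^sup>2)" using iw by simp
      show "integrable lborel ?r"
        using int[of "\<lambda>z. cos (p z + (s + h) * b z)"] int[of "\<lambda>z. cos (p z + s * b z)"] ib[of "\<lambda>z. sin (p z + s * b z)"]
        by (simp add: algebra_simps)
      show "\<bar>?r z\<bar> \<le> \<bar>w z\<bar> * h\<^sup>2" for z
        unfolding abs_mult by (intro mult_left_mono order_trans[OF cos_quadratic hb]) simp
    qed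
    finally show "\<bar>(LINT z|lborel. w z * cos (p z + (s + h) * b z)) - (LINT z|lborel. w z * cos (p z + s * b z))
       - h * - (LINT z|lborel. w z * b z * sin (p z + s * b z))\<bar> \<le> (LINT z|lborel. \<bar>w z\<bar>) * h\<^sup>2" by simp
  qed
  show "((\<lambda>s. LINT z|lborel. w z * sin (p z + s * b z)) has_real_derivative
      (LINT z|lborel. w z * b z * cos (p z + s * b z))) (at s)"
  proof (rule DERIV_quadratic_remainder[where C="LINT z|lborel. \<bar>w z\<bar>"])
    fix h
    have "(LINT z|lborel. w z * sin (p z + (s + h) * b z)) - (LINT z|lborel. w z * sin (p z + s * b z))
       - h * (LINT z|lborel. w z * b z * cos (p z + s * b z))
      = (LINT z|lborel. w z * (sin ((p z + s * b z) + h * b z) - sin (p z + s * b z) - h * b z * cos (p z + s * b z)))"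
      (is "?l = integral\<^sup>L _ ?r")
    proof -
      have "integral\<^sup>L lborel ?r = (LINT z|lborel. w z * sin (p z + (s + h) * b z) - w z * sin (p z + s * b z) - h * (w z * b z * cos (p z + s * b z)))"
        by (intro Bochner_Integration.integral_cong) (auto simp: algebra_simps)
      also have "\<dots> = ?l" by (simp add: int ib)
      finally show ?thesis by simp
    qed
    also have "\<bar>\<dots>\<bar> \<le> (LINT z|lborel. \<bar>w z\<bar> * h\<^sup>2)"
    proof (rule integral_abs_bound_integral)
      show "integrable lborel (\<lambda>z. \<bar>w z\<bar> * h\<^sup>2)" using iw by simp
      show "integrable lborel ?r"
        using int[of "\<lambda>z. sin (p z + (s + h) * b z)"] int[of "\<lambda>z. sin (p z + s * b z)"] ib[of "\<lambda>z. cos (p z + s * b z)"]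
        by (simp add: algebra_simps)
      show "\<bar>?r z\<bar> \<le> \<bar>w z\<bar> * h\<^sup>2" for z
        unfolding abs_mult by (intro mult_left_mono order_trans[OF sin_quadratic hb]) simp
    qed
    finally show "\<bar>(LINT z|lborel. w z * sin (p z + (s + h) * b z)) - (LINT z|lborel. w z * sin (p z + s * b z))
       - h * (LINT z|lborel. w z * b z * cos (p z + s * b z))\<bar> \<le> (LINT z|lborel. \<bar>w z\<bar>) * h\<^sup>2" by simp
  qed
qed

text \<open>
  A multiple of the mean of \<open>cos (y \<bullet> \<omega>)\<close> over unit vectors \<open>\<omega>\<close>: directions of Gaussian vectors are
  uniformly distributed, so no surface measure is needed.
\<close>

definition sphere_cos :: "real^'n \<Rightarrow> real" where
  "sphere_cos y = (LINT z|lborel. gauss 1 z * cos (y \<bullet> sgn z))"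

lemma sgn_measurable [measurable]: "(sgn :: real^'n \<Rightarrow> real^'n) \<in> borel_measurable borel"
  unfolding sgn_div_norm[abs_def] by measurable

lemma orthogonal_transformation_sgn:
  "orthogonal_transformation T \<Longrightarrow> sgn (T z) = T (sgn z)"
  by (simp add: sgn_div_norm orthogonal_transformation_norm orthogonal_transformation_scaleR)

lemma gauss_orthogonal [simp]: "orthogonal_transformation T \<Longrightarrow> gauss s (T z) = gauss s z"
  by (simp add: gauss_def orthogonal_transformation_norm)

lemma sphere_cos_orthogonal:
  fixes T :: "real^'n \<Rightarrow> real^'n"
  assumes T: "orthogonal_transformation T"
  shows "sphere_cos (T y) = sphere_cos y"
proof -
  have "sphere_cos (T y) = (LINT z|lborel. gauss 1 (T z) * cos (T y \<bullet> sgn (T z)))"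
    unfolding sphere_cos_def by (rule integral_orthogonal[OF T, symmetric]) measurable
  also have "\<dots> = sphere_cos y"
    using T by (simp add: sphere_cos_def orthogonal_transformation_sgn) (simp add: orthogonal_transformation_def)
  finally show ?thesis .
qed

lemma sphere_cos_radial:
  fixes y y' :: "real^'n"
  assumes "norm y = norm y'"
  shows "sphere_cos y = sphere_cos y'"
proof -
  obtain T where "orthogonal_transformation T" "T y = y'"
    using orthogonal_transformation_exists[OF assms] by blast
  then show ?thesis using sphere_cos_orthogonal[of T y] by simp
qed

lemma sphere_cos_measurable [measurable]: "(sphere_cos :: real^'n \<Rightarrow> real) \<in> borel_measurable borel"
  unfolding sphere_cos_def[abs_def] by measurable

lemma abs_sphere_cos_le: "\<bar>sphere_cos (y::real^'n)\<bar> \<le> (2 * pi) powr (CARD('n) / 2)"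
proof -
  have "\<bar>sphere_cos y\<bar> \<le> (LINT z|lborel. gauss 1 (z::real^'n))"
    unfolding sphere_cos_def
  proof (rule integral_abs_bound_integral)
    show g: "integrable lborel (gauss 1 :: real^'n \<Rightarrow> real)" by (simp add: integrable_gauss)
    show "integrable lborel (\<lambda>z. gauss 1 z * cos (y \<bullet> sgn z))"
      by (rule Bochner_Integration.integrable_bound[OF g]) (auto simp: abs_mult intro!: AE_I2 mult_left_le)
  qed (auto simp: abs_mult mult_left_le)
  then show ?thesis by (simp add: integral_gauss)
qed

text \<open>
  Away from the origin \<open>sphere_cos\<close> solves the radial Helmholtz equation: differentiating
  \<open>sphere_cos (s e + t f) = J (sqrt (s\<^sup>2 + t\<^sup>2))\<close> twice in \<open>t\<close> at \<open>0\<close>, with \<open>f\<close> orthogonal to \<open>e\<close>,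
  produces the first-order term.
\<close>

lemma sphere_cos_Helmholtz:
  fixes k :: "'n::finite"
  defines "J \<equiv> (\<lambda>s. sphere_cos (s *\<^sub>R axis k (1::real)))"
  obtains J1 J2 where "\<And>s. (J has_real_derivative J1 s) (at s)" "\<And>s. (J1 has_real_derivative J2 s) (at s)"
    "\<And>s. s > 0 \<Longrightarrow> J2 s + (real CARD('n) - 1) / s * J1 s + J s = 0"
proof -
  let ?g = "gauss 1 :: real^'n \<Rightarrow> real"
  define b where "b j z = sgn z $ j" for j and z :: "real^'n"
  have bsgn: "axis j (1::real) \<bullet> sgn z = b j z" for j z by (simp add: b_def inner_axis_axis inner_axis')
  have [measurable]: "b j \<in> borel_measurable borel" for j
    unfolding bsgn[abs_def, symmetric] by measurable
  have b1: "\<bar>b j z\<bar> \<le> 1" for j z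
  proof -
    have "\<bar>b j z\<bar> \<le> norm (sgn z)" unfolding b_def by (rule component_le_norm_cart)
    also have "\<dots> \<le> 1" by (simp add: norm_sgn)
    finally show ?thesis .
  qed
  have g: "integrable lborel ?g" by (simp add: integrable_gauss)
  have gm: "integrable lborel (\<lambda>z. ?g z * m z)" if [measurable]: "m \<in> borel_measurable borel" and "\<And>z. \<bar>m z\<bar> \<le> 1" for m
    by (rule Bochner_Integration.integrable_bound[OF g]) (use that in \<open>auto simp: abs_mult intro!: AE_I2 mult_left_le\<close>)
  have gb: "integrable lborel (\<lambda>z. ?g z * b j z)" for j by (rule gm) (auto simp: b1)
  define J1 where "J1 s = - (LINT z|lborel. ?g z * b k z * sin (0 + s * b k z))" for s
  define J2 where "J2 s = - (LINT z|lborel. ?g z * b k z * b k z * cos (0 + s * b k z))" for s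
  have J: "J s = (LINT z|lborel. ?g z * cos (0 + s * b k z))" for s
    unfolding J_def sphere_cos_def by (simp add: bsgn)
  have dJ: "(J has_real_derivative J1 s) (at s)" for s
    unfolding J[abs_def] J1_def by (rule DERIV_integral_cos[OF g]) (auto simp: b1)
  have dJ1: "(J1 has_real_derivative J2 s) (at s)" for s
    unfolding J1_def[abs_def] J2_def by (intro DERIV_minus DERIV_integral_sin[OF gb]) (auto simp: b1)
  have key: "- (LINT z|lborel. ?g z * b j z * b j z * cos (s * b k z + 0 * b j z)) = J1 s / s" if "j \<noteq> k" "s > 0" for j s
  proof -
    define V where "V t = s *\<^sub>R axis k 1 + t *\<^sub>R axis j (1::real)" for t
    have Vn: "norm (V t) = sqrt (s\<^sup>2 + t\<^sup>2)" for t
    proof -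
      have "V t \<bullet> V t = s\<^sup>2 + t\<^sup>2"
        using \<open>j \<noteq> k\<close> by (simp add: V_def inner_add_left inner_add_right inner_axis_axis power2_eq_square)
      then show ?thesis by (simp add: norm_eq_sqrt_inner)
    qed
    have CV: "sphere_cos (V t) = J (sqrt (s\<^sup>2 + t\<^sup>2))" for t
      unfolding J_def by (rule sphere_cos_radial) (simp add: Vn norm_axis_1)
    have CI: "sphere_cos (V t) = (LINT z|lborel. ?g z * cos (s * b k z + t * b j z))" for t
      unfolding sphere_cos_def V_def by (simp add: inner_add_left bsgn)
    have sq: "s\<^sup>2 + t\<^sup>2 > 0" for t using \<open>s > 0\<close> by (simp add: add_pos_nonneg)
    have d1: "((\<lambda>t. sphere_cos (V t)) has_real_derivative - (LINT z|lborel. ?g z * b j z * sin (s * b k z + t * b j z))) (at t)" for t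
      unfolding CI by (rule DERIV_integral_cos[OF g, where p="\<lambda>z. s * b k z" and b="b j"]) (auto simp: b1)
    have d2: "((\<lambda>t. sphere_cos (V t)) has_real_derivative J1 (sqrt (s\<^sup>2 + t\<^sup>2)) * (t / sqrt (s\<^sup>2 + t\<^sup>2))) (at t)" for t
    proof -
      have "((\<lambda>t. s\<^sup>2 + t\<^sup>2) has_real_derivative 2 * t) (at t)"
        by (auto intro!: derivative_eq_intros)
      from DERIV_chain2[where f=sqrt and g="\<lambda>t. s\<^sup>2 + t\<^sup>2", OF DERIV_real_sqrt[OF sq[of t]] this]
      have dsq: "((\<lambda>t. sqrt (s\<^sup>2 + t\<^sup>2)) has_real_derivative t / sqrt (s\<^sup>2 + t\<^sup>2)) (at t)"
        by (simp add: inverse_eq_divide)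
      have "((\<lambda>t. J (sqrt (s\<^sup>2 + t\<^sup>2))) has_real_derivative J1 (sqrt (s\<^sup>2 + t\<^sup>2)) * (t / sqrt (s\<^sup>2 + t\<^sup>2))) (at t)"
        by (rule DERIV_chain2[where f=J, OF dJ dsq])
      then show ?thesis by (simp only: CV)
    qed
    have eq: "- (LINT z|lborel. ?g z * b j z * sin (s * b k z + t * b j z)) = t * (J1 (sqrt (s\<^sup>2 + t\<^sup>2)) / sqrt (s\<^sup>2 + t\<^sup>2))" for t
      using DERIV_unique[OF d1 d2] by simp
    have "((\<lambda>t. - (LINT z|lborel. ?g z * b j z * sin (s * b k z + t * b j z))) has_real_derivative
        - (LINT z|lborel. ?g z * b j z * b j z * cos (s * b k z + 0 * b j z))) (at 0)"
      by (rule DERIV_minus[OF DERIV_integral_sin[OF gb, where p="\<lambda>z. s * b k z" and b="b j"]]) (auto simp: b1)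
    \<comment> \<open>The function \<open>t * Q t\<close> has derivative \<open>Q 0\<close> at
      \<open>0\<close> as soon as \<open>Q\<close> is continuous there, so continuity of
      \<open>J1\<close> suffices.\<close>
    moreover have "((\<lambda>t. t * (J1 (sqrt (s\<^sup>2 + t\<^sup>2)) / sqrt (s\<^sup>2 + t\<^sup>2))) has_real_derivative J1 s / s) (at 0)"
    proof -
      define Q where "Q t = J1 (sqrt (s\<^sup>2 + t\<^sup>2)) / sqrt (s\<^sup>2 + t\<^sup>2)" for t
      have c: "isCont (\<lambda>t. sqrt (s\<^sup>2 + t\<^sup>2)) 0" by (intro continuous_intros)
      have "isCont (\<lambda>t. J1 (sqrt (s\<^sup>2 + t\<^sup>2))) 0"
        by (rule isCont_o2[OF c DERIV_isCont[OF dJ1]])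
      then have "isCont Q 0"
        unfolding Q_def[abs_def] using sq[of 0] by (intro isCont_divide c) auto
      then have lim: "(Q \<longlongrightarrow> Q 0) (at 0)" by (simp add: isCont_def)
      have ev: "\<forall>\<^sub>F h in at 0. Q h = ((0 + h) * Q (0 + h) - 0 * Q 0) / h"
        by (simp add: eventually_at_filter)
      have "((\<lambda>t. t * Q t) has_real_derivative Q 0) (at 0)"
        unfolding DERIV_def by (rule Lim_transform_eventually[OF lim ev])
      moreover have "Q 0 = J1 s / s" using \<open>s > 0\<close> by (simp add: Q_def)
      ultimately show ?thesis by (simp add: Q_def)
    qed
    ultimately show ?thesis unfolding eq by (rule DERIV_unique)
  qed
  have bsum: "AE z in lborel. (\<Sum>j\<in>UNIV. b j z * b j z) = 1"
    using AE_lborel_singleton[of "0::real^'n"]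
  proof eventually_elim
    case (elim z)
    have "(\<Sum>j\<in>UNIV. b j z * b j z) = sgn z \<bullet> sgn z" by (simp add: inner_vec_def b_def)
    also have "\<dots> = (norm (sgn z))\<^sup>2" by (simp add: power2_norm_eq_inner)
    finally show ?case using elim by (simp add: norm_sgn)
  qed
  \<comment> \<open>Inserting the almost everywhere identity that the squares of the
    \<open>b j\<close> sum to \<open>1\<close> splits \<open>J s\<close> into \<open>- J2 s\<close>
    for the direction \<open>k\<close> and \<open>- J1 s / s\<close> for each of the other
    \<open>d - 1\<close> directions.\<close>
  have ode: "J2 s + (real CARD('n) - 1) / s * J1 s + J s = 0" if s: "s > 0" for s
  proof -
    have ii: "integrable lborel (\<lambda>z. ?g z * b j z * b j z * cos (s * b k z))" for j
      unfolding mult.assoc by (rule gm) (auto simp: abs_mult intro!: mult_le_one b1)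
    have "J s = (LINT z|lborel. (\<Sum>j\<in>UNIV. ?g z * b j z * b j z * cos (s * b k z)))"
      unfolding J
    proof (rule integral_cong_AE)
      show "AE z in lborel. ?g z * cos (0 + s * b k z) = (\<Sum>j\<in>UNIV. ?g z * b j z * b j z * cos (s * b k z))"
        using bsum
      proof eventually_elim
        case (elim z)
        have "(\<Sum>j\<in>UNIV. ?g z * b j z * b j z * cos (s * b k z)) = ?g z * (\<Sum>j\<in>UNIV. b j z * b j z) * cos (s * b k z)"
          by (simp add: sum_distrib_left sum_distrib_right mult.assoc)
        then show ?case by (simp add: elim)
      qed
    qed measurable
    also have "\<dots> = (\<Sum>j\<in>UNIV. LINT z|lborel. ?g z * b j z * b j z * cos (s * b k z))"
      by (rule Bochner_Integration.integral_sum) (rule ii)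
    also have "\<dots> = (LINT z|lborel. ?g z * b k z * b k z * cos (s * b k z)) + (\<Sum>j\<in>UNIV - {k}. LINT z|lborel. ?g z * b j z * b j z * cos (s * b k z))"
      by (simp add: sum.remove[of UNIV k])
    also have "(\<Sum>j\<in>UNIV - {k}. LINT z|lborel. ?g z * b j z * b j z * cos (s * b k z)) = (\<Sum>j\<in>UNIV - {k}. - (J1 s / s))"
    proof (rule sum.cong)
      fix j assume "j \<in> UNIV - {k}"
      then have "j \<noteq> k" by simp
      from key[OF this s]
      have "- (LINT z|lborel. ?g z * b j z * b j z * cos (s * b k z)) = J1 s / s"
        by (simp only: mult_zero_left add_0_right)
      then show "(LINT z|lborel. ?g z * b j z * b j z * cos (s * b k z)) = - (J1 s / s)" by linarith
    qed simp
    also have "\<dots> = - ((real CARD('n) - 1) / s * J1 s)"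
      by (simp add: card_Diff_singleton of_nat_diff Suc_leI)
    also have "(LINT z|lborel. ?g z * b k z * b k z * cos (s * b k z)) = - J2 s" by (simp add: J2_def)
    finally show ?thesis by simp
  qed
  show thesis by (rule that[OF dJ dJ1 ode])
qed

text \<open>
  For \<open>v = s\<^sup>a J\<close> with \<open>a = (d - 1) / 2\<close> the equation becomes \<open>v'' + v = a (a - 1) v / s\<^sup>2\<close>, and
  \<open>exp (K / s) (v\<^sup>2 + v'\<^sup>2)\<close> is nonincreasing for \<open>K = \<bar>a (a - 1)\<bar>\<close>.
\<close>

lemma Helmholtz_decay:
  fixes J J1 J2 :: "real \<Rightarrow> real" and a :: real
  assumes dJ: "\<And>s. (J has_real_derivative J1 s) (at s)" and dJ1: "\<And>s. (J1 has_real_derivative J2 s) (at s)"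
    and ode: "\<And>s. s > 0 \<Longrightarrow> J2 s + 2 * a / s * J1 s + J s = 0"
  obtains C where "C > 0" "\<And>s. s \<ge> 1 \<Longrightarrow> \<bar>J s\<bar> \<le> C * s powr (- a)"
proof -
  define K where "K = \<bar>a * (a - 1)\<bar>"
  define v where "v s = s powr a * J s" for s
  define v1 where "v1 s = s powr a * (J1 s + a * J s / s)" for s
  define H where "H s = exp (K / s) * ((v s)\<^sup>2 + (v1 s)\<^sup>2)" for s
  have dv: "(v has_real_derivative v1 s) (at s)" if "s > 0" for s
    unfolding v_def[abs_def] v1_def using that
    by (auto intro!: derivative_eq_intros dJ simp: powr_diff algebra_simps)
  have dv1: "(v1 has_real_derivative (a * (a - 1) / s\<^sup>2 * v s - v s)) (at s)" if "s > 0" for s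
  proof -
    have "(v1 has_real_derivative (a * s powr (a - 1) * (J1 s + a * J s / s) + s powr a * (J2 s + (a * J1 s * s - a * J s) / (s * s)))) (at s)"
      unfolding v1_def[abs_def] using that
      by (auto intro!: derivative_eq_intros dJ dJ1 simp: field_simps)
    moreover have "a * s powr (a - 1) * (J1 s + a * J s / s) + s powr a * (J2 s + (a * J1 s * s - a * J s) / (s * s))
       = a * (a - 1) / s\<^sup>2 * v s - v s"
    proof -
      have j2: "J2 s = - (2 * a / s * J1 s) - J s" using ode[OF that] by linarith
      have p: "s powr (a - 1) = s powr a / s" using that by (simp add: powr_diff)
      show ?thesis unfolding j2 p v_def using that by (simp add: field_simps power2_eq_square)
    qed
    ultimately show ?thesis by simp
  qed
  \<comment> \<open>In the derivative of \<open>v\<^sup>2 + v1\<^sup>2\<close> the terms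
    \<open>2 * v * v1\<close> and \<open>- 2 * v * v1\<close> cancel; what is left carries the
    factor \<open>a * (a - 1) / s\<^sup>2\<close>, which the derivative of
    \<open>exp (K / s)\<close> absorbs.\<close>
  have dH: "(H has_real_derivative exp (K / s) * (2 * a * (a - 1) / s\<^sup>2 * (v s * v1 s) - K / s\<^sup>2 * ((v s)\<^sup>2 + (v1 s)\<^sup>2))) (at s)" if "s > 0" for s
    unfolding H_def[abs_def] using that
    by (auto intro!: derivative_eq_intros dv dv1 simp: algebra_simps power2_eq_square)
  have neg: "exp (K / s) * (2 * a * (a - 1) / s\<^sup>2 * (v s * v1 s) - K / s\<^sup>2 * ((v s)\<^sup>2 + (v1 s)\<^sup>2)) \<le> 0" if "s > 0" for s
  proof -
    have "2 * (v s * v1 s) \<le> (v s)\<^sup>2 + (v1 s)\<^sup>2" "- (2 * (v s * v1 s)) \<le> (v s)\<^sup>2 + (v1 s)\<^sup>2"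
      using zero_le_power2[of "v s - v1 s"] zero_le_power2[of "v s + v1 s"] by (simp_all add: power2_eq_square algebra_simps)
    then have "\<bar>2 * (v s * v1 s)\<bar> \<le> (v s)\<^sup>2 + (v1 s)\<^sup>2" by linarith
    then have "\<bar>a * (a - 1)\<bar> * \<bar>2 * (v s * v1 s)\<bar> \<le> K * ((v s)\<^sup>2 + (v1 s)\<^sup>2)"
      unfolding K_def by (intro mult_left_mono) auto
    then have "a * (a - 1) * (2 * (v s * v1 s)) \<le> K * ((v s)\<^sup>2 + (v1 s)\<^sup>2)"
      unfolding abs_mult[symmetric] by linarith
    then have "(a * (a - 1) * (2 * (v s * v1 s)) - K * ((v s)\<^sup>2 + (v1 s)\<^sup>2)) / s\<^sup>2 \<le> 0"
      by (intro divide_nonpos_nonneg) auto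
    moreover have "(a * (a - 1) * (2 * (v s * v1 s)) - K * ((v s)\<^sup>2 + (v1 s)\<^sup>2)) / s\<^sup>2
      = 2 * a * (a - 1) / s\<^sup>2 * (v s * v1 s) - K / s\<^sup>2 * ((v s)\<^sup>2 + (v1 s)\<^sup>2)"
      by (simp add: diff_divide_distrib mult_ac)
    ultimately show ?thesis by (simp add: mult_nonneg_nonpos)
  qed
  have Hle: "H s \<le> H 1" if "s \<ge> 1" for s
  proof (rule DERIV_nonpos_imp_nonincreasing[OF that])
    fix x assume "1 \<le> x" "x \<le> s"
    then show "\<exists>y. (H has_real_derivative y) (at x) \<and> y \<le> 0" using dH[of x] neg[of x] by auto
  qed
  have H0: "H 1 \<ge> 0" by (simp add: H_def)
  show thesis
  \<comment> \<open>The added \<open>1\<close> keeps the constant positive even if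
    \<open>H 1 = 0\<close>.\<close>
  proof (rule that[of "sqrt (H 1) + 1"])
    show "sqrt (H 1) + 1 > 0" using H0 by (simp add: add_nonneg_pos)
    fix s :: real assume s: "s \<ge> 1"
    have "K / s \<ge> 0" using s by (simp add: K_def)
    then have "1 \<le> exp (K / s)" by simp
    then have "(v s)\<^sup>2 \<le> exp (K / s) * ((v s)\<^sup>2 + (v1 s)\<^sup>2)"
      using mult_mono[of 1 "exp (K / s)" "(v s)\<^sup>2" "(v s)\<^sup>2 + (v1 s)\<^sup>2"] by simp
    then have "(v s)\<^sup>2 \<le> H 1" using Hle[OF s] by (simp add: H_def)
    then have "\<bar>v s\<bar> \<le> sqrt (H 1)" using real_le_rsqrt[of "\<bar>v s\<bar>" "H 1"] by simp
    then have "s powr a * \<bar>J s\<bar> \<le> sqrt (H 1) + 1" by (simp add: v_def abs_mult)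
    then have le: "s powr (- a) * (s powr a * \<bar>J s\<bar>) \<le> s powr (- a) * (sqrt (H 1) + 1)"
      by (intro mult_left_mono) auto
    have eq: "s powr (- a) * (s powr a * \<bar>J s\<bar>) = \<bar>J s\<bar>"
    proof -
      have "s powr (- a) * s powr a = 1" using s by (simp add: powr_minus)
      then show ?thesis by (simp only: mult.assoc[symmetric] mult_1)
    qed
    show "\<bar>J s\<bar> \<le> (sqrt (H 1) + 1) * s powr (- a)" using le unfolding eq by (simp only: mult.commute)
  qed
qed

text \<open>For \<open>norm y \<ge> 1\<close> the decay comes from the radial equation with
  \<open>2 * a = d - 1\<close>. For smaller \<open>y\<close> the power is at least \<open>1\<close>,
  so the uniform bound already implies the estimate.\<close>

lemma sphere_cos_decay:
  obtains C where "C > 0" "\<And>y::real^'n. \<bar>sphere_cos y\<bar> \<le> C"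
    "\<And>y::real^'n. y \<noteq> 0 \<Longrightarrow> \<bar>sphere_cos y\<bar> \<le> C * norm y powr (- (real CARD('n) - 1) / 2)"
proof -
  obtain k :: 'n where True by simp
  define J where "J = (\<lambda>s. sphere_cos (s *\<^sub>R axis k (1::real)))"
  define a where "a = (real CARD('n) - 1) / 2"
  have a0: "a \<ge> 0" by (simp add: a_def Suc_leI)
  obtain J1 J2 where J: "\<And>s. (J has_real_derivative J1 s) (at s)" "\<And>s. (J1 has_real_derivative J2 s) (at s)"
    "\<And>s. s > 0 \<Longrightarrow> J2 s + (real CARD('n) - 1) / s * J1 s + J s = 0"
    unfolding J_def using sphere_cos_Helmholtz[of k] by metis
  have "J2 s + 2 * a / s * J1 s + J s = 0" if "s > 0" for s
  proof -
    have "2 * a = real CARD('n) - 1" by (simp add: a_def)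
    then show ?thesis using J(3)[OF that] by (simp only:)
  qed
  from Helmholtz_decay[OF J(1,2) this] obtain C1 where C1: "C1 > 0" "\<And>s. s \<ge> 1 \<Longrightarrow> \<bar>J s\<bar> \<le> C1 * s powr (- a)" by metis
  define C2 where "C2 = (2 * pi) powr (CARD('n) / 2)"
  have C2: "C2 > 0" "\<And>y::real^'n. \<bar>sphere_cos y\<bar> \<le> C2" unfolding C2_def by (simp, rule abs_sphere_cos_le)
  show thesis
  proof (rule that[of "C1 + C2"])
    show "C1 + C2 > 0" using C1 C2 by simp
    show "\<bar>sphere_cos y\<bar> \<le> C1 + C2" for y :: "real^'n" using C2(2)[of y] C1 by linarith
    fix y :: "real^'n" assume "y \<noteq> 0"
    have e: "- (real CARD('n) - 1) / 2 = - a" by (simp only: a_def minus_divide_left)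
    show "\<bar>sphere_cos y\<bar> \<le> (C1 + C2) * norm y powr (- (real CARD('n) - 1) / 2)"
    proof (cases "norm y \<ge> 1")
      case True
      have "sphere_cos y = J (norm y)" unfolding J_def by (rule sphere_cos_radial) (simp add: norm_axis_1)
      then have "\<bar>sphere_cos y\<bar> \<le> C1 * norm y powr (- a)" using C1(2)[OF True] by simp
      also have "\<dots> \<le> (C1 + C2) * norm y powr (- a)" using C2(1) by (intro mult_right_mono) auto
      finally show ?thesis unfolding e .
    next
      case False
      then have "1 \<le> norm y powr (- a)" using \<open>y \<noteq> 0\<close> a0 powr_mono2'[of "-a" "norm y" 1] by simp
      then have "C2 * 1 \<le> (C1 + C2) * norm y powr (- a)" using C1 C2 by (intro mult_mono) auto
      then show ?thesis unfolding e using C2(2)[of y] by simp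
    qed
  qed
qed

section \<open>Transforms and low-pass parts of radial functions\<close>

lemma AE_lborel_orthogonal:
  fixes T :: "real^'n \<Rightarrow> real^'n"
  assumes T: "orthogonal_transformation T" and P: "AE x in lborel. P x"
  shows "AE x in lborel. P (T x)"
proof -
  have [measurable]: "T \<in> borel_measurable borel" using T by measurable
  obtain N where N: "N \<in> null_sets lborel" "{x. \<not> P x} \<subseteq> N"
    using P by (auto simp: eventually_ae_filter)
  then have [measurable]: "N \<in> sets borel" by auto
  have "AE x in lborel. x \<notin> N" using N by (intro AE_not_in)
  then have "AE x in distr lborel borel T. x \<notin> N" by (simp only: lborel_distr_orthogonal[OF T])
  then have "AE x in lborel. T x \<notin> N" by (subst (asm) AE_distr_iff) auto
  then show ?thesis by eventually_elim (use N in auto)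
qed

text \<open>Radiality of \<open>f\<close> is an almost everywhere statement, but the transform is an
  integral and hence invariant at every point.\<close>

lemma fourier_L1_orthogonal:
  fixes f :: "real^'n \<Rightarrow> complex"
  assumes f[measurable]: "f \<in> borel_measurable borel" and rad: "radial f" and T: "orthogonal_transformation T"
  shows "fourier_L1 f (T \<xi>) = fourier_L1 f \<xi>"
proof -
  have [measurable]: "T \<in> borel_measurable borel" using T by measurable
  obtain g where g: "AE x in lborel. f x = g (norm x)" using rad by (auto simp: radial_def)
  have AE: "AE x in lborel. f (T x) = f x"
    using g AE_lborel_orthogonal[OF T g]
    by eventually_elim (simp add: orthogonal_transformation_norm[OF T])
  have inn: "T x \<bullet> T \<xi> = x \<bullet> \<xi>" for x using T by (simp add: orthogonal_transformation_def)
  have "(LINT x|lborel. exp (- (\<i> * complex_of_real (x \<bullet> T \<xi>))) * f x)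
      = (LINT x|lborel. exp (- (\<i> * complex_of_real (T x \<bullet> T \<xi>))) * f (T x))"
    by (rule integral_orthogonal[OF T, symmetric]) measurable
  also have "\<dots> = (LINT x|lborel. exp (- (\<i> * complex_of_real (x \<bullet> \<xi>))) * f x)"
    unfolding inn by (rule integral_cong_AE) (use AE in auto)
  finally show ?thesis by (simp add: fourier_L1_def)
qed

lemma integral_gauss_exp_sgn:
  fixes y :: "real^'n"
  shows "(LINT z|lborel. complex_of_real (gauss 1 z) * exp (\<i> * complex_of_real (y \<bullet> sgn z))) = complex_of_real (sphere_cos y)"
proof -
  let ?g = "gauss 1 :: real^'n \<Rightarrow> real"
  have g: "integrable lborel ?g" by (simp add: integrable_gauss)
  have ic: "integrable lborel (\<lambda>z. ?g z * cos (y \<bullet> sgn z))" and is1: "integrable lborel (\<lambda>z. ?g z * sin (y \<bullet> sgn z))"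
    by (rule Bochner_Integration.integrable_bound[OF g]; auto simp: abs_mult intro!: AE_I2 mult_left_le)+
  have "(LINT z|lborel. ?g z * sin (y \<bullet> sgn z)) = (LINT z|lborel. ?g ((-1) *\<^sub>R z) * sin (y \<bullet> sgn ((-1) *\<^sub>R z)))"
    using integral_lborel_scale[of "-1" "\<lambda>z. ?g z * sin (y \<bullet> sgn z)"] by simp
  also have "\<dots> = - (LINT z|lborel. ?g z * sin (y \<bullet> sgn z))" by (simp add: sgn_minus)
  finally have s0: "(LINT z|lborel. ?g z * sin (y \<bullet> sgn z)) = 0" by linarith
  have "(LINT z|lborel. complex_of_real (?g z) * exp (\<i> * complex_of_real (y \<bullet> sgn z)))
     = (LINT z|lborel. complex_of_real (?g z * cos (y \<bullet> sgn z)) + \<i> * complex_of_real (?g z * sin (y \<bullet> sgn z)))"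
    by (intro Bochner_Integration.integral_cong) (auto simp: cis_conv_exp[symmetric] complex_eq_iff)
  also have "\<dots> = complex_of_real (LINT z|lborel. ?g z * cos (y \<bullet> sgn z)) + \<i> * complex_of_real (LINT z|lborel. ?g z * sin (y \<bullet> sgn z))"
    using ic is1 by (simp del: of_real_mult add: integral_complex_of_real complex_of_real_integrable_eq)
  finally show ?thesis by (simp add: s0 sphere_cos_def)
qed

text \<open>The inverse transform of an invariant \<open>g\<close> depends on \<open>norm x\<close>
  only, so its value is the Gaussian average of its values at \<open>norm x *\<^sub>R sgn z\<close>.
  Exchanging the integrals replaces the plane wave by its spherical mean. Half of the exponent of
  \<open>2 * pi\<close> is the unitary normalization, half the total mass of
  \<open>gauss 1\<close>.\<close>

lemma inverse_fourier_L1_radial: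
  fixes g :: "real^'n \<Rightarrow> complex"
  assumes g: "integrable lborel g" and inv: "\<And>T \<xi>. orthogonal_transformation T \<Longrightarrow> g (T \<xi>) = g \<xi>"
  shows "inverse_fourier_L1 g x = complex_of_real ((2 * pi) powr (- real CARD('n))) *
    (LINT \<xi>|lborel. complex_of_real (sphere_cos (norm x *\<^sub>R \<xi>)) * g \<xi>)"
proof -
  have [measurable]: "g \<in> borel_measurable borel" using g by auto
  define c where "c = (2 * pi) powr (- real CARD('n) / 2)"
  let ?G = "gauss 1 :: real^'n \<Rightarrow> real"
  have Gi: "integrable lborel ?G" by (simp add: integrable_gauss)
  define e where "e x \<xi> = exp (\<i> * complex_of_real (x \<bullet> \<xi>))" for x \<xi> :: "real^'n"
  have [measurable]: "(\<lambda>p. e (fst p) (snd p)) \<in> borel_measurable (borel \<Otimes>\<^sub>M borel)"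
    unfolding e_def by measurable
  have ne: "norm (e x \<xi>) = 1" for x \<xi> by (simp add: e_def)
  define I where "I x = (LINT \<xi>|lborel. e x \<xi> * g \<xi>)" for x
  have IF: "inverse_fourier_L1 g x = complex_of_real c * I x" for x
    unfolding inverse_fourier_L1_def fourier_L1_def I_def e_def c_def by (simp add: inner_commute)
  have Irad: "I x = I y" if xy: "norm x = norm y" for x y
  proof -
    obtain T where T: "orthogonal_transformation T" "T x = y" using orthogonal_transformation_exists[OF xy] by blast
    have [measurable]: "T \<in> borel_measurable borel" using T(1) by measurable
    have "I y = (LINT \<xi>|lborel. e y (T \<xi>) * g (T \<xi>))"
      unfolding I_def by (rule integral_orthogonal[OF T(1), symmetric]) (simp add: e_def)
    also have "\<dots> = I x"
      using T unfolding I_def e_def by (simp add: inv T(2)[symmetric]) (simp add: orthogonal_transformation_def)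
    finally show ?thesis by simp
  qed
  have int: "integrable (lborel \<Otimes>\<^sub>M lborel) (\<lambda>(z, \<xi>). complex_of_real (?G z) * (e (norm x *\<^sub>R sgn z) \<xi> * g \<xi>))"
  proof (rule integrable_pair_bound[where f="\<lambda>z. complex_of_real (?G z)" and g=g])
    show "integrable lborel (\<lambda>z. complex_of_real (?G z))" using Gi by (simp add: complex_of_real_integrable_eq)
    have [measurable]: "(\<lambda>p::(real^'n)\<times>(real^'n). e (norm x *\<^sub>R sgn (fst p)) (snd p)) \<in> borel_measurable (borel \<Otimes>\<^sub>M borel)"
      unfolding e_def by measurable
    show "(\<lambda>(z, \<xi>). complex_of_real (?G z) * (e (norm x *\<^sub>R sgn z) \<xi> * g \<xi>)) \<in> borel_measurable (borel \<Otimes>\<^sub>M borel)"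
      unfolding split_beta by measurable
  qed (use g in \<open>auto simp: norm_mult ne\<close>)
  have "complex_of_real ((2 * pi) powr (CARD('n) / 2)) * I x = (LINT z|lborel. complex_of_real (?G z)) * I x"
    by (simp add: integral_gauss)
  also have "\<dots> = (LINT z|lborel. complex_of_real (?G z) * I x)"
    by (rule integral_mult_left_zero[symmetric])
  also have "\<dots> = (LINT z|lborel. complex_of_real (?G z) * I (norm x *\<^sub>R sgn z))"
  proof (rule integral_cong_AE)
    have [measurable]: "I \<in> borel_measurable borel" unfolding I_def[abs_def] e_def by measurable
    show "(\<lambda>z. complex_of_real (?G z) * I (norm x *\<^sub>R sgn z)) \<in> borel_measurable lborel" by measurable
    show "AE z in lborel. complex_of_real (?G z) * I x = complex_of_real (?G z) * I (norm x *\<^sub>R sgn z)"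
      using AE_lborel_singleton[of "0::real^'n"]
    proof eventually_elim
      case (elim z)
      then have "I x = I (norm x *\<^sub>R sgn z)" by (intro Irad) (simp add: norm_sgn)
      then show ?case by simp
    qed
  qed simp
  also have "\<dots> = (LINT z|lborel. LINT \<xi>|lborel. complex_of_real (?G z) * (e (norm x *\<^sub>R sgn z) \<xi> * g \<xi>))"
    unfolding I_def by simp
  also have "\<dots> = (LINT \<xi>|lborel. LINT z|lborel. complex_of_real (?G z) * (e (norm x *\<^sub>R sgn z) \<xi> * g \<xi>))"
    by (rule lborel_pair.Fubini_integral[symmetric, OF int])
  also have "\<dots> = (LINT \<xi>|lborel. complex_of_real (sphere_cos (norm x *\<^sub>R \<xi>)) * g \<xi>)"
  proof (rule Bochner_Integration.integral_cong)
    fix \<xi>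
    have "(LINT z|lborel. complex_of_real (?G z) * (e (norm x *\<^sub>R sgn z) \<xi> * g \<xi>))
       = (LINT z|lborel. (complex_of_real (?G z) * exp (\<i> * complex_of_real ((norm x *\<^sub>R \<xi>) \<bullet> sgn z))) * g \<xi>)"
      by (simp add: e_def inner_commute mult.assoc)
    also have "\<dots> = complex_of_real (sphere_cos (norm x *\<^sub>R \<xi>)) * g \<xi>"
      unfolding integral_mult_left_zero integral_gauss_exp_sgn ..
    finally show "(LINT z|lborel. complex_of_real (?G z) * (e (norm x *\<^sub>R sgn z) \<xi> * g \<xi>))
      = complex_of_real (sphere_cos (norm x *\<^sub>R \<xi>)) * g \<xi>" .
  qed simp
  finally have AI: "complex_of_real ((2 * pi) powr (CARD('n) / 2)) * I x
     = (LINT \<xi>|lborel. complex_of_real (sphere_cos (norm x *\<^sub>R \<xi>)) * g \<xi>)" .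
  have cc: "c * (c * (2 * pi) powr (CARD('n) / 2)) = c" by (simp add: c_def flip: powr_add)
  have c2: "c * c = (2 * pi) powr (- real CARD('n))" by (simp add: c_def flip: powr_add)
  have "inverse_fourier_L1 g x = complex_of_real (c * (c * (2 * pi) powr (CARD('n) / 2))) * I x"
    by (simp only: IF cc)
  also have "\<dots> = complex_of_real (c * c) * (complex_of_real ((2 * pi) powr (CARD('n) / 2)) * I x)"
    by (simp add: mult.assoc)
  finally show ?thesis unfolding AI c2 .
qed

lemma L2_sq_mono:
  assumes "f \<in> L2_space" "g \<in> L2_space" "\<And>x. norm (f x) \<le> norm (g x)"
  shows "L2_sq f \<le> L2_sq g"
  unfolding L2_sq_def using assms by (intro integral_mono L2_spaceD power_mono) auto

text \<open>A bounded multiplier cut off to a ball is square-integrable, so the integral is an inner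
  product with a fixed element. Pointwise formulas for low-pass parts thereby pass to mean-square
  limits.\<close>

lemma integral_bounded_mult_tendsto:
  fixes m l :: "'a::euclidean_space \<Rightarrow> complex"
  assumes f: "\<And>R. f R \<in> L2_space" and l: "l \<in> L2_space" and [measurable]: "m \<in> borel_measurable borel"
    and m: "\<And>x. norm (m x) \<le> B" and lim: "((\<lambda>R. L2_sq (\<lambda>x. f R x - l x)) \<longlongrightarrow> 0) at_top"
  shows "((\<lambda>R. LINT x|lborel. m x * ball_trunc A (f R) x) \<longlongrightarrow> (LINT x|lborel. m x * ball_trunc A l x)) at_top"
proof -
  define k where "k = ball_trunc A (\<lambda>x. cnj (m x))"
  have i: "integrable lborel (indicator (cball (0::'a) A) :: _ \<Rightarrow> real)"
    by (rule integrable_real_indicator) (simp, rule emeasure_bounded_finite, simp)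
  have "k \<in> L2_space"
  proof (rule L2_space_bound[of _ "\<lambda>x. B\<^sup>2 * indicator (cball 0 A) x"])
    show "AE x in lborel. (norm (k x))\<^sup>2 \<le> B\<^sup>2 * indicator (cball 0 A) x"
      using m by (auto simp: k_def ball_trunc_def intro!: power_mono)
  qed (use i in \<open>auto simp: k_def\<close>)
  moreover have "L2_inner h k = (LINT x|lborel. m x * ball_trunc A h x)" for h
    unfolding L2_inner_def k_def ball_trunc_def by (intro Bochner_Integration.integral_cong) auto
  ultimately show ?thesis using L2_inner_tendsto[OF f l _ lim, of k] by simp
qed

lemma radial_ball_trunc: "radial u \<Longrightarrow> radial (ball_trunc R u)"
proof -
  assume "radial u"
  then obtain g where "AE x in lborel. u x = g (norm x)" by (auto simp: radial_def)
  then have "AE x in lborel. ball_trunc R u x = (\<lambda>r. if r \<le> R then g r else 0) (norm x)"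
    by eventually_elim (simp add: ball_trunc_def)
  then show ?thesis unfolding radial_def by (rule exI[where x="\<lambda>r. if r \<le> R then g r else 0"])
qed

text \<open>\<open>fourier u\<close> is fixed only up to a null set and offers no exact rotation
  invariance. The transforms of the truncations are invariant everywhere, so the formula is proved
  for them and carried to the limit on both sides.\<close>

lemma low_pass_radial:
  fixes u :: "real^'n \<Rightarrow> complex"
  assumes u: "u \<in> L2_space" and rad: "radial u"
  shows "inverse_fourier_L1 (ball_trunc A (fourier u)) x = complex_of_real ((2 * pi) powr (- real CARD('n))) *
    (LINT \<xi>|lborel. complex_of_real (sphere_cos (norm x *\<^sub>R \<xi>)) * ball_trunc A (fourier u) \<xi>)"
proof (rule tendsto_unique)
  let ?F = "\<lambda>R. fourier_L1 (ball_trunc R u)"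
  note [measurable] = L2_spaceD(1)[OF u]
  have F: "?F R \<in> L2_space" for R by (intro plancherel_L1_L2 ball_trunc_L2 ball_trunc_integrable u)
  note lim = fourier_tendsto[OF u]
  let ?c = "complex_of_real ((2 * pi) powr (- real DIM(real^'n) / 2))"
  have e: "inverse_fourier_L1 h x = ?c * (LINT \<xi>|lborel. exp (- (\<i> * complex_of_real (\<xi> \<bullet> (- x)))) * h \<xi>)" for h
    by (simp only: inverse_fourier_L1_def fourier_L1_def)
  show "((\<lambda>R. inverse_fourier_L1 (ball_trunc A (?F R)) x) \<longlongrightarrow> inverse_fourier_L1 (ball_trunc A (fourier u)) x) at_top"
    unfolding e by (intro tendsto_mult tendsto_const integral_bounded_mult_tendsto[OF F fourier_in_L2[OF u] _ _ lim, where B=1]) auto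
  have "inverse_fourier_L1 (ball_trunc A (?F R)) x = complex_of_real ((2 * pi) powr (- real CARD('n))) *
    (LINT \<xi>|lborel. complex_of_real (sphere_cos (norm x *\<^sub>R \<xi>)) * ball_trunc A (?F R) \<xi>)" for R
  proof (rule inverse_fourier_L1_radial)
    fix T :: "real^'n \<Rightarrow> real^'n" and \<xi> assume T: "orthogonal_transformation T"
    show "ball_trunc A (?F R) (T \<xi>) = ball_trunc A (?F R) \<xi>"
      by (simp add: ball_trunc_def[of A] orthogonal_transformation_norm[OF T] fourier_L1_orthogonal[OF _ radial_ball_trunc[OF rad] T])
  qed (intro ball_trunc_integrable F)
  moreover have "((\<lambda>R. complex_of_real ((2 * pi) powr (- real CARD('n))) *
    (LINT \<xi>|lborel. complex_of_real (sphere_cos (norm x *\<^sub>R \<xi>)) * ball_trunc A (?F R) \<xi>)) \<longlongrightarrow>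
    complex_of_real ((2 * pi) powr (- real CARD('n))) *
    (LINT \<xi>|lborel. complex_of_real (sphere_cos (norm x *\<^sub>R \<xi>)) * ball_trunc A (fourier u) \<xi>)) at_top"
    by (intro tendsto_mult tendsto_const integral_bounded_mult_tendsto[OF F fourier_in_L2[OF u] _ _ lim, where B="(2 * pi) powr (CARD('n) / 2)"])
       (auto simp: abs_sphere_cos_le)
  ultimately show "((\<lambda>R. inverse_fourier_L1 (ball_trunc A (?F R)) x) \<longlongrightarrow>
    complex_of_real ((2 * pi) powr (- real CARD('n))) *
    (LINT \<xi>|lborel. complex_of_real (sphere_cos (norm x *\<^sub>R \<xi>)) * ball_trunc A (fourier u) \<xi>)) at_top" by simp
qed simp

section \<open>Low frequencies\<close>

definition symbol :: "real \<Rightarrow> 'a::euclidean_space \<Rightarrow> real" where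
  "symbol \<epsilon> \<xi> = ((norm \<xi>)\<^sup>2 - 1)\<^sup>2 + \<epsilon>"

definition energy :: "real \<Rightarrow> ('a::euclidean_space \<Rightarrow> complex) \<Rightarrow> real" where
  "energy \<epsilon> u = (LINT \<xi>|lborel. symbol \<epsilon> \<xi> * (norm (fourier u \<xi>))\<^sup>2)"

lemma symbol_measurable [measurable]: "symbol \<epsilon> \<in> borel_measurable borel"
  unfolding symbol_def[abs_def] by measurable

lemma symbol_ge: "symbol \<epsilon> \<xi> \<ge> \<epsilon>"
  by (simp add: symbol_def)

lemma symbol_pos: "\<epsilon> > 0 \<Longrightarrow> symbol \<epsilon> \<xi> > 0"
  using symbol_ge[of \<epsilon> \<xi>] by linarith

lemma symbol_nonneg: "\<epsilon> > 0 \<Longrightarrow> symbol \<epsilon> \<xi> \<ge> 0"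
  by (simp add: symbol_pos less_imp_le)

lemma H2_spaceD: "u \<in> H2_space \<Longrightarrow> u \<in> L2_space"
  by (simp add: H2_space_def)

lemma energy_integrable:
  assumes u: "u \<in> H2_space" and e: "\<epsilon> > 0"
  shows "integrable lborel (\<lambda>\<xi>. symbol \<epsilon> \<xi> * (norm (fourier u \<xi>))\<^sup>2)"
proof -
  note [measurable] = L2_spaceD(1)[OF fourier_in_L2[OF H2_spaceD[OF u]]]
  have "(\<lambda>\<xi>. complex_of_real (1 + (norm \<xi>)\<^sup>2) * fourier u \<xi>) \<in> L2_space"
    using u by (simp add: H2_space_def)
  from L2_spaceD(2)[OF this] have "integrable lborel (\<lambda>\<xi>. (1 + \<epsilon>) * (norm (complex_of_real (1 + (norm \<xi>)\<^sup>2) * fourier u \<xi>))\<^sup>2)"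
    by simp
  then show ?thesis
  proof (rule Bochner_Integration.integrable_bound)
    show "AE \<xi> in lborel. norm (symbol \<epsilon> \<xi> * (norm (fourier u \<xi>))\<^sup>2) \<le> norm ((1 + \<epsilon>) * (norm (complex_of_real (1 + (norm \<xi>)\<^sup>2) * fourier u \<xi>))\<^sup>2)"
    proof (intro AE_I2)
      fix \<xi> :: 'a
      let ?N = "(norm \<xi>)\<^sup>2"
      have N: "?N \<ge> 0" by simp
      have "norm (complex_of_real (1 + ?N)) = 1 + ?N" using N by (subst norm_of_real) simp
      then have e1: "(norm (complex_of_real (1 + ?N) * fourier u \<xi>))\<^sup>2 = (1 + ?N)\<^sup>2 * (norm (fourier u \<xi>))\<^sup>2"
        by (simp add: norm_mult power_mult_distrib)
      have "1 \<le> (1 + ?N)\<^sup>2" using N by (simp add: one_le_power)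
      then have "\<epsilon> \<le> \<epsilon> * (1 + ?N)\<^sup>2" using e by simp
      moreover have "(?N - 1)\<^sup>2 \<le> (1 + ?N)\<^sup>2" using N by (simp add: power2_eq_square algebra_simps)
      ultimately have "symbol \<epsilon> \<xi> \<le> (1 + \<epsilon>) * (1 + ?N)\<^sup>2" by (simp add: symbol_def algebra_simps)
      then have "symbol \<epsilon> \<xi> * (norm (fourier u \<xi>))\<^sup>2 \<le> (1 + \<epsilon>) * (1 + ?N)\<^sup>2 * (norm (fourier u \<xi>))\<^sup>2"
        by (rule mult_right_mono) simp
      then show "norm (symbol \<epsilon> \<xi> * (norm (fourier u \<xi>))\<^sup>2) \<le> norm ((1 + \<epsilon>) * (norm (complex_of_real (1 + ?N) * fourier u \<xi>))\<^sup>2)"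
        unfolding e1 using symbol_pos[OF e, of \<xi>] e by (simp add: mult.assoc)
    qed
  qed measurable
qed

lemma energy_nonneg: "\<epsilon> > 0 \<Longrightarrow> energy \<epsilon> u \<ge> 0"
  unfolding energy_def by (intro integral_nonneg_AE AE_I2 mult_nonneg_nonneg symbol_nonneg) auto

lemma nn_integral_energy:
  assumes u: "u \<in> H2_space" and e: "\<epsilon> > 0"
  shows "(\<integral>\<^sup>+\<xi>. ennreal (symbol \<epsilon> \<xi> * (norm (fourier u \<xi>))\<^sup>2) \<partial>lborel) = ennreal (energy \<epsilon> u)"
  unfolding energy_def
  by (rule nn_integral_eq_integral[OF energy_integrable[OF u e]]) (intro AE_I2 mult_nonneg_nonneg symbol_nonneg e, simp)

lemma energy_ge_L2_sq:
  assumes u: "u \<in> H2_space" and e: "\<epsilon> > 0"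
  shows "\<epsilon> * L2_sq u \<le> energy \<epsilon> u"
proof -
  have "\<epsilon> * L2_sq (fourier u) = (LINT \<xi>|lborel. \<epsilon> * (norm (fourier u \<xi>))\<^sup>2)" by (simp add: L2_sq_def)
  also have "\<dots> \<le> energy \<epsilon> u"
    unfolding energy_def
    by (intro integral_mono energy_integrable u e integrable_mult_right L2_spaceD fourier_in_L2 H2_spaceD mult_right_mono symbol_ge) simp
  finally show ?thesis by (simp add: plancherel_L2[OF H2_spaceD[OF u]])
qed

text \<open>For \<open>norm \<xi> \<ge> 2\<close> the difference
  \<open>(norm \<xi>)\<^sup>2 - 1\<close> is at least \<open>3/4\<close> of
  \<open>(norm \<xi>)\<^sup>2\<close>, and \<open>16/9\<close> is the inverse square of
  \<open>3/4\<close>.\<close>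

lemma high_frequency_symbol:
  assumes "norm \<xi> \<ge> 2" "\<epsilon> > 0"
  shows "(norm \<xi>) ^ 4 \<le> 16/9 * symbol \<epsilon> \<xi>"
proof -
  have "4 \<le> (norm \<xi>)\<^sup>2" using power_mono[of 2 "norm \<xi>" 2] assms by simp
  then have "3/4 * (norm \<xi>)\<^sup>2 \<le> (norm \<xi>)\<^sup>2 - 1" by simp
  then have "(3/4 * (norm \<xi>)\<^sup>2)\<^sup>2 \<le> ((norm \<xi>)\<^sup>2 - 1)\<^sup>2" by (rule power_mono) simp
  then show ?thesis using assms by (simp add: symbol_def power2_eq_square power4_eq_xxxx)
qed

lemma high_frequency_mass:
  assumes u: "u \<in> H2_space" and e: "\<epsilon> > 0" and A: "A \<ge> 2"
  shows "(LINT \<xi>|lborel. (if norm \<xi> > A then (norm (fourier u \<xi>))\<^sup>2 else 0)) \<le> 16/9 * energy \<epsilon> u / A ^ 4"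
proof -
  note [measurable] = L2_spaceD(1)[OF fourier_in_L2[OF H2_spaceD[OF u]]]
  have "(LINT \<xi>|lborel. (if norm \<xi> > A then (norm (fourier u \<xi>))\<^sup>2 else 0))
     \<le> (LINT \<xi>|lborel. 16/9 / A ^ 4 * (symbol \<epsilon> \<xi> * (norm (fourier u \<xi>))\<^sup>2))"
  proof (rule integral_mono)
    show "integrable lborel (\<lambda>\<xi>. if norm \<xi> > A then (norm (fourier u \<xi>))\<^sup>2 else 0)"
      by (rule Bochner_Integration.integrable_bound[OF L2_spaceD(2)[OF fourier_in_L2[OF H2_spaceD[OF u]]]]) auto
    show "integrable lborel (\<lambda>\<xi>. 16/9 / A ^ 4 * (symbol \<epsilon> \<xi> * (norm (fourier u \<xi>))\<^sup>2))"
      by (intro integrable_mult_right energy_integrable u e)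
    fix \<xi> :: 'a
    have A4: "A ^ 4 > 0" using A by simp
    show "(if norm \<xi> > A then (norm (fourier u \<xi>))\<^sup>2 else 0) \<le> 16/9 / A ^ 4 * (symbol \<epsilon> \<xi> * (norm (fourier u \<xi>))\<^sup>2)"
    proof (cases "norm \<xi> > A")
      case True
      have "A ^ 4 \<le> (norm \<xi>) ^ 4" using True A by (intro power_mono) auto
      also have "\<dots> \<le> 16/9 * symbol \<epsilon> \<xi>" using True A e by (intro high_frequency_symbol) auto
      finally have "1 \<le> 16/9 / A ^ 4 * symbol \<epsilon> \<xi>" using A4 by (simp add: field_simps)
      from mult_right_mono[OF this, of "(norm (fourier u \<xi>))\<^sup>2"] show ?thesis using True by (simp add: mult.assoc)
    next
      case False
      then show ?thesis using A4 symbol_pos[OF e, of \<xi>] by simp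
    qed
  qed
  then show ?thesis by (simp add: energy_def)
qed

text \<open>The factors are \<open>m\<close> over the root of the symbol and that root times the
  transform. All pointwise bounds by the energy pass through this: \<open>m\<close> is the modulus
  of the spherical mean for low frequencies and the indicator of an annulus for intermediate ones.
  Extended integrals leave integrability of the product to the conclusion.\<close>

lemma weighted_Cauchy_Schwarz:
  assumes u: "u \<in> H2_space" and e: "\<epsilon> > 0" and [measurable]: "m \<in> borel_measurable borel" and m: "\<And>\<xi>. m \<xi> \<ge> 0"
    and K: "(\<integral>\<^sup>+\<xi>. ennreal ((m \<xi>)\<^sup>2 / symbol \<epsilon> \<xi>) \<partial>lborel) \<le> ennreal K" and K0: "K \<ge> 0"
  shows "(\<integral>\<^sup>+\<xi>. ennreal (m \<xi> * norm (fourier u \<xi>)) \<partial>lborel) \<le> ennreal (sqrt (K * energy \<epsilon> u))"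
proof -
  note [measurable] = L2_spaceD(1)[OF fourier_in_L2[OF H2_spaceD[OF u]]]
  let ?X = "\<integral>\<^sup>+\<xi>. ennreal (m \<xi> * norm (fourier u \<xi>)) \<partial>lborel"
  have s: "symbol \<epsilon> \<xi> > 0" for \<xi> :: 'a by (rule symbol_pos[OF e])
  have "ennreal (m \<xi> * norm (fourier u \<xi>)) = ennreal (m \<xi> / sqrt (symbol \<epsilon> \<xi>)) * ennreal (sqrt (symbol \<epsilon> \<xi>) * norm (fourier u \<xi>))" for \<xi>
    using s[of \<xi>] m[of \<xi>] by (subst ennreal_mult[symmetric]) (auto intro!: mult_nonneg_nonneg less_imp_le)
  then have "?X\<^sup>2 = (\<integral>\<^sup>+\<xi>. ennreal (m \<xi> / sqrt (symbol \<epsilon> \<xi>)) * ennreal (sqrt (symbol \<epsilon> \<xi>) * norm (fourier u \<xi>)) \<partial>lborel)\<^sup>2"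
    by simp
  also have "\<dots> \<le> (\<integral>\<^sup>+\<xi>. ennreal (m \<xi> / sqrt (symbol \<epsilon> \<xi>)) ^ 2 \<partial>lborel) * (\<integral>\<^sup>+\<xi>. ennreal (sqrt (symbol \<epsilon> \<xi>) * norm (fourier u \<xi>)) ^ 2 \<partial>lborel)"
    by (rule Cauchy_Schwarz_nn_integral) measurable
  also have "(\<integral>\<^sup>+\<xi>. ennreal (m \<xi> / sqrt (symbol \<epsilon> \<xi>)) ^ 2 \<partial>lborel) = (\<integral>\<^sup>+\<xi>. ennreal ((m \<xi>)\<^sup>2 / symbol \<epsilon> \<xi>) \<partial>lborel)"
    by (intro nn_integral_cong, subst ennreal_power) (use s m in \<open>auto simp: power_divide less_imp_le\<close>)
  also have "(\<integral>\<^sup>+\<xi>. ennreal (sqrt (symbol \<epsilon> \<xi>) * norm (fourier u \<xi>)) ^ 2 \<partial>lborel) = ennreal (energy \<epsilon> u)"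
    unfolding nn_integral_energy[OF u e, symmetric]
    by (intro nn_integral_cong, subst ennreal_power) (use s in \<open>auto simp: power_mult_distrib less_imp_le\<close>)
  also have "(\<integral>\<^sup>+\<xi>. ennreal ((m \<xi>)\<^sup>2 / symbol \<epsilon> \<xi>) \<partial>lborel) * ennreal (energy \<epsilon> u) \<le> ennreal K * ennreal (energy \<epsilon> u)"
    by (intro mult_right_mono K) simp
  also have "\<dots> = (ennreal (sqrt (K * energy \<epsilon> u)))\<^sup>2"
    using K0 energy_nonneg[OF e, of u] by (simp add: ennreal_power flip: ennreal_mult)
  finally have "?X\<^sup>2 \<le> (ennreal (sqrt (K * energy \<epsilon> u)))\<^sup>2" .
  then show ?thesis
  proof (cases ?X)
    case (real x)
    have k: "K * energy \<epsilon> u \<ge> 0" using K0 energy_nonneg[OF e, of u] by simp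
    from \<open>?X\<^sup>2 \<le> _\<close> have "ennreal (x\<^sup>2) \<le> ennreal (K * energy \<epsilon> u)"
      using real k by (simp add: ennreal_power)
    then have "x\<^sup>2 \<le> K * energy \<epsilon> u" using k by simp
    then show ?thesis using real real_le_rsqrt by (simp add: ennreal_leI)
  next
    case top
    from \<open>?X\<^sup>2 \<le> _\<close> show ?thesis unfolding top by (simp add: power2_eq_square ennreal_top_mult top_unique ennreal_mult_eq_top_iff)
  qed
qed

text \<open>An antiderivative is
  \<open>arctan ((r - 1) / sqrt \<epsilon>) / sqrt \<epsilon>\<close>, and the arctangent varies by
  at most \<open>pi\<close>. The factor \<open>1 / sqrt \<epsilon>\<close> is the whole effect of
  the resonance at the unit sphere.\<close>

lemma nn_integral_resonance:
  assumes e: "\<epsilon> > (0::real)"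
  shows "(\<integral>\<^sup>+r. ennreal (1 / ((r - 1)\<^sup>2 + \<epsilon>)) * indicator {0..2} r \<partial>lborel) \<le> ennreal (pi / sqrt \<epsilon>)"
proof -
  have se: "sqrt \<epsilon> > 0" using e by simp
  have "(\<integral>\<^sup>+r. ennreal (1 / ((r - 1)\<^sup>2 + \<epsilon>)) * indicator {0..2} r \<partial>lborel)
     = arctan ((2 - 1) / sqrt \<epsilon>) / sqrt \<epsilon> - arctan ((0 - 1) / sqrt \<epsilon>) / sqrt \<epsilon>"
  proof (rule nn_integral_FTC_Icc[where F="\<lambda>r. arctan ((r - 1) / sqrt \<epsilon>) / sqrt \<epsilon>"])
    fix r :: real
    have pos: "(r - 1)\<^sup>2 + \<epsilon> > 0" using e by (simp add: add_nonneg_pos)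
    have "((\<lambda>r. arctan ((r - 1) / sqrt \<epsilon>) / sqrt \<epsilon>) has_real_derivative (inverse (1 + ((r - 1) / sqrt \<epsilon>)\<^sup>2) * (1 / sqrt \<epsilon>)) / sqrt \<epsilon>) (at r)"
      using se by (intro DERIV_cdivide DERIV_chain2[where f=arctan, OF DERIV_arctan]) (auto intro!: derivative_eq_intros)
    also have "(inverse (1 + ((r - 1) / sqrt \<epsilon>)\<^sup>2) * (1 / sqrt \<epsilon>)) / sqrt \<epsilon> = 1 / ((r - 1)\<^sup>2 + \<epsilon>)"
    proof -
      have "1 + ((r - 1) / sqrt \<epsilon>)\<^sup>2 = ((r - 1)\<^sup>2 + \<epsilon>) / \<epsilon>" using e by (simp add: power_divide field_simps)
      then show ?thesis using e pos by (simp add: mult.assoc)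
    qed
    finally show "((\<lambda>r. arctan ((r - 1) / sqrt \<epsilon>) / sqrt \<epsilon>) has_real_derivative 1 / ((r - 1)\<^sup>2 + \<epsilon>)) (at r)" .
    show "0 \<le> 1 / ((r - 1)\<^sup>2 + \<epsilon>)" using pos by simp
  qed auto
  also have "\<dots> \<le> ennreal (pi / sqrt \<epsilon>)"
  proof (rule ennreal_leI)
    have "arctan ((2 - 1) / sqrt \<epsilon>) - arctan ((0 - 1) / sqrt \<epsilon>) \<le> pi"
      using arctan_bounded[of "(2 - 1) / sqrt \<epsilon>"] arctan_bounded[of "(0 - 1) / sqrt \<epsilon>"] by linarith
    then show "arctan ((2 - 1) / sqrt \<epsilon>) / sqrt \<epsilon> - arctan ((0 - 1) / sqrt \<epsilon>) / sqrt \<epsilon> \<le> pi / sqrt \<epsilon>"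
      using se by (simp add: diff_divide_distrib[symmetric] divide_right_mono)
  qed
  finally show ?thesis .
qed

lemma symbol_ge_resonance: "(norm \<xi> - 1)\<^sup>2 + \<epsilon> \<le> symbol \<epsilon> \<xi>"
proof -
  have "(norm \<xi>)\<^sup>2 - 1 = (norm \<xi> - 1) * (norm \<xi> + 1)" by (simp add: power2_eq_square algebra_simps)
  then have "((norm \<xi>)\<^sup>2 - 1)\<^sup>2 = (norm \<xi> - 1)\<^sup>2 * (norm \<xi> + 1)\<^sup>2" by (simp add: power_mult_distrib)
  moreover have "(norm \<xi> - 1)\<^sup>2 * 1 \<le> (norm \<xi> - 1)\<^sup>2 * (norm \<xi> + 1)\<^sup>2" by (intro mult_left_mono one_le_power) auto
  ultimately show ?thesis by (simp add: symbol_def)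
qed

text \<open>
  Each shell \<open>\<bar>\<xi>\<bar> = r\<close> contributes \<open>r\<^sup>d\<^sup>-\<^sup>1\<close> in volume, which the decay \<open>(\<bar>x\<bar> r)\<^sup>1\<^sup>-\<^sup>d\<close> of
  \<open>sphere_cos\<^sup>2\<close> cancels exactly.
\<close>

lemma low_frequency_bound:
  obtains C where "C > 0"
    "\<And>\<epsilon> (u :: real^'n \<Rightarrow> complex) x. \<lbrakk>\<epsilon> > 0; u \<in> H2_rad\<rbrakk> \<Longrightarrow>
       (norm (inverse_fourier_L1 (ball_trunc 2 (fourier u)) x))\<^sup>2 \<le> C * (energy \<epsilon> u / sqrt \<epsilon>)"
    "\<And>\<epsilon> (u :: real^'n \<Rightarrow> complex) x. \<lbrakk>\<epsilon> > 0; u \<in> H2_rad; x \<noteq> 0\<rbrakk> \<Longrightarrow>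
       (norm (inverse_fourier_L1 (ball_trunc 2 (fourier u)) x))\<^sup>2 \<le> C * (energy \<epsilon> u / sqrt \<epsilon>) * norm x powr (- (real CARD('n) - 1))"
proof -
  define d where "d = CARD('n)"
  have d1: "d \<ge> 1" by (simp add: d_def Suc_leI)
  obtain C0 where C0: "C0 > 0" "\<And>y::real^'n. \<bar>sphere_cos y\<bar> \<le> C0"
    "\<And>y::real^'n. y \<noteq> 0 \<Longrightarrow> \<bar>sphere_cos y\<bar> \<le> C0 * norm y powr (- (real CARD('n) - 1) / 2)"
    using sphere_cos_decay by blast
  define W where "W = real d * unit_ball_vol (real d)"
  have W0: "W > 0" using d1 by (simp add: W_def)
  define c where "c = (2 * pi) powr (- real CARD('n))"
  have c0: "c > 0" by (simp add: c_def)
  text \<open>\<open>B\<close> is a common bound for \<open>sphere_cos\<^sup>2\<close> times the shell volume.\<close>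
  have gen: "(norm (inverse_fourier_L1 (ball_trunc 2 (fourier u)) x))\<^sup>2 \<le> c\<^sup>2 * (B * (W * pi)) * (energy \<epsilon> u / sqrt \<epsilon>)"
    if e: "\<epsilon> > 0" and u: "u \<in> H2_rad" and B0: "B \<ge> 0"
      and B: "\<And>\<xi>::real^'n. norm \<xi> \<le> 2 \<Longrightarrow> \<xi> \<noteq> 0 \<Longrightarrow> (sphere_cos (norm x *\<^sub>R \<xi>))\<^sup>2 * norm \<xi> ^ (d - 1) \<le> B"
    for \<epsilon> B and x :: "real^'n" and u :: "real^'n \<Rightarrow> complex"
  proof -
    have uH: "u \<in> H2_space" and rad: "radial u" using u by (auto simp: H2_rad_def)
    note uL = H2_spaceD[OF uH]
    note fu = fourier_in_L2[OF uL]
    note [measurable] = L2_spaceD(1)[OF fu]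
    define m where "m \<xi> = (if norm \<xi> \<le> 2 then \<bar>sphere_cos (norm x *\<^sub>R \<xi>)\<bar> else 0)" for \<xi> :: "real^'n"
    have [measurable]: "m \<in> borel_measurable borel" unfolding m_def[abs_def] by measurable
    have m0: "m \<xi> \<ge> 0" for \<xi> by (simp add: m_def)
    define h where "h r = ennreal (B / r ^ (d - 1) / ((r - 1)\<^sup>2 + \<epsilon>)) * indicator {0..2} r" for r :: real
    have [measurable]: "h \<in> borel_measurable borel" unfolding h_def[abs_def] by measurable
    have res: "(r - 1)\<^sup>2 + \<epsilon> > 0" for r using e by (simp add: add_nonneg_pos)
    have "(\<integral>\<^sup>+\<xi>. ennreal ((m \<xi>)\<^sup>2 / symbol \<epsilon> \<xi>) \<partial>lborel) \<le> (\<integral>\<^sup>+\<xi>. h (norm \<xi>) \<partial>(lborel :: (real^'n) measure))"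
    proof (rule nn_integral_mono_AE, use AE_lborel_singleton[of "0::real^'n"] in eventually_elim)
      case (elim \<xi>)
      show ?case
      proof (cases "norm \<xi> \<le> 2")
        case True
        have n0: "norm \<xi> ^ (d - 1) > 0" using elim by simp
        have "(sphere_cos (norm x *\<^sub>R \<xi>))\<^sup>2 \<le> B / norm \<xi> ^ (d - 1)"
          using B[OF True elim] n0 by (simp add: pos_le_divide_eq)
        then have "(sphere_cos (norm x *\<^sub>R \<xi>))\<^sup>2 / symbol \<epsilon> \<xi> \<le> B / norm \<xi> ^ (d - 1) / ((norm \<xi> - 1)\<^sup>2 + \<epsilon>)"
          using res[of "norm \<xi>"] symbol_ge_resonance[of \<xi> \<epsilon>] B0 n0 by (intro frac_le) auto
        then show ?thesis using True by (auto simp: m_def h_def power2_abs intro!: ennreal_leI)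
      qed (simp add: m_def)
    qed
    also have "\<dots> = (\<integral>\<^sup>+r. ennreal (W * r ^ (d - 1)) * indicator {0..} r * h r \<partial>lborel)"
      by (subst nn_integral_radial) (simp_all add: W_def d_def)
    also have "\<dots> \<le> (\<integral>\<^sup>+r. ennreal (W * B) * (ennreal (1 / ((r - 1)\<^sup>2 + \<epsilon>)) * indicator {0..2} r) \<partial>lborel)"
    proof (rule nn_integral_mono)
      fix r :: real
      show "ennreal (W * r ^ (d - 1)) * indicator {0..} r * h r \<le> ennreal (W * B) * (ennreal (1 / ((r - 1)\<^sup>2 + \<epsilon>)) * indicator {0..2} r)"
      proof (cases "r \<in> {0..2}")
        case True
        have "W * r ^ (d - 1) * (B / r ^ (d - 1) / ((r - 1)\<^sup>2 + \<epsilon>)) \<le> W * B * (1 / ((r - 1)\<^sup>2 + \<epsilon>))"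
          using W0 B0 res[of r] by (cases "r ^ (d - 1) = 0") auto
        then show ?thesis using True W0 B0 res[of r] unfolding h_def by (auto simp flip: ennreal_mult' intro!: ennreal_leI)
      qed (auto simp: h_def)
    qed
    also have "\<dots> = ennreal (W * B) * (\<integral>\<^sup>+r. ennreal (1 / ((r - 1)\<^sup>2 + \<epsilon>)) * indicator {0..2} r \<partial>lborel)"
      by (rule nn_integral_cmult) measurable
    also have "\<dots> \<le> ennreal (W * B) * ennreal (pi / sqrt \<epsilon>)"
      by (intro mult_left_mono nn_integral_resonance e) simp
    also have "\<dots> = ennreal (B * (W * pi) / sqrt \<epsilon>)" using W0 B0 e by (simp flip: ennreal_mult' add: mult_ac)
    finally have K: "(\<integral>\<^sup>+\<xi>. ennreal ((m \<xi>)\<^sup>2 / symbol \<epsilon> \<xi>) \<partial>lborel) \<le> ennreal (B * (W * pi) / sqrt \<epsilon>)" .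
    have K0: "B * (W * pi) / sqrt \<epsilon> \<ge> 0" using W0 B0 e by simp
    let ?I = "LINT \<xi>|lborel. complex_of_real (sphere_cos (norm x *\<^sub>R \<xi>)) * ball_trunc 2 (fourier u) \<xi>"
    have "ennreal (norm ?I) \<le> (\<integral>\<^sup>+\<xi>. ennreal (norm (complex_of_real (sphere_cos (norm x *\<^sub>R \<xi>)) * ball_trunc 2 (fourier u) \<xi>)) \<partial>lborel)"
    proof (rule integral_norm_bound_ennreal)
      have "integrable lborel (\<lambda>\<xi>. complex_of_real C0 * ball_trunc 2 (fourier u) \<xi>)" using ball_trunc_integrable[OF fu] by simp
      then show "integrable lborel (\<lambda>\<xi>. complex_of_real (sphere_cos (norm x *\<^sub>R \<xi>)) * ball_trunc 2 (fourier u) \<xi>)"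
        by (rule Bochner_Integration.integrable_bound) (use C0 in \<open>auto simp: norm_mult intro!: AE_I2 mult_right_mono\<close>)
    qed
    also have "\<dots> = (\<integral>\<^sup>+\<xi>. ennreal (m \<xi> * norm (fourier u \<xi>)) \<partial>lborel)"
      by (intro nn_integral_cong) (auto simp: m_def ball_trunc_def norm_mult)
    also have "\<dots> \<le> ennreal (sqrt (B * (W * pi) / sqrt \<epsilon> * energy \<epsilon> u))"
      by (rule weighted_Cauchy_Schwarz[OF uH e _ m0 K K0]) measurable
    finally have "norm ?I \<le> sqrt (B * (W * pi) / sqrt \<epsilon> * energy \<epsilon> u)"
      by (simp only: ennreal_le_iff[OF real_sqrt_ge_zero[OF mult_nonneg_nonneg[OF K0 energy_nonneg[OF e, of u]]]])
    then have "(norm ?I)\<^sup>2 \<le> (sqrt (B * (W * pi) / sqrt \<epsilon> * energy \<epsilon> u))\<^sup>2" by (intro power_mono) auto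
    also have "\<dots> = B * (W * pi) / sqrt \<epsilon> * energy \<epsilon> u"
      using mult_nonneg_nonneg[OF K0 energy_nonneg[OF e, of u]] by (rule real_sqrt_pow2)
    finally have "c\<^sup>2 * (norm ?I)\<^sup>2 \<le> c\<^sup>2 * (B * (W * pi) / sqrt \<epsilon> * energy \<epsilon> u)" by (rule mult_left_mono) simp
    moreover have "norm (inverse_fourier_L1 (ball_trunc 2 (fourier u)) x) = c * norm ?I"
      unfolding low_pass_radial[OF uL rad] using c0 by (simp add: norm_mult c_def)
    ultimately show ?thesis by (simp add: power_mult_distrib mult_ac)
  qed
  show thesis
  \<comment> \<open>The factor \<open>2 ^ (d - 1)\<close> bounds \<open>norm \<xi> ^ (d - 1)\<close>
    in the uniform estimate. In the decaying estimate that power cancels, and since the factor is at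
    least \<open>1\<close> the same constant serves both.\<close>
  proof (rule that[of "c\<^sup>2 * (C0\<^sup>2 * 2 ^ (d - 1) * (W * pi))"])
    show "c\<^sup>2 * (C0\<^sup>2 * 2 ^ (d - 1) * (W * pi)) > 0" using c0 C0 W0 by simp
    fix \<epsilon> and u :: "real^'n \<Rightarrow> complex" and x
    assume e: "\<epsilon> > (0::real)" and u: "u \<in> H2_rad"
    show "(norm (inverse_fourier_L1 (ball_trunc 2 (fourier u)) x))\<^sup>2 \<le> c\<^sup>2 * (C0\<^sup>2 * 2 ^ (d - 1) * (W * pi)) * (energy \<epsilon> u / sqrt \<epsilon>)"
    proof (rule gen[OF e u])
      show "0 \<le> C0\<^sup>2 * 2 ^ (d - 1)" by simp
      fix \<xi> :: "real^'n" assume "norm \<xi> \<le> 2"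
      moreover have "(sphere_cos (norm x *\<^sub>R \<xi>))\<^sup>2 \<le> C0\<^sup>2"
        using power_mono[OF C0(2)[of "norm x *\<^sub>R \<xi>"], of 2] by simp
      ultimately show "(sphere_cos (norm x *\<^sub>R \<xi>))\<^sup>2 * norm \<xi> ^ (d - 1) \<le> C0\<^sup>2 * 2 ^ (d - 1)"
        by - (rule mult_mono, auto intro: power_mono)
    qed
    assume x: "x \<noteq> 0"
    let ?P = "norm x powr (- (real CARD('n) - 1))"
    have "(norm (inverse_fourier_L1 (ball_trunc 2 (fourier u)) x))\<^sup>2 \<le> c\<^sup>2 * (C0\<^sup>2 * ?P * (W * pi)) * (energy \<epsilon> u / sqrt \<epsilon>)"
    proof (rule gen[OF e u])
      show "0 \<le> C0\<^sup>2 * ?P" by simp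
      fix \<xi> :: "real^'n" assume "\<xi> \<noteq> 0"
      define s where "s = norm (norm x *\<^sub>R \<xi>)"
      have s: "s > 0" using x \<open>\<xi> \<noteq> 0\<close> by (simp add: s_def)
      have "\<bar>sphere_cos (norm x *\<^sub>R \<xi>)\<bar> \<le> C0 * s powr (- (real CARD('n) - 1) / 2)"
        unfolding s_def using x \<open>\<xi> \<noteq> 0\<close> by (intro C0) auto
      then have "\<bar>sphere_cos (norm x *\<^sub>R \<xi>)\<bar>\<^sup>2 \<le> (C0 * s powr (- (real CARD('n) - 1) / 2))\<^sup>2" by (rule power_mono) simp
      also have "\<dots> = C0\<^sup>2 * s powr (- (real CARD('n) - 1))"
      proof -
        have "- (x - 1) / 2 + - (x - 1) / 2 = - (x - 1)" for x :: real by (simp add: field_simps)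
        from this[of "real CARD('n)"] show ?thesis
          unfolding power_mult_distrib power2_eq_square[of "s powr _"] powr_add[symmetric] by (simp only:)
      qed
      also have "s powr (- (real CARD('n) - 1)) = ?P * norm \<xi> powr (- (real CARD('n) - 1))" by (simp add: s_def powr_mult)
      finally have "(sphere_cos (norm x *\<^sub>R \<xi>))\<^sup>2 * norm \<xi> ^ (d - 1) \<le> C0\<^sup>2 * (?P * norm \<xi> powr (- (real CARD('n) - 1))) * norm \<xi> ^ (d - 1)"
        by (intro mult_right_mono) auto
      also have "\<dots> = C0\<^sup>2 * ?P * (norm \<xi> powr (- (real CARD('n) - 1)) * norm \<xi> ^ (d - 1))"
        by (simp only: mult.assoc)
      also have "norm \<xi> powr (- (real CARD('n) - 1)) * norm \<xi> ^ (d - 1) = 1"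
      proof -
        have "norm \<xi> ^ (d - 1) = norm \<xi> powr (real CARD('n) - 1)"
          using \<open>\<xi> \<noteq> 0\<close> d1 by (simp add: powr_realpow[symmetric] d_def of_nat_diff)
        then show ?thesis using \<open>\<xi> \<noteq> 0\<close> by (simp flip: powr_add)
      qed
      finally show "(sphere_cos (norm x *\<^sub>R \<xi>))\<^sup>2 * norm \<xi> ^ (d - 1) \<le> C0\<^sup>2 * ?P" by simp
    qed
    also have "\<dots> \<le> c\<^sup>2 * (C0\<^sup>2 * 2 ^ (d - 1) * (W * pi)) * (energy \<epsilon> u / sqrt \<epsilon>) * ?P"
    proof -
      have "c\<^sup>2 * (C0\<^sup>2 * ?P * (W * pi)) * (energy \<epsilon> u / sqrt \<epsilon>) = 1 * (c\<^sup>2 * C0\<^sup>2 * (W * pi) * (energy \<epsilon> u / sqrt \<epsilon>) * ?P)"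
        by (simp add: mult_ac)
      also have "\<dots> \<le> 2 ^ (d - 1) * (c\<^sup>2 * C0\<^sup>2 * (W * pi) * (energy \<epsilon> u / sqrt \<epsilon>) * ?P)"
        using W0 e energy_nonneg[OF e, of u] by (intro mult_right_mono) auto
      also have "\<dots> = c\<^sup>2 * (C0\<^sup>2 * 2 ^ (d - 1) * (W * pi)) * (energy \<epsilon> u / sqrt \<epsilon>) * ?P"
        by (simp add: mult_ac)
      finally show ?thesis .
    qed
    finally show "(norm (inverse_fourier_L1 (ball_trunc 2 (fourier u)) x))\<^sup>2 \<le> c\<^sup>2 * (C0\<^sup>2 * 2 ^ (d - 1) * (W * pi)) * (energy \<epsilon> u / sqrt \<epsilon>) * ?P" .
  qed
qed

text \<open>
  With \<open>\<kappa> = (d - 1) \<alpha> / 2 - 1\<close>, whose sign separates the three regimes, \<open>resonance_growth \<kappa> \<epsilon>\<close> is the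
  size of \<open>\<integral>\<bar>x\<bar>\<^sup>-\<^sup>q\<close> with \<open>q = (d - 1) (\<alpha> + 2) / 2\<close> over \<open>1 \<le> \<bar>x\<bar> \<le> 1 / sqrt \<epsilon>\<close>.
\<close>

definition resonance_growth :: "real \<Rightarrow> real \<Rightarrow> real" where
  "resonance_growth \<kappa> \<epsilon> = (if \<kappa> > 0 then 1 else if \<kappa> = 0 then \<bar>ln \<epsilon>\<bar> else \<epsilon> powr (\<kappa> / 2))"

section \<open>The shell integral and the \<open>L^p\<close> size of the low-frequency part\<close>

lemma abs_ln_ge_1:
  fixes \<epsilon> :: real
  assumes "0 < \<epsilon>" "\<epsilon> \<le> exp (- 1)"
  shows "\<bar>ln \<epsilon>\<bar> \<ge> 1"
proof -
  have "exp (ln \<epsilon>) \<le> exp (- 1)" using assms by simp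
  then have "ln \<epsilon> \<le> - 1" by (simp only: exp_le_cancel_iff)
  then show ?thesis by simp
qed

lemma exp_minus_1_le: "exp (- 1 :: real) \<le> 1" by simp

lemma resonance_growth_ge:
  assumes "0 < \<epsilon>" "\<epsilon> \<le> exp (- 1)"
  shows "resonance_growth \<kappa> \<epsilon> \<ge> 1" "resonance_growth \<kappa> \<epsilon> \<ge> \<epsilon> powr (\<kappa> / 2)"
proof -
  have e1: "\<epsilon> \<le> 1" using assms exp_minus_1_le by linarith
  have "1 \<le> \<epsilon> powr (\<kappa> / 2)" if "\<kappa> < 0" using powr_mono2'[of "\<kappa> / 2" \<epsilon> 1] that assms e1 by simp
  moreover have "\<epsilon> powr (\<kappa> / 2) \<le> 1" if "\<kappa> > 0" using powr_mono2[of "\<kappa> / 2" \<epsilon> 1] that assms e1 by simp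
  ultimately show "resonance_growth \<kappa> \<epsilon> \<ge> 1" "resonance_growth \<kappa> \<epsilon> \<ge> \<epsilon> powr (\<kappa> / 2)"
    using abs_ln_ge_1[OF assms] assms by (auto simp: resonance_growth_def)
qed

text \<open>The bound keeps the dominant endpoint: the inner one when the integral converges at
  infinity, the outer one when it diverges, and the logarithm in between.\<close>

lemma nn_integral_powr_Icc:
  assumes \<rho>: "\<rho> \<ge> (1::real)"
  shows "(\<integral>\<^sup>+r. ennreal (r powr (- 1 - \<kappa>)) * indicator {1..\<rho>} r \<partial>lborel)
    \<le> ennreal (if \<kappa> > 0 then 1 / \<kappa> else if \<kappa> = 0 then ln \<rho> else \<rho> powr (- \<kappa>) / (- \<kappa>))"
proof (cases "\<kappa> = 0")
  case True
  have "(\<integral>\<^sup>+r. ennreal (r powr (- 1 - \<kappa>)) * indicator {1..\<rho>} r \<partial>lborel) = ln \<rho> - ln 1"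
    by (rule nn_integral_FTC_Icc) (use True \<rho> in \<open>auto intro!: derivative_eq_intros simp: powr_minus_divide\<close>)
  then show ?thesis using True by simp
next
  case False
  have "(\<integral>\<^sup>+r. ennreal (r powr (- 1 - \<kappa>)) * indicator {1..\<rho>} r \<partial>lborel) = \<rho> powr (- \<kappa>) / (- \<kappa>) - 1 powr (- \<kappa>) / (- \<kappa>)"
  proof (rule nn_integral_FTC_Icc[where F="\<lambda>r. r powr (- \<kappa>) / (- \<kappa>)"])
    fix r assume "r \<in> {1..\<rho>}"
    then have r: "r > 0" by simp
    have "((\<lambda>r. r powr (- \<kappa>) / (- \<kappa>)) has_real_derivative (- \<kappa> * r powr (- \<kappa> - 1)) / (- \<kappa>)) (at r)"
      by (rule DERIV_cdivide[OF has_real_derivative_powr[OF r]])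
    moreover have "(- \<kappa> * r powr (- \<kappa> - 1)) / (- \<kappa>) = r powr (- 1 - \<kappa>)"
    proof -
      have "- \<kappa> - 1 = - 1 - \<kappa>" by simp
      moreover have "(- \<kappa> * X) / (- \<kappa>) = X" for X using False by simp
      ultimately show ?thesis by (simp only:)
    qed
    ultimately show "((\<lambda>r. r powr (- \<kappa>) / (- \<kappa>)) has_real_derivative r powr (- 1 - \<kappa>)) (at r)" by simp
  qed (use \<rho> in auto)
  also have "\<dots> \<le> ennreal (if \<kappa> > 0 then 1 / \<kappa> else if \<kappa> = 0 then ln \<rho> else \<rho> powr (- \<kappa>) / (- \<kappa>))"
  proof (rule ennreal_leI)
    have "\<rho> powr (- \<kappa>) \<ge> 0" by simp
    then show "\<rho> powr (- \<kappa>) / (- \<kappa>) - 1 powr (- \<kappa>) / (- \<kappa>) \<le> (if \<kappa> > 0 then 1 / \<kappa> else if \<kappa> = 0 then ln \<rho> else \<rho> powr (- \<kappa>) / (- \<kappa>))"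
      using False by (auto simp: field_simps)
  qed
  finally show ?thesis .
qed

text \<open>At the outer radius \<open>\<rho> = \<epsilon> powr (- 1/2)\<close> one has
  \<open>ln \<rho> = \<bar>ln \<epsilon>\<bar> / 2\<close> and
  \<open>\<rho> powr (- \<kappa>) = \<epsilon> powr (\<kappa> / 2)\<close>, which explains the
  constants \<open>1/2\<close> and \<open>1 / \<bar>\<kappa>\<bar>\<close>.\<close>

lemma shell_integral_le:
  obtains C where "C > 0" "\<And>\<epsilon>. \<lbrakk>0 < \<epsilon>; \<epsilon> \<le> exp (- 1)\<rbrakk> \<Longrightarrow>
    (\<integral>\<^sup>+r. ennreal (r powr (- 1 - \<kappa>)) * indicator {1..\<epsilon> powr (- 1/2)} r \<partial>lborel) \<le> ennreal (C * resonance_growth \<kappa> \<epsilon>)"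
proof (rule that[of "if \<kappa> = 0 then 1/2 else 1 / \<bar>\<kappa>\<bar>"])
  show "(if \<kappa> = 0 then 1/2 else 1 / \<bar>\<kappa>\<bar>) > 0" by simp
  fix \<epsilon> :: real assume e: "0 < \<epsilon>" "\<epsilon> \<le> exp (- 1)"
  have e1: "\<epsilon> \<le> 1" using e exp_minus_1_le by linarith
  have \<rho>: "\<epsilon> powr (- 1/2) \<ge> 1" using powr_mono2'[of "-1/2" \<epsilon> 1] e e1 by simp
  have ln: "ln \<epsilon> \<le> 0" using e e1 by simp
  have pp: "(\<epsilon> powr - (1/2)) powr (- \<kappa>) = \<epsilon> powr (\<kappa> / 2)" by (simp add: powr_powr)
  show "(\<integral>\<^sup>+r. ennreal (r powr (- 1 - \<kappa>)) * indicator {1..\<epsilon> powr (- 1/2)} r \<partial>lborel)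
    \<le> ennreal ((if \<kappa> = 0 then 1/2 else 1 / \<bar>\<kappa>\<bar>) * resonance_growth \<kappa> \<epsilon>)"
    by (rule order_trans[OF nn_integral_powr_Icc[OF \<rho>]])
       (use e ln in \<open>auto simp: resonance_growth_def pp ln_powr intro!: ennreal_leI\<close>)
qed

text \<open>Three regions: the uniform bound on the unit ball, the decay bound out to
  \<open>\<rho> = \<epsilon> powr (- 1/2)\<close>, and beyond it the decay bound on the power
  \<open>\<alpha>\<close> combined with the mass. The first two give the shell integral, and at this
  \<open>\<rho>\<close> the third does not exceed it.\<close>

lemma Lp_low_frequency:
  fixes \<alpha> :: real
  assumes \<alpha>: "\<alpha> > 0"
  defines "\<kappa> \<equiv> (real CARD('n::finite) - 1) * \<alpha> / 2 - 1"
  obtains C where "C > 0" "\<And>\<epsilon> B (f :: real^'n \<Rightarrow> complex).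
    \<lbrakk>0 < \<epsilon>; \<epsilon> \<le> exp (- 1); B \<ge> 0; f \<in> L2_space; \<And>x. (norm (f x))\<^sup>2 \<le> B;
     \<And>x. x \<noteq> 0 \<Longrightarrow> (norm (f x))\<^sup>2 \<le> B * norm x powr (- (real CARD('n) - 1)); L2_sq f \<le> B / sqrt \<epsilon>\<rbrakk> \<Longrightarrow>
    (\<integral>\<^sup>+x. ennreal (norm (f x) powr (\<alpha> + 2)) \<partial>lborel) \<le> ennreal (C * B powr ((\<alpha> + 2) / 2) * resonance_growth \<kappa> \<epsilon>)"
proof -
  define d where "d = real CARD('n)"
  have d1: "d \<ge> 1" by (simp add: d_def Suc_leI)
  define \<omega> where "\<omega> = unit_ball_vol d"
  have w0: "\<omega> > 0" using d1 by (simp add: \<omega>_def)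
  obtain C1 where C1: "C1 > 0" "\<And>\<epsilon>. \<lbrakk>0 < \<epsilon>; \<epsilon> \<le> exp (- 1)\<rbrakk> \<Longrightarrow>
    (\<integral>\<^sup>+r. ennreal (r powr (- 1 - \<kappa>)) * indicator {1..\<epsilon> powr (- 1/2)} r \<partial>lborel) \<le> ennreal (C1 * resonance_growth \<kappa> \<epsilon>)"
    using shell_integral_le[of \<kappa>] by blast
  define q where "q = (d - 1) * (\<alpha> + 2) / 2"
  have q: "d - 1 - q = - 1 - \<kappa>" by (simp add: q_def \<kappa>_def d_def field_simps)
  show thesis
  proof (rule that[of "\<omega> + d * \<omega> * C1 + 1"])
    show "\<omega> + d * \<omega> * C1 + 1 > 0" using w0 d1 C1 by (simp add: add_pos_nonneg)
    fix \<epsilon> B and f :: "real^'n \<Rightarrow> complex"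
    assume e: "0 < \<epsilon>" "\<epsilon> \<le> exp (- 1)" and B: "B \<ge> 0" and f: "f \<in> L2_space" and f1: "\<And>x. (norm (f x))\<^sup>2 \<le> B"
      and f2: "\<And>x. x \<noteq> 0 \<Longrightarrow> (norm (f x))\<^sup>2 \<le> B * norm x powr (- (real CARD('n) - 1))" and fL: "L2_sq f \<le> B / sqrt \<epsilon>"
    note [measurable] = L2_spaceD(1)[OF f]
    define \<rho> where "\<rho> = \<epsilon> powr (- 1/2)"
    have \<rho>0: "\<rho> > 0" using e by (simp add: \<rho>_def)
    let ?L = "resonance_growth \<kappa> \<epsilon>"
    have L1: "?L \<ge> 1" and L2: "?L \<ge> \<epsilon> powr (\<kappa> / 2)" using resonance_growth_ge[OF e] by auto
    have sqp: "norm z powr (\<alpha> + 2) = ((norm z)\<^sup>2) powr ((\<alpha> + 2) / 2)" for z :: complex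
    proof (cases "z = 0")
      case False
      have "((norm z)\<^sup>2) powr ((\<alpha> + 2) / 2) = (norm z powr 2) powr ((\<alpha> + 2) / 2)"
        using False by (simp add: powr_numeral)
      also have "\<dots> = norm z powr (\<alpha> + 2)" unfolding powr_powr by (simp add: add_divide_distrib)
      finally show ?thesis by simp
    qed simp
    let ?Bp = "B powr ((\<alpha> + 2) / 2)"
    \<comment> \<open>\<open>t\<close> bounds \<open>norm (f x) powr \<alpha>\<close> for all
      \<open>x\<close> outside the radius \<open>\<rho>\<close>.\<close>
    define t where "t = (B * \<rho> powr (- (d - 1))) powr (\<alpha> / 2)"
    have t0: "t \<ge> 0" by (simp add: t_def)
    define h where "h r = indicator {0..1} r + ennreal (r powr (- q)) * indicator {1..\<rho>} r" for r :: real
    have [measurable]: "h \<in> borel_measurable borel" unfolding h_def[abs_def] by measurable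
    have pt: "ennreal (norm (f x) powr (\<alpha> + 2)) \<le> ennreal ?Bp * h (norm x) + ennreal t * ennreal ((norm (f x))\<^sup>2)" for x
    proof -
      consider "norm x \<le> 1" | "1 < norm x" "norm x \<le> \<rho>" | "norm x > 1" "norm x > \<rho>" by linarith
      then show ?thesis
      proof cases
        case 1
        have "norm (f x) powr (\<alpha> + 2) \<le> ?Bp" unfolding sqp using \<alpha> by (intro powr_mono2 f1) auto
        then have "ennreal (norm (f x) powr (\<alpha> + 2)) \<le> ennreal ?Bp * 1" by (simp add: ennreal_leI)
        also have "\<dots> \<le> ennreal ?Bp * h (norm x)" using 1 by (intro mult_left_mono) (auto simp: h_def)
        finally show ?thesis by (rule order_trans) simp
      next
        case 2
        then have "x \<noteq> 0" by auto
        have "norm (f x) powr (\<alpha> + 2) \<le> (B * norm x powr (- (d - 1))) powr ((\<alpha> + 2) / 2)"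
          unfolding sqp d_def using \<alpha> by (intro powr_mono2 f2 \<open>x \<noteq> 0\<close>) auto
        also have "\<dots> = ?Bp * (norm x powr (- (d - 1))) powr ((\<alpha> + 2) / 2)" using B by (simp add: powr_mult)
        also have "(norm x powr (- (d - 1))) powr ((\<alpha> + 2) / 2) = norm x powr (- q)"
        proof -
          have "- (d - 1) * ((\<alpha> + 2) / 2) = - q" unfolding q_def by algebra
          then show ?thesis unfolding powr_powr by (simp only:)
        qed
        finally have "ennreal (norm (f x) powr (\<alpha> + 2)) \<le> ennreal ?Bp * ennreal (norm x powr (- q))"
          by (simp add: ennreal_leI flip: ennreal_mult')
        also have "\<dots> \<le> ennreal ?Bp * h (norm x)" using 2 by (intro mult_left_mono) (auto simp: h_def)
        finally show ?thesis by (rule order_trans) simp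
      next
        case 3
        then have x: "x \<noteq> 0" by auto
        have mon: "norm x powr (- (d - 1)) \<le> \<rho> powr (- (d - 1))"
          using 3 d1 \<rho>0 by (intro powr_mono2') auto
        have le: "(norm (f x))\<^sup>2 \<le> B * \<rho> powr (- (d - 1))"
          using order_trans[OF f2[OF x] mult_left_mono[OF mon[unfolded d_def] B]] unfolding d_def .
        have "norm (f x) powr (\<alpha> + 2) = ((norm (f x))\<^sup>2) powr (\<alpha> / 2) * (norm (f x))\<^sup>2"
        proof (cases "f x = 0")
          case False
          then have p: "(norm (f x))\<^sup>2 > 0" by simp
          have "(\<alpha> + 2) / 2 = \<alpha> / 2 + 1" by simp
          then show ?thesis unfolding sqp using p by (simp only: powr_add powr_one less_imp_le)
        qed simp
        also have "\<dots> \<le> t * (norm (f x))\<^sup>2"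
          unfolding t_def using \<alpha> le by (intro mult_right_mono powr_mono2) auto
        finally have "ennreal (norm (f x) powr (\<alpha> + 2)) \<le> ennreal t * ennreal ((norm (f x))\<^sup>2)"
          using t0 by (simp add: ennreal_leI flip: ennreal_mult')
        then show ?thesis by (rule order_trans) simp
      qed
    qed
    have Nh: "(\<integral>\<^sup>+x. h (norm x) \<partial>(lborel :: (real^'n) measure)) \<le> ennreal (\<omega> + d * \<omega> * (C1 * ?L))"
    proof -
      have "(\<integral>\<^sup>+x. h (norm x) \<partial>(lborel :: (real^'n) measure))
        = (\<integral>\<^sup>+x. indicator {0..1} (norm x) \<partial>(lborel :: (real^'n) measure)) + (\<integral>\<^sup>+x. ennreal (norm x powr (- q)) * indicator {1..\<rho>} (norm x) \<partial>(lborel :: (real^'n) measure))"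
        unfolding h_def by (rule nn_integral_add) measurable
      also have "(\<integral>\<^sup>+x. indicator {0..1} (norm x) \<partial>(lborel :: (real^'n) measure)) = (\<integral>\<^sup>+x. indicator (cball 0 1) x \<partial>(lborel :: (real^'n) measure))"
        by (intro nn_integral_cong) (auto simp: indicator_def)
      also have "\<dots> = ennreal \<omega>" by (simp add: emeasure_cball \<omega>_def d_def)
      also have "(\<integral>\<^sup>+x. ennreal (norm x powr (- q)) * indicator {1..\<rho>} (norm x) \<partial>(lborel :: (real^'n) measure))
        = (\<integral>\<^sup>+r. ennreal (d * \<omega> * r ^ (CARD('n) - 1)) * indicator {0..} r * (ennreal (r powr (- q)) * indicator {1..\<rho>} r) \<partial>lborel)"
        by (subst nn_integral_radial[where f="\<lambda>r. ennreal (r powr (- q)) * indicator {1..\<rho>} r"]) (simp_all add: d_def \<omega>_def)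
      also have "\<dots> = (\<integral>\<^sup>+r. ennreal (d * \<omega>) * (ennreal (r powr (- 1 - \<kappa>)) * indicator {1..\<rho>} r) \<partial>lborel)"
      proof (rule nn_integral_cong)
        fix r :: real
        show "ennreal (d * \<omega> * r ^ (CARD('n) - 1)) * indicator {0..} r * (ennreal (r powr (- q)) * indicator {1..\<rho>} r)
          = ennreal (d * \<omega>) * (ennreal (r powr (- 1 - \<kappa>)) * indicator {1..\<rho>} r)"
        proof (cases "r \<in> {1..\<rho>}")
          case True
          then have r: "r > 0" by auto
          have "r ^ (CARD('n) - 1) * r powr (- q) = r powr (d - 1) * r powr (- q)"
            using r by (simp add: powr_realpow[symmetric] d_def of_nat_diff Suc_leI)
          also have "\<dots> = r powr (- 1 - \<kappa>)" by (simp add: q[symmetric] flip: powr_add)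
          finally have "d * \<omega> * r ^ (CARD('n) - 1) * r powr (- q) = d * \<omega> * r powr (- 1 - \<kappa>)" by (simp add: mult.assoc)
          then show ?thesis using True r w0 d1 by (simp flip: ennreal_mult')
        qed simp
      qed
      also have "\<dots> = ennreal (d * \<omega>) * (\<integral>\<^sup>+r. ennreal (r powr (- 1 - \<kappa>)) * indicator {1..\<rho>} r \<partial>lborel)"
        by (rule nn_integral_cmult) measurable
      also have "\<dots> \<le> ennreal (d * \<omega>) * ennreal (C1 * ?L)"
        unfolding \<rho>_def by (intro mult_left_mono C1 e) simp
      also have "ennreal \<omega> + \<dots> = ennreal (\<omega> + d * \<omega> * (C1 * ?L))"
        using w0 d1 C1 L1 by (simp flip: ennreal_mult' ennreal_plus)
      finally show ?thesis by (simp add: add_left_mono)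
    qed
    have "(\<integral>\<^sup>+x. ennreal (norm (f x) powr (\<alpha> + 2)) \<partial>lborel) \<le> (\<integral>\<^sup>+x. ennreal ?Bp * h (norm x) + ennreal t * ennreal ((norm (f x))\<^sup>2) \<partial>lborel)"
      by (intro nn_integral_mono pt)
    also have "\<dots> = ennreal ?Bp * (\<integral>\<^sup>+x. h (norm x) \<partial>(lborel :: (real^'n) measure)) + ennreal t * (\<integral>\<^sup>+x. ennreal ((norm (f x))\<^sup>2) \<partial>lborel)"
      by (simp add: nn_integral_add nn_integral_cmult)
    also have "\<dots> \<le> ennreal ?Bp * ennreal (\<omega> + d * \<omega> * (C1 * ?L)) + ennreal t * ennreal (B / sqrt \<epsilon>)"
      using fL by (intro add_mono mult_left_mono Nh) (simp_all add: nn_integral_L2_space[OF f] L2_sq_def ennreal_leI)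
    also have "\<dots> = ennreal (?Bp * (\<omega> + d * \<omega> * (C1 * ?L)) + t * (B / sqrt \<epsilon>))"
      using w0 d1 C1 L1 t0 B e by (simp flip: ennreal_mult' ennreal_plus)
    also have "\<dots> \<le> ennreal ((\<omega> + d * \<omega> * C1 + 1) * ?Bp * ?L)"
    proof (rule ennreal_leI)
      \<comment> \<open>The exterior contributes \<open>\<epsilon>\<close> to the power
        \<open>(d - 1) * \<alpha> / 4 - 1/2 = \<kappa> / 2\<close>, which
        \<open>resonance_growth\<close> dominates in every regime.\<close>
      have "t * (B / sqrt \<epsilon>) = ?Bp * \<epsilon> powr (\<kappa> / 2)"
      proof (cases "B = 0")
        case False
        then have B': "B > 0" using B by simp
        have "- 1/2 * (- y) = y / 2" for y :: real by simp
        from this[of "d - 1"] have "\<rho> powr (- (d - 1)) = \<epsilon> powr ((d - 1) / 2)" unfolding \<rho>_def powr_powr by (simp only:)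
        then have teq: "t = B powr (\<alpha> / 2) * \<epsilon> powr ((d - 1) * \<alpha> / 4)" unfolding t_def by (simp add: powr_mult powr_powr)
        have beq: "B / sqrt \<epsilon> = B powr 1 * \<epsilon> powr (- 1/2)"
        proof -
          have "\<epsilon> powr (- 1/2) = 1 / sqrt \<epsilon>" using powr_minus_divide[of \<epsilon> "1/2"] e by (simp add: powr_half_sqrt)
          then show ?thesis using B' by simp
        qed
        have "t * (B / sqrt \<epsilon>) = (B powr (\<alpha> / 2) * B powr 1) * (\<epsilon> powr ((d - 1) * \<alpha> / 4) * \<epsilon> powr (- 1/2))"
          unfolding teq beq by (simp only: mult.assoc mult.left_commute)
        also have "\<dots> = B powr (\<alpha> / 2 + 1) * \<epsilon> powr ((d - 1) * \<alpha> / 4 + - 1/2)" by (simp only: powr_add)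
        also have "\<alpha> / 2 + 1 = (\<alpha> + 2) / 2" by simp
        also have "(d - 1) * \<alpha> / 4 + - 1/2 = \<kappa> / 2" unfolding \<kappa>_def d_def by (simp add: diff_divide_distrib)
        finally show ?thesis .
      qed (simp add: t_def)
      also have "\<dots> \<le> ?Bp * ?L" by (intro mult_left_mono L2) simp
      finally have 1: "t * (B / sqrt \<epsilon>) \<le> ?Bp * ?L" .
      have "\<omega> * 1 \<le> \<omega> * ?L" using w0 L1 by (intro mult_left_mono) auto
      then have "?Bp * (\<omega> + d * \<omega> * (C1 * ?L)) \<le> ?Bp * (\<omega> * ?L + d * \<omega> * (C1 * ?L))" by (intro mult_left_mono) auto
      then show "?Bp * (\<omega> + d * \<omega> * (C1 * ?L)) + t * (B / sqrt \<epsilon>) \<le> (\<omega> + d * \<omega> * C1 + 1) * ?Bp * ?L"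
        using 1 by (simp add: algebra_simps)
    qed
    finally show "(\<integral>\<^sup>+x. ennreal (norm (f x) powr (\<alpha> + 2)) \<partial>lborel) \<le> ennreal ((\<omega> + d * \<omega> * C1 + 1) * B powr ((\<alpha> + 2) / 2) * resonance_growth \<kappa> \<epsilon>)" .
  qed
qed

section \<open>High frequencies\<close>

text \<open>The inverse symbol decays like the fourth power, so the radial integrand is of order
  \<open>r\<close> to the power \<open>d - 5\<close>, at most
  \<open>r powr (2 * \<gamma> - 1)\<close> by the condition on \<open>\<gamma>\<close>. Positivity
  of \<open>\<gamma>\<close> gives a pure power of \<open>A\<close> also in dimensions up to
  \<open>4\<close>, where the exact exponent would be nonpositive.\<close>

lemma annulus_symbol_integral:
  fixes \<gamma> :: real
  assumes \<gamma>: "\<gamma> > 0" "(real CARD('n::finite) - 4) / 2 < \<gamma>"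
  obtains K where "K > 0" "\<And>\<epsilon> A. \<lbrakk>\<epsilon> > 0; A \<ge> 2\<rbrakk> \<Longrightarrow>
    (\<integral>\<^sup>+\<xi>. ennreal ((if 2 < norm \<xi> \<and> norm \<xi> \<le> A then 1 else 0)\<^sup>2 / symbol \<epsilon> \<xi>) \<partial>(lborel :: (real^'n) measure)) \<le> ennreal (K * A powr (2 * \<gamma>))"
proof -
  define d where "d = CARD('n)"
  have d1: "d \<ge> 1" by (simp add: d_def Suc_leI)
  define W where "W = real d * unit_ball_vol (real d)"
  have W0: "W > 0" using d1 by (simp add: W_def)
  show thesis
  proof (rule that[of "W * (16/9) / (2 * \<gamma>)"])
    show "W * (16/9) / (2 * \<gamma>) > 0" using W0 \<gamma> by simp
    fix \<epsilon> A :: real assume e: "\<epsilon> > 0" and A: "A \<ge> 2"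
    define h where "h r = ennreal (16/9 / r ^ 4) * indicator {2..A} r" for r :: real
    have [measurable]: "h \<in> borel_measurable borel" unfolding h_def[abs_def] by measurable
    have "(\<integral>\<^sup>+\<xi>. ennreal ((if 2 < norm \<xi> \<and> norm \<xi> \<le> A then 1 else 0)\<^sup>2 / symbol \<epsilon> \<xi>) \<partial>(lborel :: (real^'n) measure))
       \<le> (\<integral>\<^sup>+\<xi>. h (norm \<xi>) \<partial>(lborel :: (real^'n) measure))"
    proof (rule nn_integral_mono)
      fix \<xi> :: "real^'n"
      show "ennreal ((if 2 < norm \<xi> \<and> norm \<xi> \<le> A then 1 else 0)\<^sup>2 / symbol \<epsilon> \<xi>) \<le> h (norm \<xi>)"
      proof (cases "2 < norm \<xi> \<and> norm \<xi> \<le> A")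
        case True
        have n4: "norm \<xi> ^ 4 > 0" using True by (intro zero_less_power) auto
        have "norm \<xi> ^ 4 \<le> 16/9 * symbol \<epsilon> \<xi>" using True e by (intro high_frequency_symbol) auto
        then have "1 / symbol \<epsilon> \<xi> \<le> 16/9 / norm \<xi> ^ 4"
        proof -
          have "norm \<xi> ^ 4 / symbol \<epsilon> \<xi> \<le> 16/9"
            unfolding pos_divide_le_eq[OF symbol_pos[OF e]] by fact
          then show ?thesis unfolding pos_le_divide_eq[OF n4] by simp
        qed
        then show ?thesis using True by (simp add: h_def ennreal_leI)
      next
        case False
        show ?thesis unfolding if_not_P[OF False] by simp
      qed
    qed
    also have "\<dots> = (\<integral>\<^sup>+r. ennreal (W * r ^ (d - 1)) * indicator {0..} r * h r \<partial>lborel)"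
      by (subst nn_integral_radial) (simp_all add: W_def d_def)
    also have "\<dots> \<le> (\<integral>\<^sup>+r. ennreal (W * (16/9)) * (ennreal (r powr (2 * \<gamma> - 1)) * indicator {2..A} r) \<partial>lborel)"
    proof (rule nn_integral_mono)
      fix r :: real
      show "ennreal (W * r ^ (d - 1)) * indicator {0..} r * h r \<le> ennreal (W * (16/9)) * (ennreal (r powr (2 * \<gamma> - 1)) * indicator {2..A} r)"
      proof (cases "r \<in> {2..A}")
        case True
        then have r: "r \<ge> 2" by simp
        have "r ^ (d - 1) / r ^ 4 = r powr (real d - 1) / r powr 4"
        proof -
          have "r ^ (d - 1) = r powr real (d - 1)" using r by (intro powr_realpow[symmetric]) simp
          moreover have "real (d - 1) = real d - 1" using d1 by simp
          moreover have "r powr 4 = r ^ 4" using r by (intro powr_numeral) simp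
          ultimately show ?thesis by (simp only:)
        qed
        also have "\<dots> = r powr (real d - 1 - 4)" by (rule powr_diff[symmetric])
        also have "\<dots> \<le> r powr (2 * \<gamma> - 1)" using r \<gamma> by (intro powr_mono) (auto simp: d_def)
        finally have "W * (16/9) * (r ^ (d - 1) / r ^ 4) \<le> W * (16/9) * r powr (2 * \<gamma> - 1)"
          using W0 by (intro mult_left_mono) auto
        moreover have "W * r ^ (d - 1) * (16/9 / r ^ 4) = W * (16/9) * (r ^ (d - 1) / r ^ 4)" by simp
        ultimately have "W * r ^ (d - 1) * (16/9 / r ^ 4) \<le> W * (16/9) * r powr (2 * \<gamma> - 1)" by (simp only:)
        then show ?thesis using True W0 r by (simp add: h_def ennreal_leI flip: ennreal_mult')
      qed (simp add: h_def)
    qed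
    also have "\<dots> = ennreal (W * (16/9)) * (\<integral>\<^sup>+r. ennreal (r powr (2 * \<gamma> - 1)) * indicator {2..A} r \<partial>lborel)"
      by (rule nn_integral_cmult) measurable
    also have "(\<integral>\<^sup>+r. ennreal (r powr (2 * \<gamma> - 1)) * indicator {2..A} r \<partial>lborel) = A powr (2 * \<gamma>) / (2 * \<gamma>) - 2 powr (2 * \<gamma>) / (2 * \<gamma>)"
    proof (rule nn_integral_FTC_Icc[where F="\<lambda>r. r powr (2 * \<gamma>) / (2 * \<gamma>)"])
      fix r assume "r \<in> {2..A}"
      then have r: "r > 0" by simp
      have "((\<lambda>r. r powr (2 * \<gamma>) / (2 * \<gamma>)) has_real_derivative (2 * \<gamma> * r powr (2 * \<gamma> - 1)) / (2 * \<gamma>)) (at r)"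
        by (rule DERIV_cdivide[OF has_real_derivative_powr[OF r]])
      then show "((\<lambda>r. r powr (2 * \<gamma>) / (2 * \<gamma>)) has_real_derivative r powr (2 * \<gamma> - 1)) (at r)" using \<gamma> by simp
    qed (use A in auto)
    also have "ennreal (W * (16/9)) * ennreal (A powr (2 * \<gamma>) / (2 * \<gamma>) - 2 powr (2 * \<gamma>) / (2 * \<gamma>)) \<le> ennreal (W * (16/9)) * ennreal (A powr (2 * \<gamma>) / (2 * \<gamma>))"
      using \<gamma> by (intro mult_left_mono ennreal_leI) auto
    also have "\<dots> = ennreal (W * (16/9) / (2 * \<gamma>) * A powr (2 * \<gamma>))"
      using W0 \<gamma> by (simp flip: ennreal_mult')
    finally show "(\<integral>\<^sup>+\<xi>. ennreal ((if 2 < norm \<xi> \<and> norm \<xi> \<le> A then 1 else 0)\<^sup>2 / symbol \<epsilon> \<xi>) \<partial>(lborel :: (real^'n) measure)) \<le> ennreal (W * (16/9) / (2 * \<gamma>) * A powr (2 * \<gamma>))" .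
  qed
qed

lemma inverse_fourier_L1_diff:
  assumes "integrable lborel f" "integrable lborel g"
  shows "inverse_fourier_L1 (\<lambda>x. f x - g x) y = inverse_fourier_L1 f y - inverse_fourier_L1 (g::'a::euclidean_space \<Rightarrow> complex) y"
  unfolding inverse_fourier_L1_def by (rule fourier_L1_diff[OF assms])

text \<open>The supremum is bounded by the integral of the transform over the annulus, and that by
  Cauchy-Schwarz against the symbol. The growth in \<open>A\<close> is what limits the frequency
  cutoff at a given level.\<close>

lemma intermediate_frequency_bound:
  fixes \<gamma> :: real
  assumes \<gamma>: "\<gamma> > 0" "(real CARD('n::finite) - 4) / 2 < \<gamma>"
  obtains C where "C > 0" "\<And>\<epsilon> A (u :: real^'n \<Rightarrow> complex) x. \<lbrakk>\<epsilon> > 0; A \<ge> 2; u \<in> H2_space\<rbrakk> \<Longrightarrow>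
    norm (inverse_fourier_L1 (ball_trunc A (fourier u)) x - inverse_fourier_L1 (ball_trunc 2 (fourier u)) x) \<le> C * A powr \<gamma> * sqrt (energy \<epsilon> u)"
proof -
  obtain K where K: "K > 0" "\<And>\<epsilon> A. \<lbrakk>\<epsilon> > 0; A \<ge> 2\<rbrakk> \<Longrightarrow>
    (\<integral>\<^sup>+\<xi>. ennreal ((if 2 < norm \<xi> \<and> norm \<xi> \<le> A then 1 else 0)\<^sup>2 / symbol \<epsilon> \<xi>) \<partial>(lborel :: (real^'n) measure)) \<le> ennreal (K * A powr (2 * \<gamma>))"
    using annulus_symbol_integral[OF \<gamma>] by blast
  define c where "c = (2 * pi) powr (- real DIM(real^'n) / 2)"
  have c0: "c > 0" by (simp add: c_def)
  show thesis
  proof (rule that[of "c * sqrt K"])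
    show "c * sqrt K > 0" using c0 K by simp
    fix \<epsilon> A :: real and u :: "real^'n \<Rightarrow> complex" and x
    assume e: "\<epsilon> > 0" and A: "A \<ge> 2" and u: "u \<in> H2_space"
    note fu = fourier_in_L2[OF H2_spaceD[OF u]]
    note [measurable] = L2_spaceD(1)[OF fu]
    define g where "g \<xi> = ball_trunc A (fourier u) \<xi> - ball_trunc 2 (fourier u) \<xi>" for \<xi>
    have gi: "integrable lborel g" unfolding g_def by (intro Bochner_Integration.integrable_diff ball_trunc_integrable fu)
    have K0: "K * A powr (2 * \<gamma>) \<ge> 0" using K by simp
    have "ennreal (LINT \<xi>|lborel. norm (g \<xi>)) = (\<integral>\<^sup>+\<xi>. ennreal (norm (g \<xi>)) \<partial>lborel)"
      by (rule nn_integral_eq_integral[symmetric]) (use gi in auto)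
    also have "\<dots> = (\<integral>\<^sup>+\<xi>. ennreal ((if 2 < norm \<xi> \<and> norm \<xi> \<le> A then 1 else 0) * norm (fourier u \<xi>)) \<partial>lborel)"
      using A by (intro nn_integral_cong) (auto simp: g_def ball_trunc_def)
    also have "\<dots> \<le> ennreal (sqrt (K * A powr (2 * \<gamma>) * energy \<epsilon> u))"
      by (rule weighted_Cauchy_Schwarz[OF u e _ _ K(2)[OF e A] K0]) auto
    finally have "(LINT \<xi>|lborel. norm (g \<xi>)) \<le> sqrt (K * A powr (2 * \<gamma>) * energy \<epsilon> u)"
      by (simp only: ennreal_le_iff[OF real_sqrt_ge_zero[OF mult_nonneg_nonneg[OF K0 energy_nonneg[OF e, of u]]]])
    also have "\<dots> = sqrt K * A powr \<gamma> * sqrt (energy \<epsilon> u)"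
    proof -
      have "sqrt (A powr (2 * \<gamma>)) = A powr \<gamma>" using A by (simp add: powr_half_sqrt[symmetric] powr_powr)
      then show ?thesis by (simp add: real_sqrt_mult)
    qed
    finally have "c * (LINT \<xi>|lborel. norm (g \<xi>)) \<le> c * (sqrt K * A powr \<gamma> * sqrt (energy \<epsilon> u))"
      using c0 by (intro mult_left_mono) auto
    moreover have "inverse_fourier_L1 (ball_trunc A (fourier u)) x - inverse_fourier_L1 (ball_trunc 2 (fourier u)) x = inverse_fourier_L1 g x"
      unfolding g_def by (rule inverse_fourier_L1_diff[symmetric]) (intro ball_trunc_integrable fu)+
    moreover have "norm (inverse_fourier_L1 g x) \<le> c * (LINT \<xi>|lborel. norm (g \<xi>))"
      unfolding inverse_fourier_L1_def c_def by (rule norm_fourier_L1_le)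
    ultimately show "norm (inverse_fourier_L1 (ball_trunc A (fourier u)) x - inverse_fourier_L1 (ball_trunc 2 (fourier u)) x) \<le> c * sqrt K * A powr \<gamma> * sqrt (energy \<epsilon> u)"
      by (simp add: mult.assoc)
  qed
qed

text \<open>Below \<open>L\<close> the power \<open>t powr \<alpha>\<close> is at most
  \<open>L powr \<alpha>\<close>. Above \<open>L\<close>, the last \<open>k\<close> with
  \<open>t > L * 2 ^ k\<close> satisfies \<open>t \<le> 2 * (L * 2 ^ k)\<close>, so one term of the
  series is already large enough.\<close>

lemma dyadic_layer_cake:
  fixes t L \<alpha> :: real
  assumes t: "t \<ge> 0" and L: "L > 0" and \<alpha>: "\<alpha> > 0"
  shows "ennreal (t powr (\<alpha> + 2)) \<le> ennreal (L powr \<alpha>) * ennreal (t\<^sup>2)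
    + (\<Sum>k. ennreal ((2 * (L * 2 ^ k)) powr (\<alpha> + 2)) * (if t > L * 2 ^ k then 1 else 0))"
proof (cases "t \<le> L")
  case True
  have "t powr (\<alpha> + 2) = t powr \<alpha> * t\<^sup>2"
    using t by (cases "t = 0") (simp_all add: powr_add powr_numeral)
  also have "\<dots> \<le> L powr \<alpha> * t\<^sup>2" using True t \<alpha> by (intro mult_right_mono powr_mono2) auto
  finally have "ennreal (t powr (\<alpha> + 2)) \<le> ennreal (L powr \<alpha>) * ennreal (t\<^sup>2)"
    by (simp add: ennreal_leI flip: ennreal_mult')
  then show ?thesis by (rule order_trans) simp
next
  case False
  obtain n where n: "t / L < 2 ^ n" using real_arch_pow[of 2 "t / L"] by auto
  define m where "m = (LEAST n. t \<le> L * 2 ^ n)"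
  have ex: "t \<le> L * 2 ^ n" using n L by (simp add: field_simps)
  have m: "t \<le> L * 2 ^ m" unfolding m_def by (rule LeastI[of "\<lambda>n. t \<le> L * 2 ^ n", OF ex])
  then have "m \<noteq> 0" using False by (cases m) auto
  then obtain k where k: "m = Suc k" by (cases m) auto
  have "\<not> t \<le> L * 2 ^ k" using not_less_Least[of k "\<lambda>n. t \<le> L * 2 ^ n"] k by (simp add: m_def)
  then have gt: "t > L * 2 ^ k" by simp
  have "t powr (\<alpha> + 2) \<le> (2 * (L * 2 ^ k)) powr (\<alpha> + 2)"
    using t m \<alpha> by (intro powr_mono2) (auto simp: k mult_ac)
  then have "ennreal (t powr (\<alpha> + 2)) \<le> (\<Sum>k\<in>{k}. ennreal ((2 * (L * 2 ^ k)) powr (\<alpha> + 2)) * (if t > L * 2 ^ k then 1 else 0))"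
    using gt by (simp add: ennreal_leI)
  also have "\<dots> \<le> (\<Sum>k. ennreal ((2 * (L * 2 ^ k)) powr (\<alpha> + 2)) * (if t > L * 2 ^ k then 1 else 0))"
    by (intro sum_le_suminf) auto
  finally show ?thesis by (rule order_trans) simp
qed

text \<open>
  The level set \<open>{\<bar>w\<bar> > \<lambda>}\<close> is estimated with a frequency cutoff \<open>A\<close> for which the part of \<open>w\<close> below
  \<open>A\<close> is at most \<open>\<lambda> / 2\<close>; this replaces the Sobolev embedding theorem.
\<close>

lemma Lp_high_frequency:
  fixes \<alpha> :: real
  assumes \<alpha>: "\<alpha> > 0" and sub: "real CARD('n::finite) \<ge> 5 \<longrightarrow> \<alpha> < 8 / (real CARD('n) - 4)"
  obtains C where "C > 0" "\<And>\<epsilon> (u :: real^'n \<Rightarrow> complex). \<lbrakk>\<epsilon> > 0; u \<in> H2_space; energy \<epsilon> u > 0\<rbrakk> \<Longrightarrow>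
    (\<integral>\<^sup>+x. ennreal (norm (u x - inverse_fourier_L1 (ball_trunc 2 (fourier u)) x) powr (\<alpha> + 2)) \<partial>lborel) \<le> ennreal (C * energy \<epsilon> u powr ((\<alpha> + 2) / 2))"
proof -
  \<comment> \<open>Subcriticality enters only here: for \<open>d \<ge> 5\<close> it says
    \<open>(d - 4) / 2 < 4 / \<alpha>\<close>, which leaves room for \<open>\<gamma>\<close>. The
    lower bound is for the annulus estimate, the upper one for summing the levels.\<close>
  obtain \<gamma> where \<gamma>: "\<gamma> > 0" "(real CARD('n) - 4) / 2 < \<gamma>" "\<gamma> < 4 / \<alpha>"
  proof (cases "CARD('n) \<ge> 5")
    case True
    then have "(real CARD('n) - 4) / 2 < 4 / \<alpha>" using sub \<alpha> by (simp add: field_simps)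
    then obtain \<gamma> where "(real CARD('n) - 4) / 2 < \<gamma>" "\<gamma> < 4 / \<alpha>" using dense by blast
    moreover have "(real CARD('n) - 4) / 2 > 0" using True by simp
    ultimately show ?thesis using that[of \<gamma>] by linarith
  next
    case False
    then have "(real CARD('n) - 4) / 2 \<le> 0" by simp
    moreover have "2 / \<alpha> > 0" "2 / \<alpha> < 4 / \<alpha>" using \<alpha> by (simp_all add: divide_strict_right_mono)
    ultimately show ?thesis using that[of "2 / \<alpha>"] by linarith
  qed
  obtain C1 where C1: "C1 > 0" "\<And>\<epsilon> A (u :: real^'n \<Rightarrow> complex) x. \<lbrakk>\<epsilon> > 0; A \<ge> 2; u \<in> H2_space\<rbrakk> \<Longrightarrow>
    norm (inverse_fourier_L1 (ball_trunc A (fourier u)) x - inverse_fourier_L1 (ball_trunc 2 (fourier u)) x) \<le> C1 * A powr \<gamma> * sqrt (energy \<epsilon> u)"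
    using intermediate_frequency_bound[OF \<gamma>(1,2)] by blast
  \<comment> \<open>The ratio of consecutive layers: doubling the level costs
    \<open>2 powr \<alpha>\<close>, while the matching cutoff gains
    \<open>2 powr (- 4 / \<gamma>)\<close> from the high-frequency mass.\<close>
  define \<theta> where "\<theta> = 2 powr (\<alpha> - 4 / \<gamma>)"
  have "\<alpha> < 4 / \<gamma>" using \<gamma> \<alpha> by (simp add: field_simps)
  then have \<theta>: "0 < \<theta>" "\<theta> < 1" unfolding \<theta>_def using powr_less_mono[of "\<alpha> - 4 / \<gamma>" 0 2] by auto
  \<comment> \<open>Chosen so that the part between frequencies \<open>2\<close> and
    \<open>A k\<close> is at most half of the level \<open>L * 2 ^ k\<close> (see
    \<open>half\<close>).\<close>
  define D where "D = C1 * 2 powr (\<gamma> + 1)"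
  have D0: "D > 0" using C1 by (simp add: D_def)
  \<comment> \<open>The factor \<open>4/9\<close> is \<open>4 * (16/9) / 16\<close>: Chebyshev at
    half the level, the high-frequency mass, and \<open>2 ^ 4\<close> from \<open>A k ^ 4\<close>.
    The last factor sums the geometric series.\<close>
  define S where "S = 2 powr (\<alpha> + 2) * (4/9) * (1 / (1 - \<theta>))"
  have S0: "S > 0" using \<theta> by (simp add: S_def)
  show thesis
  proof (rule that[of "D powr \<alpha> * (1 + S)"])
    show "D powr \<alpha> * (1 + S) > 0" using D0 S0 by simp
    fix \<epsilon> and u :: "real^'n \<Rightarrow> complex" assume e: "\<epsilon> > (0::real)" and u: "u \<in> H2_space" and E: "energy \<epsilon> u > 0"
    define E where "E = energy \<epsilon> u"
    have E0: "E > 0" using \<open>energy \<epsilon> u > 0\<close> by (simp add: E_def)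
    note uL = H2_spaceD[OF u]
    note fu = fourier_in_L2[OF uL]
    define U where "U A = inverse_fourier_L1 (ball_trunc A (fourier u))" for A
    have UL: "U A \<in> L2_space" for A unfolding U_def by (intro inverse_fourier_L1_L2 ball_trunc_L2 ball_trunc_integrable fu)
    note [measurable] = L2_spaceD(1)[OF uL] L2_spaceD(1)[OF UL]
    define w where "w x = u x - U 2 x" for x
    have [measurable]: "w \<in> borel_measurable borel" unfolding w_def[abs_def] by measurable
    have tail: "(\<integral>\<^sup>+x. ennreal ((norm (u x - U A x))\<^sup>2) \<partial>lborel) \<le> ennreal (16/9 * E / A ^ 4)" if "A \<ge> 2" for A
      unfolding nn_integral_L2_space[OF L2_space_diff[OF uL UL]]
      using high_frequency_mass[OF u e that] low_pass_error[OF uL, of A]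
      by (intro ennreal_leI) (simp add: U_def L2_sq_def E_def)
    define L where "L = D * sqrt E"
    have L0: "L > 0" using D0 E0 by (simp add: L_def)
    \<comment> \<open>With this cutoff \<open>A k powr \<gamma>\<close> doubles with
      \<open>k\<close>, in step with the levels, and \<open>A k \<ge> 2\<close> always.\<close>
    define A where "A k = 2 * 2 powr (real k / \<gamma>)" for k :: nat
    have A2: "A k \<ge> 2" for k
    proof -
      have "1 \<le> 2 powr (real k / \<gamma>)" using \<gamma> by (intro ge_one_powr_ge_zero) auto
      then show ?thesis by (simp add: A_def)
    qed
    have A\<gamma>: "A k powr \<gamma> = 2 powr \<gamma> * 2 ^ k" for k
      using \<gamma> by (simp add: A_def powr_mult powr_powr powr_realpow)
    have level: "(\<integral>\<^sup>+x. (if norm (w x) > L * 2 ^ k then 1 else 0) \<partial>lborel) \<le> ennreal (4 / (L * 2 ^ k)\<^sup>2 * (16/9 * E / A k ^ 4))" for k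
    proof -
      define l where "l = L * 2 ^ k"
      have l0: "l > 0" using L0 by (simp add: l_def)
      have half: "C1 * A k powr \<gamma> * sqrt E = l / 2"
        unfolding A\<gamma> l_def L_def D_def by (simp add: powr_add)
      \<comment> \<open>Chebyshev: where \<open>w\<close> exceeds \<open>l\<close>, the intermediate
        frequencies account for at most \<open>l / 2\<close>, so the tail above \<open>A k\<close>
        is at least \<open>l / 2\<close>.\<close>
      have "(if norm (w x) > l then 1 else 0) \<le> ennreal (4 / l\<^sup>2) * ennreal ((norm (u x - U (A k) x))\<^sup>2)" for x
      proof (cases "norm (w x) > l")
        case True
        have "norm (U (A k) x - U 2 x) \<le> l / 2"
          using C1(2)[OF e A2 u, of k x] half by (simp add: U_def E_def)
        moreover have "norm (w x) \<le> norm (u x - U (A k) x) + norm (U (A k) x - U 2 x)"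
          unfolding w_def using norm_triangle_ineq[of "u x - U (A k) x" "U (A k) x - U 2 x"] by simp
        ultimately have "l / 2 \<le> norm (u x - U (A k) x)" using True by linarith
        then have "(l / 2)\<^sup>2 \<le> (norm (u x - U (A k) x))\<^sup>2" using l0 by (intro power_mono) auto
        then have "4 / l\<^sup>2 * (l / 2)\<^sup>2 \<le> 4 / l\<^sup>2 * (norm (u x - U (A k) x))\<^sup>2" by (intro mult_left_mono) auto
        then have "1 \<le> 4 / l\<^sup>2 * (norm (u x - U (A k) x))\<^sup>2" using l0 by (simp add: power_divide)
        then have "ennreal 1 \<le> ennreal (4 / l\<^sup>2 * (norm (u x - U (A k) x))\<^sup>2)" by (rule ennreal_leI)
        also have "\<dots> = ennreal (4 / l\<^sup>2) * ennreal ((norm (u x - U (A k) x))\<^sup>2)" by (rule ennreal_mult) simp_all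
        finally show ?thesis using True by simp
      qed simp
      then have "(\<integral>\<^sup>+x. (if norm (w x) > l then 1 else 0) \<partial>lborel) \<le> (\<integral>\<^sup>+x. ennreal (4 / l\<^sup>2) * ennreal ((norm (u x - U (A k) x))\<^sup>2) \<partial>lborel)"
        by (rule nn_integral_mono)
      also have "\<dots> = ennreal (4 / l\<^sup>2) * (\<integral>\<^sup>+x. ennreal ((norm (u x - U (A k) x))\<^sup>2) \<partial>lborel)"
        by (rule nn_integral_cmult) measurable
      also have "\<dots> \<le> ennreal (4 / l\<^sup>2) * ennreal (16/9 * E / A k ^ 4)"
        by (intro mult_left_mono tail A2) simp
      also have "\<dots> = ennreal (4 / l\<^sup>2 * (16/9 * E / A k ^ 4))" using E0 A2[of k] by (simp flip: ennreal_mult')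
      finally show ?thesis by (simp add: l_def)
    qed
    have term_eq: "(2 * (L * 2 ^ k)) powr (\<alpha> + 2) * (4 / (L * 2 ^ k)\<^sup>2 * (16/9 * E / A k ^ 4)) = L powr \<alpha> * E * (2 powr (\<alpha> + 2) * (4/9)) * \<theta> ^ k" for k
    proof -
      define l where "l = L * 2 ^ k"
      have l0: "l > 0" using L0 by (simp add: l_def)
      have "(2 * l) powr (\<alpha> + 2) = 2 powr (\<alpha> + 2) * (l powr \<alpha> * l\<^sup>2)" using l0 by (simp add: powr_mult powr_add powr_numeral)
      moreover have "l powr \<alpha> = L powr \<alpha> * (2 powr \<alpha>) ^ k"
      proof -
        have "(2 ^ k :: real) powr \<alpha> = (2 powr real k) powr \<alpha>" by (simp add: powr_realpow)
        also have "\<dots> = (2 powr \<alpha>) powr real k" by (simp only: powr_powr mult.commute)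
        also have "\<dots> = (2 powr \<alpha>) ^ k" by (rule powr_realpow) simp
        finally show ?thesis unfolding l_def powr_mult by simp
      qed
      moreover have "A k ^ 4 = 16 * (2 powr (4 / \<gamma>)) ^ k"
      proof -
        have "(2 powr (real k / \<gamma>)) ^ 4 = 2 powr (real k / \<gamma> * 4)" by (simp add: powr_powr flip: powr_numeral)
        also have "\<dots> = 2 powr (4 / \<gamma> * real k)" by (simp add: mult.commute)
        also have "\<dots> = (2 powr (4 / \<gamma>)) ^ k" by (simp only: powr_powr[symmetric] powr_realpow powr_gt_zero)
        finally show ?thesis by (simp add: A_def power_mult_distrib)
      qed
      moreover have "\<theta> ^ k = (2 powr \<alpha>) ^ k / (2 powr (4 / \<gamma>)) ^ k" by (simp add: \<theta>_def powr_diff power_divide)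
      ultimately have "(2 * l) powr (\<alpha> + 2) * (4 / l\<^sup>2 * (16/9 * E / A k ^ 4)) = L powr \<alpha> * E * (2 powr (\<alpha> + 2) * (4/9)) * \<theta> ^ k"
        using l0 by (simp add: field_simps)
      then show ?thesis by (simp add: l_def)
    qed
    have "(\<integral>\<^sup>+x. ennreal (norm (w x) powr (\<alpha> + 2)) \<partial>lborel)
      \<le> (\<integral>\<^sup>+x. ennreal (L powr \<alpha>) * ennreal ((norm (w x))\<^sup>2) + (\<Sum>k. ennreal ((2 * (L * 2 ^ k)) powr (\<alpha> + 2)) * (if norm (w x) > L * 2 ^ k then 1 else 0)) \<partial>lborel)"
      by (intro nn_integral_mono dyadic_layer_cake L0 \<alpha>) simp
    also have "\<dots> = ennreal (L powr \<alpha>) * (\<integral>\<^sup>+x. ennreal ((norm (w x))\<^sup>2) \<partial>lborel) + (\<Sum>k. ennreal ((2 * (L * 2 ^ k)) powr (\<alpha> + 2)) * (\<integral>\<^sup>+x. (if norm (w x) > L * 2 ^ k then 1 else 0) \<partial>lborel))"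
      by (simp add: nn_integral_add nn_integral_cmult nn_integral_suminf)
    also have "\<dots> \<le> ennreal (L powr \<alpha>) * ennreal E + ennreal (L powr \<alpha> * E * S)"
    proof (rule add_mono)
      have "(\<integral>\<^sup>+x. ennreal ((norm (w x))\<^sup>2) \<partial>lborel) \<le> ennreal (16/9 * E / 2 ^ 4)" unfolding w_def by (rule tail) simp
      also have "\<dots> \<le> ennreal E" using E0 by (intro ennreal_leI) simp
      finally show "ennreal (L powr \<alpha>) * (\<integral>\<^sup>+x. ennreal ((norm (w x))\<^sup>2) \<partial>lborel) \<le> ennreal (L powr \<alpha>) * ennreal E"
        by (rule mult_left_mono) simp
      have "(\<Sum>k. ennreal ((2 * (L * 2 ^ k)) powr (\<alpha> + 2)) * (\<integral>\<^sup>+x. (if norm (w x) > L * 2 ^ k then 1 else 0) \<partial>lborel))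
         \<le> (\<Sum>k. ennreal (L powr \<alpha> * E * (2 powr (\<alpha> + 2) * (4/9)) * \<theta> ^ k))"
      proof (intro suminf_le allI)
        fix k
        have "ennreal ((2 * (L * 2 ^ k)) powr (\<alpha> + 2)) * (\<integral>\<^sup>+x. (if norm (w x) > L * 2 ^ k then 1 else 0) \<partial>lborel)
          \<le> ennreal ((2 * (L * 2 ^ k)) powr (\<alpha> + 2)) * ennreal (4 / (L * 2 ^ k)\<^sup>2 * (16/9 * E / A k ^ 4))"
          by (rule mult_left_mono[OF level]) simp
        also have "\<dots> = ennreal (L powr \<alpha> * E * (2 powr (\<alpha> + 2) * (4/9)) * \<theta> ^ k)"
          unfolding term_eq[symmetric] by (rule ennreal_mult'[symmetric]) simp
        finally show "ennreal ((2 * (L * 2 ^ k)) powr (\<alpha> + 2)) * (\<integral>\<^sup>+x. (if norm (w x) > L * 2 ^ k then 1 else 0) \<partial>lborel) \<le> \<dots>" .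
      qed auto
      also have "\<dots> = ennreal (\<Sum>k. L powr \<alpha> * E * (2 powr (\<alpha> + 2) * (4/9)) * \<theta> ^ k)"
        by (rule suminf_ennreal_eq) (use \<theta> E0 in \<open>auto intro!: summable_sums summable_mult summable_geometric\<close>)
      also have "(\<Sum>k. L powr \<alpha> * E * (2 powr (\<alpha> + 2) * (4/9)) * \<theta> ^ k) = L powr \<alpha> * E * (2 powr (\<alpha> + 2) * (4/9)) * (1 / (1 - \<theta>))"
        using \<theta> by (subst suminf_mult) (auto simp: suminf_geometric)
      also have "\<dots> = L powr \<alpha> * E * S" by (simp only: S_def mult.assoc)
      finally show "(\<Sum>k. ennreal ((2 * (L * 2 ^ k)) powr (\<alpha> + 2)) * (\<integral>\<^sup>+x. (if norm (w x) > L * 2 ^ k then 1 else 0) \<partial>lborel)) \<le> ennreal (L powr \<alpha> * E * S)" .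
    qed
    also have "\<dots> = ennreal (L powr \<alpha> * E * (1 + S))"
      using E0 S0 by (simp add: algebra_simps flip: ennreal_mult' ennreal_plus)
    also have "L powr \<alpha> * E * (1 + S) = D powr \<alpha> * (1 + S) * E powr ((\<alpha> + 2) / 2)"
    proof -
      have "L powr \<alpha> = D powr \<alpha> * E powr (\<alpha> / 2)" unfolding L_def using E0 by (simp add: powr_mult powr_half_sqrt[symmetric] powr_powr)
      moreover have "E powr (\<alpha> / 2) * E = E powr ((\<alpha> + 2) / 2)" using E0 by (simp add: add_divide_distrib powr_add)
      ultimately show ?thesis by (simp add: mult_ac)
    qed
    finally show "(\<integral>\<^sup>+x. ennreal (norm (u x - inverse_fourier_L1 (ball_trunc 2 (fourier u)) x) powr (\<alpha> + 2)) \<partial>lborel)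
      \<le> ennreal (D powr \<alpha> * (1 + S) * energy \<epsilon> u powr ((\<alpha> + 2) / 2))"
      unfolding w_def U_def E_def .
  qed
qed

section \<open>The lower bound for the Rayleigh quotient\<close>

lemma norm_add_powr_le:
  fixes a b :: "'a::real_normed_vector"
  assumes "p \<ge> 0"
  shows "norm (a + b) powr p \<le> 2 powr p * (norm a powr p + norm b powr p)"
proof -
  have "norm (a + b) \<le> 2 * max (norm a) (norm b)"
    using norm_triangle_ineq[of a b] by (auto simp: max_def)
  then have "norm (a + b) powr p \<le> (2 * max (norm a) (norm b)) powr p"
    using assms by (intro powr_mono2) auto
  also have "\<dots> = 2 powr p * max (norm a) (norm b) powr p" by (rule powr_mult)
  also have "\<dots> \<le> 2 powr p * (norm a powr p + norm b powr p)"
    by (intro mult_left_mono) (auto simp: max_def)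
  finally show ?thesis .
qed

text \<open>The high-frequency part is harmless: it is controlled by the energy itself, while the
  low-frequency part loses the factor \<open>1 / sqrt \<epsilon> \<ge> 1\<close>.\<close>

lemma Lp_energy_bound:
  fixes \<alpha> :: real
  assumes \<alpha>: "\<alpha> > 0" and sub: "real CARD('n::finite) \<ge> 5 \<longrightarrow> \<alpha> < 8 / (real CARD('n) - 4)"
  defines "\<kappa> \<equiv> (real CARD('n) - 1) * \<alpha> / 2 - 1"
  obtains C where "C > 0" "\<And>\<epsilon> (u :: real^'n \<Rightarrow> complex). \<lbrakk>0 < \<epsilon>; \<epsilon> \<le> exp (- 1); u \<in> H2_rad; energy \<epsilon> u > 0\<rbrakk> \<Longrightarrow>
    (\<integral>\<^sup>+x. ennreal (norm (u x) powr (\<alpha> + 2)) \<partial>lborel) \<le> ennreal (C * (energy \<epsilon> u / sqrt \<epsilon>) powr ((\<alpha> + 2) / 2) * resonance_growth \<kappa> \<epsilon>)"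
proof -
  let ?p = "(\<alpha> + 2) / 2"
  obtain C1 where C1: "C1 > 0"
    "\<And>\<epsilon> (u :: real^'n \<Rightarrow> complex) x. \<lbrakk>\<epsilon> > 0; u \<in> H2_rad\<rbrakk> \<Longrightarrow>
       (norm (inverse_fourier_L1 (ball_trunc 2 (fourier u)) x))\<^sup>2 \<le> C1 * (energy \<epsilon> u / sqrt \<epsilon>)"
    "\<And>\<epsilon> (u :: real^'n \<Rightarrow> complex) x. \<lbrakk>\<epsilon> > 0; u \<in> H2_rad; x \<noteq> 0\<rbrakk> \<Longrightarrow>
       (norm (inverse_fourier_L1 (ball_trunc 2 (fourier u)) x))\<^sup>2 \<le> C1 * (energy \<epsilon> u / sqrt \<epsilon>) * norm x powr (- (real CARD('n) - 1))"
    using low_frequency_bound by blast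
  obtain C2 where C2: "C2 > 0" "\<And>\<epsilon> B (f :: real^'n \<Rightarrow> complex).
    \<lbrakk>0 < \<epsilon>; \<epsilon> \<le> exp (- 1); B \<ge> 0; f \<in> L2_space; \<And>x. (norm (f x))\<^sup>2 \<le> B;
     \<And>x. x \<noteq> 0 \<Longrightarrow> (norm (f x))\<^sup>2 \<le> B * norm x powr (- (real CARD('n) - 1)); L2_sq f \<le> B / sqrt \<epsilon>\<rbrakk> \<Longrightarrow>
    (\<integral>\<^sup>+x. ennreal (norm (f x) powr (\<alpha> + 2)) \<partial>lborel) \<le> ennreal (C2 * B powr ?p * resonance_growth \<kappa> \<epsilon>)"
    unfolding \<kappa>_def using Lp_low_frequency[OF \<alpha>, where 'n='n] by blast
  obtain C3 where C3: "C3 > 0" "\<And>\<epsilon> (u :: real^'n \<Rightarrow> complex). \<lbrakk>\<epsilon> > 0; u \<in> H2_space; energy \<epsilon> u > 0\<rbrakk> \<Longrightarrow>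
    (\<integral>\<^sup>+x. ennreal (norm (u x - inverse_fourier_L1 (ball_trunc 2 (fourier u)) x) powr (\<alpha> + 2)) \<partial>lborel) \<le> ennreal (C3 * energy \<epsilon> u powr ?p)"
    using Lp_high_frequency[OF \<alpha> sub] by blast
  \<comment> \<open>One \<open>B = M * X\<close> must dominate the pointwise bounds, which need
    \<open>C1\<close>, and the mass bound, which needs \<open>1\<close> because the mass is at most
    the energy over \<open>\<epsilon>\<close>, that is \<open>X / sqrt \<epsilon>\<close>.\<close>
  define M where "M = max C1 1"
  show thesis
  proof (rule that[of "2 powr (\<alpha> + 2) * (C3 + C2 * M powr ?p)"])
    show "2 powr (\<alpha> + 2) * (C3 + C2 * M powr ?p) > 0" using C2 C3 by (simp add: add_pos_nonneg)
    fix \<epsilon> :: real and u :: "real^'n \<Rightarrow> complex"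
    assume e: "0 < \<epsilon>" "\<epsilon> \<le> exp (- 1)" and u: "u \<in> H2_rad" and E: "energy \<epsilon> u > 0"
    have uH: "u \<in> H2_space" using u by (simp add: H2_rad_def)
    note uL = H2_spaceD[OF uH]
    note fu = fourier_in_L2[OF uL]
    define f where "f = inverse_fourier_L1 (ball_trunc 2 (fourier u))"
    have fL: "f \<in> L2_space" unfolding f_def by (intro inverse_fourier_L1_L2 ball_trunc_L2 ball_trunc_integrable fu)
    note [measurable] = L2_spaceD(1)[OF uL] L2_spaceD(1)[OF fL]
    define X where "X = energy \<epsilon> u / sqrt \<epsilon>"
    have X0: "X > 0" using E e by (simp add: X_def)
    let ?G = "resonance_growth \<kappa> \<epsilon>"
    have G1: "?G \<ge> 1" using resonance_growth_ge[OF e] by auto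
    have MX: "C1 * X \<le> M * X" "X \<le> M * X" using X0 by (simp_all add: M_def mult_right_mono)
    have low: "(\<integral>\<^sup>+x. ennreal (norm (f x) powr (\<alpha> + 2)) \<partial>lborel) \<le> ennreal (C2 * (M * X) powr ?p * ?G)"
    proof (rule C2(2)[OF e _ fL])
      show "M * X \<ge> 0" using X0 MX by linarith
      show "(norm (f x))\<^sup>2 \<le> M * X" for x
        using C1(2)[OF e(1) u, of x] MX unfolding f_def X_def by linarith
      show "(norm (f x))\<^sup>2 \<le> M * X * norm x powr (- (real CARD('n) - 1))" if "x \<noteq> 0" for x
        using order_trans[OF C1(3)[OF e(1) u that] mult_right_mono[OF MX(1)[unfolded X_def] powr_ge_zero]] unfolding f_def X_def .
      have "L2_sq f = L2_sq (ball_trunc 2 (fourier u))"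
        unfolding f_def by (intro inverse_fourier_L1_L2 ball_trunc_L2 ball_trunc_integrable fu)
      also have "\<dots> \<le> L2_sq (fourier u)"
        by (intro L2_sq_mono ball_trunc_L2 fu) (simp add: ball_trunc_def)
      also have "\<dots> = L2_sq u" by (rule plancherel_L2[OF uL])
      also have "\<dots> \<le> X / sqrt \<epsilon>"
      proof -
        have "X / sqrt \<epsilon> = energy \<epsilon> u / \<epsilon>" using e by (simp add: X_def)
        then show ?thesis using energy_ge_L2_sq[OF uH e(1)] e by (simp add: pos_le_divide_eq mult.commute)
      qed
      also have "\<dots> \<le> M * X / sqrt \<epsilon>" using MX e by (intro divide_right_mono) auto
      finally show "L2_sq f \<le> M * X / sqrt \<epsilon>" .
    qed
    have "energy \<epsilon> u \<le> X"
    proof -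
      have "\<epsilon> \<le> 1" using e exp_minus_1_le by linarith
      then have "sqrt \<epsilon> \<le> 1" by simp
      then show ?thesis using E e by (simp add: X_def pos_le_divide_eq mult_left_le)
    qed
    then have "C3 * energy \<epsilon> u powr ?p \<le> C3 * (X powr ?p * ?G)"
    proof (intro mult_left_mono)
      assume "energy \<epsilon> u \<le> X"
      then have "energy \<epsilon> u powr ?p \<le> X powr ?p" using E \<alpha> by (intro powr_mono2) auto
      also have "\<dots> = X powr ?p * 1" by simp
      also have "\<dots> \<le> X powr ?p * ?G" using G1 by (intro mult_left_mono) auto
      finally show "energy \<epsilon> u powr ?p \<le> X powr ?p * ?G" .
    qed (use C3 in auto)
    then have high: "(\<integral>\<^sup>+x. ennreal (norm (u x - f x) powr (\<alpha> + 2)) \<partial>lborel) \<le> ennreal (C3 * (X powr ?p * ?G))"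
      unfolding f_def by (intro order_trans[OF C3(2)[OF e(1) uH E]] ennreal_leI)
    have "(\<integral>\<^sup>+x. ennreal (norm (u x) powr (\<alpha> + 2)) \<partial>lborel)
      \<le> (\<integral>\<^sup>+x. ennreal (2 powr (\<alpha> + 2)) * (ennreal (norm (u x - f x) powr (\<alpha> + 2)) + ennreal (norm (f x) powr (\<alpha> + 2))) \<partial>lborel)"
    proof (rule nn_integral_mono)
      fix x
      have "ennreal (norm (u x) powr (\<alpha> + 2)) \<le> ennreal (2 powr (\<alpha> + 2) * (norm (u x - f x) powr (\<alpha> + 2) + norm (f x) powr (\<alpha> + 2)))"
        using norm_add_powr_le[of "\<alpha> + 2" "u x - f x" "f x"] \<alpha> by (intro ennreal_leI) simp
      also have "\<dots> = ennreal (2 powr (\<alpha> + 2)) * (ennreal (norm (u x - f x) powr (\<alpha> + 2)) + ennreal (norm (f x) powr (\<alpha> + 2)))"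
        by (subst ennreal_mult) auto
      finally show "ennreal (norm (u x) powr (\<alpha> + 2)) \<le> \<dots>" .
    qed
    also have "\<dots> = ennreal (2 powr (\<alpha> + 2)) * ((\<integral>\<^sup>+x. ennreal (norm (u x - f x) powr (\<alpha> + 2)) \<partial>lborel) + (\<integral>\<^sup>+x. ennreal (norm (f x) powr (\<alpha> + 2)) \<partial>lborel))"
      by (simp add: nn_integral_cmult nn_integral_add)
    also have "\<dots> \<le> ennreal (2 powr (\<alpha> + 2)) * (ennreal (C3 * (X powr ?p * ?G)) + ennreal (C2 * (M * X) powr ?p * ?G))"
      by (intro mult_left_mono add_mono high low) simp
    also have "\<dots> = ennreal (2 powr (\<alpha> + 2) * (C3 * (X powr ?p * ?G) + C2 * (M * X) powr ?p * ?G))"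
    proof -
      have a: "C3 * (X powr ?p * ?G) \<ge> 0" "C2 * (M * X) powr ?p * ?G \<ge> 0" using C2 C3 G1 by auto
      show ?thesis unfolding ennreal_plus[OF a, symmetric] by (rule ennreal_mult[symmetric]) (use a in auto)
    qed
    also have "2 powr (\<alpha> + 2) * (C3 * (X powr ?p * ?G) + C2 * (M * X) powr ?p * ?G) = 2 powr (\<alpha> + 2) * (C3 + C2 * M powr ?p) * X powr ?p * ?G"
      unfolding powr_mult by (simp only: distrib_left distrib_right mult.assoc)
    finally show "(\<integral>\<^sup>+x. ennreal (norm (u x) powr (\<alpha> + 2)) \<partial>lborel) \<le> ennreal (2 powr (\<alpha> + 2) * (C3 + C2 * M powr ?p) * (energy \<epsilon> u / sqrt \<epsilon>) powr ?p * ?G)"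
      by (simp only: X_def)
  qed
qed

lemma rayleigh_quotient_energy: "rayleigh_quotient \<alpha> \<epsilon> u = energy \<epsilon> u / (Lp_norm (\<alpha> + 2) u)\<^sup>2"
  by (simp add: rayleigh_quotient_def energy_def symbol_def)

lemma L2_sq_pos:
  assumes "u \<in> L2_space" "\<not> (AE x in lborel. u x = 0)"
  shows "L2_sq u > 0"
  using L2_sq_eq_0[OF assms(1)] assms(2) L2_sq_nonneg[of u] by linarith

lemma energy_pos:
  assumes u: "u \<in> H2_space" and nz: "\<not> (AE x in lborel. u x = 0)" and e: "\<epsilon> > 0"
  shows "energy \<epsilon> u > 0"
  using energy_ge_L2_sq[OF u e] mult_pos_pos[OF e L2_sq_pos[OF H2_spaceD[OF u] nz]] by linarith

lemma Lp_norm_power2: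
  "(Lp_norm (\<alpha> + 2) u)\<^sup>2 = (LINT x|lborel. norm (u x) powr (\<alpha> + 2)) powr (2 / (\<alpha> + 2))"
proof -
  have "(Lp_norm (\<alpha> + 2) u)\<^sup>2 = Lp_norm (\<alpha> + 2) u * Lp_norm (\<alpha> + 2) u" by (rule power2_eq_square)
  then show ?thesis unfolding Lp_norm_def by (simp flip: powr_add)
qed

text \<open>The integral in the denominator must be finite, as a divergent integral would make it \<open>0\<close>.\<close>

lemma rayleigh_quotient_lower:
  fixes \<alpha> :: real
  assumes \<alpha>: "\<alpha> > 0" and sub: "real CARD('n::finite) \<ge> 5 \<longrightarrow> \<alpha> < 8 / (real CARD('n) - 4)"
  defines "\<kappa> \<equiv> (real CARD('n) - 1) * \<alpha> / 2 - 1"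
  obtains c where "c > 0" "\<And>\<epsilon> (u :: real^'n \<Rightarrow> complex). \<lbrakk>0 < \<epsilon>; \<epsilon> \<le> exp (- 1); u \<in> H2_rad; \<not> (AE x in lborel. u x = 0)\<rbrakk> \<Longrightarrow>
    integrable lborel (\<lambda>x. norm (u x) powr (\<alpha> + 2)) \<and>
    c * (sqrt \<epsilon> * resonance_growth \<kappa> \<epsilon> powr (- (2 / (\<alpha> + 2)))) \<le> rayleigh_quotient \<alpha> \<epsilon> u"
proof -
  obtain C where C: "C > 0" "\<And>\<epsilon> (u :: real^'n \<Rightarrow> complex). \<lbrakk>0 < \<epsilon>; \<epsilon> \<le> exp (- 1); u \<in> H2_rad; energy \<epsilon> u > 0\<rbrakk> \<Longrightarrow>
    (\<integral>\<^sup>+x. ennreal (norm (u x) powr (\<alpha> + 2)) \<partial>lborel) \<le> ennreal (C * (energy \<epsilon> u / sqrt \<epsilon>) powr ((\<alpha> + 2) / 2) * resonance_growth \<kappa> \<epsilon>)"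
    unfolding \<kappa>_def using Lp_energy_bound[OF \<alpha> sub] by blast
  let ?q = "2 / (\<alpha> + 2)"
  show thesis
  proof (rule that[of "C powr (- ?q)"])
    show "C powr (- ?q) > 0" using C by simp
    fix \<epsilon> :: real and u :: "real^'n \<Rightarrow> complex"
    assume e: "0 < \<epsilon>" "\<epsilon> \<le> exp (- 1)" and u: "u \<in> H2_rad" and nz: "\<not> (AE x in lborel. u x = 0)"
    have uH: "u \<in> H2_space" using u by (simp add: H2_rad_def)
    note [measurable] = L2_spaceD(1)[OF H2_spaceD[OF uH]]
    have E: "energy \<epsilon> u > 0" by (rule energy_pos[OF uH nz e(1)])
    let ?G = "resonance_growth \<kappa> \<epsilon>"
    have G1: "?G \<ge> 1" using resonance_growth_ge[OF e] by auto
    define X where "X = energy \<epsilon> u / sqrt \<epsilon>"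
    have X0: "X > 0" using E e by (simp add: X_def)
    define I where "I = (LINT x|lborel. norm (u x) powr (\<alpha> + 2))"
    note B = C(2)[OF e u E, folded X_def]
    have int: "integrable lborel (\<lambda>x. norm (u x) powr (\<alpha> + 2))"
      by (rule integrableI_nonneg) (use le_less_trans[OF B ennreal_less_top] in auto)
    have "ennreal I \<le> ennreal (C * X powr ((\<alpha> + 2) / 2) * ?G)"
      using B nn_integral_eq_integral[OF int] by (simp add: I_def)
    then have IB: "I \<le> C * X powr ((\<alpha> + 2) / 2) * ?G" using C X0 G1 by (subst (asm) ennreal_le_iff) auto
    have "I \<noteq> 0"
    proof
      assume "I = 0"
      then have "AE x in lborel. norm (u x) powr (\<alpha> + 2) = 0"
        using integral_nonneg_eq_0_iff_AE[OF int] by (simp add: I_def)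
      then show False using nz by simp
    qed
    moreover have "I \<ge> 0" by (simp add: I_def)
    ultimately have I0: "I > 0" by simp
    have "I powr ?q \<le> (C * X powr ((\<alpha> + 2) / 2) * ?G) powr ?q" using IB I0 \<alpha> by (intro powr_mono2) auto
    also have "\<dots> = C powr ?q * X * ?G powr ?q"
    proof -
      have q1: "(\<alpha> + 2) / 2 * ?q = 1" using \<alpha> by simp
      show ?thesis unfolding powr_mult powr_powr q1 using X0 by simp
    qed
    finally have "I powr ?q \<le> C powr ?q * X * ?G powr ?q" .
    then have "C powr (- ?q) * ?G powr (- ?q) * I powr ?q \<le> C powr (- ?q) * ?G powr (- ?q) * (C powr ?q * X * ?G powr ?q)"
      by (intro mult_left_mono) auto
    also have "\<dots> = X * (C powr (- ?q) * C powr ?q) * (?G powr (- ?q) * ?G powr ?q)" by (simp only: mult_ac)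
    also have "\<dots> = X" using C G1 by (simp flip: powr_add)
    finally have "sqrt \<epsilon> * (C powr (- ?q) * ?G powr (- ?q) * I powr ?q) \<le> sqrt \<epsilon> * X" using e by (intro mult_left_mono) auto
    also have "\<dots> = energy \<epsilon> u" using e by (simp add: X_def)
    finally have "C powr (- ?q) * (sqrt \<epsilon> * ?G powr (- ?q)) * I powr ?q \<le> energy \<epsilon> u" by (simp only: mult_ac)
    then have "C powr (- ?q) * (sqrt \<epsilon> * ?G powr (- ?q)) \<le> rayleigh_quotient \<alpha> \<epsilon> u"
      unfolding rayleigh_quotient_energy Lp_norm_power2 I_def[symmetric] using I0 by (subst pos_le_divide_eq) auto
    with int show "integrable lborel (\<lambda>x. norm (u x) powr (\<alpha> + 2)) \<and>
      C powr (- ?q) * (sqrt \<epsilon> * ?G powr (- ?q)) \<le> rayleigh_quotient \<alpha> \<epsilon> u" ..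
  qed
qed

section \<open>The test function\<close>

lemma power_diff_le:
  fixes a b :: real
  assumes "0 \<le> b" "b \<le> a" "a \<le> 2"
  shows "a ^ n - b ^ n \<le> real n * 2 ^ n * (a - b)"
proof (induction n)
  case (Suc n)
  have ab: "a - b \<ge> 0" using assms by simp
  have "b ^ n \<le> a ^ n" using assms by (intro power_mono) auto
  then have d0: "a ^ n - b ^ n \<ge> 0" by simp
  have "b ^ n \<le> 2 ^ n" using assms by (intro power_mono) auto
  have "a ^ Suc n - b ^ Suc n = a * (a ^ n - b ^ n) + (a - b) * b ^ n" by (simp add: algebra_simps)
  also have "a * (a ^ n - b ^ n) \<le> 2 * (real n * 2 ^ n * (a - b))" using assms d0 Suc by (intro mult_mono) auto
  also have "(a - b) * b ^ n \<le> (a - b) * (2 * 2 ^ n)"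
  proof (rule mult_left_mono[OF _ ab])
    have "(2::real) ^ n \<le> 2 * 2 ^ n" by simp
    with \<open>b ^ n \<le> 2 ^ n\<close> show "b ^ n \<le> 2 * 2 ^ n" by (rule order_trans)
  qed
  finally have "a ^ Suc n - b ^ Suc n \<le> 2 * (real n * 2 ^ n * (a - b)) + (a - b) * (2 * 2 ^ n)" by simp
  also have "\<dots> = real (Suc n) * 2 ^ Suc n * (a - b)" by (simp add: algebra_simps)
  finally show ?case .
qed simp

lemma power_diff_ge:
  fixes \<delta> :: real
  assumes "0 \<le> \<delta>" "\<delta> \<le> 1" "n \<ge> 1"
  shows "2 * \<delta> \<le> (1 + \<delta>) ^ n - (1 - \<delta>) ^ n"
proof -
  have "(1 + \<delta>) ^ 1 \<le> (1 + \<delta>) ^ n" using assms by (intro power_increasing) auto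
  moreover have "(1 - \<delta>) ^ n \<le> (1 - \<delta>) ^ 1" using assms by (intro power_decreasing) auto
  ultimately show ?thesis by simp
qed

text \<open>A cap of the unit sphere, encoded as the solid cone over it so that Lebesgue measure can
  weigh it.\<close>

definition dir_cone :: "real^'n \<Rightarrow> real \<Rightarrow> (real^'n) set" where
  "dir_cone e s = {\<eta>. norm (sgn \<eta> - e) \<le> s}"

lemma dir_cone_measurable [measurable]: "dir_cone e s \<in> sets borel"
  unfolding dir_cone_def by measurable

lemma sgn_scaleR_pos: "t > 0 \<Longrightarrow> sgn (t *\<^sub>R y) = sgn (y::'a::real_normed_vector)"
  by (simp add: sgn_div_norm)

lemma emeasure_dir_cone_cball:
  fixes e :: "real^'n"
  assumes t: "t > 0"
  shows "emeasure lborel (dir_cone e s \<inter> cball 0 t) = ennreal (t ^ CARD('n) * measure lborel (dir_cone e s \<inter> cball 0 1))"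
proof -
  let ?S = "\<lambda>t. dir_cone e s \<inter> cball 0 t"
  have S[measurable]: "?S t \<in> sets borel" for t by (intro sets.Int) auto
  have fin: "emeasure lborel (?S 1) = ennreal (measure lborel (?S 1))"
  proof (rule emeasure_eq_ennreal_measure)
    have "emeasure lborel (?S 1) \<le> emeasure lborel (cball (0::real^'n) 1)" by (intro emeasure_mono) auto
    also have "\<dots> < \<infinity>" by (intro emeasure_bounded_finite) simp
    finally show "emeasure lborel (?S 1) \<noteq> top" by simp
  qed
  have "emeasure lborel (?S t) = (\<integral>\<^sup>+z. indicator (?S t) z \<partial>lborel)" by simp
  also have "\<dots> = (\<integral>\<^sup>+y. ennreal (\<bar>t\<bar> ^ DIM(real^'n)) * indicator (?S t) (t *\<^sub>R y) \<partial>lborel)"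
    using t by (intro nn_integral_lborel_scale borel_measurable_indicator S) auto
  also have "\<dots> = (\<integral>\<^sup>+y. ennreal (t ^ CARD('n)) * indicator (?S 1) y \<partial>lborel)"
  proof (rule nn_integral_cong)
    fix y :: "real^'n"
    have "t *\<^sub>R y \<in> ?S t \<longleftrightarrow> y \<in> ?S 1"
      using t by (simp add: dir_cone_def sgn_scaleR_pos mult_le_cancel_left1 mult_le_cancel_left2)
    then show "ennreal (\<bar>t\<bar> ^ DIM(real^'n)) * indicator (?S t) (t *\<^sub>R y) = ennreal (t ^ CARD('n)) * indicator (?S 1) y"
      using t by (simp add: indicator_def)
  qed
  also have "\<dots> = ennreal (t ^ CARD('n)) * emeasure lborel (?S 1)"
    by (subst nn_integral_cmult) auto
  finally show ?thesis using t by (simp add: fin ennreal_mult)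
qed

lemma emeasure_dir_cone_shell:
  fixes e :: "real^'n"
  assumes "0 < \<sigma>" "\<sigma> < 1"
  shows "emeasure lborel (dir_cone e s \<inter> cball 0 (1 + \<sigma>) - dir_cone e s \<inter> cball 0 (1 - \<sigma>))
    = ennreal (((1 + \<sigma>) ^ CARD('n) - (1 - \<sigma>) ^ CARD('n)) * measure lborel (dir_cone e s \<inter> cball 0 1))"
proof -
  have "emeasure lborel (dir_cone e s \<inter> cball 0 (1 + \<sigma>) - dir_cone e s \<inter> cball 0 (1 - \<sigma>))
    = emeasure lborel (dir_cone e s \<inter> cball 0 (1 + \<sigma>)) - emeasure lborel (dir_cone e s \<inter> cball 0 (1 - \<sigma>))"
    using assms by (intro emeasure_Diff) (auto simp: emeasure_dir_cone_cball)
  also have "\<dots> = ennreal ((1 + \<sigma>) ^ CARD('n) * measure lborel (dir_cone e s \<inter> cball 0 1) - (1 - \<sigma>) ^ CARD('n) * measure lborel (dir_cone e s \<inter> cball 0 1))"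
    using assms by (simp add: emeasure_dir_cone_cball ennreal_minus)
  finally show ?thesis by (simp add: left_diff_distrib)
qed

text \<open>
  A ball of radius \<open>s / 4\<close> about \<open>e\<close> lies in the part of the cone of aperture \<open>s\<close> within a shell of
  thickness \<open>s / 2\<close>; homogeneity of the cone then gives its volume in shells of any thickness.
\<close>

lemma dir_cone_mass:
  obtains c where "c > 0" "\<And>e s. norm (e::real^'n) = 1 \<Longrightarrow> 0 < s \<Longrightarrow> s \<le> 1 \<Longrightarrow>
    c * s ^ (CARD('n) - 1) \<le> measure lborel (dir_cone e s \<inter> cball 0 1)"
proof -
  define d where "d = CARD('n)"
  have d1: "d \<ge> 1" by (simp add: d_def Suc_leI)
  define \<omega> where "\<omega> = unit_ball_vol (real d)"
  have w0: "\<omega> > 0" by (simp add: \<omega>_def)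
  show thesis
  proof (rule that[of "\<omega> / (4 ^ (d - 1) * (real d * 2 ^ d * 2))"])
    show "\<omega> / (4 ^ (d - 1) * (real d * 2 ^ d * 2)) > 0" using w0 d1 by simp
    fix e :: "real^'n" and s :: real assume e: "norm e = 1" and s: "0 < s" "s \<le> 1"
    define \<sigma> where "\<sigma> = s / 4"
    have \<sigma>: "0 < \<sigma>" "\<sigma> \<le> 1/4" using s by (simp_all add: \<sigma>_def)
    define m where "m = measure lborel (dir_cone e s \<inter> cball 0 1)"
    have m0: "m \<ge> 0" by (simp add: m_def)
    have sub: "ball e \<sigma> \<subseteq> dir_cone e s \<inter> cball 0 (1 + \<sigma>) - dir_cone e s \<inter> cball 0 (1 - \<sigma>)"
    proof
      fix \<eta> assume "\<eta> \<in> ball e \<sigma>"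
      then have n: "norm (\<eta> - e) < \<sigma>" by (simp add: dist_norm norm_minus_commute)
      have n1: "\<bar>norm \<eta> - 1\<bar> < \<sigma>" using norm_triangle_ineq3[of \<eta> e] n e by linarith
      then have nz: "\<eta> \<noteq> 0" using \<sigma> by auto
      have "sgn \<eta> - \<eta> = (1 - norm \<eta>) *\<^sub>R sgn \<eta>" using nz by (simp add: sgn_div_norm algebra_simps)
      then have "norm (sgn \<eta> - \<eta>) = \<bar>1 - norm \<eta>\<bar>" using nz by (simp add: norm_sgn)
      then have "norm (sgn \<eta> - e) \<le> \<sigma> + \<sigma>"
        using norm_triangle_ineq[of "sgn \<eta> - \<eta>" "\<eta> - e"] n n1 by simp
      also have "\<dots> \<le> s" using s by (simp add: \<sigma>_def)
      finally show "\<eta> \<in> dir_cone e s \<inter> cball 0 (1 + \<sigma>) - dir_cone e s \<inter> cball 0 (1 - \<sigma>)"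
        using n1 by (auto simp: dir_cone_def)
    qed
    have "ennreal (\<omega> * \<sigma> ^ d) = emeasure lborel (ball e \<sigma>)" using \<sigma> by (simp add: emeasure_ball \<omega>_def d_def)
    also have "\<dots> \<le> emeasure lborel (dir_cone e s \<inter> cball 0 (1 + \<sigma>) - dir_cone e s \<inter> cball 0 (1 - \<sigma>))"
      by (intro emeasure_mono sub) auto
    also have "\<dots> = ennreal (((1 + \<sigma>) ^ d - (1 - \<sigma>) ^ d) * m)"
      unfolding d_def m_def using \<sigma> by (intro emeasure_dir_cone_shell) auto
    finally have "ennreal (\<omega> * \<sigma> ^ d) \<le> ennreal (((1 + \<sigma>) ^ d - (1 - \<sigma>) ^ d) * m)" .
    moreover have "(1 - \<sigma>) ^ d \<le> (1 + \<sigma>) ^ d" using \<sigma> by (intro power_mono) auto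
    ultimately have "\<omega> * \<sigma> ^ d \<le> ((1 + \<sigma>) ^ d - (1 - \<sigma>) ^ d) * m"
      using m0 by (subst (asm) ennreal_le_iff) auto
    also have "\<dots> \<le> (real d * 2 ^ d * (2 * \<sigma>)) * m"
      using power_diff_le[of "1 - \<sigma>" "1 + \<sigma>" d] \<sigma> m0 by (intro mult_right_mono) auto
    \<comment> \<open>The small ball has volume of order \<open>\<sigma> ^ d\<close> and the shell
      has thickness of order \<open>\<sigma>\<close>; cancelling one factor leaves the power
      \<open>d - 1\<close> of a cap.\<close>
    finally have "\<sigma> * (\<omega> * \<sigma> ^ (d - 1)) \<le> \<sigma> * ((real d * 2 ^ d * 2) * m)"
      using d1 by (cases d) (auto simp: mult_ac)
    then have "\<omega> * \<sigma> ^ (d - 1) \<le> (real d * 2 ^ d * 2) * m" using \<sigma> by (simp only: mult_le_cancel_left_pos)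
    then have "\<omega> * s ^ (d - 1) / 4 ^ (d - 1) \<le> (real d * 2 ^ d * 2) * m" by (simp add: \<sigma>_def power_divide)
    then have "\<omega> * s ^ (d - 1) / 4 ^ (d - 1) / (real d * 2 ^ d * 2) \<le> m"
      using d1 by (subst pos_divide_le_eq) (auto simp: mult_ac)
    then show "\<omega> / (4 ^ (d - 1) * (real d * 2 ^ d * 2)) * s ^ (CARD('n) - 1) \<le> measure lborel (dir_cone e s \<inter> cball 0 1)"
      by (simp add: m_def d_def)
  qed
qed

definition unit_shell :: "real \<Rightarrow> (real^'n) set" where
  "unit_shell \<delta> = {\<xi>. \<bar>norm \<xi> - 1\<bar> \<le> \<delta>}"

lemma unit_shell_measurable [measurable]: "unit_shell \<delta> \<in> sets borel"
  unfolding unit_shell_def by measurable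

text \<open>A point of the shell in the cone of aperture \<open>s\<close> around the direction of
  \<open>x\<close> is within \<open>4 * s\<close> of \<open>x\<close>: at most \<open>2 * s\<close>
  along the sphere, as its norm is at most \<open>2\<close>, and at most
  \<open>2 * \<delta> \<le> 2 * s\<close> radially.\<close>

lemma unit_shell_cap_cball:
  obtains c where "c > 0" "\<And>\<delta> s (x::real^'n). \<lbrakk>0 < \<delta>; \<delta> \<le> 1/2; \<delta> \<le> s; s \<le> 1; x \<in> unit_shell \<delta>\<rbrakk> \<Longrightarrow>
    ennreal (c * \<delta> * s ^ (CARD('n) - 1)) \<le> emeasure lborel (unit_shell \<delta> \<inter> cball x (4 * s))"
proof -
  obtain c where c: "c > 0" "\<And>e s. norm (e::real^'n) = 1 \<Longrightarrow> 0 < s \<Longrightarrow> s \<le> 1 \<Longrightarrow>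
    c * s ^ (CARD('n) - 1) \<le> measure lborel (dir_cone e s \<inter> cball 0 1)"
    using dir_cone_mass by blast
  show thesis
  proof (rule that[of "2 * c"])
    show "2 * c > 0" using c by simp
    fix \<delta> s :: real and x :: "real^'n"
    assume \<delta>: "0 < \<delta>" "\<delta> \<le> 1/2" and s: "\<delta> \<le> s" "s \<le> 1" and x: "x \<in> unit_shell \<delta>"
    have xn: "\<bar>norm x - 1\<bar> \<le> \<delta>" using x by (simp add: unit_shell_def)
    then have x0: "x \<noteq> 0" using \<delta> by auto
    define e where "e = sgn x"
    have e: "norm e = 1" "x = norm x *\<^sub>R e" using x0 by (simp_all add: e_def norm_sgn sgn_div_norm)
    have sub: "dir_cone e s \<inter> cball 0 (1 + \<delta>) - dir_cone e s \<inter> cball 0 (1 - \<delta>) \<subseteq> unit_shell \<delta> \<inter> cball x (4 * s)"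
    proof
      fix \<eta> assume "\<eta> \<in> dir_cone e s \<inter> cball 0 (1 + \<delta>) - dir_cone e s \<inter> cball 0 (1 - \<delta>)"
      then have h: "norm (sgn \<eta> - e) \<le> s" "norm \<eta> \<le> 1 + \<delta>" "norm \<eta> > 1 - \<delta>" by (auto simp: dir_cone_def)
      then have "\<eta> \<noteq> 0" using \<delta> by auto
      have "\<eta> = norm \<eta> *\<^sub>R sgn \<eta>" using \<open>\<eta> \<noteq> 0\<close> by (simp add: sgn_div_norm)
      then have "\<eta> - x = norm \<eta> *\<^sub>R (sgn \<eta> - e) + (norm \<eta> - norm x) *\<^sub>R e"
        using e(2) by (metis (no_types, lifting) add_diff_eq diff_add_cancel scaleR_diff_left scaleR_diff_right)
      then have "norm (\<eta> - x) \<le> norm \<eta> * norm (sgn \<eta> - e) + \<bar>norm \<eta> - norm x\<bar>"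
        using norm_triangle_ineq[of "norm \<eta> *\<^sub>R (sgn \<eta> - e)" "(norm \<eta> - norm x) *\<^sub>R e"] e(1) by simp
      also have "norm \<eta> * norm (sgn \<eta> - e) \<le> 2 * s" using h \<delta> by (intro mult_mono) auto
      also have "\<bar>norm \<eta> - norm x\<bar> \<le> 2 * s" using h xn s by linarith
      finally have "norm (\<eta> - x) \<le> 4 * s" by simp
      then show "\<eta> \<in> unit_shell \<delta> \<inter> cball x (4 * s)" using h by (auto simp: unit_shell_def dist_norm norm_minus_commute)
    qed
    have m: "c * s ^ (CARD('n) - 1) \<le> measure lborel (dir_cone e s \<inter> cball 0 1)" using \<delta> s by (intro c e) auto
    have "2 * c * \<delta> * s ^ (CARD('n) - 1) = 2 * \<delta> * (c * s ^ (CARD('n) - 1))" by simp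
    also have "\<dots> \<le> ((1 + \<delta>) ^ CARD('n) - (1 - \<delta>) ^ CARD('n)) * measure lborel (dir_cone e s \<inter> cball 0 1)"
      using \<delta> s c by (intro mult_mono m power_diff_ge) (auto simp: Suc_leI power_mono)
    finally have "ennreal (2 * c * \<delta> * s ^ (CARD('n) - 1)) \<le> emeasure lborel (dir_cone e s \<inter> cball 0 (1 + \<delta>) - dir_cone e s \<inter> cball 0 (1 - \<delta>))"
      using \<delta> by (subst emeasure_dir_cone_shell) (auto intro!: ennreal_leI)
    also have "\<dots> \<le> emeasure lborel (unit_shell \<delta> \<inter> cball x (4 * s))" by (intro emeasure_mono sub) auto
    finally show "ennreal (2 * c * \<delta> * s ^ (CARD('n) - 1)) \<le> emeasure lborel (unit_shell \<delta> \<inter> cball x (4 * s))" .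
  qed
qed

lemma emeasure_unit_shell:
  assumes \<delta>: "0 < \<delta>" "\<delta> \<le> 1/2"
  shows emeasure_unit_shell_ge: "ennreal (2 * \<delta> * unit_ball_vol (real CARD('n))) \<le> emeasure lborel (unit_shell \<delta> :: (real^'n) set)"
    and emeasure_unit_shell_le: "emeasure lborel (unit_shell \<delta> :: (real^'n) set) \<le> ennreal (real CARD('n) * unit_ball_vol (real CARD('n)) * 2 ^ CARD('n) * 2 * \<delta>)"
proof -
  let ?d = "CARD('n)"
  have d1: "?d \<ge> 1" by (simp add: Suc_leI)
  let ?\<omega> = "unit_ball_vol (real ?d)"
  have w0: "?\<omega> > 0" by simp
  have "2 * \<delta> * ?\<omega> \<le> ((1 + \<delta>) ^ ?d - (1 - \<delta>) ^ ?d) * ?\<omega>"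
    using \<delta> d1 by (intro mult_right_mono power_diff_ge) auto
  also have "\<dots> = ?\<omega> * (1 + \<delta>) ^ ?d - ?\<omega> * (1 - \<delta>) ^ ?d" by (simp add: algebra_simps)
  finally have "ennreal (2 * \<delta> * ?\<omega>) \<le> ennreal (?\<omega> * (1 + \<delta>) ^ ?d - ?\<omega> * (1 - \<delta>) ^ ?d)" by (rule ennreal_leI)
  also have "\<dots> = emeasure lborel (cball (0::real^'n) (1 + \<delta>)) - emeasure lborel (cball (0::real^'n) (1 - \<delta>))"
    using \<delta> by (simp add: emeasure_cball ennreal_minus)
  also have "\<dots> = emeasure lborel (cball (0::real^'n) (1 + \<delta>) - cball 0 (1 - \<delta>))"
    using \<delta> by (intro emeasure_Diff[symmetric]) (auto simp: emeasure_cball)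
  also have "\<dots> \<le> emeasure lborel (unit_shell \<delta> :: (real^'n) set)"
    by (intro emeasure_mono) (auto simp: unit_shell_def)
  finally show "ennreal (2 * \<delta> * ?\<omega>) \<le> emeasure lborel (unit_shell \<delta> :: (real^'n) set)" .
  have "emeasure lborel (unit_shell \<delta> :: (real^'n) set) = (\<integral>\<^sup>+x. indicator {1 - \<delta>..1 + \<delta>} (norm x) \<partial>(lborel :: (real^'n) measure))"
  proof -
    have "indicator {1 - \<delta>..1 + \<delta>} (norm x) = (indicator (unit_shell \<delta>) x :: ennreal)" for x :: "real^'n"
      by (auto simp: unit_shell_def indicator_def abs_le_iff)
    then show ?thesis by simp
  qed
  also have "\<dots> = (\<integral>\<^sup>+r. ennreal (real ?d * ?\<omega> * r ^ (?d - 1)) * indicator {0..} r * indicator {1 - \<delta>..1 + \<delta>} r \<partial>lborel)"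
    by (subst nn_integral_radial) simp_all
  also have "\<dots> \<le> (\<integral>\<^sup>+r. ennreal (real ?d * ?\<omega> * 2 ^ ?d) * indicator {1 - \<delta>..1 + \<delta>} r \<partial>lborel)"
  proof (rule nn_integral_mono)
    fix r :: real
    show "ennreal (real ?d * ?\<omega> * r ^ (?d - 1)) * indicator {0..} r * indicator {1 - \<delta>..1 + \<delta>} r \<le> ennreal (real ?d * ?\<omega> * 2 ^ ?d) * indicator {1 - \<delta>..1 + \<delta>} r"
    proof (cases "r \<in> {1 - \<delta>..1 + \<delta>}")
      case True
      then have r: "0 \<le> r" "r \<le> 2" using \<delta> by auto
      have "r ^ (?d - 1) \<le> 2 ^ (?d - 1)" using r by (intro power_mono)
      also have "\<dots> \<le> 2 ^ ?d" by (intro power_increasing) auto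
      finally have "real ?d * ?\<omega> * r ^ (?d - 1) \<le> real ?d * ?\<omega> * 2 ^ ?d" using w0 by (intro mult_left_mono) auto
      then show ?thesis using True r by (simp add: ennreal_leI)
    qed simp
  qed
  also have "\<dots> = ennreal (real ?d * ?\<omega> * 2 ^ ?d) * ennreal (2 * \<delta>)"
    using \<delta> by (subst nn_integral_cmult_indicator) auto
  also have "\<dots> = ennreal (real ?d * ?\<omega> * 2 ^ ?d * 2 * \<delta>)"
    using w0 \<delta> by (subst ennreal_mult[symmetric]) (auto simp: mult.assoc)
  finally show "emeasure lborel (unit_shell \<delta> :: (real^'n) set) \<le> ennreal (real ?d * ?\<omega> * 2 ^ ?d * 2 * \<delta>)" .
qed

text \<open>Dividing by \<open>\<delta>\<close> keeps the total mass of order \<open>1\<close>, as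
  for surface measure on the unit sphere; the squared norm is then of order
  \<open>1 / \<delta>\<close> and the energy at \<open>\<epsilon> = \<delta>\<^sup>2\<close> of
  order \<open>\<delta>\<close>.\<close>

definition shell_profile :: "real \<Rightarrow> real^'n \<Rightarrow> complex" where
  "shell_profile \<delta> \<xi> = complex_of_real (indicator (unit_shell \<delta>) \<xi> / \<delta>)"

lemma shell_profile_measurable [measurable]: "shell_profile \<delta> \<in> borel_measurable borel"
  unfolding shell_profile_def[abs_def] by measurable

lemma integrable_unit_shell:
  assumes "0 < \<delta>" "\<delta> \<le> 1/2"
  shows "integrable lborel (indicator (unit_shell \<delta> :: (real^'n) set) :: _ \<Rightarrow> real)"
proof (rule integrable_real_indicator)
  have "emeasure lborel (unit_shell \<delta> :: (real^'n) set) < \<infinity>"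
    using le_less_trans[OF emeasure_unit_shell_le[OF assms, where 'n='n] ennreal_less_top] by simp
  then show "emeasure lborel (unit_shell \<delta> :: (real^'n) set) < \<infinity>" .
qed simp

lemma integrable_shell_profile:
  assumes "0 < \<delta>" "\<delta> \<le> 1/2"
  shows "integrable lborel (shell_profile \<delta> :: real^'n \<Rightarrow> complex)"
  unfolding shell_profile_def[abs_def] complex_of_real_integrable_eq
  by (intro integrable_divide_zero integrable_unit_shell assms)

lemma shell_profile_norm: "(norm (shell_profile \<delta> \<xi>))\<^sup>2 = indicator (unit_shell \<delta>) \<xi> / \<delta>\<^sup>2"
  by (simp add: shell_profile_def indicator_def power_divide norm_divide)

lemma shell_profile_L2:
  assumes "0 < \<delta>" "\<delta> \<le> 1/2"
  shows "(shell_profile \<delta> :: real^'n \<Rightarrow> complex) \<in> L2_space"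
  by (rule L2_space_bound[where h="\<lambda>\<xi>. indicator (unit_shell \<delta>) \<xi> / \<delta>\<^sup>2"])
     (auto simp: shell_profile_norm intro!: integrable_divide_zero integrable_unit_shell assms)

lemma orthogonal_transformation_uminus: "orthogonal_transformation (uminus :: real^'n \<Rightarrow> real^'n)"
  by (simp add: orthogonal_transformation_def linear_uminus)

lemma radial_shell_profile: "radial (shell_profile \<delta>)"
  unfolding radial_def
  by (rule exI[of _ "\<lambda>r. complex_of_real (indicator {r. \<bar>r - 1\<bar> \<le> \<delta>} r / \<delta>)"])
     (simp add: shell_profile_def unit_shell_def indicator_def)

lemma inverse_fourier_shell_profile:
  "inverse_fourier_L1 (shell_profile \<delta>) x = fourier_L1 (shell_profile \<delta>) (x :: real^'n)"
  unfolding inverse_fourier_L1_def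
  using fourier_L1_orthogonal[OF shell_profile_measurable radial_shell_profile orthogonal_transformation_uminus, of \<delta> x] by simp

text \<open>The forward transform fits \<open>gauss_quadratic_form\<close>. As the profile is even,
  it is also the inverse transform, so the Fourier transform of the wave is the profile.\<close>

definition shell_wave :: "real \<Rightarrow> real^'n \<Rightarrow> complex" where
  "shell_wave \<delta> = fourier_L1 (shell_profile \<delta>)"

lemma shell_wave_inverse: "shell_wave \<delta> = inverse_fourier_L1 (shell_profile \<delta>)"
  by (rule ext) (simp add: shell_wave_def inverse_fourier_shell_profile)

lemma shell_wave_H2_rad:
  assumes \<delta>: "0 < \<delta>" "\<delta> \<le> 1/2"
  shows "(shell_wave \<delta> :: real^'n \<Rightarrow> complex) \<in> H2_rad"
    and "AE \<xi> in lborel. fourier (shell_wave \<delta>) \<xi> = shell_profile \<delta> (\<xi> :: real^'n)"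
proof -
  note w = shell_profile_L2[OF \<delta>, where 'n='n] integrable_shell_profile[OF \<delta>, where 'n='n]
  have L: "(shell_wave \<delta> :: real^'n \<Rightarrow> complex) \<in> L2_space"
    unfolding shell_wave_inverse by (rule inverse_fourier_L1_L2[OF w])
  show F: "AE \<xi> in lborel. fourier (shell_wave \<delta>) \<xi> = shell_profile \<delta> (\<xi> :: real^'n)"
    unfolding shell_wave_inverse by (rule fourier_inverse_fourier_L1[OF w])
  note [measurable] = L2_spaceD(1)[OF fourier_in_L2[OF L]]
  have "(\<lambda>\<xi>::real^'n. complex_of_real (1 + (norm \<xi>)\<^sup>2) * fourier (shell_wave \<delta>) \<xi>) \<in> L2_space"
  \<comment> \<open>On the shell \<open>norm \<xi> \<le> 2\<close>, so
    \<open>1 + (norm \<xi>)\<^sup>2 \<le> 5\<close>, and \<open>25\<close> is its square.\<close>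
  proof (rule L2_space_bound[where h="\<lambda>\<xi>. 25 * (indicator (unit_shell \<delta>) \<xi> / \<delta>\<^sup>2)"])
    show "AE \<xi>::real^'n in lborel. (norm (complex_of_real (1 + (norm \<xi>)\<^sup>2) * fourier (shell_wave \<delta>) \<xi>))\<^sup>2 \<le> 25 * (indicator (unit_shell \<delta>) \<xi> / \<delta>\<^sup>2)"
      using F
    proof eventually_elim
      case (elim \<xi>)
      show ?case
      proof (cases "\<xi> \<in> unit_shell \<delta>")
        case True
        then have "norm \<xi> \<le> 2" using \<delta> by (auto simp: unit_shell_def)
        then have "(norm \<xi>)\<^sup>2 \<le> 2\<^sup>2" by (intro power_mono) auto
        then have "norm (complex_of_real (1 + (norm \<xi>)\<^sup>2)) \<le> 5" by (subst norm_of_real) auto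
        then have "(norm (complex_of_real (1 + (norm \<xi>)\<^sup>2)))\<^sup>2 \<le> 5\<^sup>2" by (intro power_mono) auto
        then have "(norm (complex_of_real (1 + (norm \<xi>)\<^sup>2)))\<^sup>2 * (indicator (unit_shell \<delta>) \<xi> / \<delta>\<^sup>2) \<le> 25 * (indicator (unit_shell \<delta>) \<xi> / \<delta>\<^sup>2)"
          by (intro mult_right_mono) auto
        then show ?thesis unfolding elim norm_mult power_mult_distrib shell_profile_norm .
      qed (simp add: elim shell_profile_def)
    qed
  qed (auto intro!: integrable_mult_right integrable_divide_zero integrable_unit_shell \<delta>)
  then have H: "(shell_wave \<delta> :: real^'n \<Rightarrow> complex) \<in> H2_space" using L by (simp add: H2_space_def)
  have "radial (shell_wave \<delta> :: real^'n \<Rightarrow> complex)"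
  proof -
    obtain k :: 'n where True by simp
    have "shell_wave \<delta> x = shell_wave \<delta> (norm x *\<^sub>R axis k (1::real))" for x :: "real^'n"
    proof -
      have "norm x = norm (norm x *\<^sub>R axis k (1::real) :: real^'n)" by (simp add: norm_axis_1)
      then obtain T where T: "orthogonal_transformation T" "T x = norm x *\<^sub>R axis k (1::real)"
        using orthogonal_transformation_exists by blast
      show ?thesis unfolding shell_wave_def T(2)[symmetric]
        by (rule fourier_L1_orthogonal[OF shell_profile_measurable radial_shell_profile T(1), symmetric])
    qed
    then show ?thesis unfolding radial_def by (intro exI[of _ "\<lambda>r. shell_wave \<delta> (r *\<^sub>R axis k (1::real))"]) simp
  qed
  then show "(shell_wave \<delta> :: real^'n \<Rightarrow> complex) \<in> H2_rad" using H by (simp add: H2_rad_def)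
qed

text \<open>On the shell \<open>(norm \<xi>)\<^sup>2 - 1\<close> is at most
  \<open>3 * \<delta>\<close> in modulus, so the symbol is at most
  \<open>10 * \<delta>\<^sup>2\<close>. This cancels the squared height of the profile and leaves
  ten times the volume of the shell.\<close>

lemma energy_shell_wave_le:
  obtains C where "C > 0" "\<And>\<delta>. \<lbrakk>0 < \<delta>; \<delta> \<le> 1/2\<rbrakk> \<Longrightarrow> energy (\<delta>\<^sup>2) (shell_wave \<delta> :: real^'n \<Rightarrow> complex) \<le> C * \<delta>"
proof -
  define V where "V = real CARD('n) * unit_ball_vol (real CARD('n)) * 2 ^ CARD('n) * 2"
  have V0: "V > 0" by (simp add: V_def)
  show thesis
  proof (rule that[of "10 * V"])
    show "10 * V > 0" using V0 by simp
    fix \<delta> :: real assume \<delta>: "0 < \<delta>" "\<delta> \<le> 1/2"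
    have H: "(shell_wave \<delta> :: real^'n \<Rightarrow> complex) \<in> H2_space" using shell_wave_H2_rad(1)[OF \<delta>, where 'n='n] by (simp add: H2_rad_def)
    have \<delta>2: "\<delta>\<^sup>2 > 0" using \<delta> by simp
    have "energy (\<delta>\<^sup>2) (shell_wave \<delta> :: real^'n \<Rightarrow> complex) \<le> (LINT \<xi>|lborel. 10 * indicator (unit_shell \<delta> :: (real^'n) set) \<xi>)"
      unfolding energy_def
    proof (rule integral_mono_AE)
      show "integrable lborel (\<lambda>\<xi>::real^'n. symbol (\<delta>\<^sup>2) \<xi> * (norm (fourier (shell_wave \<delta>) \<xi>))\<^sup>2)"
        by (rule energy_integrable[OF H \<delta>2])
      show "integrable lborel (\<lambda>\<xi>. 10 * indicator (unit_shell \<delta> :: (real^'n) set) \<xi> :: real)"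
        by (intro integrable_mult_right integrable_unit_shell \<delta>)
      show "AE \<xi>::real^'n in lborel. symbol (\<delta>\<^sup>2) \<xi> * (norm (fourier (shell_wave \<delta>) \<xi>))\<^sup>2 \<le> 10 * indicator (unit_shell \<delta>) \<xi>"
        using shell_wave_H2_rad(2)[OF \<delta>]
      proof eventually_elim
        case (elim \<xi>)
        show ?case
        proof (cases "\<xi> \<in> unit_shell \<delta>")
          case True
          then have n: "\<bar>norm \<xi> - 1\<bar> \<le> \<delta>" by (simp add: unit_shell_def)
          then have n3: "\<bar>norm \<xi> + 1\<bar> \<le> 3" using \<delta> by linarith
          have "(norm \<xi>)\<^sup>2 - 1 = (norm \<xi> - 1) * (norm \<xi> + 1)" by (simp add: power2_eq_square algebra_simps)
          then have "\<bar>(norm \<xi>)\<^sup>2 - 1\<bar> = \<bar>norm \<xi> - 1\<bar> * \<bar>norm \<xi> + 1\<bar>" by (simp only: abs_mult)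
          also have "\<dots> \<le> \<delta> * 3" using n n3 by (intro mult_mono) auto
          finally have "\<bar>(norm \<xi>)\<^sup>2 - 1\<bar>\<^sup>2 \<le> (\<delta> * 3)\<^sup>2" by (rule power_mono) simp
          then have "symbol (\<delta>\<^sup>2) \<xi> \<le> 10 * \<delta>\<^sup>2" by (simp add: symbol_def power_mult_distrib)
          then have "symbol (\<delta>\<^sup>2) \<xi> * (1 / \<delta>\<^sup>2) \<le> 10 * \<delta>\<^sup>2 * (1 / \<delta>\<^sup>2)" by (intro mult_right_mono) auto
          then show ?thesis using True \<delta> unfolding elim shell_profile_norm by simp
        qed (simp add: elim shell_profile_def)
      qed
    qed
    also have "\<dots> = 10 * measure lborel (unit_shell \<delta> :: (real^'n) set)" by simp
    also have "measure lborel (unit_shell \<delta> :: (real^'n) set) \<le> V * \<delta>"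
      unfolding measure_def using emeasure_unit_shell_le[OF \<delta>, where 'n='n] V0 \<delta>
      by (intro enn2real_leI) (auto simp: V_def)
    finally show "energy (\<delta>\<^sup>2) (shell_wave \<delta> :: real^'n \<Rightarrow> complex) \<le> 10 * V * \<delta>" by simp
  qed
qed

text \<open>The size \<open>r\<close> is that of the mass in a ball of radius \<open>r\<close> of a
  wave decaying like \<open>|x|\<close> to the power \<open>-(d - 1) / 2\<close>. Profile and kernel
  are nonnegative, so the quadratic form has no cancellation: a kernel of height
  \<open>r ^ d\<close> and width \<open>1 / r\<close> meets, around each point of the shell, a cap
  of volume of order \<open>\<delta> * (1 / r) ^ (d - 1)\<close>. The limit
  \<open>r \<le> 1 / \<delta>\<close> keeps the cap at least as wide as the shell is thick.\<close>

lemma shell_wave_gauss_mass: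
  obtains c where "c > 0" "\<And>\<delta> r. \<lbrakk>0 < \<delta>; \<delta> \<le> 1/2; 1 \<le> r; r \<le> 1 / \<delta>\<rbrakk> \<Longrightarrow>
    ennreal (c * r) \<le> (\<integral>\<^sup>+x. ennreal ((norm (shell_wave \<delta> x))\<^sup>2 * gauss (1 / r\<^sup>2) x) \<partial>(lborel :: (real^'n) measure))"
proof -
  define d where "d = CARD('n)"
  have d1: "d \<ge> 1" by (simp add: d_def Suc_leI)
  obtain c where c: "c > 0" "\<And>\<delta> s (x::real^'n). \<lbrakk>0 < \<delta>; \<delta> \<le> 1/2; \<delta> \<le> s; s \<le> 1; x \<in> unit_shell \<delta>\<rbrakk> \<Longrightarrow>
    ennreal (c * \<delta> * s ^ (CARD('n) - 1)) \<le> emeasure lborel (unit_shell \<delta> \<inter> cball x (4 * s))"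
    using unit_shell_cap_cball by blast
  \<comment> \<open>The cap reaches out to distance \<open>4 / r\<close>, where the Gaussian
    \<open>gauss (r\<^sup>2)\<close> has the value \<open>exp (- 8)\<close>.\<close>
  define k where "k = (2 * pi) powr (- real d / 2) * exp (- 8)"
  have k0: "k > 0" by (simp add: k_def)
  define \<omega> where "\<omega> = unit_ball_vol (real d)"
  have w0: "\<omega> > 0" by (simp add: \<omega>_def)
  show thesis
  proof (rule that[of "k * c * (2 * \<omega>)"])
    show "k * c * (2 * \<omega>) > 0" using k0 c w0 by simp
    fix \<delta> r :: real assume \<delta>: "0 < \<delta>" "\<delta> \<le> 1/2" and r: "1 \<le> r" "r \<le> 1 / \<delta>"
    define s where "s = 1 / r"
    have s: "\<delta> \<le> s" "s \<le> 1" "s > 0" using r \<delta> by (simp_all add: s_def field_simps)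
    define K where "K z = gauss_kernel (1 / r\<^sup>2) z" for z :: "real^'n"
    have [measurable]: "K \<in> borel_measurable borel" unfolding K_def[abs_def] by measurable
    have K0: "K z \<ge> 0" for z by (simp add: K_def gauss_kernel_nonneg)
    have Keq: "K z = (2 * pi) powr (- real d / 2) * r ^ d * gauss (r\<^sup>2) z" for z
    proof -
      have "(2 * pi / (1 / r\<^sup>2)) powr (real d / 2) = (2 * pi) powr (real d / 2) * (r\<^sup>2) powr (real d / 2)" by (simp add: powr_mult)
      moreover have "(r\<^sup>2) powr (real d / 2) = r ^ d"
      proof -
        have "(r\<^sup>2) powr (real d / 2) = (r powr 2) powr (real d / 2)" using r by (simp add: powr_numeral)
        also have "\<dots> = r powr real d" unfolding powr_powr by simp
        also have "\<dots> = r ^ d" using r by (intro powr_realpow) simp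
        finally show ?thesis .
      qed
      moreover have "(2 * pi) powr (- real d / 2) * (2 * pi) powr (real d / 2) = 1" by (simp flip: powr_add)
      ultimately show ?thesis by (simp add: K_def gauss_kernel_def d_def mult.assoc[symmetric])
    qed
    have Klow: "k * r ^ d \<le> K z" if "norm z \<le> 4 * s" for z
    proof -
      have "r * norm z \<le> 4" using mult_left_mono[OF that, of r] r by (simp add: s_def)
      then have "(r * norm z)\<^sup>2 \<le> 4\<^sup>2" using r by (intro power_mono) auto
      then have "exp (- 8) \<le> gauss (r\<^sup>2) z" by (simp add: gauss_def power_mult_distrib)
      then have "(2 * pi) powr (- real d / 2) * r ^ d * exp (- 8) \<le> (2 * pi) powr (- real d / 2) * r ^ d * gauss (r\<^sup>2) z"
        using r by (intro mult_left_mono) auto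
      then show ?thesis by (simp add: Keq k_def mult_ac)
    qed
    define Kmax where "Kmax = (2 * pi) powr (- real d / 2) * r ^ d"
    have Kle: "K z \<le> Kmax" for z
      unfolding Keq Kmax_def using r by (intro mult_left_le) (auto simp: gauss_def)
    have Kmax0: "\<bar>Kmax\<bar> = Kmax" using order_trans[OF K0[of 0] Kle[of 0]] by simp
    define w where "w \<xi> = indicator (unit_shell \<delta>) \<xi> / \<delta>" for \<xi> :: "real^'n"
    have [measurable]: "w \<in> borel_measurable borel" unfolding w_def[abs_def] by measurable
    have w_nn: "w \<xi> \<ge> 0" for \<xi> using \<delta> by (simp add: w_def)
    have wi: "integrable lborel w" unfolding w_def[abs_def] by (intro integrable_divide_zero integrable_unit_shell \<delta>)
    have prof: "shell_profile \<delta> \<xi> = complex_of_real (w \<xi>)" for \<xi> :: "real^'n" by (simp add: shell_profile_def w_def)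
    \<comment> \<open>The profile smoothed by the kernel; the Gaussian mass of the wave is the
      integral of \<open>w x * H x\<close>.\<close>
    define H where "H x = (LINT y|lborel. w y * K (y - x))" for x
    have [measurable]: "H \<in> borel_measurable borel" unfolding H_def[abs_def] by measurable
    have wKi: "integrable lborel (\<lambda>y. w y * K (y - x))" for x
      by (rule Bochner_Integration.integrable_bound[of _ "\<lambda>y. w y * Kmax"])
         (use wi w_nn Kle K0 in \<open>auto simp: abs_mult Kmax0 intro!: AE_I2 mult_left_mono\<close>)
    have Hle: "H x \<le> (LINT y|lborel. w y) * Kmax" for x
      unfolding H_def integral_mult_left_zero[symmetric]
      by (intro integral_mono wKi integrable_mult_left wi mult_left_mono Kle w_nn)
    have H0: "H x \<ge> 0" for x unfolding H_def by (intro integral_nonneg_AE AE_I2 mult_nonneg_nonneg w_nn K0)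
    have wHi: "integrable lborel (\<lambda>x. w x * H x)"
      by (rule Bochner_Integration.integrable_bound[of _ "\<lambda>x. w x * ((LINT y|lborel. w y) * Kmax)"])
         (use wi w_nn Hle H0 in \<open>auto simp: abs_mult Kmax0 intro!: AE_I2 mult_left_mono\<close>)
    have Hlow: "k * c * r \<le> H x" if x: "x \<in> unit_shell \<delta>" for x
    proof -
      have "ennreal (k * r ^ d / \<delta>) * ennreal (c * \<delta> * s ^ (d - 1)) \<le> ennreal (k * r ^ d / \<delta>) * emeasure lborel (unit_shell \<delta> \<inter> cball x (4 * s))"
        using c(2)[OF \<delta> s(1,2) x] by (intro mult_left_mono) (auto simp: d_def)
      also have "\<dots> = (\<integral>\<^sup>+y. ennreal (k * r ^ d / \<delta>) * indicator (unit_shell \<delta> \<inter> cball x (4 * s)) y \<partial>lborel)"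
        by (rule nn_integral_cmult_indicator[symmetric]) (auto intro!: sets.Int)
      also have "\<dots> \<le> (\<integral>\<^sup>+y. ennreal (w y * K (y - x)) \<partial>lborel)"
      proof (rule nn_integral_mono)
        fix y
        show "ennreal (k * r ^ d / \<delta>) * indicator (unit_shell \<delta> \<inter> cball x (4 * s)) y \<le> ennreal (w y * K (y - x))"
        proof (cases "y \<in> unit_shell \<delta> \<inter> cball x (4 * s)")
          case True
          then have "k * r ^ d \<le> K (y - x)" by (intro Klow) (auto simp: dist_norm norm_minus_commute)
          then have "k * r ^ d / \<delta> \<le> K (y - x) / \<delta>" using \<delta> by (intro divide_right_mono) auto
          then show ?thesis using True by (auto simp: w_def intro!: ennreal_leI)
        qed simp
      qed
      also have "\<dots> = ennreal (H x)" unfolding H_def by (rule nn_integral_eq_integral[OF wKi]) (simp add: w_nn K0)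
      also have "ennreal (k * r ^ d / \<delta>) * ennreal (c * \<delta> * s ^ (d - 1)) = ennreal (k * c * r)"
      proof -
        have "r ^ d = r * r ^ (d - 1)" using d1 by (cases d) auto
        moreover have "r ^ (d - 1) * s ^ (d - 1) = 1" using r by (simp add: s_def flip: power_mult_distrib)
        ultimately have "r ^ d * s ^ (d - 1) = r" by (simp add: mult.assoc)
        moreover have "k * r ^ d / \<delta> * (c * \<delta> * s ^ (d - 1)) = k * c * (r ^ d * s ^ (d - 1))" using \<delta> by simp
        ultimately have e1: "k * r ^ d / \<delta> * (c * \<delta> * s ^ (d - 1)) = k * c * r" by (simp only:)
        have "ennreal (k * r ^ d / \<delta>) * ennreal (c * \<delta> * s ^ (d - 1)) = ennreal (k * r ^ d / \<delta> * (c * \<delta> * s ^ (d - 1)))"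
          using k0 r \<delta> c s by (intro ennreal_mult[symmetric]) auto
        then show ?thesis by (simp only: e1)
      qed
      finally show ?thesis using H0 by (subst (asm) ennreal_le_iff) auto
    qed
    have "(LINT x|lborel. (norm (shell_wave \<delta> x))\<^sup>2 * gauss (1 / r\<^sup>2) (x :: real^'n)) = (LINT x|lborel. w x * H x)"
    proof -
      have "complex_of_real (LINT x|lborel. (norm (shell_wave \<delta> x))\<^sup>2 * gauss (1 / r\<^sup>2) (x :: real^'n))
        = (LINT x|lborel. shell_profile \<delta> x * (LINT y|lborel. cnj (shell_profile \<delta> y) * complex_of_real (gauss_kernel (1 / r\<^sup>2) (y - x :: real^'n))))"
        unfolding shell_wave_def using r by (intro gauss_quadratic_form integrable_shell_profile \<delta>) auto
      also have "\<dots> = (LINT x|lborel. complex_of_real (w x * H x))"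
      proof (rule Bochner_Integration.integral_cong)
        fix x :: "real^'n"
        have i1: "(LINT y|lborel. cnj (shell_profile \<delta> y) * complex_of_real (gauss_kernel (1 / r\<^sup>2) (y - x))) = (LINT y|lborel. complex_of_real (w y * K (y - x)))"
          by (simp add: prof K_def)
        have "(LINT y|lborel. complex_of_real (w y * K (y - x))) = complex_of_real (H x)"
          unfolding H_def by (rule integral_complex_of_real)
        with i1 show "shell_profile \<delta> x * (LINT y|lborel. cnj (shell_profile \<delta> y) * complex_of_real (gauss_kernel (1 / r\<^sup>2) (y - x))) = complex_of_real (w x * H x)"
          by (simp only: prof of_real_mult)
      qed simp
      also have "\<dots> = complex_of_real (LINT x|lborel. w x * H x)" by (rule integral_complex_of_real)
      finally show ?thesis by (simp only: of_real_eq_iff)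
    qed
    moreover have "(\<integral>\<^sup>+x. ennreal ((norm (shell_wave \<delta> x))\<^sup>2 * gauss (1 / r\<^sup>2) x) \<partial>(lborel :: (real^'n) measure)) = ennreal (LINT x|lborel. (norm (shell_wave \<delta> x))\<^sup>2 * gauss (1 / r\<^sup>2) (x :: real^'n))"
      unfolding shell_wave_def using r
      by (intro nn_integral_eq_integral integrable_fourier_gauss integrable_shell_profile \<delta>) auto
    moreover have "ennreal (k * c * (2 * \<omega>) * r) \<le> (\<integral>\<^sup>+x. ennreal (w x * H x) \<partial>lborel)"
    proof -
      have "ennreal (k * c * (2 * \<omega>) * r) = ennreal (k * c * r / \<delta>) * ennreal (2 * \<delta> * \<omega>)"
      proof -
        have "k * c * (2 * \<omega>) * r = k * c * r / \<delta> * (2 * \<delta> * \<omega>)" using \<delta> by simp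
        then show ?thesis using \<delta> k0 c(1) r w0 by (simp only:) (intro ennreal_mult, auto)
      qed
      also have "\<dots> \<le> ennreal (k * c * r / \<delta>) * emeasure lborel (unit_shell \<delta> :: (real^'n) set)"
        using emeasure_unit_shell_ge[OF \<delta>, where 'n='n] by (intro mult_left_mono) (auto simp: \<omega>_def d_def)
      also have "\<dots> = (\<integral>\<^sup>+x. ennreal (k * c * r / \<delta>) * indicator (unit_shell \<delta> :: (real^'n) set) x \<partial>lborel)"
        by (rule nn_integral_cmult_indicator[symmetric]) auto
      also have "\<dots> \<le> (\<integral>\<^sup>+x. ennreal (w x * H x) \<partial>lborel)"
      proof (rule nn_integral_mono)
        fix x :: "real^'n"
        show "ennreal (k * c * r / \<delta>) * indicator (unit_shell \<delta>) x \<le> ennreal (w x * H x)"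
        proof (cases "x \<in> unit_shell \<delta>")
          case True
          from divide_right_mono[OF Hlow[OF True], of \<delta>] \<delta> have "k * c * r / \<delta> \<le> H x / \<delta>" by simp
          then show ?thesis using True by (simp add: w_def ennreal_leI)
        qed simp
      qed
      finally show ?thesis .
    qed
    moreover have "(\<integral>\<^sup>+x. ennreal (w x * H x) \<partial>lborel) = ennreal (LINT x|lborel. w x * H x)"
      by (rule nn_integral_eq_integral[OF wHi]) (simp add: w_nn H0)
    ultimately show "ennreal (k * c * (2 * \<omega>) * r) \<le> (\<integral>\<^sup>+x. ennreal ((norm (shell_wave \<delta> x))\<^sup>2 * gauss (1 / r\<^sup>2) x) \<partial>(lborel :: (real^'n) measure))"
      by simp
  qed
qed

text \<open>The exponent \<open>1 + 2 / \<alpha>\<close> is conjugate to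
  \<open>(\<alpha> + 2) / 2\<close>. In place of Hoelder a pointwise inequality is used, by
  comparing \<open>p\<close> with \<open>T * norm z powr \<alpha>\<close>; the extended integrals
  allow the case of infinite \<open>L^p\<close> norm.\<close>

lemma weight_duality:
  fixes u :: "'a::euclidean_space \<Rightarrow> complex" and \<phi> :: "'a \<Rightarrow> real"
  assumes [measurable]: "u \<in> borel_measurable borel" "\<phi> \<in> borel_measurable borel"
    and \<phi>: "\<And>x. \<phi> x \<ge> 0" and \<alpha>: "\<alpha> > 0" and a: "a > 0" and b: "b > 0"
    and A: "ennreal a \<le> (\<integral>\<^sup>+x. ennreal ((norm (u x))\<^sup>2 * \<phi> x) \<partial>lborel)"
    and B: "(\<integral>\<^sup>+x. ennreal (\<phi> x powr (1 + 2 / \<alpha>)) \<partial>lborel) \<le> ennreal b"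
  shows "ennreal (a / 2 * (2 * b / a) powr (- \<alpha> / 2)) \<le> (\<integral>\<^sup>+x. ennreal (norm (u x) powr (\<alpha> + 2)) \<partial>lborel)"
proof -
  \<comment> \<open>Chosen so that the weight term amounts to exactly \<open>a / 2\<close> (see
    \<open>Tb\<close>), leaving the other half of \<open>a\<close> for the \<open>L^p\<close>
    integral.\<close>
  define T where "T = (2 * b / a) powr (\<alpha> / 2)"
  have T: "T > 0" using a b by (simp add: T_def)
  have Tb: "T powr (- 2 / \<alpha>) * b = a / 2"
  proof -
    have "\<alpha> / 2 * (- 2 / \<alpha>) = - 1" using \<alpha> by simp
    then have "T powr (- 2 / \<alpha>) = (2 * b / a) powr (- 1)" unfolding T_def powr_powr by (simp only:)
    also have "\<dots> = 1 / (2 * b / a)" using a b by (subst powr_minus_divide) simp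
    finally show ?thesis using a b by simp
  qed
  let ?P = "\<integral>\<^sup>+x. ennreal (norm (u x) powr (\<alpha> + 2)) \<partial>lborel"
  have pt: "(norm z)\<^sup>2 * p \<le> T * norm z powr (\<alpha> + 2) + T powr (- 2 / \<alpha>) * p powr (1 + 2 / \<alpha>)" if p: "p \<ge> 0" for z :: complex and p
  proof (cases "p \<le> T * norm z powr \<alpha>")
    case True
    have "(norm z)\<^sup>2 * p \<le> (norm z)\<^sup>2 * (T * norm z powr \<alpha>)" using True by (intro mult_left_mono) auto
    also have "\<dots> = T * norm z powr (\<alpha> + 2)" by (cases "z = 0") (simp_all add: powr_add)
    finally show ?thesis using T by (simp add: add_increasing2)
  next
    case False
    then have "p > 0" using T p by (smt (verit) mult_nonneg_nonneg powr_ge_zero)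
    have "norm z powr \<alpha> \<le> p / T" using False T by (simp add: pos_le_divide_eq mult.commute)
    then have "(norm z powr \<alpha>) powr (2 / \<alpha>) \<le> (p / T) powr (2 / \<alpha>)" using \<alpha> by (intro powr_mono2) auto
    moreover have "(norm z powr \<alpha>) powr (2 / \<alpha>) = (norm z)\<^sup>2"
      unfolding powr_powr using \<alpha> by (cases "z = 0") simp_all
    ultimately have "(norm z)\<^sup>2 * p \<le> (p / T) powr (2 / \<alpha>) * p" using p by (intro mult_right_mono) auto
    also have "(p / T) powr (2 / \<alpha>) = p powr (2 / \<alpha>) * T powr (- 2 / \<alpha>)"
      using p T by (simp add: powr_divide powr_minus_divide)
    also have "p powr (2 / \<alpha>) * T powr (- 2 / \<alpha>) * p = T powr (- 2 / \<alpha>) * p powr (1 + 2 / \<alpha>)"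
      using \<open>p > 0\<close> by (simp add: powr_add)
    finally show ?thesis using T by (simp add: add_increasing)
  qed
  have "ennreal a \<le> (\<integral>\<^sup>+x. ennreal T * ennreal (norm (u x) powr (\<alpha> + 2)) + ennreal (T powr (- 2 / \<alpha>)) * ennreal (\<phi> x powr (1 + 2 / \<alpha>)) \<partial>lborel)"
  proof (rule order_trans[OF A], rule nn_integral_mono)
    fix x
    have "ennreal ((norm (u x))\<^sup>2 * \<phi> x) \<le> ennreal (T * norm (u x) powr (\<alpha> + 2) + T powr (- 2 / \<alpha>) * \<phi> x powr (1 + 2 / \<alpha>))"
      by (rule ennreal_leI[OF pt[OF \<phi>]])
    also have "\<dots> = ennreal T * ennreal (norm (u x) powr (\<alpha> + 2)) + ennreal (T powr (- 2 / \<alpha>)) * ennreal (\<phi> x powr (1 + 2 / \<alpha>))"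
      using T by (simp add: ennreal_mult)
    finally show "ennreal ((norm (u x))\<^sup>2 * \<phi> x) \<le> \<dots>" .
  qed
  also have "\<dots> = ennreal T * ?P + ennreal (T powr (- 2 / \<alpha>)) * (\<integral>\<^sup>+x. ennreal (\<phi> x powr (1 + 2 / \<alpha>)) \<partial>lborel)"
    by (simp add: nn_integral_add nn_integral_cmult)
  also have "\<dots> \<le> ennreal T * ?P + ennreal (T powr (- 2 / \<alpha>)) * ennreal b"
    by (intro add_left_mono mult_left_mono B) simp
  also have "ennreal (T powr (- 2 / \<alpha>)) * ennreal b = ennreal (a / 2)"
    unfolding Tb[symmetric] using b by (intro ennreal_mult[symmetric]) auto
  finally have main: "ennreal a \<le> ennreal T * ?P + ennreal (a / 2)" .
  show ?thesis
  proof (cases ?P)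
    case (real P)
    then have "ennreal a \<le> ennreal (T * P + a / 2)"
      using main T a by (simp add: ennreal_mult)
    then have "a \<le> T * P + a / 2" using real T a by (subst (asm) ennreal_le_iff) auto
    then have "a / 2 \<le> P * T" by (simp add: mult.commute)
    then have "a / 2 / T \<le> P" using T by (simp add: pos_divide_le_eq)
    moreover have "a / 2 * (2 * b / a) powr (- \<alpha> / 2) = a / 2 / T" unfolding T_def by (simp add: powr_minus_divide)
    ultimately show ?thesis using real by (simp add: ennreal_leI)
  qed simp
qed

section \<open>Power integrals of the Gaussian and dyadic weights\<close>

lemma gauss_powr: "gauss s x powr p = gauss (s * p) x"
  by (simp add: gauss_def exp_powr_real)

lemma nn_integral_gauss_powr:
  assumes "r > 0" "p > 0"
  shows "(\<integral>\<^sup>+x. ennreal (gauss (1 / r\<^sup>2) (x::real^'n) powr p) \<partial>lborel) = ennreal ((2 * pi / p) powr (CARD('n) / 2) * r ^ CARD('n))"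
proof -
  have "(r\<^sup>2) powr (CARD('n) / 2) = (r powr 2) powr (CARD('n) / 2)" using assms by simp
  also have "\<dots> = r powr CARD('n)" unfolding powr_powr by simp
  also have "\<dots> = r ^ CARD('n)" using assms by (intro powr_realpow)
  finally have r: "(r\<^sup>2) powr (CARD('n) / 2) = r ^ CARD('n)" .
  have "2 * pi / (1 / r\<^sup>2 * p) = 2 * pi / p * r\<^sup>2" by simp
  then have "(2 * pi / (1 / r\<^sup>2 * p)) powr (CARD('n) / 2) = (2 * pi / p) powr (CARD('n) / 2) * r ^ CARD('n)"
    by (simp only: powr_mult r)
  moreover have "(\<integral>\<^sup>+x. ennreal (gauss (1 / r\<^sup>2 * p) (x::real^'n)) \<partial>lborel) = ennreal ((2 * pi / (1 / r\<^sup>2 * p)) powr (DIM(real^'n) / 2))"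
    using assms by (intro nn_integral_gauss) simp
  ultimately show ?thesis unfolding gauss_powr by simp
qed

text \<open>
  The critical weight is a dyadic superposition of Gaussians: each scale contributes equally to its
  pairing with \<open>\<bar>u\<bar>\<^sup>2\<close>, while it is bounded by \<open>1 / \<bar>x\<bar>\<close>, by telescoping against \<open>1 / (2\<^sup>k + \<bar>x\<bar>)\<close>.
\<close>

definition dyadic_weight :: "nat \<Rightarrow> real^'n \<Rightarrow> real" where
  "dyadic_weight N x = (\<Sum>k\<le>N. (1/2) ^ k * gauss (1 / (2 ^ k)\<^sup>2) x)"

lemma dyadic_weight_measurable [measurable]: "dyadic_weight N \<in> borel_measurable borel"
  unfolding dyadic_weight_def[abs_def] by measurable

lemma dyadic_weight_nonneg: "dyadic_weight N x \<ge> 0"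
  unfolding dyadic_weight_def by (intro sum_nonneg) simp

lemma dyadic_weight_le: "dyadic_weight N x \<le> 5 / (1 + norm x)"
proof -
  define y where "y = norm x"
  have y: "y \<ge> 0" by (simp add: y_def)
  define G where "G k = 1 / (2 ^ k + y)" for k :: nat
  have pos: "2 ^ k + y > 0" for k :: nat using y by (simp add: add_pos_nonneg)
  have step: "(1/2) ^ k * gauss (1 / (2 ^ k)\<^sup>2) x \<le> 5 * (G k - G (Suc k))" for k
  proof -
    define t where "t = y / 2 ^ k"
    have t: "t \<ge> 0" using y by (simp add: t_def)
    have yt: "y = 2 ^ k * t" by (simp add: t_def)
    have g: "gauss (1 / (2 ^ k)\<^sup>2) x = exp (- (t\<^sup>2 / 2))" by (simp add: gauss_def t_def y_def power_divide)
    \<comment> \<open>The difference of the two sides is \<open>3/2 * ((t - 1)\<^sup>2 + 1)\<close>;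
      this fixes the constant \<open>5\<close>.\<close>
    have "(1 + t) * (2 + t) \<le> 5 * (1 + t\<^sup>2 / 2)"
      using zero_le_power2[of "t - 1"] by (simp add: power2_eq_square algebra_simps)
    also have "\<dots> \<le> 5 * exp (t\<^sup>2 / 2)" by (intro mult_left_mono exp_ge_add_one_self) simp
    finally have "exp (- (t\<^sup>2 / 2)) * ((1 + t) * (2 + t)) \<le> exp (- (t\<^sup>2 / 2)) * (5 * exp (t\<^sup>2 / 2))" by (rule mult_left_mono) simp
    also have "\<dots> = 5" by (simp add: exp_minus)
    finally have "exp (- (t\<^sup>2 / 2)) \<le> 5 / ((1 + t) * (2 + t))" using t by (subst pos_le_divide_eq) auto
    then have "(1/2) ^ k * gauss (1 / (2 ^ k)\<^sup>2) x \<le> (1/2) ^ k * (5 / ((1 + t) * (2 + t)))" unfolding g by (rule mult_left_mono) simp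
    also have "\<dots> = 5 * (G k - G (Suc k))"
    proof -
      have "G k = (1/2) ^ k * (1 / (1 + t))" "G (Suc k) = (1/2) ^ k * (1 / (2 + t))"
        using t by (simp_all add: G_def yt power_divide field_simps)
      then have "G k - G (Suc k) = (1/2) ^ k * (1 / (1 + t) - 1 / (2 + t))" by (simp only: right_diff_distrib)
      also have "1 / (1 + t) - 1 / (2 + t) = 1 / ((1 + t) * (2 + t))" using t by (simp add: field_simps)
      finally show ?thesis by simp
    qed
    finally show ?thesis .
  qed
  have "dyadic_weight N x \<le> (\<Sum>k\<le>N. 5 * (G k - G (Suc k)))" unfolding dyadic_weight_def by (intro sum_mono step)
  also have "\<dots> = 5 * (G 0 - G (Suc N))" unfolding sum_distrib_left[symmetric] by (subst sum_telescope) simp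
  also have "\<dots> \<le> 5 * G 0" using pos[of "Suc N"] by (simp add: G_def)
  finally show ?thesis by (simp add: G_def y_def)
qed

text \<open>The bound \<open>exp (- v) \<le> 1 / v\<close> turns the \<open>k\<close>-th term into a
  multiple of \<open>2 ^ k / (norm x)\<^sup>2\<close>, and the geometric sum is of the size of its
  last term. Beyond the largest scale this faster decay makes the \<open>d\<close>-th power
  integrable.\<close>

lemma dyadic_weight_tail:
  assumes x: "x \<noteq> 0" and N: "2 ^ N \<le> \<rho>"
  shows "dyadic_weight N x \<le> 4 * \<rho> / (norm x)\<^sup>2"
proof -
  define y where "y = norm x"
  have y: "y > 0" using x by (simp add: y_def)
  have step: "(1/2) ^ k * gauss (1 / (2 ^ k)\<^sup>2) x \<le> 2 / y\<^sup>2 * 2 ^ k" for k :: nat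
  proof -
    define v where "v = (y / 2 ^ k)\<^sup>2 / 2"
    have v: "v > 0" using y by (simp add: v_def)
    have "v \<le> exp v" using exp_ge_add_one_self[of v] by linarith
    then have "v * exp (- v) \<le> exp v * exp (- v)" by (rule mult_right_mono) simp
    then have "v * exp (- v) \<le> 1" by (simp add: exp_minus)
    then have "exp (- v) \<le> 1 / v" using v by (simp add: pos_le_divide_eq mult.commute)
    moreover have "gauss (1 / (2 ^ k)\<^sup>2) x = exp (- v)" by (simp add: gauss_def v_def y_def power_divide)
    moreover have "(1/2) ^ k * (1 / v) = 2 / y\<^sup>2 * 2 ^ k" using y by (simp add: v_def power_divide power2_eq_square)
    ultimately show ?thesis by (metis mult_left_mono zero_le_divide_1_iff zero_le_numeral zero_le_power)
  qed
  have "dyadic_weight N x \<le> (\<Sum>k\<le>N. 2 / y\<^sup>2 * 2 ^ k)" unfolding dyadic_weight_def by (intro sum_mono step)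
  also have "\<dots> = 2 / y\<^sup>2 * (2 ^ Suc N - 1)" unfolding sum_distrib_left[symmetric] lessThan_Suc_atMost[symmetric]
    by (subst geometric_sum) auto
  also have "\<dots> \<le> 2 / y\<^sup>2 * (2 * \<rho>)" using N by (intro mult_left_mono) auto
  finally show ?thesis by (simp add: y_def)
qed

text \<open>At the critical exponent the dual power \<open>1 + 2 / \<alpha>\<close> equals
  \<open>d\<close>, and \<open>|x|\<close> to the power \<open>- d\<close> integrates to a logarithm
  between \<open>1\<close> and \<open>\<rho>\<close>. The unit ball and the exterior of radius
  \<open>\<rho>\<close> contribute only constants.\<close>

lemma dyadic_weight_power_integral:
  obtains C where "C > 0" "\<And>\<epsilon> N. \<lbrakk>0 < \<epsilon>; \<epsilon> \<le> exp (- 1); 2 ^ N \<le> \<epsilon> powr (- 1/2)\<rbrakk> \<Longrightarrow>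
    (\<integral>\<^sup>+x. ennreal (dyadic_weight N x powr CARD('n)) \<partial>(lborel :: (real^'n) measure)) \<le> ennreal (C * \<bar>ln \<epsilon>\<bar>)"
proof -
  define d where "d = CARD('n)"
  have d1: "d \<ge> 1" by (simp add: d_def Suc_leI)
  define \<omega> where "\<omega> = unit_ball_vol (real d)"
  have w0: "\<omega> > 0" by (simp add: \<omega>_def)
  obtain C1 where C1: "C1 > 0" "\<And>\<epsilon>. \<lbrakk>0 < \<epsilon>; \<epsilon> \<le> exp (- 1)\<rbrakk> \<Longrightarrow>
    (\<integral>\<^sup>+r. ennreal (r powr (- 1 - 0)) * indicator {1..\<epsilon> powr (- 1/2)} r \<partial>lborel) \<le> ennreal (C1 * resonance_growth 0 \<epsilon>)"
    using shell_integral_le[of 0] by blast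
  define D where "D = \<omega> * 5 ^ d + real d * \<omega> * 5 ^ d * C1 + \<omega> * 4 ^ d"
  show thesis
  proof (rule that[of D])
    show "D > 0" unfolding D_def using w0 C1 by (simp add: add_pos_nonneg)
    fix \<epsilon> :: real and N assume e: "0 < \<epsilon>" "\<epsilon> \<le> exp (- 1)" and N: "2 ^ N \<le> \<epsilon> powr (- 1/2)"
    define \<rho> where "\<rho> = \<epsilon> powr (- 1/2)"
    have \<rho>0: "\<rho> > 0" using e by (simp add: \<rho>_def)
    have L: "\<bar>ln \<epsilon>\<bar> \<ge> 1" by (rule abs_ln_ge_1[OF e])
    \<comment> \<open>Each power is divided by \<open>r ^ (d - 1)\<close> to cancel the volume
      factor of polar coordinates. The exponent \<open>- 1 - 0\<close> is the form of
      \<open>shell_integral_le\<close> at \<open>\<kappa> = 0\<close>.\<close>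
    define f where "f r = ennreal (5 ^ d) * indicator {0..1} r + ennreal (5 ^ d) * (ennreal (r powr (- 1 - 0) / r ^ (d - 1)) * indicator {1..\<rho>} r)
      + ennreal ((4 * \<rho>) ^ d) * (ennreal (r powr (- (real d + 1)) / r ^ (d - 1)) * indicator {\<rho>..} r)" for r :: real
    have [measurable]: "f \<in> borel_measurable borel" unfolding f_def[abs_def] by measurable
    have pt: "ennreal (dyadic_weight N x powr CARD('n)) \<le> f (norm x)" for x :: "real^'n"
    proof -
      have D: "dyadic_weight N x powr CARD('n) = dyadic_weight N x ^ d"
      proof (cases "dyadic_weight N x = 0")
        case False
        then have "dyadic_weight N x > 0" using dyadic_weight_nonneg[of N x] by simp
        then show ?thesis unfolding d_def by (rule powr_realpow)
      qed (use d1 in \<open>simp add: zero_power\<close>)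
      consider "norm x \<le> 1" | "1 < norm x" "norm x \<le> \<rho>" | "norm x > \<rho>" by linarith
      then show ?thesis
      proof cases
        case 1
        have "1 + norm x > 0" by (simp add: add_pos_nonneg)
        then have "5 / (1 + norm x) \<le> 5" by (subst pos_divide_le_eq) auto
        then have "dyadic_weight N x \<le> 5" by (rule order_trans[OF dyadic_weight_le])
        then have "dyadic_weight N x ^ d \<le> 5 ^ d" using dyadic_weight_nonneg by (intro power_mono) auto
        then have "ennreal (dyadic_weight N x powr CARD('n)) \<le> ennreal (5 ^ d) * indicator {0..1} (norm x)"
          using 1 unfolding D by (simp add: ennreal_leI)
        then show ?thesis unfolding f_def by (simp add: add_increasing2 add.assoc)
      next
        case 2
        then have x: "norm x > 0" by linarith
        have "dyadic_weight N x \<le> 5 / norm x"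
          by (rule order_trans[OF dyadic_weight_le]) (use x in \<open>intro divide_left_mono mult_pos_pos add_pos_nonneg, auto\<close>)
        then have "dyadic_weight N x ^ d \<le> (5 / norm x) ^ d" using dyadic_weight_nonneg by (intro power_mono) auto
        also have "\<dots> = 5 ^ d * (1 / norm x ^ d)" by (simp add: power_divide)
        also have "1 / norm x ^ d = norm x powr (- 1 - 0) / norm x ^ (d - 1)"
          using x d1 by (cases d) (simp_all add: powr_minus_divide)
        finally have "ennreal (dyadic_weight N x powr CARD('n)) \<le> ennreal (5 ^ d) * (ennreal (norm x powr (- 1 - 0) / norm x ^ (d - 1)) * indicator {1..\<rho>} (norm x))"
          using 2 unfolding D by (simp add: ennreal_leI flip: ennreal_mult)
        then show ?thesis unfolding f_def by (simp add: add_increasing add_increasing2)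
      next
        case 3
        then have x: "norm x > 0" using \<rho>0 by linarith
        then have "x \<noteq> 0" by auto
        have "dyadic_weight N x \<le> 4 * \<rho> / (norm x)\<^sup>2"
          by (rule dyadic_weight_tail[OF \<open>x \<noteq> 0\<close>]) (use N in \<open>simp add: \<rho>_def\<close>)
        then have "dyadic_weight N x ^ d \<le> (4 * \<rho> / (norm x)\<^sup>2) ^ d" using dyadic_weight_nonneg by (intro power_mono) auto
        also have "\<dots> = (4 * \<rho>) ^ d * (1 / ((norm x)\<^sup>2) ^ d)" by (simp add: power_divide)
        also have "1 / ((norm x)\<^sup>2) ^ d = norm x powr (- (real d + 1)) / norm x ^ (d - 1)"
        proof -
          have "((norm x)\<^sup>2) ^ d = norm x ^ (d + 1) * norm x ^ (d - 1)"
          proof -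
            have e: "2 * d = (d + 1) + (d - 1)" using d1 by simp
            have "((norm x)\<^sup>2) ^ d = norm x ^ (2 * d)" by (rule power_mult[symmetric])
            then show ?thesis unfolding e power_add .
          qed
          moreover have "norm x powr (- (real d + 1)) = 1 / norm x ^ (d + 1)"
            using x by (simp only: powr_minus_divide) (simp add: powr_add powr_realpow mult.commute)
          ultimately show ?thesis by simp
        qed
        finally have "ennreal (dyadic_weight N x powr CARD('n)) \<le> ennreal ((4 * \<rho>) ^ d) * (ennreal (norm x powr (- (real d + 1)) / norm x ^ (d - 1)) * indicator {\<rho>..} (norm x))"
          using 3 \<rho>0 unfolding D by (simp add: ennreal_leI flip: ennreal_mult)
        then show ?thesis unfolding f_def by (simp add: add_increasing)
      qed
    qed
    have cancel: "ennreal (real d * \<omega> * r ^ (d - 1)) * indicator {0..} r * (ennreal c * (ennreal (g / r ^ (d - 1)) * indicator S r))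
       = ennreal (real d * \<omega> * c) * (ennreal g * indicator S r)" if S: "S \<subseteq> {0<..}" and g: "g \<ge> 0" and c: "c \<ge> 0" for r c g :: real and S
    proof (cases "r \<in> S")
      case True
      then have r: "r > 0" using S by auto
      have "real d * \<omega> * r ^ (d - 1) * (c * (g / r ^ (d - 1))) = real d * \<omega> * c * g" using r by simp
      then show ?thesis using True r w0 g c by (simp flip: ennreal_mult)
    qed simp
    have i2: "(\<integral>\<^sup>+r. ennreal (real d * \<omega> * r ^ (d - 1)) * indicator {0..} r * (ennreal (5 ^ d) * (ennreal (r powr (- 1 - 0) / r ^ (d - 1)) * indicator {1..\<rho>} r)) \<partial>lborel)
       \<le> ennreal (real d * \<omega> * 5 ^ d * (C1 * \<bar>ln \<epsilon>\<bar>))"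
    proof -
      have "(\<integral>\<^sup>+r. ennreal (real d * \<omega> * r ^ (d - 1)) * indicator {0..} r * (ennreal (5 ^ d) * (ennreal (r powr (- 1 - 0) / r ^ (d - 1)) * indicator {1..\<rho>} r)) \<partial>lborel)
        = ennreal (real d * \<omega> * 5 ^ d) * (\<integral>\<^sup>+r. ennreal (r powr (- 1 - 0)) * indicator {1..\<rho>} r \<partial>lborel)"
        by (subst nn_integral_cmult[symmetric], measurable) (intro nn_integral_cong cancel, auto)
      also have "\<dots> \<le> ennreal (real d * \<omega> * 5 ^ d) * ennreal (C1 * resonance_growth 0 \<epsilon>)"
        unfolding \<rho>_def by (intro mult_left_mono C1 e) simp
      also have "\<dots> = ennreal (real d * \<omega> * 5 ^ d * (C1 * \<bar>ln \<epsilon>\<bar>))"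
        using w0 C1 by (simp add: resonance_growth_def flip: ennreal_mult)
      finally show ?thesis .
    qed
    have i3: "(\<integral>\<^sup>+r. ennreal (real d * \<omega> * r ^ (d - 1)) * indicator {0..} r * (ennreal ((4 * \<rho>) ^ d) * (ennreal (r powr (- (real d + 1)) / r ^ (d - 1)) * indicator {\<rho>..} r)) \<partial>lborel)
       = ennreal (\<omega> * 4 ^ d)"
    proof -
      have "(\<integral>\<^sup>+r. ennreal (real d * \<omega> * r ^ (d - 1)) * indicator {0..} r * (ennreal ((4 * \<rho>) ^ d) * (ennreal (r powr (- (real d + 1)) / r ^ (d - 1)) * indicator {\<rho>..} r)) \<partial>lborel)
        = ennreal (real d * \<omega> * (4 * \<rho>) ^ d) * (\<integral>\<^sup>+r. ennreal (r powr (- (real d + 1))) * indicator {\<rho>..} r \<partial>lborel)"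
        by (subst nn_integral_cmult[symmetric], measurable) (intro nn_integral_cong cancel, use \<rho>0 in auto)
      also have "(\<integral>\<^sup>+r. ennreal (r powr (- (real d + 1))) * indicator {\<rho>..} r \<partial>lborel) = 0 - (\<rho> powr (- real d) / (- real d))"
      proof (rule nn_integral_FTC_atLeast[where F="\<lambda>r. r powr (- real d) / (- real d)"])
        fix r assume "\<rho> \<le> r"
        then have r: "r > 0" using \<rho>0 by linarith
        have "((\<lambda>r. r powr (- real d) / (- real d)) has_real_derivative (- real d * r powr (- real d - 1)) / (- real d)) (at r)"
          by (rule DERIV_cdivide[OF has_real_derivative_powr[OF r]])
        moreover have "(- real d * X) / (- real d) = X" for X using d1 by simp
        moreover have "- real d - 1 = - (real d + 1)" by simp
        ultimately show "((\<lambda>r. r powr (- real d) / (- real d)) has_real_derivative r powr (- (real d + 1))) (at r)" by (simp only:)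
      next
        have "((\<lambda>r. r powr (- real d)) \<longlongrightarrow> 0) at_top"
          by (rule tendsto_neg_powr) (use d1 filterlim_ident in auto)
        then have "((\<lambda>r. r powr (- real d) / (- real d)) \<longlongrightarrow> 0 / (- real d)) at_top"
          by (intro tendsto_divide tendsto_const) (use d1 in auto)
        then show "((\<lambda>r. r powr (- real d) / (- real d)) \<longlongrightarrow> 0) at_top" by simp
      qed auto
      also have "ennreal (real d * \<omega> * (4 * \<rho>) ^ d) * ennreal (0 - (\<rho> powr (- real d) / (- real d))) = ennreal (\<omega> * 4 ^ d)"
      proof -
        have "\<rho> powr (- real d) = 1 / \<rho> ^ d" using \<rho>0 by (simp add: powr_minus_divide powr_realpow)
        then have "real d * \<omega> * (4 * \<rho>) ^ d * (0 - (\<rho> powr (- real d) / (- real d))) = \<omega> * 4 ^ d"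
          using \<rho>0 d1 by (simp add: power_mult_distrib)
        then show ?thesis using w0 \<rho>0 by (subst ennreal_mult[symmetric]) auto
      qed
      finally show ?thesis .
    qed
    have i1: "(\<integral>\<^sup>+r. ennreal (real d * \<omega> * r ^ (d - 1)) * indicator {0..} r * (ennreal (5 ^ d) * indicator {0..1} r) \<partial>lborel) = ennreal (\<omega> * 5 ^ d)"
    proof -
      have "(\<integral>\<^sup>+r. ennreal (real d * \<omega> * r ^ (d - 1)) * indicator {0..} r * (ennreal (5 ^ d) * indicator {0..1} r) \<partial>lborel)
        = (\<integral>\<^sup>+x. ennreal (5 ^ d) * indicator {0..1} (norm x) \<partial>(lborel :: (real^'n) measure))"
        by (subst nn_integral_radial[where f="\<lambda>r. ennreal (5 ^ d) * indicator {0..1} r"]) (simp_all add: d_def \<omega>_def)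
      also have "\<dots> = (\<integral>\<^sup>+x. ennreal (5 ^ d) * indicator (cball 0 1) x \<partial>(lborel :: (real^'n) measure))"
        by (intro nn_integral_cong) (auto simp: indicator_def)
      also have "\<dots> = ennreal (5 ^ d) * ennreal \<omega>"
        by (subst nn_integral_cmult_indicator) (simp_all add: emeasure_cball \<omega>_def d_def)
      also have "\<dots> = ennreal (\<omega> * 5 ^ d)" using w0 by (subst ennreal_mult[symmetric]) (auto simp: mult.commute)
      finally show ?thesis .
    qed
    have "(\<integral>\<^sup>+x. ennreal (dyadic_weight N x powr CARD('n)) \<partial>(lborel :: (real^'n) measure)) \<le> (\<integral>\<^sup>+x. f (norm x) \<partial>(lborel :: (real^'n) measure))"
      by (intro nn_integral_mono pt)
    also have "\<dots> = (\<integral>\<^sup>+r. ennreal (real d * \<omega> * r ^ (d - 1)) * indicator {0..} r * f r \<partial>lborel)"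
      by (subst nn_integral_radial) (simp_all add: d_def \<omega>_def)
    also have "\<dots> = (\<integral>\<^sup>+r. ennreal (real d * \<omega> * r ^ (d - 1)) * indicator {0..} r * (ennreal (5 ^ d) * indicator {0..1} r) \<partial>lborel)
      + (\<integral>\<^sup>+r. ennreal (real d * \<omega> * r ^ (d - 1)) * indicator {0..} r * (ennreal (5 ^ d) * (ennreal (r powr (- 1 - 0) / r ^ (d - 1)) * indicator {1..\<rho>} r)) \<partial>lborel)
      + (\<integral>\<^sup>+r. ennreal (real d * \<omega> * r ^ (d - 1)) * indicator {0..} r * (ennreal ((4 * \<rho>) ^ d) * (ennreal (r powr (- (real d + 1)) / r ^ (d - 1)) * indicator {\<rho>..} r)) \<partial>lborel)"
      unfolding f_def distrib_left by (subst nn_integral_add; measurable)+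
    also have "\<dots> \<le> ennreal (\<omega> * 5 ^ d) + ennreal (real d * \<omega> * 5 ^ d * (C1 * \<bar>ln \<epsilon>\<bar>)) + ennreal (\<omega> * 4 ^ d)"
      unfolding i1 i3 by (intro add_right_mono add_left_mono i2)
    also have "\<dots> = ennreal (\<omega> * 5 ^ d + real d * \<omega> * 5 ^ d * (C1 * \<bar>ln \<epsilon>\<bar>) + \<omega> * 4 ^ d)"
      using w0 C1 by (simp flip: ennreal_plus)
    also have "\<dots> \<le> ennreal (D * \<bar>ln \<epsilon>\<bar>)"
    proof (rule ennreal_leI)
      have "\<omega> * 5 ^ d * 1 \<le> \<omega> * 5 ^ d * \<bar>ln \<epsilon>\<bar>" "\<omega> * 4 ^ d * 1 \<le> \<omega> * 4 ^ d * \<bar>ln \<epsilon>\<bar>"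
        using w0 L by (intro mult_left_mono; simp)+
      then show "\<omega> * 5 ^ d + real d * \<omega> * 5 ^ d * (C1 * \<bar>ln \<epsilon>\<bar>) + \<omega> * 4 ^ d \<le> D * \<bar>ln \<epsilon>\<bar>"
        by (simp add: D_def distrib_right)
    qed
    finally show "(\<integral>\<^sup>+x. ennreal (dyadic_weight N x powr CARD('n)) \<partial>(lborel :: (real^'n) measure)) \<le> ennreal (D * \<bar>ln \<epsilon>\<bar>)" .
  qed
qed

section \<open>Asymptotics of the minimal level and of the mass\<close>

text \<open>Duality with a Gaussian of width \<open>r\<close> has \<open>a\<close> of order
  \<open>r\<close> and \<open>b\<close> of order \<open>r ^ d\<close>, giving a bound of order
  \<open>r powr (- \<kappa>)\<close>. The best width is \<open>1\<close> for positive
  \<open>\<kappa>\<close> and the largest admissible one, \<open>1 / \<delta>\<close>, for negative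
  \<open>\<kappa>\<close>. At \<open>\<kappa> = 0\<close> all widths are equally good, and
  superposing the dyadic ones gains the number of scales.\<close>

lemma shell_wave_Lp_lower:
  fixes \<alpha> :: real
  assumes \<alpha>: "\<alpha> > 0" and d2: "CARD('n::finite) \<ge> 2"
  defines "\<kappa> \<equiv> (real CARD('n) - 1) * \<alpha> / 2 - 1"
  obtains c where "c > 0" "\<And>\<delta>. \<lbrakk>0 < \<delta>; \<delta> \<le> 1/2; \<delta>\<^sup>2 \<le> exp (- 1)\<rbrakk> \<Longrightarrow>
    ennreal (c * resonance_growth \<kappa> (\<delta>\<^sup>2)) \<le> (\<integral>\<^sup>+x. ennreal (norm (shell_wave \<delta> x) powr (\<alpha> + 2)) \<partial>(lborel :: (real^'n) measure))"
proof -
  define d where "d = CARD('n)"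
  obtain c where c: "c > 0" "\<And>\<delta> r. \<lbrakk>0 < \<delta>; \<delta> \<le> 1/2; 1 \<le> r; r \<le> 1 / \<delta>\<rbrakk> \<Longrightarrow>
    ennreal (c * r) \<le> (\<integral>\<^sup>+x. ennreal ((norm (shell_wave \<delta> x))\<^sup>2 * gauss (1 / r\<^sup>2) x) \<partial>(lborel :: (real^'n) measure))"
    using shell_wave_gauss_mass by blast
  define \<beta> where "\<beta> = 1 + 2 / \<alpha>"
  have \<beta>: "\<beta> > 0" using \<alpha> by (simp add: \<beta>_def add_pos_pos)
  define G where "G = (2 * pi / \<beta>) powr (real d / 2)"
  have G0: "G > 0" using \<beta> by (simp add: G_def)
  define K where "K = c / 2 * (2 * G / c) powr (- \<alpha> / 2)"
  have K0: "K > 0" using c G0 by (simp add: K_def)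
  have single: "ennreal (c * r / 2 * (2 * (G * r ^ d) / (c * r)) powr (- \<alpha> / 2)) \<le> (\<integral>\<^sup>+x. ennreal (norm (shell_wave \<delta> x) powr (\<alpha> + 2)) \<partial>(lborel :: (real^'n) measure))"
    if \<delta>: "0 < \<delta>" "\<delta> \<le> 1/2" and r: "1 \<le> r" "r \<le> 1 / \<delta>" for \<delta> r
  proof (rule weight_duality[where \<phi>="gauss (1 / r\<^sup>2)"])
    have "(shell_wave \<delta> :: real^'n \<Rightarrow> complex) \<in> L2_space"
      using shell_wave_H2_rad(1)[OF \<delta>, where 'n='n] by (simp add: H2_rad_def H2_spaceD)
    then show "(shell_wave \<delta> :: real^'n \<Rightarrow> complex) \<in> borel_measurable borel" by (rule L2_spaceD)
    show "ennreal (c * r) \<le> (\<integral>\<^sup>+x. ennreal ((norm (shell_wave \<delta> x))\<^sup>2 * gauss (1 / r\<^sup>2) x) \<partial>(lborel :: (real^'n) measure))"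
      by (rule c(2)[OF \<delta> r])
    show "(\<integral>\<^sup>+x. ennreal (gauss (1 / r\<^sup>2) x powr (1 + 2 / \<alpha>)) \<partial>(lborel :: (real^'n) measure)) \<le> ennreal (G * r ^ d)"
      using nn_integral_gauss_powr[of r "1 + 2 / \<alpha>", where 'n='n] r \<beta> by (simp add: G_def \<beta>_def d_def)
  qed (use \<alpha> c G0 r in auto)
  consider "\<kappa> > 0" | "\<kappa> = 0" | "\<kappa> < 0" by linarith
  then show thesis
  proof cases
    case 1
    show thesis
    proof (rule that[OF K0])
      fix \<delta> :: real assume \<delta>: "0 < \<delta>" "\<delta> \<le> 1/2"
      have "1 \<le> 1 / \<delta>" using \<delta> by simp
      from single[OF \<delta> order_refl this]
      show "ennreal (K * resonance_growth \<kappa> (\<delta>\<^sup>2)) \<le> (\<integral>\<^sup>+x. ennreal (norm (shell_wave \<delta> x) powr (\<alpha> + 2)) \<partial>(lborel :: (real^'n) measure))"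
        using 1 by (simp add: resonance_growth_def K_def)
    qed
  next
    case 3
    show thesis
    proof (rule that[OF K0])
      fix \<delta> :: real assume \<delta>: "0 < \<delta>" "\<delta> \<le> 1/2"
      define r where "r = 1 / \<delta>"
      have r: "1 \<le> r" "r \<le> 1 / \<delta>" using \<delta> by (simp_all add: r_def)
      have r0: "r > 0" using r by linarith
      have "2 * (G * r ^ d) / (c * r) = 2 * G / c * r powr (real d - 1)"
        using r0 by (simp add: powr_diff powr_realpow)
      then have "(2 * (G * r ^ d) / (c * r)) powr (- \<alpha> / 2) = (2 * G / c) powr (- \<alpha> / 2) * (r powr (real d - 1)) powr (- \<alpha> / 2)"
        by (simp only: powr_mult)
      also have "(r powr (real d - 1)) powr (- \<alpha> / 2) = r powr (- \<kappa> - 1)"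
        unfolding powr_powr by (simp add: \<kappa>_def d_def)
      finally have "c * r / 2 * (2 * (G * r ^ d) / (c * r)) powr (- \<alpha> / 2) = K * (r powr (- \<kappa> - 1) * r)"
        by (simp add: K_def)
      also have "r powr (- \<kappa> - 1) * r = r powr (- \<kappa>)" using r0 by (simp add: powr_diff)
      also have "r powr (- \<kappa>) = (\<delta>\<^sup>2) powr (\<kappa> / 2)"
      proof -
        have "(\<delta>\<^sup>2) powr (\<kappa> / 2) = (\<delta> powr 2) powr (\<kappa> / 2)" using \<delta> by simp
        also have "\<dots> = \<delta> powr \<kappa>" unfolding powr_powr by simp
        also have "\<dots> = r powr (- \<kappa>)" using \<delta> by (simp add: r_def powr_divide powr_minus_divide)
        finally show ?thesis by simp
      qed
      finally show "ennreal (K * resonance_growth \<kappa> (\<delta>\<^sup>2)) \<le> (\<integral>\<^sup>+x. ennreal (norm (shell_wave \<delta> x) powr (\<alpha> + 2)) \<partial>(lborel :: (real^'n) measure))"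
        using single[OF \<delta> r] 3 by (simp add: resonance_growth_def)
    qed
  next
    case 2
    then have ad: "(real d - 1) * \<alpha> = 2" by (simp add: \<kappa>_def d_def)
    then have bd: "1 + 2 / \<alpha> = real d" using \<alpha> by (simp add: field_simps)
    obtain C where C: "C > 0" "\<And>\<epsilon> N. \<lbrakk>0 < \<epsilon>; \<epsilon> \<le> exp (- 1); 2 ^ N \<le> \<epsilon> powr (- 1/2)\<rbrakk> \<Longrightarrow>
      (\<integral>\<^sup>+x. ennreal (dyadic_weight N x powr CARD('n)) \<partial>(lborel :: (real^'n) measure)) \<le> ennreal (C * \<bar>ln \<epsilon>\<bar>)"
      using dyadic_weight_power_integral by blast
    \<comment> \<open>Here both \<open>a\<close> and \<open>b\<close> are multiples of
      \<open>\<bar>ln (\<delta>\<^sup>2)\<bar>\<close>, so \<open>2 * b / a\<close> is the constant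
      \<open>4 * C / c\<close> and the bound keeps one full logarithm from \<open>a\<close>.\<close>
    define K' where "K' = c / 2 / 2 * (4 * C / c) powr (- \<alpha> / 2)"
    have K'0: "K' > 0" using c C by (simp add: K'_def)
    show thesis
    proof (rule that[OF K'0])
      fix \<delta> :: real assume \<delta>: "0 < \<delta>" "\<delta> \<le> 1/2" and \<delta>e: "\<delta>\<^sup>2 \<le> exp (- 1)"
      define \<rho> where "\<rho> = 1 / \<delta>"
      have \<rho>: "\<rho> \<ge> 2" using \<delta> by (simp add: \<rho>_def field_simps)
      have \<delta>2: "\<delta>\<^sup>2 > 0" using \<delta> by simp
      have \<rho>eq: "(\<delta>\<^sup>2) powr (- 1/2) = \<rho>"
      proof -
        have "(\<delta>\<^sup>2) powr (- 1/2) = (\<delta> powr 2) powr (- 1/2)" using \<delta> by simp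
        also have "\<dots> = \<delta> powr (- 1)" unfolding powr_powr by simp
        also have "\<dots> = \<rho>" using \<delta> by (simp add: \<rho>_def powr_minus_divide)
        finally show ?thesis .
      qed
      have L1: "\<bar>ln (\<delta>\<^sup>2)\<bar> \<ge> 1" by (rule abs_ln_ge_1[OF \<delta>2 \<delta>e])
      have Leq: "\<bar>ln (\<delta>\<^sup>2)\<bar> = 2 * ln \<rho>"
        using \<delta> by (simp add: \<rho>_def ln_div ln_realpow)
      \<comment> \<open>The largest \<open>N\<close> for which every width \<open>2 ^ k\<close> with
        \<open>k \<le> N\<close> stays below \<open>1 / \<delta>\<close>. Rounding costs less than
        one scale, so the \<open>N + 1\<close> scales from \<open>0\<close> to \<open>N\<close>
        number at least \<open>log 2 \<rho>\<close>, hence at least \<open>ln \<rho>\<close> as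
        \<open>ln 2 \<le> 1\<close>.\<close>
      define N where "N = nat \<lfloor>log 2 \<rho>\<rfloor>"
      have l0: "log 2 \<rho> \<ge> 0" using \<rho> by simp
      have N1: "real N \<le> log 2 \<rho>" and N2: "log 2 \<rho> \<le> real N + 1"
        using l0 unfolding N_def by linarith+
      have N3: "2 ^ N \<le> \<rho>"
      proof -
        have "2 powr real N \<le> 2 powr (log 2 \<rho>)" using N1 by (intro powr_mono) auto
        then show ?thesis using \<rho> by (simp add: powr_realpow)
      qed
      have "ln \<rho> \<le> log 2 \<rho>"
      proof -
        have "ln (2::real) \<le> 1" using ln_le_minus_one[of "2::real"] by simp
        then have "ln \<rho> * ln 2 \<le> ln \<rho>" using \<rho> by (intro mult_left_le) auto
        then show ?thesis by (simp add: log_def pos_le_divide_eq)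
      qed
      then have N4: "\<bar>ln (\<delta>\<^sup>2)\<bar> / 2 \<le> real N + 1" using N2 Leq by linarith
      have mass: "ennreal (c * (\<bar>ln (\<delta>\<^sup>2)\<bar> / 2)) \<le> (\<integral>\<^sup>+x. ennreal ((norm (shell_wave \<delta> x))\<^sup>2 * dyadic_weight N x) \<partial>(lborel :: (real^'n) measure))"
      proof -
        have sL: "(shell_wave \<delta> :: real^'n \<Rightarrow> complex) \<in> L2_space"
          using shell_wave_H2_rad(1)[OF \<delta>, where 'n='n] by (simp add: H2_rad_def H2_spaceD)
        note [measurable] = L2_spaceD(1)[OF sL]
        have "ennreal (c * (\<bar>ln (\<delta>\<^sup>2)\<bar> / 2)) \<le> ennreal (c * (real N + 1))"
          using N4 c by (intro ennreal_leI mult_left_mono) auto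
        also have "\<dots> = (\<Sum>k\<le>N. ennreal c)"
          using c by (subst sum_ennreal) (auto simp: algebra_simps)
        also have "\<dots> \<le> (\<Sum>k\<le>N. \<integral>\<^sup>+x. ennreal ((1/2) ^ k) * ennreal ((norm (shell_wave \<delta> x))\<^sup>2 * gauss (1 / (2 ^ k)\<^sup>2) x) \<partial>(lborel :: (real^'n) measure))"
        proof (rule sum_mono)
          fix k assume "k \<in> {..N}"
          then have "(2::real) ^ k \<le> 2 ^ N" by (intro power_increasing) auto
          from order_trans[OF this N3] have k: "(2::real) ^ k \<le> 1 / \<delta>" by (simp only: \<rho>_def)
          have "ennreal c = ennreal ((1/2) ^ k) * ennreal (c * 2 ^ k)"
            using c by (subst ennreal_mult[symmetric]) (auto simp: power_divide)
          also have "\<dots> \<le> ennreal ((1/2) ^ k) * (\<integral>\<^sup>+x. ennreal ((norm (shell_wave \<delta> x))\<^sup>2 * gauss (1 / (2 ^ k)\<^sup>2) x) \<partial>(lborel :: (real^'n) measure))"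
            by (intro mult_left_mono c(2) \<delta> k) auto
          also have "\<dots> = (\<integral>\<^sup>+x. ennreal ((1/2) ^ k) * ennreal ((norm (shell_wave \<delta> x))\<^sup>2 * gauss (1 / (2 ^ k)\<^sup>2) x) \<partial>(lborel :: (real^'n) measure))"
            by (rule nn_integral_cmult[symmetric]) measurable
          finally show "ennreal c \<le> \<dots>" .
        qed
        also have "\<dots> = (\<integral>\<^sup>+x. (\<Sum>k\<le>N. ennreal ((1/2) ^ k) * ennreal ((norm (shell_wave \<delta> x))\<^sup>2 * gauss (1 / (2 ^ k)\<^sup>2) x)) \<partial>(lborel :: (real^'n) measure))"
          by (rule nn_integral_sum[symmetric]) measurable
        also have "\<dots> = (\<integral>\<^sup>+x. ennreal ((norm (shell_wave \<delta> x))\<^sup>2 * dyadic_weight N x) \<partial>(lborel :: (real^'n) measure))"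
        proof (rule nn_integral_cong)
          fix x :: "real^'n"
          have "(\<Sum>k\<le>N. ennreal ((1/2) ^ k) * ennreal ((norm (shell_wave \<delta> x))\<^sup>2 * gauss (1 / (2 ^ k)\<^sup>2) x))
             = (\<Sum>k\<le>N. ennreal ((norm (shell_wave \<delta> x))\<^sup>2 * ((1/2) ^ k * gauss (1 / (2 ^ k)\<^sup>2) x)))"
          proof (rule sum.cong)
            fix k
            have "(1/2) ^ k * ((norm (shell_wave \<delta> x))\<^sup>2 * gauss (1 / (2 ^ k)\<^sup>2) x) = (norm (shell_wave \<delta> x))\<^sup>2 * ((1/2) ^ k * gauss (1 / (2 ^ k)\<^sup>2) x)"
              by (rule mult.left_commute)
            then show "ennreal ((1/2) ^ k) * ennreal ((norm (shell_wave \<delta> x))\<^sup>2 * gauss (1 / (2 ^ k)\<^sup>2) x)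
              = ennreal ((norm (shell_wave \<delta> x))\<^sup>2 * ((1/2) ^ k * gauss (1 / (2 ^ k)\<^sup>2) x))"
              by (subst ennreal_mult[symmetric]) (simp_all only: zero_le_power zero_le_mult_iff gauss_nonneg zero_le_power2 simp_thms zero_le_divide_1_iff zero_le_numeral)
          qed simp
          also have "\<dots> = ennreal ((norm (shell_wave \<delta> x))\<^sup>2 * dyadic_weight N x)"
            unfolding dyadic_weight_def sum_distrib_left by (rule sum_ennreal) simp
          finally show "(\<Sum>k\<le>N. ennreal ((1/2) ^ k) * ennreal ((norm (shell_wave \<delta> x))\<^sup>2 * gauss (1 / (2 ^ k)\<^sup>2) x)) = ennreal ((norm (shell_wave \<delta> x))\<^sup>2 * dyadic_weight N x)" .
        qed
        finally show ?thesis .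
      qed
      have "ennreal (c * (\<bar>ln (\<delta>\<^sup>2)\<bar> / 2) / 2 * (2 * (C * \<bar>ln (\<delta>\<^sup>2)\<bar>) / (c * (\<bar>ln (\<delta>\<^sup>2)\<bar> / 2))) powr (- \<alpha> / 2))
        \<le> (\<integral>\<^sup>+x. ennreal (norm (shell_wave \<delta> x) powr (\<alpha> + 2)) \<partial>(lborel :: (real^'n) measure))"
      proof (rule weight_duality[where \<phi>="dyadic_weight N"])
        have "(shell_wave \<delta> :: real^'n \<Rightarrow> complex) \<in> L2_space"
          using shell_wave_H2_rad(1)[OF \<delta>, where 'n='n] by (simp add: H2_rad_def H2_spaceD)
        then show "(shell_wave \<delta> :: real^'n \<Rightarrow> complex) \<in> borel_measurable borel" by (rule L2_spaceD)
        show "(\<integral>\<^sup>+x. ennreal (dyadic_weight N x powr (1 + 2 / \<alpha>)) \<partial>(lborel :: (real^'n) measure)) \<le> ennreal (C * \<bar>ln (\<delta>\<^sup>2)\<bar>)"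
          unfolding bd d_def by (rule C(2)[OF \<delta>2 \<delta>e]) (simp only: \<rho>eq N3)
        show "0 < c * (\<bar>ln (\<delta>\<^sup>2)\<bar> / 2)" using c L1 by (intro mult_pos_pos) linarith+
        show "0 < C * \<bar>ln (\<delta>\<^sup>2)\<bar>" using C L1 by (intro mult_pos_pos) linarith+
      qed (use \<alpha> mass dyadic_weight_nonneg in auto)
      also have "2 * (C * \<bar>ln (\<delta>\<^sup>2)\<bar>) / (c * (\<bar>ln (\<delta>\<^sup>2)\<bar> / 2)) = 4 * C / c"
      proof -
        have "l > 0 \<Longrightarrow> 2 * (C * l) / (c * (l / 2)) = 4 * C / c" for l :: real by simp
        then show ?thesis using L1 by (metis less_le_trans zero_less_one)
      qed
      also have "c * (\<bar>ln (\<delta>\<^sup>2)\<bar> / 2) / 2 * (4 * C / c) powr (- \<alpha> / 2) = K' * resonance_growth \<kappa> (\<delta>\<^sup>2)"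
        using 2 unfolding K'_def resonance_growth_def by simp
      finally show "ennreal (K' * resonance_growth \<kappa> (\<delta>\<^sup>2)) \<le> (\<integral>\<^sup>+x. ennreal (norm (shell_wave \<delta> x) powr (\<alpha> + 2)) \<partial>(lborel :: (real^'n) measure))" .
    qed
  qed
qed

text \<open>The test function with \<open>\<delta> = sqrt \<epsilon> \<le> 1/2\<close> requires
  \<open>\<epsilon> \<le> 1/4\<close>; this makes the bounds stated for
  \<open>\<epsilon> \<le> exp (- 1)\<close> available as well.\<close>

lemma quarter_le_exp: "1/4 \<le> exp (- 1 :: real)"
proof -
  have "exp 1 \<le> (4::real)" using exp_le by simp
  then have "1 / 4 \<le> 1 / exp (1::real)" by (intro divide_left_mono) auto
  then show ?thesis by (simp add: exp_minus inverse_eq_divide)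
qed

text \<open>The comparison function for the minimal quotient. The \<open>L^p\<close> integral is at
  most of order \<open>resonance_growth\<close> when the energy is \<open>sqrt \<epsilon>\<close>,
  and the quotient has its power \<open>2 / (\<alpha> + 2)\<close> in the denominator.\<close>

definition ground_level :: "real \<Rightarrow> real \<Rightarrow> real \<Rightarrow> real" where
  "ground_level \<alpha> \<kappa> \<epsilon> = sqrt \<epsilon> * resonance_growth \<kappa> \<epsilon> powr (- (2 / (\<alpha> + 2)))"

lemma R_rad_bounds:
  fixes \<alpha> :: real
  assumes \<alpha>: "\<alpha> > 0" and d2: "CARD('n::finite) \<ge> 2" and sub: "real CARD('n) \<ge> 5 \<longrightarrow> \<alpha> < 8 / (real CARD('n) - 4)"
  defines "\<kappa> \<equiv> (real CARD('n) - 1) * \<alpha> / 2 - 1"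
  obtains c C where "0 < c" "0 < C" "\<And>\<epsilon>. \<lbrakk>0 < \<epsilon>; \<epsilon> \<le> 1/4\<rbrakk> \<Longrightarrow>
    c * ground_level \<alpha> \<kappa> \<epsilon> \<le> R_rad TYPE(real^'n) \<alpha> \<epsilon> \<and> R_rad TYPE(real^'n) \<alpha> \<epsilon> \<le> C * ground_level \<alpha> \<kappa> \<epsilon>"
    "\<And>\<epsilon> u :: real^'n \<Rightarrow> complex. \<lbrakk>0 < \<epsilon>; u \<in> H2_rad; \<not> (AE x in lborel. u x = 0)\<rbrakk> \<Longrightarrow> R_rad TYPE(real^'n) \<alpha> \<epsilon> \<le> rayleigh_quotient \<alpha> \<epsilon> u"
proof -
  obtain c where c: "c > 0" "\<And>\<epsilon> (u :: real^'n \<Rightarrow> complex). \<lbrakk>0 < \<epsilon>; \<epsilon> \<le> exp (- 1); u \<in> H2_rad; \<not> (AE x in lborel. u x = 0)\<rbrakk> \<Longrightarrow>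
    integrable lborel (\<lambda>x. norm (u x) powr (\<alpha> + 2)) \<and> c * ground_level \<alpha> \<kappa> \<epsilon> \<le> rayleigh_quotient \<alpha> \<epsilon> u"
    unfolding \<kappa>_def ground_level_def using rayleigh_quotient_lower[OF \<alpha> sub] by blast
  obtain C1 where C1: "C1 > 0" "\<And>\<delta>. \<lbrakk>0 < \<delta>; \<delta> \<le> 1/2\<rbrakk> \<Longrightarrow> energy (\<delta>\<^sup>2) (shell_wave \<delta> :: real^'n \<Rightarrow> complex) \<le> C1 * \<delta>"
    using energy_shell_wave_le by blast
  obtain c1 where c1: "c1 > 0" "\<And>\<delta>. \<lbrakk>0 < \<delta>; \<delta> \<le> 1/2; \<delta>\<^sup>2 \<le> exp (- 1)\<rbrakk> \<Longrightarrow>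
    ennreal (c1 * resonance_growth \<kappa> (\<delta>\<^sup>2)) \<le> (\<integral>\<^sup>+x. ennreal (norm (shell_wave \<delta> x) powr (\<alpha> + 2)) \<partial>(lborel :: (real^'n) measure))"
    unfolding \<kappa>_def using shell_wave_Lp_lower[OF \<alpha> d2] by blast
  let ?q = "2 / (\<alpha> + 2)"
  let ?S = "{u :: real^'n \<Rightarrow> complex. u \<in> H2_rad \<and> \<not> (AE x in lborel. u x = 0)}"
  have le: "R_rad TYPE(real^'n) \<alpha> \<epsilon> \<le> rayleigh_quotient \<alpha> \<epsilon> u" if "0 < \<epsilon>" "u \<in> ?S" for \<epsilon> u
    unfolding R_rad_def
  proof (rule cINF_lower[OF _ that(2)])
    show "bdd_below (rayleigh_quotient \<alpha> \<epsilon> ` ?S)"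
      by (intro bdd_belowI[of _ 0]) (auto simp: rayleigh_quotient_energy intro!: divide_nonneg_nonneg energy_nonneg that(1))
  qed
  have main: "(shell_wave (sqrt \<epsilon>) :: real^'n \<Rightarrow> complex) \<in> ?S \<and> rayleigh_quotient \<alpha> \<epsilon> (shell_wave (sqrt \<epsilon>) :: real^'n \<Rightarrow> complex) \<le> C1 * c1 powr (- ?q) * ground_level \<alpha> \<kappa> \<epsilon>"
    if e: "0 < \<epsilon>" "\<epsilon> \<le> 1/4" for \<epsilon>
  proof -
    define \<delta> where "\<delta> = sqrt \<epsilon>"
    have "sqrt \<epsilon> \<le> sqrt (1/4)" using e by simp
    also have "sqrt (1/4) = 1/2" by (simp add: real_sqrt_divide)
    finally have \<delta>: "0 < \<delta>" "\<delta> \<le> 1/2" using e by (simp_all add: \<delta>_def)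
    have \<delta>2: "\<delta>\<^sup>2 = \<epsilon>" using e by (simp add: \<delta>_def)
    have ee: "\<epsilon> \<le> exp (- 1)" using e quarter_le_exp by linarith
    have G1: "resonance_growth \<kappa> \<epsilon> \<ge> 1" using resonance_growth_ge[OF e(1) ee] by auto
    let ?u = "shell_wave \<delta> :: real^'n \<Rightarrow> complex"
    have H: "?u \<in> H2_rad" by (rule shell_wave_H2_rad[OF \<delta>])
    note low = c1(2)[OF \<delta>, unfolded \<delta>2, OF ee]
    have pos: "c1 * resonance_growth \<kappa> \<epsilon> > 0" using c1 G1 by simp
    have nz: "\<not> (AE x in lborel. ?u x = 0)"
    proof
      assume "AE x in lborel. ?u x = 0"
      then have "(\<integral>\<^sup>+x. ennreal (norm (?u x) powr (\<alpha> + 2)) \<partial>lborel) = (\<integral>\<^sup>+(x::real^'n). 0 \<partial>lborel)"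
        by (intro nn_integral_cong_AE) (auto elim!: eventually_mono)
      then show False using low pos by (simp add: ennreal_eq_0_iff)
    qed
    define I where "I = (LINT x|lborel. norm (?u x) powr (\<alpha> + 2))"
    \<comment> \<open>Finiteness comes from the lower-bound lemma; without it the integral
      \<open>I\<close> could take the default value \<open>0\<close> and the extended bound
      \<open>low\<close> would say nothing about it.\<close>
    have int: "integrable lborel (\<lambda>x. norm (?u x) powr (\<alpha> + 2))" using c(2)[OF e(1) ee H nz] by blast
    have "ennreal (c1 * resonance_growth \<kappa> \<epsilon>) \<le> ennreal I"
      using low nn_integral_eq_integral[OF int] by (simp add: I_def)
    then have I: "c1 * resonance_growth \<kappa> \<epsilon> \<le> I" by (subst (asm) ennreal_le_iff) (simp_all add: I_def)
    have "(c1 * resonance_growth \<kappa> \<epsilon>) powr ?q \<le> I powr ?q" using I pos \<alpha> by (intro powr_mono2) auto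
    moreover have "(c1 * resonance_growth \<kappa> \<epsilon>) powr ?q > 0"
      by (rule powr_gt_zero[THEN iffD2]) (rule less_imp_neq[OF pos, THEN not_sym])
    ultimately have "energy \<epsilon> ?u / I powr ?q \<le> C1 * \<delta> / (c1 * resonance_growth \<kappa> \<epsilon>) powr ?q"
      using C1(2)[OF \<delta>] C1(1) \<delta> by (intro frac_le) (auto simp: \<delta>2)
    also have "\<dots> = C1 * c1 powr (- ?q) * ground_level \<alpha> \<kappa> \<epsilon>"
      unfolding powr_mult ground_level_def by (simp add: powr_minus_divide \<delta>_def)
    finally have "rayleigh_quotient \<alpha> \<epsilon> ?u \<le> C1 * c1 powr (- ?q) * ground_level \<alpha> \<kappa> \<epsilon>"
      unfolding rayleigh_quotient_energy Lp_norm_power2 I_def .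
    then show ?thesis using H nz by (simp add: \<delta>_def)
  qed
  show thesis
  proof (rule that[of c "C1 * c1 powr (- ?q)"])
    show "0 < c" by (rule c)
    show "0 < C1 * c1 powr (- ?q)" using C1 c1 by simp
    show "R_rad TYPE(real^'n) \<alpha> \<epsilon> \<le> rayleigh_quotient \<alpha> \<epsilon> u" if "0 < \<epsilon>" "u \<in> H2_rad" "\<not> (AE x in lborel. u x = 0)" for \<epsilon> and u :: "real^'n \<Rightarrow> complex"
      using le[OF that(1), of u] that by simp
    fix \<epsilon> :: real assume e: "0 < \<epsilon>" "\<epsilon> \<le> 1/4"
    have ee: "\<epsilon> \<le> exp (- 1)" using e quarter_le_exp by linarith
    show "c * ground_level \<alpha> \<kappa> \<epsilon> \<le> R_rad TYPE(real^'n) \<alpha> \<epsilon> \<and> R_rad TYPE(real^'n) \<alpha> \<epsilon> \<le> C1 * c1 powr (- ?q) * ground_level \<alpha> \<kappa> \<epsilon>"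
    proof
      show "c * ground_level \<alpha> \<kappa> \<epsilon> \<le> R_rad TYPE(real^'n) \<alpha> \<epsilon>"
        unfolding R_rad_def
      proof (rule cINF_greatest)
        show "?S \<noteq> {}" using main[OF e] by blast
        show "c * ground_level \<alpha> \<kappa> \<epsilon> \<le> rayleigh_quotient \<alpha> \<epsilon> u" if "u \<in> ?S" for u
          using c(2)[OF e(1) ee, of u] that by simp
      qed
      show "R_rad TYPE(real^'n) \<alpha> \<epsilon> \<le> C1 * c1 powr (- ?q) * ground_level \<alpha> \<kappa> \<epsilon>"
        using order_trans[OF le[OF e(1) conjunct1[OF main[OF e]]] conjunct2[OF main[OF e]]] .
    qed
  qed
qed

section \<open>From the minimal level to the mass\<close>

lemma mass_eq_L2_sq: "mass u = L2_sq u"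
proof -
  have "norm (u x) powr (0 + 2) = (norm (u x))\<^sup>2" for x by simp
  then show ?thesis
    using Lp_norm_power2[of 0 u] by (simp add: mass_def L2_sq_def)
qed

lemma L2_sq_scale: "L2_sq (\<lambda>x. complex_of_real a * u x) = a\<^sup>2 * L2_sq u"
  by (simp add: L2_sq_def norm_mult power_mult_distrib)

text \<open>The symbol is affine in \<open>\<epsilon>\<close> with slope \<open>1\<close>, so the
  mass is the slope of the energy. This is the link between the levels at two values of
  \<open>\<epsilon>\<close> and the mass of a minimizer.\<close>

lemma energy_shift:
  assumes u: "u \<in> H2_space" and e: "0 < \<epsilon>" "0 < \<epsilon>'"
  shows "energy \<epsilon>' u = energy \<epsilon> u + (\<epsilon>' - \<epsilon>) * L2_sq u"
proof -
  note fu = fourier_in_L2[OF H2_spaceD[OF u]]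
  have "energy \<epsilon>' u = (LINT \<xi>|lborel. symbol \<epsilon> \<xi> * (norm (fourier u \<xi>))\<^sup>2 + (\<epsilon>' - \<epsilon>) * (norm (fourier u \<xi>))\<^sup>2)"
    unfolding energy_def symbol_def by (intro Bochner_Integration.integral_cong) (auto simp: algebra_simps)
  also have "\<dots> = energy \<epsilon> u + (\<epsilon>' - \<epsilon>) * L2_sq (fourier u)"
    unfolding energy_def L2_sq_def using energy_integrable[OF u e(1)] L2_spaceD(2)[OF fu] by simp
  finally show ?thesis by (simp add: plancherel_L2[OF H2_spaceD[OF u]])
qed

lemma resonance_growth_antimono:
  assumes "0 < \<epsilon>" "\<epsilon> \<le> \<epsilon>'" "\<epsilon>' \<le> 1"
  shows "resonance_growth \<kappa> \<epsilon>' \<le> resonance_growth \<kappa> \<epsilon>"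
proof -
  have "ln \<epsilon> \<le> ln \<epsilon>'" "ln \<epsilon>' \<le> 0" using assms by auto
  then have "\<bar>ln \<epsilon>'\<bar> \<le> \<bar>ln \<epsilon>\<bar>" by simp
  moreover have "\<epsilon>' powr (\<kappa> / 2) \<le> \<epsilon> powr (\<kappa> / 2)" if "\<kappa> < 0"
    using that assms by (intro powr_mono2') auto
  ultimately show ?thesis by (auto simp: resonance_growth_def)
qed

text \<open>The growth factor does not increase with \<open>\<epsilon>\<close> and enters with a
  negative power, so in all three regimes the root alone provides the gain.\<close>

lemma ground_level_scale:
  assumes "0 < \<epsilon>" "1 \<le> K" "K * \<epsilon> \<le> 1/4" "\<alpha> > 0"
  shows "sqrt K * ground_level \<alpha> \<kappa> \<epsilon> \<le> ground_level \<alpha> \<kappa> (K * \<epsilon>)"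
proof -
  have K: "\<epsilon> \<le> K * \<epsilon>" using assms by simp
  have "K * \<epsilon> \<le> exp (- 1)" using assms quarter_le_exp by linarith
  then have G: "resonance_growth \<kappa> (K * \<epsilon>) \<ge> 1" using assms by (intro resonance_growth_ge) auto
  have "resonance_growth \<kappa> (K * \<epsilon>) \<le> resonance_growth \<kappa> \<epsilon>" using assms K by (intro resonance_growth_antimono) auto
  then have "resonance_growth \<kappa> \<epsilon> powr (- (2 / (\<alpha> + 2))) \<le> resonance_growth \<kappa> (K * \<epsilon>) powr (- (2 / (\<alpha> + 2)))"
    using G assms by (intro powr_mono2') auto
  then have "sqrt K * sqrt \<epsilon> * resonance_growth \<kappa> \<epsilon> powr (- (2 / (\<alpha> + 2))) \<le> sqrt K * sqrt \<epsilon> * resonance_growth \<kappa> (K * \<epsilon>) powr (- (2 / (\<alpha> + 2)))"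
    using assms by (intro mult_left_mono) auto
  then show ?thesis by (simp add: ground_level_def real_sqrt_mult mult.assoc)
qed

text \<open>The mass of \<open>Q\<close> is the level to the power \<open>2 / \<alpha>\<close> times
  the mass of the minimizer, which is of order level over \<open>\<epsilon>\<close>. As
  \<open>(2 / (\<alpha> + 2)) * (2 / \<alpha> + 1) = 2 / \<alpha>\<close>, this is
  \<open>\<epsilon> powr (1 / \<alpha> - 1/2)\<close> times the growth to the power
  \<open>- 2 / \<alpha>\<close>; the three values of the growth give the three rates.\<close>

lemma ground_level_mass:
  assumes e: "0 < \<epsilon>" and \<alpha>: "\<alpha> > 0" and d: "d > 1"
  defines "\<kappa> \<equiv> (d - 1) * \<alpha> / 2 - 1"
  shows "ground_level \<alpha> \<kappa> \<epsilon> powr (2 / \<alpha> + 1) / \<epsilon> =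
    (if \<alpha> < 2 / (d - 1) then \<epsilon> powr (2 / \<alpha> - d / 2)
     else if \<alpha> = 2 / (d - 1) then \<epsilon> powr ((d - 2) / 2) * \<bar>ln \<epsilon>\<bar> powr (- (d - 1))
     else \<epsilon> powr (1 / \<alpha> - 1 / 2))"
proof -
  have ex1: "1/2 * (2 / \<alpha> + 1) - 1 = 1 / \<alpha> - 1 / 2" using \<alpha> by (simp add: field_simps)
  have ex2: "- (2 / (\<alpha> + 2)) * (2 / \<alpha> + 1) = - 2 / \<alpha>"
  proof -
    have "2 / \<alpha> + 1 = (\<alpha> + 2) / \<alpha>" using \<alpha> by (simp add: field_simps)
    moreover have "- (2 / y) * (y / \<alpha>) = - 2 / \<alpha>" if "y > 0" for y using that by simp
    moreover have "\<alpha> + 2 > 0" using \<alpha> by simp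
    ultimately show ?thesis by (simp only:)
  qed
  have "ground_level \<alpha> \<kappa> \<epsilon> = \<epsilon> powr (1/2) * resonance_growth \<kappa> \<epsilon> powr (- (2 / (\<alpha> + 2)))"
    using e by (simp add: ground_level_def powr_half_sqrt)
  then have "ground_level \<alpha> \<kappa> \<epsilon> powr (2 / \<alpha> + 1) = \<epsilon> powr (1/2 * (2 / \<alpha> + 1)) * resonance_growth \<kappa> \<epsilon> powr (- 2 / \<alpha>)"
    by (simp only: powr_mult powr_powr ex2)
  then have "ground_level \<alpha> \<kappa> \<epsilon> powr (2 / \<alpha> + 1) / \<epsilon> = \<epsilon> powr (1/2 * (2 / \<alpha> + 1)) / \<epsilon> powr 1 * resonance_growth \<kappa> \<epsilon> powr (- 2 / \<alpha>)"
    using e by simp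
  also have "\<epsilon> powr (1/2 * (2 / \<alpha> + 1)) / \<epsilon> powr 1 = \<epsilon> powr (1 / \<alpha> - 1 / 2)"
    unfolding powr_diff[symmetric] ex1 ..
  finally have main: "ground_level \<alpha> \<kappa> \<epsilon> powr (2 / \<alpha> + 1) / \<epsilon> = \<epsilon> powr (1 / \<alpha> - 1 / 2) * resonance_growth \<kappa> \<epsilon> powr (- 2 / \<alpha>)" .
  consider "\<alpha> < 2 / (d - 1)" | "\<alpha> = 2 / (d - 1)" | "\<alpha> > 2 / (d - 1)" by linarith
  then show ?thesis
  proof cases
    case 1
    then have k: "\<kappa> < 0" using d by (simp add: \<kappa>_def field_simps)
    have "1 / \<alpha> - 1 / 2 + \<kappa> / 2 * (- 2 / \<alpha>) = 2 / \<alpha> - d / 2" using \<alpha> by (simp add: \<kappa>_def field_simps)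
    then have "\<epsilon> powr (1 / \<alpha> - 1 / 2) * (\<epsilon> powr (\<kappa> / 2)) powr (- 2 / \<alpha>) = \<epsilon> powr (2 / \<alpha> - d / 2)"
      by (simp only: powr_powr powr_add[symmetric])
    then show ?thesis unfolding main using 1 k by (simp add: resonance_growth_def)
  next
    case 2
    then have a2: "2 / \<alpha> = d - 1" using d by simp
    have k: "\<kappa> = 0" using 2 d by (simp add: \<kappa>_def)
    have "1 / \<alpha> = (d - 1) / 2" using a2 by simp
    then have e1: "1 / \<alpha> - 1 / 2 = (d - 2) / 2" by (simp add: field_simps)
    have e2: "- 2 / \<alpha> = - (d - 1)" using a2 by simp
    have g: "resonance_growth \<kappa> \<epsilon> = \<bar>ln \<epsilon>\<bar>" by (simp add: resonance_growth_def k)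
    have "\<not> \<alpha> < 2 / (d - 1)" using 2 by simp
    then show ?thesis unfolding main e1 e2 g if_not_P[OF \<open>\<not> \<alpha> < 2 / (d - 1)\<close>] if_P[OF 2] by simp
  next
    case 3
    then have k: "\<kappa> > 0" using d by (simp add: \<kappa>_def field_simps)
    then show ?thesis unfolding main using 3 by (simp add: resonance_growth_def)
  qed
qed

theorem mainTheorem6:
  fixes \<alpha> d :: real
  defines "d \<equiv> real CARD('n::finite)"
  assumes "d \<ge> 2"
    and "\<alpha> > 0"
    and "d \<ge> 5 \<longrightarrow> \<alpha> < 8 / (d - 4)"
  shows "\<exists>c C \<epsilon>\<^sub>0 :: real. 0 < c \<and> c < C \<and> 0 < \<epsilon>\<^sub>0 \<and>
    (\<forall>\<epsilon>. 0 < \<epsilon> \<and> \<epsilon> < \<epsilon>\<^sub>0 \<longrightarrow>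
      (\<forall>Q :: real ^ 'n \<Rightarrow> complex. radial_ground_state \<alpha> \<epsilon> Q \<longrightarrow>
        (let B = (if \<alpha> < 2 / (d - 1) then \<epsilon> powr (2 / \<alpha> - d / 2)
                  else if \<alpha> = 2 / (d - 1) then \<epsilon> powr ((d - 2) / 2) * \<bar>ln \<epsilon>\<bar> powr (- (d - 1))
                  else \<epsilon> powr (1 / \<alpha> - 1 / 2))
         in c * B \<le> mass Q \<and> mass Q \<le> C * B)))"
proof -
  have \<alpha>: "\<alpha> > 0" by fact
  have d2: "CARD('n) \<ge> 2" using assms(2) by (simp add: d_def)
  have sub: "real CARD('n) \<ge> 5 \<longrightarrow> \<alpha> < 8 / (real CARD('n) - 4)" using assms(4) by (simp add: d_def)
  define \<kappa> where "\<kappa> = (real CARD('n) - 1) * \<alpha> / 2 - 1"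
  have \<kappa>d: "(d - 1) * \<alpha> / 2 - 1 = \<kappa>" by (simp add: \<kappa>_def d_def)
  let ?b = "ground_level \<alpha> \<kappa>"
  let ?R = "R_rad TYPE(real^'n) \<alpha>"
  obtain c C0 where c: "0 < c" and C0: "0 < C0" and R0: "\<And>\<epsilon>. \<lbrakk>0 < \<epsilon>; \<epsilon> \<le> 1/4\<rbrakk> \<Longrightarrow> c * ?b \<epsilon> \<le> ?R \<epsilon> \<and> ?R \<epsilon> \<le> C0 * ?b \<epsilon>"
    and Rle: "\<And>\<epsilon> u :: real^'n \<Rightarrow> complex. \<lbrakk>0 < \<epsilon>; u \<in> H2_rad; \<not> (AE x in lborel. u x = 0)\<rbrakk> \<Longrightarrow> ?R \<epsilon> \<le> rayleigh_quotient \<alpha> \<epsilon> u"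
    unfolding \<kappa>_def using R_rad_bounds[OF \<alpha> d2 sub] by blast
  \<comment> \<open>Enlarging \<open>C0\<close> to at least \<open>c\<close> makes
    \<open>2 * C / c\<close>, and with it \<open>K\<close>, at least \<open>1\<close>.\<close>
  define C where "C = max C0 c"
  have C: "C \<ge> c" "C > 0" using c by (simp_all add: C_def)
  have b0: "?b \<epsilon> \<ge> 0" if "0 < \<epsilon>" for \<epsilon> using that by (simp add: ground_level_def)
  have Rup: "?R \<epsilon> \<le> C * ?b \<epsilon>" if "0 < \<epsilon>" "\<epsilon> \<le> 1/4" for \<epsilon>
  proof -
    have "C0 * ?b \<epsilon> \<le> C * ?b \<epsilon>" using b0[OF that(1)] by (intro mult_right_mono) (simp add: C_def)
    then show ?thesis using R0[OF that] by linarith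
  qed
  \<comment> \<open>With this \<open>K\<close> one has \<open>c * sqrt K = 2 * C\<close>, so the
    lower bound at \<open>K * \<epsilon>\<close> is at least twice the upper bound at
    \<open>\<epsilon>\<close>.\<close>
  define K where "K = (2 * C / c)\<^sup>2"
  have sK: "sqrt K = 2 * C / c" using C c by (simp add: K_def)
  have "2 * C / c \<ge> 1" using C c by (simp add: pos_le_divide_eq)
  then have K1: "K \<ge> 1" unfolding K_def by (rule one_le_power)
  define c' where "c' = c powr (2 / \<alpha>) * C / K"
  define C' where "C' = C powr (2 / \<alpha> + 1)"
  have c'0: "c' > 0" using c C K1 by (simp add: c'_def)
  have C'0: "C' > 0" using C by (simp add: C'_def)
  show ?thesis
  proof (intro exI conjI allI impI)
    show "0 < c'" by (rule c'0)
    \<comment> \<open>Adding \<open>c'\<close> to the upper constant makes the inequality between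
      the constants strict.\<close>
    show "c' < C' + c'" using C'0 by simp
    \<comment> \<open>Below \<open>1 / (4 * K)\<close> also \<open>K * \<epsilon>\<close> lies in
      the range where the level is known.\<close>
    show "0 < 1 / (4 * K)" using K1 by simp
    fix \<epsilon> :: real and Q :: "real^'n \<Rightarrow> complex"
    assume \<epsilon>: "0 < \<epsilon> \<and> \<epsilon> < 1 / (4 * K)" and Q: "radial_ground_state \<alpha> \<epsilon> Q"
    have e0: "0 < \<epsilon>" using \<epsilon> by simp
    have Ke: "K * \<epsilon> \<le> 1/4" using \<epsilon> K1 by (simp add: field_simps)
    have eK: "\<epsilon> \<le> K * \<epsilon>" using K1 e0 by simp
    have e4: "\<epsilon> \<le> 1/4" using eK Ke by linarith
    obtain v :: "real^'n \<Rightarrow> complex" where v: "normalized_minimizer \<alpha> \<epsilon> v"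
      and Qv: "Q = (\<lambda>x. complex_of_real (?R \<epsilon> powr (1 / \<alpha>)) * v x)"
      using Q unfolding radial_ground_state_def by blast
    have vH: "v \<in> H2_rad" "\<not> (AE x in lborel. v x = 0)" "Lp_norm (\<alpha> + 2) v = 1" "rayleigh_quotient \<alpha> \<epsilon> v = ?R \<epsilon>"
      using v unfolding normalized_minimizer_def by blast+
    have vH2: "v \<in> H2_space" using vH by (simp add: H2_rad_def)
    have rq: "rayleigh_quotient \<alpha> \<epsilon>' v = energy \<epsilon>' v" for \<epsilon>' by (simp add: rayleigh_quotient_energy vH)
    define m where "m = L2_sq v"
    have m0: "m \<ge> 0" by (simp add: m_def)
    define b where "b = ?b \<epsilon>"
    have G: "resonance_growth \<kappa> \<epsilon> \<ge> 1" using e4 quarter_le_exp e0 by (intro resonance_growth_ge) auto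
    have bpos: "b > 0" using e0 G by (simp add: b_def ground_level_def)
    have Rlo: "c * b \<le> ?R \<epsilon>" using R0[OF e0 e4] by (simp add: b_def)
    have Rhi: "?R \<epsilon> \<le> C * b" using Rup[OF e0 e4] by (simp add: b_def)
    have Rpos: "?R \<epsilon> > 0" using Rlo mult_pos_pos[OF c bpos] by linarith
    have massQ: "mass Q = ?R \<epsilon> powr (2 / \<alpha>) * m"
    proof -
      have "(?R \<epsilon> powr (1 / \<alpha>))\<^sup>2 = ?R \<epsilon> powr (2 / \<alpha>)" by (simp add: power2_eq_square flip: powr_add)
      then show ?thesis unfolding mass_eq_L2_sq Qv L2_sq_scale m_def by simp
    qed
    have em: "\<epsilon> * m \<le> ?R \<epsilon>" using energy_ge_L2_sq[OF vH2 e0] vH(4) rq[of \<epsilon>] by (simp add: m_def)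
    \<comment> \<open>The minimizer at \<open>\<epsilon>\<close> is a competitor at
      \<open>K * \<epsilon>\<close>; its \<open>L^p\<close> norm is \<open>1\<close>, so both
      quotients are energies and differ by a multiple of the mass.\<close>
    have "?R (K * \<epsilon>) \<le> ?R \<epsilon> + (K * \<epsilon> - \<epsilon>) * m"
      using Rle[of "K * \<epsilon>" v] vH rq energy_shift[OF vH2 e0, of "K * \<epsilon>"] e0 K1 by (simp add: m_def)
    moreover have "(2 * C) * b \<le> ?R (K * \<epsilon>)"
    proof -
      have "(2 * C) * b = c * (sqrt K * b)" unfolding sK using c by simp
      also have "\<dots> \<le> c * ?b (K * \<epsilon>)"
        unfolding b_def using ground_level_scale[OF e0 K1 Ke \<alpha>] c by (intro mult_left_mono) auto
      also have "\<dots> \<le> ?R (K * \<epsilon>)" using R0[of "K * \<epsilon>"] Ke e0 K1 by simp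
      finally show ?thesis .
    qed
    moreover have "(K * \<epsilon> - \<epsilon>) * m \<le> K * \<epsilon> * m" using e0 m0 by (intro mult_right_mono) auto
    \<comment> \<open>From \<open>2 * C * b \<le> ?R (K * \<epsilon>)\<close> and
      \<open>?R \<epsilon> \<le> C * b\<close>, one copy of \<open>C * b\<close> remains for the
      mass term.\<close>
    ultimately have Cb: "C * b \<le> K * \<epsilon> * m" using Rhi by linarith
    have "C * b / (K * \<epsilon>) \<le> m" using Cb K1 e0 by (subst pos_divide_le_eq) (auto simp: mult_ac)
    define B where "B = b powr (2 / \<alpha> + 1) / \<epsilon>"
    have bB: "b powr (2 / \<alpha>) * b = b powr (2 / \<alpha> + 1)" using bpos by (simp add: powr_add)
    have lower: "c' * B \<le> mass Q"
    proof -
      have "c' * B = (c * b) powr (2 / \<alpha>) * (C * b / (K * \<epsilon>))"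
        unfolding c'_def B_def bB[symmetric] powr_mult by simp
      also have "\<dots> \<le> ?R \<epsilon> powr (2 / \<alpha>) * m"
        using Rlo \<open>C * b / (K * \<epsilon>) \<le> m\<close> c bpos \<alpha> C K1 e0 by (intro mult_mono powr_mono2) auto
      finally show ?thesis unfolding massQ .
    qed
    have upper: "mass Q \<le> (C' + c') * B"
    proof -
      have "m \<le> ?R \<epsilon> / \<epsilon>" using em e0 by (simp add: pos_le_divide_eq mult.commute)
      then have "mass Q \<le> ?R \<epsilon> powr (2 / \<alpha>) * (?R \<epsilon> / \<epsilon>)" unfolding massQ by (rule mult_left_mono) simp
      also have "\<dots> = ?R \<epsilon> powr (2 / \<alpha> + 1) / \<epsilon>" using Rpos by (simp add: powr_add)
      also have "\<dots> \<le> (C * b) powr (2 / \<alpha> + 1) / \<epsilon>"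
        using Rhi Rpos e0 \<alpha> by (intro divide_right_mono powr_mono2) (auto intro: add_nonneg_nonneg)
      also have "\<dots> = C' * B" by (simp add: C'_def B_def powr_mult)
      also have "\<dots> \<le> (C' + c') * B" using c'0 e0 by (intro mult_right_mono) (auto simp: B_def)
      finally show ?thesis .
    qed
    have "d > 1" using assms(2) by simp
    note Beq = ground_level_mass[OF e0 \<alpha> this, unfolded \<kappa>d]
    show "let B = (if \<alpha> < 2 / (d - 1) then \<epsilon> powr (2 / \<alpha> - d / 2)
                  else if \<alpha> = 2 / (d - 1) then \<epsilon> powr ((d - 2) / 2) * \<bar>ln \<epsilon>\<bar> powr (- (d - 1))
                  else \<epsilon> powr (1 / \<alpha> - 1 / 2))
         in c' * B \<le> mass Q \<and> mass Q \<le> (C' + c') * B"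
      unfolding Beq[symmetric] Let_def using lower upper unfolding B_def b_def by simp
  qed
qed

end
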